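(* Let $(u,w)\in\mathcal{U}$ be the solution of $B((u,w),(y,z))=F(y)$ for all $(y,z)\in\mathcal{U}$, having the solution decomposition described in the context, and let $(u_h,w_h)\in\mathcal{U}_h$ be the solution of $B((u_h,w_h),(y,z))=F(y)$ for all $(y,z)\in\mathcal{U}_h$ on the S-type mesh with parameter $\sigma$ described in the context, with piecewise polynomials of degree $q\ge1$. If $u,w\in H^{q+1}(\Omega)$ and $\sigma\ge q+1$, then the supercloseness result $$|||(I_1u-u_h,\,I_2w-w_h)|||\lesssim(h+N^{-1}\max|\psi'|)^{q+1}$$ and the convergence result $$|||(u-u_h,\,w-w_h)|||\lesssim(h+N^{-1}\max|\psi'|)^{q}$$ hold.
   Context: Problem: $m\in\{1,2\}$, $\Omega=(0,2)$, $\varepsilon>0$ small; $u$ solves $\varepsilon^2u^{(4)}-bu''+cu+d\,u(\cdot-1)=f$ in $\Omega$, $u=\Phi$ on $(-1,0)$, $u(0)=u(2)=0$, $u^{(m)}(0)=u^{(m)}(2)=0$, where $b,c,d$ are smooth, $b\ge\beta^2>0$ ($\beta>0$), $c-\frac12\|d\|_{L^\infty(1,2)}-\frac{1}{2\beta^2}\|b'\|_{L^\infty}^2\ge\delta>0$, $\Phi(0)=\Phi^{(m)}(0)=0$. Put $w=\varepsilon u''$. Variational formulation: $\mathcal{U}=H_0^1(\Omega)\times H^1(\Omega)$ if $m=1$, $\mathcal{U}=H_0^1(\Omega)\times H_0^1(\Omega)$ if $m=2$. With $\langle\cdot,\cdot\rangle_D$ the $L^2(D)$ inner product ($D=\Omega$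 if omitted; likewise for norms), $$B((u,w),(y,z))=-\varepsilon\langle w',y'\rangle+\langle bu',y'\rangle+\langle b'u',y\rangle+\langle cu,y\rangle+\langle d\,u(\cdot-1),y\rangle_{(1,2)}+\varepsilon\langle u',z'\rangle+\langle w,z\rangle,$$ $F(y)=\langle f,y\rangle-\langle d\,\Phi(\cdot-1),y\rangle_{(0,1)}$, and $|||(y,z)|||^2=\|z\|_{L^2}^2+\frac{\beta^2}{2}\|y'\|_{L^2}^2+\delta\|y\|_{L^2}^2$. Solution decomposition (standing assumption): $u=S+E_1+E_2+W_1\chi_{(0,1)}+W_2\chi_{(1,2)}$ and $w=\tilde S+\tilde E_1+\tilde E_2+\tilde W_1\chi_{(0,1)}+\tilde W_2\chi_{(1,2)}$, where for $0\le k\le q+1$: $\|S^{(k)}\|_{L^2(0,1)}+\|S^{(k)}\|_{L^2(1,2)}\lesssim1$; $|E_1^{(k)}(x)|\lesssim\varepsilon^{m-k}e^{-\beta x/\varepsilon}$, $|E_2^{(k)}(x)|\lesssim\varepsilon^{m-k}e^{-\beta(2-x)/\varepsilon}$; $|W_1^{(k)}(x)|\lesssim\varepsilon^{3-k}e^{-\beta(1-x)/\varepsilon}$ on $(0,1)$, $|W_2^{(k)}(x)|\lesssim\varepsilon^{3-k}e^{-\beta(x-1)/\varepsilon}$ on $(1,2)$; $|\tilde S^{(k)}(x)|\lesssim\varepsilon$ on $\Omega\setminus\{1\}$; $|\tilde E_1^{(k)}(x)|\lesssim\varepsilon^{m-1-k}e^{-\beta x/\varepsilon}$, $|\tilde E_2^{(k)}(x)|\lesssim\varepsilon^{m-1-k}e^{-\beta(2-x)/\varepsilon}$;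 $|\tilde W_1^{(k)}(x)|\lesssim\varepsilon^{2-k}e^{-\beta(1-x)/\varepsilon}$ on $(0,1)$, $|\tilde W_2^{(k)}(x)|\lesssim\varepsilon^{2-k}e^{-\beta(x-1)/\varepsilon}$ on $(1,2)$. S-type mesh: $N\in\mathbb{N}$ divisible by 8, $\sigma>0$, $\lambda=\frac{\sigma}{\beta}\varepsilon\ln N$, with $\varepsilon$ small enough that $\lambda<\frac14$. The mesh-defining function $\phi:[0,\frac12]\to\mathbb{R}$ (which may depend on $N$) is continuous, piecewise continuously differentiable, monotonically increasing, $\phi(0)=0$, $\phi(\frac12)=\ln N$, $\max\phi'\lesssim N$. The nodes are $x_i=\frac{\sigma\varepsilon}{\beta}\phi(\frac{4i}{N})$ for $0\le i\le\frac N8$; $x_i=\frac{4i}{N}(1-2\lambda)+2\lambda-\frac12$ for $\frac N8\le i\le\frac{3N}8$; $x_i=1-\frac{\sigma\varepsilon}{\beta}\phi(2-\frac{4i}{N})$ for $\frac{3N}8\le i\le\frac N2$; $x_i=1+x_{i-N/2}$ for $\frac N2\le i\le N$. The mesh characterising function is $\psi=e^{-\phi}$ and $\max|\psi'|=\max_{t\in[0,1/2]}|\psi'(t)|$. $h$ denotes the maximum mesh width in the layer regions $(0,\lambda)\cup(1-\lambda,1+\lambda)\cup(2-\lambda,2)$; one has $h\lesssim\varepsilon$, and, e.g., $x_i-x_{i-1}\lesssim\varepsilon N^{-1}\max|\psi'|e^{\beta x/(\sigma\varepsilon)}$ for $x\in[x_{i-1},x_i]\subset[0,\lambda]$ (analogously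 in the other layer regions). Discrete space: $\mathcal{U}_h=\{(y,z)\in\mathcal{U}: y|_T,z|_T\in\mathbb{P}_q(T)\text{ for each cell }T=[x_{i-1},x_i]\}$, $\mathbb{P}_q$ the polynomials of degree at most $q$. Interpolation: for $j\in\{1,2\}$ and continuous $v$, $I_jv$ is the continuous piecewise polynomial of degree $\le q$ with, on each cell, $(I_jv-v)(x_{i-1})=(I_jv-v)(x_i)=0$ and $\int_{x_{i-1}}^{x_i}(I_jv-v)\xi\,dx=0$ for all polynomials $\xi$ of degree $\le q-2$ (no condition if $q=1$). $A\lesssim B$ means $A\le CB$ with $C$ independent of $\varepsilon$ and $N$. *)

theory Defs
  imports "HOL-Analysis.Analysis"
begin

abbreviation Dom :: "real set" where "Dom \<equiv> {0<..<2}"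

definition L2_space :: "real set \<Rightarrow> (real \<Rightarrow> real) set" where
  "L2_space D = {v. v \<in> borel_measurable (lebesgue_on D) \<and>
                    integrable (lebesgue_on D) (\<lambda>x. (v x)\<^sup>2)}"

definition L2_inner :: "real set \<Rightarrow> (real \<Rightarrow> real) \<Rightarrow> (real \<Rightarrow> real) \<Rightarrow> real" where
  "L2_inner D v g = integral\<^sup>L (lebesgue_on D) (\<lambda>x. v x * g x)"

definition L2_norm :: "real set \<Rightarrow> (real \<Rightarrow> real) \<Rightarrow> real" where
  "L2_norm D v = sqrt (L2_inner D v v)"

definition Linf_norm :: "real set \<Rightarrow> (real \<Rightarrow> real) \<Rightarrow> real" where
  "Linf_norm D v = Inf {C. 0 \<le> C \<and> (AE x in lebesgue_on D. \<bar>v x\<bar> \<le> C)}"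

definition loc_integrable :: "real set \<Rightarrow> (real \<Rightarrow> real) \<Rightarrow> bool" where
  "loc_integrable D v \<longleftrightarrow> (\<forall>K. compact K \<and> K \<subseteq> D \<longrightarrow> integrable (lebesgue_on K) v)"

text \<open>Continuously differentiable functions with compact support in \<open>D\<close>. In one dimension these
  test functions determine the same weak derivatives as the infinitely differentiable ones
  (this is Brezis' definition of the Sobolev spaces on an interval).\<close>

definition test_functions :: "real set \<Rightarrow> (real \<Rightarrow> real) set" where
  "test_functions D = {\<eta>. \<eta> C1_differentiable_on UNIV \<and>
                          (\<exists>K. compact K \<and> K \<subseteq> D \<and> (\<forall>x. x \<notin> K \<longrightarrow> \<eta> x = 0))}"

definition has_weak_deriv :: "real set \<Rightarrow> (real \<Rightarrow> real) \<Rightarrow> (real \<Rightarrow> real) \<Rightarrow> bool" where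
  "has_weak_deriv D v g \<longleftrightarrow> loc_integrable D v \<and> loc_integrable D g \<and>
     (\<forall>\<eta>\<in>test_functions D. L2_inner D v (deriv \<eta>) = - L2_inner D g \<eta>)"

text \<open>Unique up to null sets whenever a weak derivative exists; used only inside integrals.\<close>

definition wderiv :: "real set \<Rightarrow> (real \<Rightarrow> real) \<Rightarrow> (real \<Rightarrow> real)" where
  "wderiv D v = (SOME g. has_weak_deriv D v g)"

definition Sobolev :: "nat \<Rightarrow> real set \<Rightarrow> (real \<Rightarrow> real) set" where
  "Sobolev k D = {v. \<exists>g. g 0 = v \<and> (\<forall>j\<le>k. g j \<in> L2_space D) \<and>
                        (\<forall>j<k. has_weak_deriv D (g j) (g (Suc j)))}"

text \<open>Elements of \<open>H\<^sup>1(0,2)\<close> are represented by their representative that is continuous on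
  the closed interval, so that point values (boundary values, nodal values) make sense.
  Values outside \<open>[0,2]\<close> are irrelevant.\<close>

definition H1 :: "(real \<Rightarrow> real) set" where
  "H1 = {v \<in> Sobolev 1 Dom. continuous_on {0..2} v}"

definition H10 :: "(real \<Rightarrow> real) set" where
  "H10 = {v \<in> H1. v 0 = 0 \<and> v 2 = 0}"

text \<open>\<open>D k\<close> is the classical \<open>k\<close>-th derivative of \<open>v\<close> on \<open>A\<close> for \<open>k \<le> n\<close>; one-sided at
  boundary points belonging to \<open>A\<close>.\<close>

definition has_derivs :: "nat \<Rightarrow> real set \<Rightarrow> (real \<Rightarrow> real) \<Rightarrow> (nat \<Rightarrow> real \<Rightarrow> real) \<Rightarrow> bool" where
  "has_derivs n A v D \<longleftrightarrow> D 0 = v \<and>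
     (\<forall>k<n. \<forall>x\<in>A. (D k has_real_derivative D (Suc k) x) (at x within A))"

definition smooth_on :: "real set \<Rightarrow> (real \<Rightarrow> real) \<Rightarrow> bool" where
  "smooth_on A v \<longleftrightarrow> (\<exists>D. \<forall>n. has_derivs n A v D)"

definition derivs_bounded :: "nat \<Rightarrow> real set \<Rightarrow> (real \<Rightarrow> real) \<Rightarrow> (nat \<Rightarrow> real \<Rightarrow> real) \<Rightarrow> bool" where
  "derivs_bounded n A v M \<longleftrightarrow>
     (\<exists>D. has_derivs n A v D \<and> (\<forall>k\<le>n. \<forall>x\<in>A. \<bar>D k x\<bar> \<le> M k x))"

text \<open>\<open>\<Phi>(0) = \<Phi>\<^sup>(\<^sup>m\<^sup>)(0) = 0\<close>, the derivative being taken from the left.\<close>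

definition history_compatible :: "nat \<Rightarrow> (real \<Rightarrow> real) \<Rightarrow> bool" where
  "history_compatible m \<Phi> \<longleftrightarrow> \<Phi> 0 = 0 \<and>
     (\<exists>r>0. \<exists>D. has_derivs m {-r..0} \<Phi> D \<and> D m 0 = 0)"

definition U_space :: "nat \<Rightarrow> ((real \<Rightarrow> real) \<times> (real \<Rightarrow> real)) set" where
  "U_space m = (if m = 1 then H10 \<times> H1 else H10 \<times> H10)"

fun bform :: "real \<Rightarrow> (real \<Rightarrow> real) \<Rightarrow> (real \<Rightarrow> real) \<Rightarrow> (real \<Rightarrow> real) \<Rightarrow>
    (real \<Rightarrow> real) \<times> (real \<Rightarrow> real) \<Rightarrow> (real \<Rightarrow> real) \<times> (real \<Rightarrow> real) \<Rightarrow> real" where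
  "bform \<epsilon> b c d (u, w) (y, z) =
     - \<epsilon> * L2_inner Dom (wderiv Dom w) (wderiv Dom y)
     + L2_inner Dom (\<lambda>x. b x * wderiv Dom u x) (wderiv Dom y)
     + L2_inner Dom (\<lambda>x. deriv b x * wderiv Dom u x) y
     + L2_inner Dom (\<lambda>x. c x * u x) y
     + L2_inner {1<..<2} (\<lambda>x. d x * u (x - 1)) y
     + \<epsilon> * L2_inner Dom (wderiv Dom u) (wderiv Dom z)
     + L2_inner Dom w z"

definition load :: "(real \<Rightarrow> real) \<Rightarrow> (real \<Rightarrow> real) \<Rightarrow> (real \<Rightarrow> real) \<Rightarrow> (real \<Rightarrow> real) \<Rightarrow> real" where
  "load f d \<Phi> y = L2_inner Dom f y - L2_inner {0<..<1} (\<lambda>x. d x * \<Phi> (x - 1)) y"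

fun energy_norm :: "real \<Rightarrow> real \<Rightarrow> (real \<Rightarrow> real) \<times> (real \<Rightarrow> real) \<Rightarrow> real" where
  "energy_norm \<beta> \<delta> (y, z) =
     sqrt ((L2_norm Dom z)\<^sup>2 + \<beta>\<^sup>2 / 2 * (L2_norm Dom (wderiv Dom y))\<^sup>2 + \<delta> * (L2_norm Dom y)\<^sup>2)"

text \<open>\<open>K\<close> is the constant hidden in all the bounds. The decomposition is required off the point 1,
  where the characteristic functions and the smooth parts may jump.\<close>

definition has_decomposition ::
    "nat \<Rightarrow> nat \<Rightarrow> real \<Rightarrow> real \<Rightarrow> real \<Rightarrow> (real \<Rightarrow> real) \<Rightarrow> (real \<Rightarrow> real) \<Rightarrow> bool" where
  "has_decomposition m q \<beta> K \<epsilon> u w \<longleftrightarrow>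
    (\<exists>S E1 E2 W1 W2 S' E1' E2' W1' W2'.
      (\<forall>x \<in> Dom - {1}. u x = S x + E1 x + E2 x + W1 x * indicator {0<..<1} x
                                               + W2 x * indicator {1<..<2} x) \<and>
      (\<forall>x \<in> Dom - {1}. w x = S' x + E1' x + E2' x + W1' x * indicator {0<..<1} x
                                                  + W2' x * indicator {1<..<2} x) \<and>
      S \<in> Sobolev (q + 1) {0<..<1} \<and> S \<in> Sobolev (q + 1) {1<..<2} \<and>
      (\<forall>k\<le>q + 1. L2_norm {0<..<1} ((wderiv {0<..<1} ^^ k) S)
                + L2_norm {1<..<2} ((wderiv {1<..<2} ^^ k) S) \<le> K) \<and>
      derivs_bounded (q + 1) Dom E1
        (\<lambda>k x. K * \<epsilon> powi (int m - int k) * exp (- \<beta> * x / \<epsilon>)) \<and>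
      derivs_bounded (q + 1) Dom E2
        (\<lambda>k x. K * \<epsilon> powi (int m - int k) * exp (- \<beta> * (2 - x) / \<epsilon>)) \<and>
      derivs_bounded (q + 1) {0<..<1} W1
        (\<lambda>k x. K * \<epsilon> powi (3 - int k) * exp (- \<beta> * (1 - x) / \<epsilon>)) \<and>
      derivs_bounded (q + 1) {1<..<2} W2
        (\<lambda>k x. K * \<epsilon> powi (3 - int k) * exp (- \<beta> * (x - 1) / \<epsilon>)) \<and>
      derivs_bounded (q + 1) (Dom - {1}) S' (\<lambda>k x. K * \<epsilon>) \<and>
      derivs_bounded (q + 1) Dom E1'
        (\<lambda>k x. K * \<epsilon> powi (int m - 1 - int k) * exp (- \<beta> * x / \<epsilon>)) \<and>
      derivs_bounded (q + 1) Dom E2'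
        (\<lambda>k x. K * \<epsilon> powi (int m - 1 - int k) * exp (- \<beta> * (2 - x) / \<epsilon>)) \<and>
      derivs_bounded (q + 1) {0<..<1} W1'
        (\<lambda>k x. K * \<epsilon> powi (2 - int k) * exp (- \<beta> * (1 - x) / \<epsilon>)) \<and>
      derivs_bounded (q + 1) {1<..<2} W2'
        (\<lambda>k x. K * \<epsilon> powi (2 - int k) * exp (- \<beta> * (x - 1) / \<epsilon>)))"

definition transition :: "real \<Rightarrow> real \<Rightarrow> real \<Rightarrow> nat \<Rightarrow> real" where
  "transition \<sigma> \<beta> \<epsilon> N = \<sigma> / \<beta> * \<epsilon> * ln (real N)"

definition mesh_function :: "nat \<Rightarrow> (real \<Rightarrow> real) \<Rightarrow> bool" where
  "mesh_function N \<phi> \<longleftrightarrow> continuous_on {0..1/2} \<phi> \<and> \<phi> piecewise_C1_differentiable_on {0..1/2} \<and>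
     mono_on {0..1/2} \<phi> \<and> \<phi> 0 = 0 \<and> \<phi> (1/2) = ln (real N)"

definition half_node :: "real \<Rightarrow> real \<Rightarrow> real \<Rightarrow> (real \<Rightarrow> real) \<Rightarrow> nat \<Rightarrow> nat \<Rightarrow> real" where
  "half_node \<sigma> \<beta> \<epsilon> \<phi> N i =
     (let t = 4 * real i / real N; l = transition \<sigma> \<beta> \<epsilon> N in
      if i \<le> N div 8 then \<sigma> * \<epsilon> / \<beta> * \<phi> t
      else if i \<le> 3 * N div 8 then t * (1 - 2 * l) + 2 * l - 1/2
      else 1 - \<sigma> * \<epsilon> / \<beta> * \<phi> (2 - t))"

definition node :: "real \<Rightarrow> real \<Rightarrow> real \<Rightarrow> (real \<Rightarrow> real) \<Rightarrow> nat \<Rightarrow> nat \<Rightarrow> real" where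
  "node \<sigma> \<beta> \<epsilon> \<phi> N i = (if i \<le> N div 2 then half_node \<sigma> \<beta> \<epsilon> \<phi> N i
                        else 1 + half_node \<sigma> \<beta> \<epsilon> \<phi> N (i - N div 2))"

text \<open>The cells \<open>[x (i - 1), x i]\<close> lying in \<open>[0,\<lambda>]\<close>, in \<open>[1-\<lambda>,1+\<lambda>]\<close> and in \<open>[2-\<lambda>,2]\<close>.\<close>

definition layer_cells :: "nat \<Rightarrow> nat set" where
  "layer_cells N = {1..N div 8} \<union> {3 * N div 8 + 1..5 * N div 8} \<union> {7 * N div 8 + 1..N}"

definition layer_width :: "(nat \<Rightarrow> real) \<Rightarrow> nat \<Rightarrow> real" where
  "layer_width x N = Max ((\<lambda>i. x i - x (i - 1)) ` layer_cells N)"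

text \<open>\<open>max |\<psi>'|\<close> for \<open>\<psi> = exp (- \<phi>)\<close>. As \<open>\<phi>\<close> is only piecewise continuously differentiable, the
  supremum runs over the points of differentiability.\<close>

definition max_psi_deriv :: "(real \<Rightarrow> real) \<Rightarrow> real" where
  "max_psi_deriv \<phi> = (let \<psi> = (\<lambda>t. exp (- \<phi> t)) in
     Sup ((\<lambda>t. \<bar>deriv \<psi> t\<bar>) ` {t \<in> {0<..<1/2}. \<psi> field_differentiable at t}))"

definition piecewise_poly :: "nat \<Rightarrow> (nat \<Rightarrow> real) \<Rightarrow> nat \<Rightarrow> (real \<Rightarrow> real) \<Rightarrow> bool" where
  "piecewise_poly q x N v \<longleftrightarrow>
     (\<forall>i\<in>{1..N}. \<exists>p. degree p \<le> q \<and> (\<forall>t\<in>{x (i - 1)..x i}. v t = poly p t))"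

definition Uh_space :: "nat \<Rightarrow> nat \<Rightarrow> (nat \<Rightarrow> real) \<Rightarrow> nat \<Rightarrow> ((real \<Rightarrow> real) \<times> (real \<Rightarrow> real)) set" where
  "Uh_space m q x N = {(y, z) \<in> U_space m. piecewise_poly q x N y \<and> piecewise_poly q x N z}"

text \<open>The interpolation operators of both components satisfy the same conditions. The interpolant
  is unique on \<open>[x 0, x N]\<close>; \<open>degree \<xi> + 2 \<le> q\<close> is void for \<open>q = 1\<close>.\<close>

definition is_interpolant ::
    "nat \<Rightarrow> (nat \<Rightarrow> real) \<Rightarrow> nat \<Rightarrow> (real \<Rightarrow> real) \<Rightarrow> (real \<Rightarrow> real) \<Rightarrow> bool" where
  "is_interpolant q x N v g \<longleftrightarrow> continuous_on {x 0..x N} g \<and> piecewise_poly q x N g \<and>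
     (\<forall>i\<in>{1..N}. g (x (i - 1)) - v (x (i - 1)) = 0 \<and> g (x i) - v (x i) = 0 \<and>
        (\<forall>\<xi>. degree \<xi> + 2 \<le> q \<longrightarrow> L2_inner {x (i - 1)..x i} (\<lambda>t. g t - v t) (poly \<xi>) = 0))"

definition interp :: "nat \<Rightarrow> (nat \<Rightarrow> real) \<Rightarrow> nat \<Rightarrow> (real \<Rightarrow> real) \<Rightarrow> (real \<Rightarrow> real)" where
  "interp q x N v = (SOME g. is_interpolant q x N v g)"

end

theory Submission
  imports Defs
begin

text \<open>Let \<open>\<xi>\<close> be the difference of interpolant and discrete solution. By coercivity and Galerkin
  orthogonality \<open>|||\<xi>|||\<^sup>2\<close> is at most minus the bilinear form at the interpolation error and \<open>\<xi>\<close>.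
  The interpolant matches nodal values and moments, so integration by parts on each cell annihilates
  both terms with the factor \<open>\<epsilon>\<close> and moves the derivative in the convection and diffusion
  terms onto \<open>\<xi>\<close>. There \<open>b\<close> may be replaced by its difference to a constant on the cell; the
  cell width gained this way compensates the inverse inequality. Hence \<open>|||\<xi>|||\<close> is bounded by the
  \<open>L\<^sup>2\<close> norms of the interpolation errors alone, which are one order better than the derivative.
  The interpolation errors are estimated for each part of the decomposition: in its own layer region
  the mesh grading turns the decay of a layer term into the full power of the rate, and elsewhere
  the term is at most \<open>N\<^sup>-\<^sup>\<sigma>\<close>, so that stability of the interpolation suffices.\<close>

section \<open>Square integrable functions on an interval\<close>

text \<open>Two features of the setting shape the estimates. The decomposition says nothing at the
  point 1, its smooth part is only weakly differentiable, and weak derivatives are arbitrary choices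
  up to null sets; so the derivative of \<open>u\<close> is never split along it. Instead a function
  is approximated on a cell by a polynomial up to a sup bound or a Lipschitz constant. Such bounds
  pass through sums and ignore null sets, and only the Lipschitz constant of the whole error is
  turned into a bound of its weak derivative. For \<open>w\<close> sup bounds suffice, since the
  energy norm contains no derivative of the second component. The smooth part of \<open>u\<close> is
  controlled in L2 only, so its cell bound keeps the local L2 norm of the highest derivative; the
  squares of these norms add up over the mesh whatever the number of cells. The condition \<sigma>
  \<ge> q + 1 enters twice: it lets the decay inside a layer absorb q + 1 powers of the cell width,
  and it makes a layer term outside its region at most N^-(q+1). The derivative of the interpolation
  error of \<open>u\<close> is one order worse, which is all that separates convergence from
  supercloseness.\<close>

lemma continuous_on_Icc_bounded:
  fixes f :: "real \<Rightarrow> real"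
  assumes "continuous_on {a..b} f"
  obtains M where "M \<ge> 0" "\<And>t. t \<in> {a..b} \<Longrightarrow> \<bar>f t\<bar> \<le> M"
proof -
  have "bounded (f ` {a..b})"
    using assms compact_continuous_image compact_imp_bounded by blast
  then obtain M where M: "\<forall>y\<in>f ` {a..b}. \<bar>y\<bar> \<le> M"
    by (auto simp: bounded_iff)
  show ?thesis
  proof (rule that[of "max M 0"])
    fix t assume "t \<in> {a..b}"
    then have "\<bar>f t\<bar> \<le> M" using M by simp
    then show "\<bar>f t\<bar> \<le> max M 0" by simp
  qed simp
qed

text \<open>The closed interval replaces the open one of \<open>L2_space\<close>. This changes
  nothing up to the null set of end points and makes the calculus of \<open>integral\<close> over
  \<open>{a..b}\<close> available, into which the Bochner integrals of the problem are
  translated.\<close>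

definition L2on :: "real \<Rightarrow> real \<Rightarrow> (real \<Rightarrow> real) \<Rightarrow> bool" where
  "L2on a b v \<longleftrightarrow> v \<in> borel_measurable (lebesgue_on {a..b}) \<and> (\<lambda>x. (v x)\<^sup>2) integrable_on {a..b}"

lemma measurable_lebesgue_Icc_iff_Ioo:
  fixes v :: "real \<Rightarrow> real"
  shows "v \<in> borel_measurable (lebesgue_on {a<..<b}) \<longleftrightarrow> v \<in> borel_measurable (lebesgue_on {a..b})"
proof -
  have ae: "AE x in lebesgue. (if x \<in> {a..b} then v x else 0) = (if x \<in> {a<..<b} then v x else 0)"
  proof -
    have "negligible {a, b}" by simp
    then have "{a,b} \<in> null_sets lebesgue" by (simp add: negligible_iff_null_sets)
    then show ?thesis
      by (rule AE_I') auto
  qed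
  have 1: "v \<in> borel_measurable (lebesgue_on S) \<longleftrightarrow> (\<lambda>x. if x \<in> S then v x else 0) \<in> borel_measurable lebesgue"
    if "S \<in> sets lebesgue" for S
    using borel_measurable_if that by blast
  have "(\<lambda>x. if x \<in> {a..b} then v x else 0) \<in> borel_measurable lebesgue \<longleftrightarrow>
        (\<lambda>x. if x \<in> {a<..<b} then v x else 0) \<in> borel_measurable lebesgue"
    using borel_measurable_AE[OF _ ae] borel_measurable_AE[of "(\<lambda>x. if x \<in> {a<..<b} then v x else 0)" "(\<lambda>x. if x \<in> {a..b} then v x else 0)"] ae
    by (smt (verit) AE_cong)
  then show ?thesis
    using 1[of "{a..b}"] 1[of "{a<..<b}"] by simp
qed

lemma L2_space_iff: "v \<in> L2_space {a<..<b} \<longleftrightarrow> L2on a b v"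
proof -
  have "integrable (lebesgue_on {a<..<b}) (\<lambda>x. (v x)\<^sup>2) \<longleftrightarrow> (\<lambda>x. (v x)\<^sup>2) integrable_on {a..b}"
    (is "?L \<longleftrightarrow> ?R")
  proof -
    have "?L \<longleftrightarrow> (\<lambda>x. (v x)\<^sup>2) absolutely_integrable_on {a<..<b}"
      by (simp add: integrable_restrict_space set_integrable_def)
    also have "\<dots> \<longleftrightarrow> (\<lambda>x. (v x)\<^sup>2) absolutely_integrable_on {a..b}"
      by (simp add: absolutely_integrable_on_Icc_iff_Ioo)
    also have "\<dots> \<longleftrightarrow> ?R"
      by (rule absolutely_integrable_on_iff_nonneg) auto
    finally show ?thesis .
  qed
  then show ?thesis
    by (simp add: L2_space_def L2on_def measurable_lebesgue_Icc_iff_Ioo)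
qed

lemma L2on_square: "L2on a b v \<Longrightarrow> (\<lambda>x. (v x)\<^sup>2) integrable_on {a..b}"
  by (simp add: L2on_def)

lemma L2on_mult:
  assumes "L2on a b v" "L2on a b g"
  shows "(\<lambda>x. v x * g x) absolutely_integrable_on {a..b}"
proof (rule measurable_bounded_by_integrable_imp_absolutely_integrable)
  show "(\<lambda>x. v x * g x) \<in> borel_measurable (lebesgue_on {a..b})"
    using assms unfolding L2on_def by auto
  show "(\<lambda>x. (v x)\<^sup>2 + (g x)\<^sup>2) integrable_on {a..b}"
    using assms unfolding L2on_def by (intro integrable_add) auto
  show "norm (v x * g x) \<le> (v x)\<^sup>2 + (g x)\<^sup>2" if "x \<in> {a..b}" for x
  proof -
    have "0 \<le> (\<bar>v x\<bar> - \<bar>g x\<bar>)\<^sup>2" by simp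
    then have "2 * (\<bar>v x\<bar> * \<bar>g x\<bar>) \<le> (v x)\<^sup>2 + (g x)\<^sup>2"
      unfolding power2_diff by (simp only: power2_abs)
    moreover have "0 \<le> \<bar>v x\<bar> * \<bar>g x\<bar>" by simp
    ultimately show ?thesis unfolding real_norm_def abs_mult by linarith
  qed
qed simp

lemma L2on_integrable_mult: "L2on a b v \<Longrightarrow> L2on a b g \<Longrightarrow> (\<lambda>x. v x * g x) integrable_on {a..b}"
  using L2on_mult set_lebesgue_integral_eq_integral(1) by blast

lemma L2on_continuous: "continuous_on {a..b} v \<Longrightarrow> L2on a b v"
  unfolding L2on_def
  by (auto intro!: continuous_imp_measurable_on_sets_lebesgue integrable_continuous_real continuous_intros)

lemma L2on_absint: "L2on a b v \<Longrightarrow> v absolutely_integrable_on {a..b}"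
  using L2on_mult[of a b v "\<lambda>_. 1"] L2on_continuous[of a b "\<lambda>_. 1"] by simp

lemma L2on_integrable: "L2on a b v \<Longrightarrow> v integrable_on {a..b}"
  using L2on_absint set_lebesgue_integral_eq_integral(1) by blast

lemma L2on_bounded_mult:
  assumes "L2on a b v" "\<beta> \<in> borel_measurable (lebesgue_on {a..b})" "\<And>x. x \<in> {a..b} \<Longrightarrow> \<bar>\<beta> x\<bar> \<le> B"
  shows "L2on a b (\<lambda>x. \<beta> x * v x)"
proof -
  have "(\<lambda>x. (\<beta> x)\<^sup>2 * (v x)\<^sup>2) absolutely_integrable_on {a..b}"
  proof (rule absolutely_integrable_bounded_measurable_product_real)
    show "(\<lambda>x. (\<beta> x)\<^sup>2) \<in> borel_measurable (lebesgue_on {a..b})" using assms(2) by auto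
    have "\<bar>(\<beta> x)\<^sup>2\<bar> \<le> B\<^sup>2" if "x \<in> {a..b}" for x
      using assms(3)[OF that] abs_le_square_iff by fastforce
    then show "bounded ((\<lambda>x. (\<beta> x)\<^sup>2) ` {a..b})"
      by (auto simp: bounded_iff intro!: exI[of _ "B\<^sup>2"])
    show "(\<lambda>x. (v x)\<^sup>2) absolutely_integrable_on {a..b}"
      using assms(1) by (subst absolutely_integrable_on_iff_nonneg) (auto simp: L2on_def)
  qed simp
  then have "(\<lambda>x. (\<beta> x * v x)\<^sup>2) integrable_on {a..b}"
    by (simp add: power_mult_distrib set_lebesgue_integral_eq_integral(1))
  then show ?thesis using assms unfolding L2on_def by auto
qed

lemma L2on_cont_mult:
  assumes "L2on a b v" "continuous_on {a..b} \<beta>"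
  shows "L2on a b (\<lambda>x. \<beta> x * v x)"
proof -
  obtain B where "B \<ge> 0" "\<And>x. x \<in> {a..b} \<Longrightarrow> \<bar>\<beta> x\<bar> \<le> B"
    using continuous_on_Icc_bounded[OF assms(2)] by metis
  then show ?thesis
    using L2on_bounded_mult[OF assms(1)] continuous_imp_measurable_on_sets_lebesgue[OF assms(2)] by auto
qed

lemma L2on_cmult: "L2on a b v \<Longrightarrow> L2on a b (\<lambda>x. c * v x)"
  by (intro L2on_cont_mult) auto

lemma L2on_add:
  assumes "L2on a b v" "L2on a b g"
  shows "L2on a b (\<lambda>x. v x + g x)"
proof -
  have "(\<lambda>x. (v x)\<^sup>2 + (g x)\<^sup>2 + 2 * (v x * g x)) integrable_on {a..b}"
    using assms by (intro integrable_add integrable_on_mult_right L2on_integrable_mult) (auto simp: L2on_def)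
  then have "(\<lambda>x. (v x + g x)\<^sup>2) integrable_on {a..b}"
    by (simp add: power2_sum mult.assoc)
  then show ?thesis using assms unfolding L2on_def by auto
qed

lemma L2on_diff:
  assumes "L2on a b v" "L2on a b g"
  shows "L2on a b (\<lambda>x. v x - g x)"
  using L2on_add[OF assms(1) L2on_cmult[OF assms(2), of "-1"]] by simp

lemma L2on_subinterval:
  assumes "L2on a b v" "a \<le> c" "d \<le> b"
  shows "L2on c d v"
proof -
  have "{c..d} \<subseteq> {a..b}" using assms by auto
  then have "(\<lambda>x. (v x)\<^sup>2) integrable_on {c..d}"
    using assms(1) L2on_def integrable_on_subinterval by blast
  moreover have "v \<in> borel_measurable (lebesgue_on {c..d})"
  proof (rule measurable_restrict_mono)
    show "v \<in> borel_measurable (lebesgue_on {a..b})" using assms(1) by (simp add: L2on_def)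
  qed fact
  ultimately show ?thesis by (simp add: L2on_def)
qed

lemma L2_inner_eq_integral:
  assumes "(\<lambda>x. v x * g x) absolutely_integrable_on {a..b}"
  shows "L2_inner {a<..<b} v g = integral {a..b} (\<lambda>x. v x * g x)"
proof -
  have "(\<lambda>x. v x * g x) absolutely_integrable_on {a<..<b}"
    using assms by (simp add: absolutely_integrable_on_Icc_iff_Ioo)
  then have "integrable (lebesgue_on {a<..<b}) (\<lambda>x. v x * g x)"
    by (simp add: integrable_restrict_space set_integrable_def)
  then show ?thesis
    by (simp add: L2_inner_def lebesgue_integral_eq_integral integral_open_interval_real)
qed

lemma L2_norm_sq:
  assumes "L2on a b v"
  shows "(L2_norm {a<..<b} v)\<^sup>2 = integral {a..b} (\<lambda>x. (v x)\<^sup>2)"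
proof -
  have "0 \<le> integral {a..b} (\<lambda>x. (v x)\<^sup>2)"
    by (rule integral_nonneg) (use assms in \<open>auto simp: L2on_def\<close>)
  then show ?thesis
    using L2_inner_eq_integral[OF L2on_mult[OF assms assms]] by (simp add: L2_norm_def power2_eq_square)
qed

lemma L2on_Cauchy_Schwarz:
  assumes v: "L2on a b v" and g: "L2on a b g"
  shows "(integral {a..b} (\<lambda>x. v x * g x))\<^sup>2 \<le> integral {a..b} (\<lambda>x. (v x)\<^sup>2) * integral {a..b} (\<lambda>x. (g x)\<^sup>2)"
proof -
  define A where "A = integral {a..b} (\<lambda>x. (v x)\<^sup>2)"
  define B where "B = integral {a..b} (\<lambda>x. v x * g x)"
  define G where "G = integral {a..b} (\<lambda>x. (g x)\<^sup>2)"
  have q: "0 \<le> A * t\<^sup>2 - 2 * t * B + G" for t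
  proof -
    have i: "(\<lambda>x. (v x)\<^sup>2) integrable_on {a..b}" "(\<lambda>x. (g x)\<^sup>2) integrable_on {a..b}"
      using assms by (auto simp: L2on_def)
    note j = L2on_integrable_mult[OF assms]
    have "0 \<le> integral {a..b} (\<lambda>x. (t * v x - g x)\<^sup>2)"
      by (rule integral_nonneg) (use L2on_diff[OF L2on_cmult[OF v] g] in \<open>auto simp: L2on_def\<close>)
    also have "(\<lambda>x. (t * v x - g x)\<^sup>2) = (\<lambda>x. t\<^sup>2 * (v x)\<^sup>2 - (2 * t) * (v x * g x) + (g x)\<^sup>2)"
      by (auto simp: power2_eq_square algebra_simps)
    also have "integral {a..b} \<dots> = A * t\<^sup>2 - 2 * t * B + G"
      using i j by (simp add: integral_add integral_diff integrable_diff integrable_on_mult_right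
          integral_mult_right A_def B_def G_def)
    finally show ?thesis .
  qed
  have A0: "0 \<le> A" "0 \<le> G"
    unfolding A_def G_def by (rule integral_nonneg; use assms in \<open>auto simp: L2on_def\<close>)+
  have "B\<^sup>2 \<le> A * G"
  proof (cases "A = 0")
    case True
    have "B = 0"
    proof (rule ccontr)
      assume "B \<noteq> 0"
      then have e: "2 * ((G + 1) / B) * B = 2 * (G + 1)" by simp
      \<comment> \<open>With \<open>A = 0\<close> the quadratic in t is affine, and this value of t
        makes it equal to -(G + 2), which is negative.\<close>
      have "0 \<le> A * ((G + 1) / B)\<^sup>2 - 2 * ((G + 1) / B) * B + G" by (rule q)
      then have "0 \<le> 0 - 2 * (G + 1) + G" unfolding True e by (simp only: mult_zero_left)
      then show False using A0 by (simp add: algebra_simps)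
    qed
    then show ?thesis using A0 by simp
  next
    case False
    then have "A > 0" using A0 by simp
    have "0 \<le> A * (A * (B / A)\<^sup>2 - 2 * (B / A) * B + G)" using q[of "B / A"] \<open>A > 0\<close> by simp
    also have "\<dots> = A * G - B\<^sup>2" using \<open>A > 0\<close> by (simp add: field_simps power2_eq_square)
    finally show ?thesis by simp
  qed
  then show ?thesis by (simp add: A_def B_def G_def)
qed

section \<open>Lebesgue points and almost everywhere bounds\<close>

lemma lebesgue_points:
  fixes f :: "real \<Rightarrow> real"
  assumes "f absolutely_integrable_on {a..b}"
  obtains Z where "negligible Z"
    "\<And>x. x \<in> {a<..<b} - Z \<Longrightarrow> ((\<lambda>h. integral {x..x+h} f / h) \<longlongrightarrow> f x) (at_right 0)"
proof -
  \<comment> \<open>Extension by zero makes the function locally integrable on the whole line. The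
    cube with lower corner x yields averages to the right of x, hence the one-sided limit.\<close>
  define F where "F x = (if x \<in> {a..b} then f x else 0)" for x
  have "F absolutely_integrable_on UNIV"
    using assms unfolding F_def by (subst absolutely_integrable_restrict_UNIV)
  then have "F integrable_on cbox c d" for c d
    using set_lebesgue_integral_eq_integral(1) integrable_on_subcbox by blast
  from integrable_ccontinuous_explicit[OF this] obtain Z where Z: "negligible Z" and
    *: "\<And>x e. \<lbrakk>x \<notin> Z; 0 < e\<rbrakk> \<Longrightarrow> \<exists>d>0. \<forall>h. 0 < h \<and> h < d \<longrightarrow>
         norm(integral (cbox x (x + h *\<^sub>R One)) F /\<^sub>R h ^ DIM(real) - F x) < e" by metis
  show ?thesis
  proof (rule that[OF Z])
    fix x assume x: "x \<in> {a<..<b} - Z"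
    show "((\<lambda>h. integral {x..x+h} f / h) \<longlongrightarrow> f x) (at_right 0)"
    proof (rule tendstoI)
      fix e :: real assume "e > 0"
      then obtain d where d: "d > 0" and
        dd: "\<And>h. 0 < h \<and> h < d \<Longrightarrow> norm(integral (cbox x (x + h *\<^sub>R One)) F /\<^sub>R h ^ DIM(real) - F x) < e"
        using *[of x e] x by auto
      have "dist (integral {x..x+h} f / h) (f x) < e" if "0 < h" "h < min d (b - x)" for h
      proof -
        have "integral {x..x+h} f = integral {x..x+h} F"
          using x that by (intro integral_cong) (auto simp: F_def)
        moreover have "F x = f x" using x by (simp add: F_def)
        ultimately show ?thesis using dd[of h] that by (simp add: dist_norm divide_inverse mult.commute)
      qed
      moreover have "eventually (\<lambda>h. 0 < h \<and> h < min d (b - x)) (at_right 0)"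
        using d x eventually_at_right_real[of 0 "min d (b - x)"] by (auto elim!: eventually_mono)
      ultimately show "\<forall>\<^sub>F h in at_right 0. dist (integral {x..x+h} f / h) (f x) < e"
        by (auto elim!: eventually_mono)
    qed
  qed
qed

text \<open>At a Lebesgue point where the bound fails, the averages of \<open>g\<close> over all
  short intervals to the right exceed \<open>L\<close> in absolute value. A null set contains no
  interval, so some such interval ends outside \<open>Z\<close>, where the average is bounded by
  assumption.\<close>

lemma AE_bound_of_Lipschitz_integral:
  fixes g :: "real \<Rightarrow> real"
  assumes g: "g absolutely_integrable_on {a..b}" and Z: "negligible Z"
    and L: "\<And>x y. x \<in> {a<..<b} - Z \<Longrightarrow> y \<in> {a<..<b} - Z \<Longrightarrow> x < y \<Longrightarrow> \<bar>integral {x..y} g\<bar> \<le> L * (y - x)"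
  obtains Z' where "negligible Z'" "\<And>t. t \<in> {a<..<b} - Z' \<Longrightarrow> \<bar>g t\<bar> \<le> L"
proof -
  obtain Y where Y: "negligible Y" and
    *: "\<And>x. x \<in> {a<..<b} - Y \<Longrightarrow> ((\<lambda>h. integral {x..x+h} g / h) \<longlongrightarrow> g x) (at_right 0)"
    using lebesgue_points[OF g] by metis
  show ?thesis
  proof (rule that[of "Z \<union> Y"])
    show "negligible (Z \<union> Y)" using Z Y by auto
    fix t assume t: "t \<in> {a<..<b} - (Z \<union> Y)"
    show "\<bar>g t\<bar> \<le> L"
    proof (rule ccontr)
      assume "\<not> \<bar>g t\<bar> \<le> L"
      moreover have "((\<lambda>h. \<bar>integral {t..t+h} g / h\<bar>) \<longlongrightarrow> \<bar>g t\<bar>) (at_right 0)"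
        using *[of t] t tendsto_rabs by blast
      ultimately have "eventually (\<lambda>h. \<bar>integral {t..t+h} g / h\<bar> > L) (at_right 0)"
        using order_tendstoD(1)[of _ "\<bar>g t\<bar>" _ L] by auto
      then obtain d where d: "d > 0" "\<And>h. 0 < h \<Longrightarrow> h < d \<Longrightarrow> \<bar>integral {t..t+h} g / h\<bar> > L"
        unfolding eventually_at_right_field by (metis add.left_neutral)
      define c where "c = min (t + d) b"
      have "t < c" using d t by (auto simp: c_def)
      have "\<not> {t<..<c} \<subseteq> Z"
      proof
        assume "{t<..<c} \<subseteq> Z"
        then have "negligible {t<..<c}" using Z negligible_subset by blast
        then show False
          using \<open>t < c\<close> open_not_negligible[of "{t<..<c}"] by auto
      qed
      then obtain y where y: "y \<in> {t<..<c}" "y \<notin> Z" by blast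
      have "\<bar>integral {t..y} g\<bar> \<le> L * (y - t)"
        using L[of t y] y t by (auto simp: c_def)
      moreover have "\<bar>integral {t..t+(y-t)} g / (y-t)\<bar> > L"
        using y by (intro d) (auto simp: c_def)
      ultimately show False using y by (simp add: abs_divide field_simps)
    qed
  qed
qed

section \<open>Weak derivatives and primitives\<close>

lemma has_derivative_integral_from_zero:
  fixes \<kappa> :: "real \<Rightarrow> real"
  assumes c: "continuous_on UNIV \<kappa>" and z: "\<And>r. r \<le> 0 \<Longrightarrow> \<kappa> r = 0"
  shows "((\<lambda>t. integral {0..t} \<kappa>) has_real_derivative \<kappa> t) (at t)"
proof -
  define m where "m = min t 0 - 1"
  define M where "M = max t 0 + 1"
  have cc: "continuous_on {p..q} \<kappa>" for p q using c continuous_on_subset by blast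
  have "((\<lambda>t. integral {m..t} \<kappa>) has_real_derivative \<kappa> t) (at t within {m..M})"
    by (rule integral_has_real_derivative) (auto simp: cc m_def M_def)
  moreover have "at t within {m..M} = at t"
    by (rule at_within_interior) (auto simp: m_def M_def)
  ultimately have d: "((\<lambda>t. integral {m..t} \<kappa>) has_real_derivative \<kappa> t) (at t)" by simp
  \<comment> \<open>For negative \<open>y\<close> the integral over the empty interval
    \<open>{0..y}\<close> is 0, which agrees with the primitive because \<open>\<kappa>\<close>
    vanishes there.\<close>
  have eq: "integral {m..y} \<kappa> = integral {0..y} \<kappa>" if "y \<in> {m<..<M}" for y
  proof (cases "y \<ge> 0")
    case True
    have "integral {m..0} \<kappa> + integral {0..y} \<kappa> = integral {m..y} \<kappa>"
      by (rule Henstock_Kurzweil_Integration.integral_combine)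
         (use True that cc in \<open>auto intro!: integrable_continuous_real simp: m_def\<close>)
    moreover have "integral {m..0} \<kappa> = integral {m..0} (\<lambda>_. 0)"
      by (rule integral_cong) (auto simp: z)
    ultimately show ?thesis by simp
  next
    case False
    have "integral {m..y} \<kappa> = integral {m..y} (\<lambda>_. 0)"
      by (rule integral_cong) (use False in \<open>auto simp: z\<close>)
    then show ?thesis using False by simp
  qed
  show ?thesis
    by (rule has_field_derivative_transform_within_open[OF d, of "{m<..<M}"])
       (auto simp: eq, auto simp: m_def M_def)
qed

lemma integral_lebesgue_on_supported:
  fixes f :: "real \<Rightarrow> real"
  assumes f: "f absolutely_integrable_on {p..q}" and D: "D \<in> sets lebesgue" "{p..q} \<subseteq> D"
    and z: "\<And>x. x \<in> D - {p..q} \<Longrightarrow> f x = 0"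
  shows "integral\<^sup>L (lebesgue_on D) f = integral {p..q} f"
proof -
  have "integral\<^sup>L (lebesgue_on D) f = integral\<^sup>L lebesgue (\<lambda>x. indicator D x *\<^sub>R f x)"
    using D by (subst integral_restrict_space) auto
  also have "(\<lambda>x. indicator D x *\<^sub>R f x) = (\<lambda>x. indicator {p..q} x *\<^sub>R f x)"
    using D z by (auto simp: indicator_def fun_eq_iff)
  also have "integral\<^sup>L lebesgue \<dots> = integral {p..q} f"
    using set_lebesgue_integral_eq_integral(2)[OF f] by (simp add: set_lebesgue_integral_def)
  finally show ?thesis .
qed

text \<open>A continuous minorant of the indicator function of (0, s), increasing to it with n.
  Being continuous, it has a continuously differentiable primitive, as \<open>test_functions\<close>
  demands.\<close>

definition trap :: "real \<Rightarrow> nat \<Rightarrow> real \<Rightarrow> real" where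
  "trap s n r = min 1 (real n * max 0 (r * (s - r)))"

lemma trap_bounds: "0 \<le> trap s n r" "trap s n r \<le> 1" "\<bar>trap s n r\<bar> \<le> 1"
  by (auto simp: trap_def)

lemma trap_zero: "s \<ge> 0 \<Longrightarrow> r \<le> 0 \<or> r \<ge> s \<Longrightarrow> trap s n r = 0"
proof -
  assume "s \<ge> 0" "r \<le> 0 \<or> r \<ge> s"
  then have "r * (s - r) \<le> 0" by (auto simp: mult_le_0_iff)
  then show ?thesis by (simp add: trap_def max_absorb1)
qed

lemma continuous_trap: "continuous_on A (trap s n)"
  unfolding trap_def by (intro continuous_intros)

lemma trap_tendsto: "s > 0 \<Longrightarrow> (\<lambda>n. trap s n r) \<longlonglongrightarrow> indicator {0<..<s} r"
proof (cases "r \<in> {0<..<s}")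
  case True
  then have p: "r * (s - r) > 0" by simp
  then obtain n0 where n0: "real n0 * (r * (s - r)) > 1" using reals_Archimedean3 by blast
  have "trap s n r = 1" if "n \<ge> n0" for n
  proof -
    have "real n0 * (r * (s - r)) \<le> real n * (r * (s - r))" using that p by (intro mult_right_mono) auto
    then show ?thesis using n0 p by (simp add: trap_def)
  qed
  then have "(\<lambda>n. trap s n r) \<longlonglongrightarrow> 1"
    by (intro tendsto_eventually) (auto simp: eventually_sequentially)
  then show ?thesis using True by simp
next
  case False
  assume "s > 0"
  then show ?thesis using False trap_zero[of s r] by (auto simp: indicator_def)
qed

text \<open>The primitive of the indicator function of (0, s) that vanishes at 0: the limit of the
  primitives of \<open>trap\<close>.\<close>

definition ramp :: "real \<Rightarrow> real \<Rightarrow> real" where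
  "ramp s z = max 0 (min s z)"

lemma integral_trap_tendsto:
  assumes "s > 0"
  shows "(\<lambda>n. integral {0..z} (trap s n)) \<longlonglongrightarrow> ramp s z"
proof -
  have "(\<lambda>n. integral {0..z} (trap s n)) \<longlonglongrightarrow> integral {0..z} (indicator {0<..<s})"
    by (rule dominated_convergence[of _ _ "\<lambda>_. 1"])
       (auto simp: trap_bounds trap_tendsto assms intro!: integrable_continuous_real continuous_trap)
  moreover have "integral {0..z} (indicator {0<..<s} :: real \<Rightarrow> real) = ramp s z"
  proof -
    have "integral {0..z} (indicator {0<..<s} :: real \<Rightarrow> real) = integral {0..z} (\<lambda>x. if x \<in> {0..s} then 1 else 0)"
      by (rule integral_spike[of "{0,s}"]) (auto simp: indicator_def)
    also have "\<dots> = integral ({0..s} \<inter> {0..z}) (\<lambda>_. 1)"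
      by (rule integral_restrict_Int)
    also have "\<dots> = ramp s z"
      using assms by (auto simp: ramp_def min_def max_def)
    finally show ?thesis .
  qed
  ultimately show ?thesis by simp
qed

text \<open>The weak derivative identity extends from continuously differentiable test functions to the
  piecewise linear bump whose slope is 1 on \<open>{x..x+s}\<close> and -1 on \<open>{y..y+s}\<close>.\<close>

lemma weak_deriv_ramp:
  assumes w: "has_weak_deriv {a<..<b} v g" and ab: "a < x" "x \<le> y" "y + s \<le> z" "z < b" "s > 0"
  shows "integral {x..x+s} v - integral {y..y+s} v = - integral {x..z} (\<lambda>t. g t * (ramp s (t - x) - ramp s (t - y)))"
proof -
  have sub: "{x..z} \<subseteq> {a<..<b}" using ab by auto
  have absi: "f absolutely_integrable_on {x..z}" if "loc_integrable {a<..<b} f" for f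
  proof -
    have "integrable (lebesgue_on {x..z}) f"
      using that sub unfolding loc_integrable_def by (meson compact_Icc)
    then show ?thesis by (simp add: integrable_restrict_space set_integrable_def)
  qed
  have v: "v absolutely_integrable_on {x..z}" and g: "g absolutely_integrable_on {x..z}"
    using w absi by (auto simp: has_weak_deriv_def)
  have prod: "(\<lambda>t. f t * k t) absolutely_integrable_on {x..z}"
    if "f absolutely_integrable_on {x..z}" "continuous_on UNIV k" for f k :: "real \<Rightarrow> real"
  proof -
    have c: "continuous_on {x..z} k" using that(2) continuous_on_subset by blast
    have "(\<lambda>t. k t * f t) absolutely_integrable_on {x..z}"
      by (rule absolutely_integrable_bounded_measurable_product_real)
         (use c that(1) in \<open>auto intro: continuous_imp_measurable_on_sets_lebesgue compact_imp_bounded compact_continuous_image\<close>)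
    then show ?thesis by (simp add: mult.commute)
  qed
  define \<zeta> where "\<zeta> n t = trap s n (t - x) - trap s n (t - y)" for n t
  \<comment> \<open>A smoothed bump: it gains height on \<open>{x..x+s}\<close>, loses the same
    amount on \<open>{y..y+s}\<close> and therefore vanishes beyond \<open>y + s\<close>. This makes
    it a test function, with derivative \<open>\<zeta> n\<close>.\<close>
  define \<eta> where "\<eta> n t = integral {0..t - x} (trap s n) - integral {0..t - y} (trap s n)" for n t
  have d: "(\<eta> n has_real_derivative \<zeta> n t) (at t)" for n t
  proof -
    have "((\<lambda>t. integral {0..t} (trap s n)) has_real_derivative trap s n (t - p)) (at (t - p))" for p
      using has_derivative_integral_from_zero[OF continuous_trap] trap_zero ab by auto
    then have "((\<lambda>t. integral {0..t - p} (trap s n)) has_real_derivative trap s n (t - p) * 1) (at t)" for p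
      by (rule DERIV_chain2) (auto intro!: derivative_eq_intros)
    then show ?thesis unfolding \<eta>_def \<zeta>_def by (auto intro!: derivative_eq_intros)
  qed
  have c\<zeta>: "continuous_on UNIV (\<zeta> n)" for n
  proof -
    have "continuous_on UNIV (\<lambda>t. trap s n (t - p))" for p
      by (rule continuous_on_compose2[OF continuous_trap]) (auto intro!: continuous_intros)
    then show ?thesis unfolding \<zeta>_def by (intro continuous_intros)
  qed
  have c\<eta>: "continuous_on UNIV (\<eta> n)" for n
    using d by (meson DERIV_isCont continuous_at_imp_continuous_on)
  have z\<zeta>: "\<zeta> n t = 0" if "t \<notin> {x..z}" for n t
    using that ab unfolding \<zeta>_def by (auto simp: trap_zero)
  have zz: "integral {0..r} (trap s n) = integral {0..s} (trap s n)" if "r \<ge> s" for r n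
  proof -
    have "integral {0..s} (trap s n) + integral {s..r} (trap s n) = integral {0..r} (trap s n)"
      by (rule Henstock_Kurzweil_Integration.integral_combine)
         (use that ab in \<open>auto intro!: integrable_continuous_real continuous_trap\<close>)
    moreover have "integral {s..r} (trap s n) = integral {s..r} (\<lambda>_. 0)"
      by (rule integral_cong) (use ab in \<open>auto simp: trap_zero\<close>)
    ultimately show ?thesis by simp
  qed
  have z\<eta>: "\<eta> n t = 0" if "t \<notin> {x..z}" for n t
  proof (cases "t < x")
    case True
    then show ?thesis using ab by (simp add: \<eta>_def)
  next
    case False
    then show ?thesis using that ab zz[of "t - x" n] zz[of "t - y" n] by (simp add: \<eta>_def)
  qed
  have test: "\<eta> n \<in> test_functions {a<..<b}" for n
  proof -
    have "\<eta> n C1_differentiable_on UNIV"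
      unfolding C1_differentiable_on_def using d c\<zeta> has_real_derivative_iff_has_vector_derivative by blast
    then show ?thesis
      unfolding test_functions_def using sub z\<eta> by (auto intro!: exI[of _ "{x..z}"])
  qed
  have deriv: "deriv (\<eta> n) = \<zeta> n" for n
    using d DERIV_imp_deriv by blast
  have id: "integral {x..z} (\<lambda>t. v t * \<zeta> n t) = - integral {x..z} (\<lambda>t. g t * \<eta> n t)" for n
  proof -
    have "L2_inner {a<..<b} v (\<zeta> n) = - L2_inner {a<..<b} g (\<eta> n)"
      using w test[of n] deriv unfolding has_weak_deriv_def by auto
    moreover have "L2_inner {a<..<b} v (\<zeta> n) = integral {x..z} (\<lambda>t. v t * \<zeta> n t)"
      unfolding L2_inner_def
      by (rule integral_lebesgue_on_supported[OF prod[OF v c\<zeta>]]) (use sub z\<zeta> in auto)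
    moreover have "L2_inner {a<..<b} g (\<eta> n) = integral {x..z} (\<lambda>t. g t * \<eta> n t)"
      unfolding L2_inner_def
      by (rule integral_lebesgue_on_supported[OF prod[OF g c\<eta>]]) (use sub z\<eta> in auto)
    ultimately show ?thesis by simp
  qed
  have ind: "integral {x..z} (\<lambda>t. v t * indicator {0<..<s} (t - p)) = integral {p..p+s} v"
    "(\<lambda>t. v t * indicator {0<..<s} (t - p)) integrable_on {x..z}"
    if "x \<le> p" "p + s \<le> z" for p
  proof -
    have vp: "v integrable_on {p..p+s}"
      using v that set_lebesgue_integral_eq_integral(1)
      by (metis absolutely_integrable_on_subinterval atLeastatMost_subset_iff)
    have h: "((\<lambda>t. if t \<in> {p..p+s} then v t else 0) has_integral integral {p..p+s} v) {x..z}"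
      using that vp by (subst has_integral_restrict) (auto simp: integrable_integral)
    have "((\<lambda>t. v t * indicator {0<..<s} (t - p)) has_integral integral {p..p+s} v) {x..z}"
      by (rule has_integral_spike[of "{p,p+s}", OF _ _ h]) (auto simp: indicator_def)
    then show "integral {x..z} (\<lambda>t. v t * indicator {0<..<s} (t - p)) = integral {p..p+s} v"
      "(\<lambda>t. v t * indicator {0<..<s} (t - p)) integrable_on {x..z}"
      by (auto simp: has_integral_iff)
  qed
  have iabs: "(\<lambda>t. c * \<bar>f t\<bar>) integrable_on {x..z}" if "f absolutely_integrable_on {x..z}" for f :: "real \<Rightarrow> real" and c
    using that by (intro integrable_on_mult_right) (simp add: absolutely_integrable_on_def)
  have lim1: "(\<lambda>n. integral {x..z} (\<lambda>t. v t * \<zeta> n t)) \<longlonglongrightarrow>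
      integral {x..z} (\<lambda>t. v t * (indicator {0<..<s} (t - x) - indicator {0<..<s} (t - y)))"
  proof (rule dominated_convergence[of _ _ "\<lambda>t. 2 * \<bar>v t\<bar>"])
    show "(\<lambda>t. v t * \<zeta> n t) integrable_on {x..z}" for n
      using prod[OF v c\<zeta>] set_lebesgue_integral_eq_integral(1) by blast
    show "norm (v t * \<zeta> n t) \<le> 2 * \<bar>v t\<bar>" for n t
    proof -
      have "\<bar>\<zeta> n t\<bar> \<le> 2" unfolding \<zeta>_def using trap_bounds[of s n "t - x"] trap_bounds[of s n "t - y"] by linarith
      then have "\<bar>v t\<bar> * \<bar>\<zeta> n t\<bar> \<le> \<bar>v t\<bar> * 2" by (intro mult_left_mono) auto
      then show ?thesis by (simp add: abs_mult)
    qed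
    show "(\<lambda>n. v t * \<zeta> n t) \<longlonglongrightarrow> v t * (indicator {0<..<s} (t - x) - indicator {0<..<s} (t - y))" for t
      unfolding \<zeta>_def using ab by (intro tendsto_intros trap_tendsto)
  qed (rule iabs[OF v])
  have r1: "integral {x..z} (\<lambda>t. v t * (indicator {0<..<s} (t - x) - indicator {0<..<s} (t - y)))
      = integral {x..x+s} v - integral {y..y+s} v"
    using ind[of x] ind[of y] ab by (simp add: right_diff_distrib integral_diff)
  have lim2: "(\<lambda>n. integral {x..z} (\<lambda>t. g t * \<eta> n t)) \<longlonglongrightarrow>
      integral {x..z} (\<lambda>t. g t * (ramp s (t - x) - ramp s (t - y)))"
  proof (rule dominated_convergence[of _ _ "\<lambda>t. (2 * (z - x)) * \<bar>g t\<bar>"])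
    show "(\<lambda>t. g t * \<eta> n t) integrable_on {x..z}" for n
      using prod[OF g c\<eta>] set_lebesgue_integral_eq_integral(1) by blast
    show "norm (g t * \<eta> n t) \<le> (2 * (z - x)) * \<bar>g t\<bar>" if "t \<in> {x..z}" for n t
    proof -
      have i: "\<bar>integral {0..t - p} (trap s n)\<bar> \<le> z - x" if "x \<le> p" for p
      proof -
        have "norm (integral {0..t - p} (trap s n)) \<le> integral {0..t - p} (\<lambda>_. 1)"
          by (rule integral_norm_bound_integral)
             (auto simp: trap_bounds intro!: integrable_continuous_real continuous_trap)
        then show ?thesis using that \<open>t \<in> {x..z}\<close> by (auto split: if_splits)
      qed
      have "\<bar>\<eta> n t\<bar> \<le> 2 * (z - x)" unfolding \<eta>_def using i[OF order_refl] i[OF ab(2)] by (smt (verit))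
      then have "\<bar>g t\<bar> * \<bar>\<eta> n t\<bar> \<le> \<bar>g t\<bar> * (2 * (z - x))" by (intro mult_left_mono) auto
      then show ?thesis by (simp add: abs_mult mult_ac)
    qed
    show "(\<lambda>n. g t * \<eta> n t) \<longlonglongrightarrow> g t * (ramp s (t - x) - ramp s (t - y))" for t
      unfolding \<eta>_def using ab by (intro tendsto_intros integral_trap_tendsto)
  qed (rule iabs[OF g])
  have "(\<lambda>n. integral {x..z} (\<lambda>t. v t * \<zeta> n t)) \<longlonglongrightarrow>
      - integral {x..z} (\<lambda>t. g t * (ramp s (t - x) - ramp s (t - y)))"
    unfolding id using lim2 by (rule tendsto_minus)
  then show ?thesis using LIMSEQ_unique lim1[unfolded r1] by blast
qed

text \<open>Dividing the bump identity by \<open>s\<close> and letting \<open>s\<close> tend to 0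
  turns its left side into point values at Lebesgue points of \<open>v\<close>, while the normalised
  bump tends to the indicator function of the interval between the two points.\<close>

lemma weak_deriv_integral:
  assumes w: "has_weak_deriv {a<..<b} v g" and vi: "v absolutely_integrable_on {a..b}"
    and gi: "g absolutely_integrable_on {a..b}"
  obtains Z where "negligible Z"
    "\<And>x y. x \<in> {a<..<b} - Z \<Longrightarrow> y \<in> {a<..<b} - Z \<Longrightarrow> x < y \<Longrightarrow> v y - v x = integral {x..y} g"
proof -
  obtain Z where Z: "negligible Z" and
    *: "\<And>x. x \<in> {a<..<b} - Z \<Longrightarrow> ((\<lambda>h. integral {x..x+h} v / h) \<longlongrightarrow> v x) (at_right 0)"
    using lebesgue_points[OF vi] by metis
  show ?thesis
  proof (rule that[OF Z])
    fix x y assume x: "x \<in> {a<..<b} - Z" and y: "y \<in> {a<..<b} - Z" and xy: "x < y"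
    \<comment> \<open>Room to the right of \<open>y\<close>: every bump with
      \<open>s n \<le> z - y\<close> is supported in \<open>{x..z}\<close>, away from
      \<open>b\<close>.\<close>
    define z where "z = (y + b) / 2"
    have z: "y < z" "z < b" using y by (auto simp: z_def)
    define s where "s n = min (z - y) 1 / real (Suc n)" for n
    have s0: "s n > 0" and sz: "s n \<le> z - y" for n
    proof -
      show "s n > 0" using z by (auto simp: s_def)
      have "min (z - y) 1 / real (Suc n) \<le> min (z - y) 1 / 1" using z by (intro divide_left_mono) auto
      then show "s n \<le> z - y" by (auto simp: s_def)
    qed
    have slim: "s \<longlonglongrightarrow> 0" unfolding s_def
      using LIMSEQ_Suc[OF lim_const_over_n] by simp
    then have sat: "filterlim s (at_right 0) sequentially"
      using less_imp_neq[OF s0, symmetric] s0 by (auto simp: filterlim_at)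
    have gz: "g absolutely_integrable_on {x..z}"
      using gi by (rule absolutely_integrable_on_subinterval) (use x z in auto)
    have l: "(\<lambda>n. integral {p..p+s n} v / s n) \<longlonglongrightarrow> v p" if "p \<in> {a<..<b} - Z" for p
      using filterlim_compose[OF *[OF that] sat] .
    have d1: "(\<lambda>n. integral {x..x+s n} v / s n - integral {y..y+s n} v / s n) \<longlonglongrightarrow> v x - v y"
      by (intro tendsto_diff l x y)
    have d2: "integral {x..x+s n} v / s n - integral {y..y+s n} v / s n
      = - integral {x..z} (\<lambda>t. g t * ((ramp (s n) (t - x) - ramp (s n) (t - y)) / s n))" for n
    proof -
      have "integral {x..x+s n} v / s n - integral {y..y+s n} v / s n
        = (integral {x..x+s n} v - integral {y..y+s n} v) / s n" by (simp add: diff_divide_distrib)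
      also have "\<dots> = - integral {x..z} (\<lambda>t. g t * (ramp (s n) (t - x) - ramp (s n) (t - y))) / s n"
        using weak_deriv_ramp[OF w, of x y "s n" z] x xy z s0[of n] sz[of n] by auto
      also have "\<dots> = - integral {x..z} (\<lambda>t. g t * (ramp (s n) (t - x) - ramp (s n) (t - y)) / s n)"
        by simp
      finally show ?thesis by simp
    qed
    have d3: "(\<lambda>n. integral {x..z} (\<lambda>t. g t * ((ramp (s n) (t - x) - ramp (s n) (t - y)) / s n)))
      \<longlonglongrightarrow> integral {x..z} (\<lambda>t. g t * indicator {x<..y} t)"
    proof (rule dominated_convergence[of _ _ "\<lambda>t. \<bar>g t\<bar>"])
      have c: "continuous_on {x..z} (\<lambda>t. (ramp (s n) (t - x) - ramp (s n) (t - y)) / s n)" for n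
        unfolding ramp_def using s0[of n] by (intro continuous_intros) auto
      have "(\<lambda>t. (ramp (s n) (t - x) - ramp (s n) (t - y)) / s n * g t) absolutely_integrable_on {x..z}" for n
        by (rule absolutely_integrable_bounded_measurable_product_real)
         (use c gz in \<open>auto intro: continuous_imp_measurable_on_sets_lebesgue compact_imp_bounded compact_continuous_image\<close>)
      then show "(\<lambda>t. g t * ((ramp (s n) (t - x) - ramp (s n) (t - y)) / s n)) integrable_on {x..z}" for n
        by (simp add: mult.commute absolutely_integrable_on_def)
      show "norm (g t * ((ramp (s n) (t - x) - ramp (s n) (t - y)) / s n)) \<le> \<bar>g t\<bar>" for n t
      proof -
        have "\<bar>ramp (s n) (t - x) - ramp (s n) (t - y)\<bar> \<le> s n"
          using s0[of n] xy by (auto simp: ramp_def)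
        then have "\<bar>(ramp (s n) (t - x) - ramp (s n) (t - y)) / s n\<bar> \<le> 1"
          using s0[of n] by (simp add: abs_divide)
        then have "\<bar>g t\<bar> * \<bar>(ramp (s n) (t - x) - ramp (s n) (t - y)) / s n\<bar> \<le> \<bar>g t\<bar> * 1"
          by (intro mult_left_mono) auto
        then show ?thesis by (simp add: abs_mult)
      qed
      show "(\<lambda>n. g t * ((ramp (s n) (t - x) - ramp (s n) (t - y)) / s n)) \<longlonglongrightarrow> g t * indicator {x<..y} t"
        if t: "t \<in> {x..z}" for t
      proof (intro tendsto_mult tendsto_const)
        have ev: "eventually (\<lambda>n. s n < r) sequentially" if "r > 0" for r
          using order_tendstoD(2)[OF slim that] .
        \<comment> \<open>The normalised bump is 0 at \<open>x\<close>, eventually 1 at each point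
          of (x, y], and eventually 0 at each point to the right of \<open>y\<close>.\<close>
        consider "t = x" | "x < t" "t \<le> y" | "y < t" using t by fastforce
        then show "(\<lambda>n. (ramp (s n) (t - x) - ramp (s n) (t - y)) / s n) \<longlonglongrightarrow> indicator {x<..y} t"
        proof cases
          case 1
          then show ?thesis using xy less_imp_le[OF s0] by (simp add: ramp_def)
        next
          case 2
          have "eventually (\<lambda>n. (ramp (s n) (t - x) - ramp (s n) (t - y)) / s n = 1) sequentially"
            using ev[of "t - x"] 2 less_imp_le[OF s0] s0 
            by (auto elim!: eventually_mono simp: ramp_def) (metis less_irrefl)
          then show ?thesis using 2 by (simp add: tendsto_eventually)
        next
          case 3
          have "eventually (\<lambda>n. (ramp (s n) (t - x) - ramp (s n) (t - y)) / s n = 0) sequentially"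
            using ev[of "t - y"] 3 xy
            by (auto elim!: eventually_mono simp: ramp_def)
          then show ?thesis using 3 by (simp add: tendsto_eventually)
        qed
      qed
      show "(\<lambda>t. \<bar>g t\<bar>) integrable_on {x..z}"
        using gz by (simp add: absolutely_integrable_on_def)
    qed
    have "v x - v y = - integral {x..z} (\<lambda>t. g t * indicator {x<..y} t)"
      using LIMSEQ_unique[OF d1[unfolded d2] tendsto_minus[OF d3]] .
    moreover have "integral {x..z} (\<lambda>t. g t * indicator {x<..y} t) = integral {x..y} g"
    proof -
      have "integral {x..z} (\<lambda>t. g t * indicator {x<..y} t) = integral {x..z} (\<lambda>t. if t \<in> {x..y} then g t else 0)"
        by (rule integral_spike[of "{x}"]) (auto simp: indicator_def)
      also have "\<dots> = integral ({x..y} \<inter> {x..z}) g"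
        by (rule integral_restrict_Int)
      also have "{x..y} \<inter> {x..z} = {x..y}" using z by auto
      finally show ?thesis .
    qed
    ultimately show "v y - v x = integral {x..y} g" by simp
  qed
qed

lemma dense_Ioo_minus_negligible:
  fixes Z :: "real set"
  assumes "negligible Z" "a < b"
  shows "{a..b} \<subseteq> closure ({a<..<b} - Z)"
proof
  fix x assume x: "x \<in> {a..b}"
  show "x \<in> closure ({a<..<b} - Z)"
    unfolding closure_approachable
  proof (intro allI impI)
    fix e :: real assume "e > 0"
    define p where "p = max a (x - e)"
    define q where "q = min b (x + e)"
    have "p < q" using x \<open>e > 0\<close> assms by (auto simp: p_def q_def)
    then have "\<not> negligible {p<..<q}" using open_not_negligible[of "{p<..<q}"] by auto
    then have "\<not> {p<..<q} \<subseteq> Z" using assms negligible_subset by blast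
    then obtain y where "y \<in> {p<..<q}" "y \<notin> Z" by blast
    then show "\<exists>y\<in>{a<..<b} - Z. dist y x < e"
      by (intro bexI[of _ y]) (auto simp: p_def q_def dist_real_def)
  qed
qed

lemma L2_inner_restrict:
  assumes "D' \<subseteq> D" "D \<in> sets lebesgue" "D' \<in> sets lebesgue" "\<And>x. x \<in> D - D' \<Longrightarrow> f x = 0"
  shows "L2_inner D v f = L2_inner D' v f"
proof -
  have "L2_inner D v f = integral\<^sup>L lebesgue (\<lambda>x. indicator D x *\<^sub>R (v x * f x))"
    unfolding L2_inner_def using assms by (subst integral_restrict_space) auto
  also have "(\<lambda>x. indicator D x *\<^sub>R (v x * f x)) = (\<lambda>x. indicator D' x *\<^sub>R (v x * f x))"
    using assms by (auto simp: indicator_def fun_eq_iff)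
  also have "integral\<^sup>L lebesgue \<dots> = L2_inner D' v f"
    unfolding L2_inner_def using assms by (subst integral_restrict_space) auto
  finally show ?thesis .
qed

text \<open>A test function of the smaller interval is one of the larger, and both it and its
  derivative vanish outside its compact support \<open>K\<close>.\<close>

lemma has_weak_deriv_subinterval:
  assumes w: "has_weak_deriv {a<..<b} v g" and ab: "a \<le> p" "q \<le> b"
  shows "has_weak_deriv {p<..<q} v g"
proof -
  have sub: "{p<..<q} \<subseteq> {a<..<b}" using ab by auto
  have "L2_inner {p<..<q} v (deriv \<eta>) = - L2_inner {p<..<q} g \<eta>"
    if t: "\<eta> \<in> test_functions {p<..<q}" for \<eta>
  proof -
    obtain K where K: "compact K" "K \<subseteq> {p<..<q}" "\<And>x. x \<notin> K \<Longrightarrow> \<eta> x = 0"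
      using t by (auto simp: test_functions_def)
    have t': "\<eta> \<in> test_functions {a<..<b}"
      using t sub by (auto simp: test_functions_def)
    have d: "deriv \<eta> x = 0" if "x \<notin> K" for x
    proof -
      have "open (- K)" using K compact_imp_closed by blast
      then have "(\<eta> has_real_derivative 0) (at x)"
        using has_field_derivative_transform_within_open[of "\<lambda>_. 0" 0 x "- K" \<eta>] K(3) that by auto
      then show ?thesis by (rule DERIV_imp_deriv)
    qed
    have "L2_inner {a<..<b} v (deriv \<eta>) = L2_inner {p<..<q} v (deriv \<eta>)"
      by (rule L2_inner_restrict[OF sub]) (simp, simp, use K(2) d in blast)
    moreover have "L2_inner {a<..<b} g \<eta> = L2_inner {p<..<q} g \<eta>"
      by (rule L2_inner_restrict[OF sub]) (simp, simp, use K(2,3) in blast)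
    moreover have "L2_inner {a<..<b} v (deriv \<eta>) = - L2_inner {a<..<b} g \<eta>"
      using w t' by (auto simp: has_weak_deriv_def)
    ultimately show ?thesis by simp
  qed
  moreover have "loc_integrable {p<..<q} v" "loc_integrable {p<..<q} g"
    using w sub unfolding has_weak_deriv_def loc_integrable_def by blast+
  ultimately show ?thesis by (simp add: has_weak_deriv_def)
qed

lemma loc_integrable_Icc:
  assumes "loc_integrable {a<..<b} f" "a < p" "q < b"
  shows "f absolutely_integrable_on {p..q}"
proof -
  have "{p..q} \<subseteq> {a<..<b}" using assms by auto
  then have "integrable (lebesgue_on {p..q}) f"
    using assms(1) unfolding loc_integrable_def by (meson compact_Icc)
  then show ?thesis by (simp add: integrable_restrict_space set_integrable_def)
qed

text \<open>Both candidates have the same integral between any two points off a null set, so the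
  Lipschitz criterion applies to their difference with constant 0. Weak derivatives are only locally
  integrable, so the argument runs on compact subintervals that exhaust the interval.\<close>

lemma weak_deriv_unique:
  assumes g: "has_weak_deriv {a<..<b} v g" and h: "has_weak_deriv {a<..<b} v h"
  obtains Z where "negligible Z" "\<And>x. x \<in> {a<..<b} - Z \<Longrightarrow> g x = h x"
proof -
  have "\<exists>Z. negligible Z \<and> (\<forall>x\<in>{p<..<q} - Z. g x = h x)" if pq: "a < p" "q < b" for p q
  proof -
    have li: "loc_integrable {a<..<b} v" "loc_integrable {a<..<b} g" "loc_integrable {a<..<b} h"
      using g h by (auto simp: has_weak_deriv_def)
    note ai = li[THEN loc_integrable_Icc, OF pq]
    have wg: "has_weak_deriv {p<..<q} v g" and wh: "has_weak_deriv {p<..<q} v h"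
      using has_weak_deriv_subinterval g h pq by auto
    obtain Z1 where Z1: "negligible Z1" "\<And>x y. x \<in> {p<..<q} - Z1 \<Longrightarrow> y \<in> {p<..<q} - Z1 \<Longrightarrow> x < y \<Longrightarrow> v y - v x = integral {x..y} g"
      using weak_deriv_integral[OF wg ai(1,2)] by metis
    obtain Z2 where Z2: "negligible Z2" "\<And>x y. x \<in> {p<..<q} - Z2 \<Longrightarrow> y \<in> {p<..<q} - Z2 \<Longrightarrow> x < y \<Longrightarrow> v y - v x = integral {x..y} h"
      using weak_deriv_integral[OF wh ai(1,3)] by metis
    have d: "(\<lambda>x. g x - h x) absolutely_integrable_on {p..q}"
      using ai by (intro set_integral_diff(1))
    obtain Z' where "negligible Z'" "\<And>t. t \<in> {p<..<q} - Z' \<Longrightarrow> \<bar>g t - h t\<bar> \<le> 0"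
    proof (rule AE_bound_of_Lipschitz_integral[OF d negligible_Un[OF Z1(1) Z2(1)], of 0])
      fix x y assume xy: "x \<in> {p<..<q} - (Z1 \<union> Z2)" "y \<in> {p<..<q} - (Z1 \<union> Z2)" "x < y"
      have "g absolutely_integrable_on {x..y}" "h absolutely_integrable_on {x..y}"
        by (rule absolutely_integrable_on_subinterval[OF ai(2)] absolutely_integrable_on_subinterval[OF ai(3)]; use xy in auto)+
      then have "g integrable_on {x..y}" "h integrable_on {x..y}"
        by (auto simp: absolutely_integrable_on_def)
      then show "\<bar>integral {x..y} (\<lambda>x. g x - h x)\<bar> \<le> 0 * (y - x)"
        using Z1(2)[of x y] Z2(2)[of x y] xy by (simp add: integral_diff)
    qed metis
    then show ?thesis by (intro exI[of _ Z']) auto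
  qed
  then have "\<exists>Z. negligible Z \<and> (\<forall>x\<in>{a + 1 / real (Suc n)<..<b - 1 / real (Suc n)} - Z. g x = h x)" for n
    by (simp add: divide_simps)
  then obtain Z where Z: "\<And>n. negligible (Z n)"
    "\<And>n x. x\<in>{a + 1 / real (Suc n)<..<b - 1 / real (Suc n)} - Z n \<Longrightarrow> g x = h x"
    by metis
  show ?thesis
  proof (rule that[of "\<Union>n. Z n"])
    show "negligible (\<Union>n. Z n)" using Z(1) by (rule negligible_Union_nat)
    fix x assume x: "x \<in> {a<..<b} - (\<Union>n. Z n)"
    then obtain n where "inverse (real (Suc n)) < min (x - a) (b - x)"
      using reals_Archimedean[of "min (x - a) (b - x)"] by auto
    then show "g x = h x" using x by (intro Z(2)[of _ n]) (auto simp: inverse_eq_divide)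
  qed
qed

lemma L2on_spike:
  assumes g: "L2on a b g" and Z: "negligible Z" "\<And>x. x \<in> {a<..<b} - Z \<Longrightarrow> h x = g x"
  shows "L2on a b h"
proof -
  have eq: "h x = g x" if "x \<in> {a..b} - (Z \<union> {a,b})" for x using that Z by auto
  have neg: "negligible (Z \<union> {a,b})" using Z by auto
  have "(\<lambda>x. (h x)\<^sup>2) integrable_on {a..b}"
    using integrable_spike[OF _ neg, of "\<lambda>x. (g x)\<^sup>2" "{a..b}" "\<lambda>x. (h x)\<^sup>2"] g eq by (auto simp: L2on_def)
  moreover have "h absolutely_integrable_on {a..b}"
    using absolutely_integrable_spike[OF L2on_absint[OF g] neg] eq by auto
  then have "h \<in> borel_measurable (lebesgue_on {a..b})"
    using absolutely_integrable_measurable_real[of "{a..b}" h] by auto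
  ultimately show ?thesis by (simp add: L2on_def)
qed

section \<open>Primitives of square integrable functions\<close>

text \<open>The derivative is an explicit argument, as \<open>wderiv\<close> is an arbitrary choice
  among functions that agree off null sets. With it, sums and differences have the expected
  derivative by construction.\<close>

definition AC :: "real \<Rightarrow> real \<Rightarrow> (real \<Rightarrow> real) \<Rightarrow> (real \<Rightarrow> real) \<Rightarrow> bool" where
  "AC a b v g \<longleftrightarrow> L2on a b g \<and> continuous_on {a..b} v \<and>
     (\<forall>x y. a \<le> x \<and> x \<le> y \<and> y \<le> b \<longrightarrow> v y - v x = integral {x..y} g)"

lemma AC_D: "AC a b v g \<Longrightarrow> a \<le> x \<Longrightarrow> x \<le> y \<Longrightarrow> y \<le> b \<Longrightarrow> v y - v x = integral {x..y} g"
  by (simp add: AC_def)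

lemma AC_L2: "AC a b v g \<Longrightarrow> L2on a b g" "AC a b v g \<Longrightarrow> L2on a b v" "AC a b v g \<Longrightarrow> continuous_on {a..b} v"
  by (auto simp: AC_def L2on_continuous)

lemma AC_subinterval: "AC a b v g \<Longrightarrow> a \<le> c \<Longrightarrow> d \<le> b \<Longrightarrow> AC c d v g"
  unfolding AC_def by (auto intro: L2on_subinterval continuous_on_subset)

lemma AC_add:
  assumes "AC a b v g" "AC a b v' g'"
  shows "AC a b (\<lambda>x. v x + v' x) (\<lambda>x. g x + g' x)"
proof -
  have "g integrable_on {x..y}" "g' integrable_on {x..y}" if "a \<le> x" "y \<le> b" for x y
    using assms that L2on_integrable L2on_subinterval AC_L2(1) by metis+
  then show ?thesis
    using assms unfolding AC_def
    by (auto intro!: L2on_add continuous_intros simp: integral_add) (smt (verit))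
qed

lemma AC_cmult:
  assumes "AC a b v g"
  shows "AC a b (\<lambda>x. c * v x) (\<lambda>x. c * g x)"
  using assms unfolding AC_def
  by (auto intro!: L2on_cmult continuous_intros simp flip: right_diff_distrib)

lemma AC_diff:
  assumes "AC a b v g" "AC a b v' g'"
  shows "AC a b (\<lambda>x. v x - v' x) (\<lambda>x. g x - g' x)"
  using AC_add[OF assms(1) AC_cmult[OF assms(2), of "-1"]] by simp

lemma AC_C1:
  assumes "\<And>x. x \<in> {a..b} \<Longrightarrow> (v has_real_derivative g x) (at x within {a..b})" "continuous_on {a..b} g"
  shows "AC a b v g"
  unfolding AC_def
proof (intro conjI allI impI)
  show "L2on a b g" using assms by (simp add: L2on_continuous)
  show "continuous_on {a..b} v" using assms(1) DERIV_continuous_on by blast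
  fix x y assume xy: "a \<le> x \<and> x \<le> y \<and> y \<le> b"
  have "(v has_vector_derivative g t) (at t within {x..y})" if "t \<in> {x..y}" for t
    using assms(1)[of t] that xy DERIV_subset[of v "g t" t "{a..b}" "{x..y}"]
    by (auto simp flip: has_real_derivative_iff_has_vector_derivative)
  then have "(g has_integral (v y - v x)) {x..y}"
    using xy by (intro fundamental_theorem_of_calculus) auto
  then show "v y - v x = integral {x..y} g" by (simp add: integral_unique)
qed

lemma AC_poly: "AC a b (poly p) (poly (pderiv p))"
  by (rule AC_C1) (auto intro!: has_field_derivative_at_within poly_DERIV continuous_intros)

text \<open>The link from Lipschitz constants of an interpolation error to bounds of its weak
  derivative.\<close>

lemma AC_Lipschitz_bound:
  assumes "AC a b v g" "\<And>x y. a < x \<Longrightarrow> x < y \<Longrightarrow> y < b \<Longrightarrow> \<bar>v y - v x\<bar> \<le> L * (y - x)"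
  obtains Z where "negligible Z" "\<And>t. t \<in> {a<..<b} - Z \<Longrightarrow> \<bar>g t\<bar> \<le> L"
proof (rule AE_bound_of_Lipschitz_integral[OF L2on_absint[OF AC_L2(1)[OF assms(1)]] negligible_empty])
  show "\<bar>integral {x..y} g\<bar> \<le> L * (y - x)" if "x \<in> {a<..<b} - {}" "y \<in> {a<..<b} - {}" "x < y" for x y
    using assms(2)[of x y] AC_D[OF assms(1), of x y] that by simp
qed (use that in blast)

lemma AC_unique:
  assumes "AC a b v g" "AC a b v' g'" "\<And>x. a < x \<Longrightarrow> x < b \<Longrightarrow> v x = v' x"
  obtains Z where "negligible Z" "\<And>t. t \<in> {a<..<b} - Z \<Longrightarrow> g t = g' t"
proof -
  obtain Z where "negligible Z" "\<And>t. t \<in> {a<..<b} - Z \<Longrightarrow> \<bar>g t - g' t\<bar> \<le> 0"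
    using AC_Lipschitz_bound[OF AC_diff[OF assms(1,2)], of 0] assms(3) by auto
  then show ?thesis using that by simp
qed

text \<open>The difference of both sides has derivative 0 everywhere, because its increment over
  \<open>{x..y}\<close> is at most a multiple of \<open>y - x\<close> times the integral of \<open>\<bar>g\<bar>\<close> over \<open>{x..y}\<close>.\<close>

lemma AC_by_parts:
  assumes e: "AC a b e g" and "a \<le> b"
    and r: "\<And>x. x \<in> {a..b} \<Longrightarrow> (r has_real_derivative r' x) (at x within {a..b})"
    and r': "continuous_on {a..b} r'"
  shows "integral {a..b} (\<lambda>t. g t * r t) = e b * r b - e a * r a - integral {a..b} (\<lambda>t. e t * r' t)"
proof -
  have rc: "AC a b r r'" by (rule AC_C1[OF r r'])
  obtain M where M: "\<And>t. t \<in> {a..b} \<Longrightarrow> \<bar>r' t\<bar> \<le> M" and M0: "M \<ge> 0"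
    using continuous_on_Icc_bounded[OF r'] by metis
  have gi: "g integrable_on {x..y}" and gai: "(\<lambda>t. \<bar>g t\<bar>) integrable_on {x..y}"
    and gri: "(\<lambda>t. g t * r t) integrable_on {x..y}" 
    and gsi: "(\<lambda>t. g t * (r t - c)) integrable_on {x..y}" 
    and eri: "(\<lambda>t. e t * r' t) integrable_on {x..y}"
    and esi: "(\<lambda>t. (e t - c) * r' t) integrable_on {x..y}"
    and r'i: "r' integrable_on {x..y}" if "a \<le> x" "y \<le> b" for x y c
  proof -
    have g: "L2on x y g" using L2on_subinterval[OF AC_L2(1)[OF e] that] .
    have sub: "{x..y} \<subseteq> {a..b}" using that by auto
    note c = continuous_on_subset[OF AC_L2(3)[OF rc] sub] continuous_on_subset[OF AC_L2(3)[OF e] sub]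
      continuous_on_subset[OF r' sub]
    show "g integrable_on {x..y}" using L2on_integrable[OF g] .
    show "(\<lambda>t. \<bar>g t\<bar>) integrable_on {x..y}" using L2on_absint[OF g] by (simp add: absolutely_integrable_on_def)
    show "(\<lambda>t. g t * r t) integrable_on {x..y}" "(\<lambda>t. g t * (r t - c)) integrable_on {x..y}"
      using c by (intro L2on_integrable_mult g L2on_continuous continuous_intros; simp)+
    show "(\<lambda>t. e t * r' t) integrable_on {x..y}" "(\<lambda>t. (e t - c) * r' t) integrable_on {x..y}"
      "r' integrable_on {x..y}"
      using c by (intro integrable_continuous_real continuous_intros; simp)+
  qed
  define G where "G y = integral {a..y} (\<lambda>t. \<bar>g t\<bar>)" for y
  define \<Phi> where "\<Phi> y = integral {a..y} (\<lambda>t. g t * r t + e t * r' t) - e y * r y" for y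
  have Gdiff: "integral {x..y} (\<lambda>t. \<bar>g t\<bar>) = G y - G x" if "a \<le> x" "x \<le> y" "y \<le> b" for x y
    using Henstock_Kurzweil_Integration.integral_combine[of a x y "\<lambda>t. \<bar>g t\<bar>"] gai[of a y] that by (simp add: G_def)
  have ev: "\<bar>e y - e x\<bar> \<le> G y - G x" if "a \<le> x" "x \<le> y" "y \<le> b" for x y
  proof -
    have "\<bar>e y - e x\<bar> = norm (integral {x..y} g)" using AC_D[OF e] that by simp
    also have "\<dots> \<le> integral {x..y} (\<lambda>t. \<bar>g t\<bar>)"
      by (rule integral_norm_bound_integral) (use gi gai that in auto)
    finally show ?thesis using Gdiff that by simp
  qed
  have Gmono: "G x \<le> G y" if "a \<le> x" "x \<le> y" "y \<le> b" for x y
    using ev[OF that] by linarith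
  have key: "\<bar>\<Phi> y - \<Phi> x\<bar> \<le> 2 * M * (G y - G x) * (y - x)" if xy: "a \<le> x" "x \<le> y" "y \<le> b" for x y
  proof -
    have "integral {a..x} (\<lambda>t. g t * r t + e t * r' t) + integral {x..y} (\<lambda>t. g t * r t + e t * r' t)
      = integral {a..y} (\<lambda>t. g t * r t + e t * r' t)"
      using xy by (intro Henstock_Kurzweil_Integration.integral_combine integrable_add gri eri) auto
    then have "\<Phi> y - \<Phi> x = integral {x..y} (\<lambda>t. g t * r t) + integral {x..y} (\<lambda>t. e t * r' t) - (e y * r y - e x * r x)"
      unfolding \<Phi>_def using xy gri eri by (simp add: integral_add)
    \<comment> \<open>Subtracting \<open>r x\<close> here and \<open>e y\<close> in the other
      integral makes the boundary terms cancel. What remains has one factor that is small with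
      \<open>y - x\<close> and one controlled by \<open>G y - G x\<close>.\<close>
    also have "integral {x..y} (\<lambda>t. g t * r t) = integral {x..y} (\<lambda>t. g t * (r t - r x)) + r x * (e y - e x)"
    proof -
      have "integral {x..y} (\<lambda>t. g t * r t) = integral {x..y} (\<lambda>t. g t * (r t - r x) + r x * g t)"
        by (intro integral_cong) (simp add: algebra_simps)
      also have "\<dots> = integral {x..y} (\<lambda>t. g t * (r t - r x)) + r x * integral {x..y} g"
        using gsi gi xy by (subst integral_add) (auto intro!: integrable_on_mult_right)
      finally show ?thesis using AC_D[OF e xy] by simp
    qed
    also have "integral {x..y} (\<lambda>t. e t * r' t) = integral {x..y} (\<lambda>t. (e t - e y) * r' t) + e y * (r y - r x)"
    proof -
      have "integral {x..y} (\<lambda>t. e t * r' t) = integral {x..y} (\<lambda>t. (e t - e y) * r' t + e y * r' t)"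
        by (intro integral_cong) (simp add: algebra_simps)
      also have "\<dots> = integral {x..y} (\<lambda>t. (e t - e y) * r' t) + e y * integral {x..y} r'"
        using esi r'i xy by (subst integral_add) (auto intro!: integrable_on_mult_right)
      finally show ?thesis using AC_D[OF rc xy] by simp
    qed
    finally have "\<Phi> y - \<Phi> x = integral {x..y} (\<lambda>t. g t * (r t - r x)) + integral {x..y} (\<lambda>t. (e t - e y) * r' t)"
      by (simp add: algebra_simps)
    moreover have "\<bar>integral {x..y} (\<lambda>t. g t * (r t - r x))\<bar> \<le> M * (y - x) * (G y - G x)"
    proof -
      have i: "(\<lambda>t. g t * (r t - r x)) integrable_on {x..y}"
        "(\<lambda>t. (M * (y - x)) * \<bar>g t\<bar>) integrable_on {x..y}"
        using gsi[OF xy(1,3)] gai[OF xy(1,3)] by (auto intro!: integrable_on_mult_right)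
      have "norm (integral {x..y} (\<lambda>t. g t * (r t - r x))) \<le> integral {x..y} (\<lambda>t. (M * (y - x)) * \<bar>g t\<bar>)"
      proof (rule integral_norm_bound_integral[OF i])
        fix t assume t: "t \<in> {x..y}"
        have "\<bar>r t - r x\<bar> = norm (integral {x..t} r')" using AC_D[OF rc] t xy by simp
        also have "\<dots> \<le> integral {x..t} (\<lambda>_. M)"
          by (rule integral_norm_bound_integral) (use r'i t xy M in auto)
        also have "\<dots> \<le> M * (y - x)" using t M0 by (simp add: mult.commute mult_left_mono)
        finally show "norm (g t * (r t - r x)) \<le> (M * (y - x)) * \<bar>g t\<bar>"
          using mult_left_mono[of "\<bar>r t - r x\<bar>" "M * (y - x)" "\<bar>g t\<bar>"] by (simp add: abs_mult mult_ac)
      qed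
      then show ?thesis using Gdiff[OF xy] by simp
    qed
    moreover have "\<bar>integral {x..y} (\<lambda>t. (e t - e y) * r' t)\<bar> \<le> M * (y - x) * (G y - G x)"
    proof -
      have "norm (integral {x..y} (\<lambda>t. (e t - e y) * r' t)) \<le> integral {x..y} (\<lambda>t. (G y - G x) * M)"
      proof (rule integral_norm_bound_integral[OF esi[OF xy(1,3)]])
        fix t assume t: "t \<in> {x..y}"
        have "\<bar>e t - e y\<bar> \<le> G y - G t" using ev[of t y] t xy by (simp add: abs_minus_commute)
        also have "\<dots> \<le> G y - G x" using Gmono[of x t] t xy by simp
        finally show "norm ((e t - e y) * r' t) \<le> (G y - G x) * M"
          unfolding real_norm_def abs_mult using M[of t] t xy by (intro mult_mono) auto
      qed (rule integrable_const_ivl)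
      then show ?thesis using xy by (simp add: mult_ac)
    qed
    moreover have "M * (y - x) * (G y - G x) + M * (y - x) * (G y - G x) = 2 * M * (G y - G x) * (y - x)"
      by (simp add: algebra_simps)
    ultimately show ?thesis by linarith
  qed
  \<comment> \<open>The difference quotient of \<open>\<Phi>\<close> is bounded by the increment of
    \<open>G\<close>, in both directions, and so tends to 0.\<close>
  have key2: "\<bar>(\<Phi> y - \<Phi> x) / (y - x)\<bar> \<le> 2 * M * \<bar>G y - G x\<bar>" if "x \<in> {a..b}" "y \<in> {a..b}" for x y
  proof (cases x y rule: linorder_cases)
    case less
    then show ?thesis using key[of x y] Gmono[of x y] that
      by (simp add: abs_divide pos_divide_le_eq)
  next
    case greater
    have "(\<Phi> y - \<Phi> x) / (y - x) = (\<Phi> x - \<Phi> y) / (x - y)"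
      using minus_divide_divide[of "\<Phi> x - \<Phi> y" "x - y"] by simp
    moreover have "\<bar>G y - G x\<bar> = \<bar>G x - G y\<bar>" by (rule abs_minus_commute)
    ultimately show ?thesis using greater key[of y x] Gmono[of y x] that
      by (simp add: abs_divide pos_divide_le_eq)
  qed (use M0 in auto)
  have Gc: "continuous_on {a..b} G"
    unfolding G_def using gai[of a b] by (intro indefinite_integral_continuous_1) auto
  have "\<exists>c. \<forall>x\<in>{a..b}. \<Phi> x = c"
  proof (rule has_field_derivative_zero_constant)
    fix x assume x: "x \<in> {a..b}"
    show "(\<Phi> has_real_derivative 0) (at x within {a..b})"
      unfolding has_field_derivative_iff
    proof (rule Lim_null_comparison[of _ "\<lambda>y. 2 * M * \<bar>G y - G x\<bar>"])
      show "\<forall>\<^sub>F y in at x within {a..b}. norm ((\<Phi> y - \<Phi> x) / (y - x)) \<le> 2 * M * \<bar>G y - G x\<bar>"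
        using key2[OF x] by (auto simp: eventually_at_filter)
      have "(G \<longlongrightarrow> G x) (at x within {a..b})" using Gc x by (simp add: continuous_on)
      then have "((\<lambda>y. 2 * M * \<bar>G y - G x\<bar>) \<longlongrightarrow> 2 * M * \<bar>G x - G x\<bar>) (at x within {a..b})"
        by (intro tendsto_intros)
      then show "((\<lambda>y. 2 * M * \<bar>G y - G x\<bar>) \<longlongrightarrow> 0) (at x within {a..b})" by simp
    qed
  qed simp
  then have "\<Phi> b = \<Phi> a" using \<open>a \<le> b\<close> by auto
  then show ?thesis unfolding \<Phi>_def using gri[of a b] eri[of a b] by (simp add: integral_add)
qed

section \<open>Continuous representatives of weakly differentiable functions\<close>

text \<open>The difference of \<open>v\<close> and the integral of its weak derivative is continuous
  and constant off a null set, hence constant. The choice made by \<open>wderiv\<close> is square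
  integrable, because it agrees almost everywhere with the derivative that \<open>Sobolev\<close>
  provides.\<close>

lemma H1_AC:
  assumes "v \<in> H1"
  shows "AC 0 2 v (wderiv Dom v)"
proof -
  obtain g where g: "v \<in> L2_space Dom" "g \<in> L2_space Dom" "has_weak_deriv Dom v g"
    and c: "continuous_on {0..2} v"
    using assms unfolding H1_def Sobolev_def by force
  have w: "has_weak_deriv Dom v (wderiv Dom v)"
    unfolding wderiv_def using someI[of "\<lambda>g. has_weak_deriv Dom v g", OF g(3)] .
  obtain Z where Z: "negligible Z" "\<And>x. x \<in> {0<..<2} - Z \<Longrightarrow> wderiv Dom v x = g x"
    using weak_deriv_unique[OF w g(3)] by metis
  have L: "L2on 0 2 v" "L2on 0 2 g" using g by (auto simp: L2_space_iff)
  then have L': "L2on 0 2 (wderiv Dom v)" using L2on_spike[OF L(2) Z(1), of "wderiv Dom v"] Z(2) by blast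
  obtain Y where Y: "negligible Y" "\<And>x y. x \<in> {0<..<2} - Y \<Longrightarrow> y \<in> {0<..<2} - Y \<Longrightarrow> x < y \<Longrightarrow>
     v y - v x = integral {x..y} (wderiv Dom v)"
    using weak_deriv_integral[OF w L2on_absint[OF L(1)] L2on_absint[OF L']] by metis
  define \<Phi> where "\<Phi> x = v x - integral {0..x} (wderiv Dom v)" for x
  have gi: "wderiv Dom v integrable_on {0..2}" by (rule L2on_integrable[OF L'])
  have c\<Phi>: "continuous_on {0..2} \<Phi>"
    unfolding \<Phi>_def by (intro continuous_intros c indefinite_integral_continuous_1 gi)
  have comb: "integral {0..x} (wderiv Dom v) + integral {x..y} (wderiv Dom v) = integral {0..y} (wderiv Dom v)"
    if "0 \<le> x" "x \<le> y" "y \<le> 2" for x y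
    using that gi by (intro Henstock_Kurzweil_Integration.integral_combine) (auto intro: integrable_subinterval_real)
  have "{0<..<2} - Y \<noteq> {}"
  proof
    assume e: "{0<..<2} - Y = {}"
    have "1 \<in> closure ({0<..<2} - Y)" using dense_Ioo_minus_negligible[OF Y(1), of 0 2] by force
    then show False unfolding e by simp
  qed
  then obtain x0 where x0: "x0 \<in> {0<..<2} - Y" by blast
  have S: "\<Phi> x = \<Phi> x0" if "x \<in> {0<..<2} - Y" for x
  proof -
    have "\<Phi> x = \<Phi> y" if "x \<in> {0<..<2} - Y" "y \<in> {0<..<2} - Y" "x < y" for x y
      unfolding \<Phi>_def using Y(2)[OF that] comb[of x y] that by auto
    then show ?thesis using that x0 by (cases x x0 rule: linorder_cases) auto
  qed
  have cl: "closure ({0<..<2} - Y) \<subseteq> {0..2}"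
    by (rule closure_minimal) auto
  have \<Phi>: "\<Phi> x = \<Phi> x0" if "x \<in> {0..2}" for x
    using continuous_constant_on_closure[of "{0<..<2} - Y" \<Phi> "\<Phi> x0" x] S
      continuous_on_subset[OF c\<Phi> cl] that dense_Ioo_minus_negligible[OF Y(1), of 0 2] by auto
  have "v y - v x = integral {x..y} (wderiv Dom v)" if "0 \<le> x" "x \<le> y" "y \<le> 2" for x y
    using comb[OF that] \<Phi>[of x] \<Phi>[of y] that by (simp add: \<Phi>_def)
  then show ?thesis using L' c by (simp add: AC_def)
qed

lemma loc_integrable_L2on:
  assumes "L2on a b f"
  shows "loc_integrable {a<..<b} f"
  unfolding loc_integrable_def
proof (intro allI impI)
  fix K assume K: "compact K \<and> K \<subseteq> {a<..<b}"
  have m: "K \<in> sets lebesgue" using K lmeasurable_compact by blast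
  have "K \<subseteq> {a..b}" using K by force
  then have "f absolutely_integrable_on K"
    using set_integrable_subset[OF L2on_absint[OF assms] m] by blast
  then show "integrable (lebesgue_on K) f"
    using m by (simp add: integrable_restrict_space set_integrable_def)
qed

text \<open>Integration by parts against a test function, which vanishes at 0 and 2.\<close>

lemma AC_H1:
  assumes "AC 0 2 v g"
  shows "v \<in> H1"
proof -
  have "L2_inner Dom v (deriv \<eta>) = - L2_inner Dom g \<eta>" if t: "\<eta> \<in> test_functions Dom" for \<eta>
  proof -
    obtain D where D: "\<And>x. (\<eta> has_real_derivative D x) (at x)" "continuous_on UNIV D"
      using t unfolding test_functions_def C1_differentiable_on_def
      by (auto simp: has_real_derivative_iff_has_vector_derivative)
    have "deriv \<eta> = D" using D(1) DERIV_imp_deriv by blast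
    obtain K where K: "K \<subseteq> Dom" "\<And>x. x \<notin> K \<Longrightarrow> \<eta> x = 0"
      using t by (auto simp: test_functions_def)
    have z: "\<eta> 0 = 0" "\<eta> 2 = 0" using K by (auto intro!: K(2))
    have c: "continuous_on {0..2} D" "continuous_on {0..2} \<eta>"
      using D continuous_on_subset by (blast, meson DERIV_isCont continuous_at_imp_continuous_on)
    have "integral {0..2} (\<lambda>t. g t * \<eta> t) = - integral {0..2} (\<lambda>t. v t * D t)"
      using AC_by_parts[OF assms, of \<eta> D] D(1) c z by (auto intro: has_field_derivative_at_within)
    moreover have "L2_inner Dom v D = integral {0..2} (\<lambda>t. v t * D t)"
      by (intro L2_inner_eq_integral L2on_mult AC_L2(2)[OF assms] L2on_continuous c)
    moreover have "L2_inner Dom g \<eta> = integral {0..2} (\<lambda>t. g t * \<eta> t)"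
      by (intro L2_inner_eq_integral L2on_mult AC_L2(1)[OF assms] L2on_continuous c)
    ultimately show ?thesis using \<open>deriv \<eta> = D\<close> by simp
  qed
  then have w: "has_weak_deriv Dom v g"
    using loc_integrable_L2on AC_L2[OF assms] by (auto simp: has_weak_deriv_def)
  have "v \<in> Sobolev 1 Dom"
    unfolding Sobolev_def using w AC_L2[OF assms]
    by (auto intro!: exI[of _ "\<lambda>j. if j = 0 then v else g"] simp: L2_space_iff)
  then show ?thesis using AC_L2[OF assms] by (simp add: H1_def)
qed

lemma H1_iff_AC: "v \<in> H1 \<longleftrightarrow> (\<exists>g. AC 0 2 v g)"
  using H1_AC AC_H1 by blast

lemma H1_diff: "v \<in> H1 \<Longrightarrow> g \<in> H1 \<Longrightarrow> (\<lambda>x. v x - g x) \<in> H1"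
  unfolding H1_iff_AC using AC_diff by blast

section \<open>Polynomials on a cell\<close>

text \<open>The bubble \<open>x * (1 - x)\<close> is the weight for which the moment conditions on the bubble part of
  the reference interpolant become orthogonality conditions.\<close>

definition bubble_ip :: "real poly \<Rightarrow> real poly \<Rightarrow> real" where
  "bubble_ip p q = integral {0..1} (\<lambda>x. x * (1 - x) * poly p x * poly q x)"

lemma bubble_integrable: "(\<lambda>x. x * (1 - x) * poly p x * poly q x) integrable_on {0..(1::real)}"
  by (intro integrable_continuous_real continuous_intros)

lemma bubble_ip_commute: "bubble_ip p q = bubble_ip q p"
  by (simp add: bubble_ip_def mult_ac)

lemma bubble_ip_add: "bubble_ip (p + p') q = bubble_ip p q + bubble_ip p' q"
proof -
  have "bubble_ip (p + p') q = integral {0..1} (\<lambda>x. x * (1 - x) * poly p x * poly q x + x * (1 - x) * poly p' x * poly q x)"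
    unfolding bubble_ip_def by (intro integral_cong) (simp add: algebra_simps)
  then show ?thesis using bubble_integrable by (simp add: integral_add bubble_ip_def)
qed

lemma bubble_ip_smult: "bubble_ip (smult c p) q = c * bubble_ip p q"
proof -
  have "bubble_ip (smult c p) q = integral {0..1} (\<lambda>x. c * (x * (1 - x) * poly p x * poly q x))"
    unfolding bubble_ip_def by (intro integral_cong) (simp add: algebra_simps)
  then show ?thesis by (simp add: bubble_ip_def)
qed

lemma bubble_ip_diff: "bubble_ip (p - p') q = bubble_ip p q - bubble_ip p' q"
  using bubble_ip_add[of p "smult (-1) p'" q] unfolding bubble_ip_smult by simp

lemma bubble_ip_sum: "bubble_ip (\<Sum>i\<in>A. f i) q = (\<Sum>i\<in>A. bubble_ip (f i) q)"
proof (induction A rule: infinite_finite_induct)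
  case empty
  show ?case by (simp add: bubble_ip_def)
qed (simp_all add: bubble_ip_add, simp add: bubble_ip_def)

text \<open>The weight is positive inside (0, 1), so a vanishing integral forces infinitely many
  roots.\<close>

lemma bubble_ip_pos:
  assumes "p \<noteq> 0"
  shows "bubble_ip p p > 0"
proof -
  have nn: "0 \<le> x * (1 - x) * poly p x * poly p x" if "x \<in> {0..1}" for x
    using that by (simp add: mult.assoc)
  have "0 \<le> bubble_ip p p"
    unfolding bubble_ip_def by (rule integral_nonneg[OF bubble_integrable nn])
  moreover have "bubble_ip p p \<noteq> 0"
  proof
    assume "bubble_ip p p = 0"
    then have "\<forall>x\<in>{0..1}. x * (1 - x) * poly p x * poly p x = 0"
      unfolding bubble_ip_def using nn
      by (subst (asm) integral_eq_0_iff) (auto intro!: continuous_intros)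
    then have "poly p x = 0" if "x \<in> {0<..<1}" for x using that by (auto dest!: bspec[of _ _ x])
    then have "{0<..<1} \<subseteq> {x. poly p x = 0}" by blast
    moreover have "infinite {0<..<1::real}" by (rule infinite_Ioo) simp
    ultimately show False using poly_roots_finite[OF assms] finite_subset by blast
  qed
  ultimately show ?thesis by simp
qed

text \<open>A condition on coefficients instead of the degree, so that \<open>poly_lt 0\<close> is
  the zero space. This covers linear interpolation, where there is no bubble part.\<close>

definition poly_lt :: "nat \<Rightarrow> real poly set" where
  "poly_lt n = {p. \<forall>k\<ge>n. coeff p k = 0}"

lemma poly_lt_degree: "p \<in> poly_lt n \<Longrightarrow> n > 0 \<Longrightarrow> degree p < n"
  unfolding poly_lt_def by (cases "p = 0") (auto, meson leading_coeff_0_iff not_less)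

lemma poly_lt_degreeI: "degree p < n \<Longrightarrow> p \<in> poly_lt n"
  by (auto simp: poly_lt_def intro: coeff_eq_0)

text \<open>Gram-Schmidt, one monomial at a time. The expansion is carried along because the later
  bounds rest on it: it recovers a polynomial from its weighted moments.\<close>

lemma bubble_orthonormal:
  "\<exists>e. (\<forall>i<n. e i \<in> poly_lt n) \<and>
     (\<forall>i<n. \<forall>j<n. bubble_ip (e i) (e j) = (if i = j then 1 else 0)) \<and>
     (\<forall>p\<in>poly_lt n. p = (\<Sum>i<n. smult (bubble_ip p (e i)) (e i)))"
proof (induction n)
  case 0
  show ?case by (auto simp: poly_lt_def poly_eq_iff)
next
  case (Suc n)
  then obtain e where e: "\<And>i. i < n \<Longrightarrow> e i \<in> poly_lt n"
    and o: "\<And>i j. i < n \<Longrightarrow> j < n \<Longrightarrow> bubble_ip (e i) (e j) = (if i = j then 1 else 0)"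
    and ex: "\<And>p. p \<in> poly_lt n \<Longrightarrow> p = (\<Sum>i<n. smult (bubble_ip p (e i)) (e i))"
    by metis
  define X where "X = monom (1::real) n"
  \<comment> \<open>Its leading coefficient is 1, so subtracting \<open>coeff p n\<close> times
    \<open>f\<close> moves any \<open>p\<close> of \<open>poly_lt (Suc n)\<close> into
    \<open>poly_lt n\<close>.\<close>
  define f where "f = X - (\<Sum>i<n. smult (bubble_ip X (e i)) (e i))"
  have cf: "coeff f n = 1" "coeff f k = 0" if "k > n" for k
    using e that by (auto simp: f_def X_def coeff_sum poly_lt_def)
  have cfn: "coeff f n = 1" using cf(1)[of "Suc n"] by simp
  then have "f \<noteq> 0" by auto
  define c where "c = bubble_ip f f"
  have c: "c > 0" unfolding c_def by (rule bubble_ip_pos) fact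
  have fo: "bubble_ip f (e j) = 0" if "j < n" for j
  proof -
    have "bubble_ip f (e j) = bubble_ip X (e j) - (\<Sum>i<n. bubble_ip X (e i) * (if i = j then 1 else 0))"
      unfolding f_def bubble_ip_diff bubble_ip_sum bubble_ip_smult using o that by (intro arg_cong2[of _ _ _ _ "(-)"] sum.cong) auto
    also have "\<dots> = 0" using that by (simp add: if_distrib[of "(*) _"] sum.delta cong: if_cong)
    finally show ?thesis .
  qed
  define e' where "e' i = (if i < n then e i else smult (1 / sqrt c) f)" for i
  have e'n: "e' n = smult (1 / sqrt c) f" by (simp add: e'_def)
  have e'l: "e' i = e i" if "i < n" for i using that by (simp add: e'_def)
  show ?case
  proof (intro exI[of _ e'] conjI allI impI ballI)
    fix i assume "i < Suc n"
    show "e' i \<in> poly_lt (Suc n)"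
    proof (cases "i < n")
      case True
      then show ?thesis using e[of i] by (auto simp: e'l poly_lt_def)
    next
      case False
      then show ?thesis using cf by (auto simp: e'_def poly_lt_def)
    qed
  next
    fix i j assume ij: "i < Suc n" "j < Suc n"
    have ff: "bubble_ip (e' n) (e' n) = 1"
      using c by (simp add: e'n bubble_ip_smult bubble_ip_commute[of f "smult _ f"] flip: c_def)
    consider "i < n" "j < n" | "i = n" "j < n" | "i < n" "j = n" | "i = n" "j = n" using ij by linarith
    then show "bubble_ip (e' i) (e' j) = (if i = j then 1 else 0)"
      by cases (use o fo ff in \<open>auto simp: e'l e'n bubble_ip_smult bubble_ip_commute[of "e _" "smult _ f"]\<close>)
  next
    fix p assume p: "p \<in> poly_lt (Suc n)"
    define p' where "p' = p - smult (coeff p n) f"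
    have "coeff p' k = 0" if "k \<ge> n" for k
      using that p cf(2)[of k] cfn by (cases "k = n") (auto simp: p'_def poly_lt_def)
    then have p': "p' \<in> poly_lt n" by (simp add: poly_lt_def)
    have pe: "bubble_ip p' (e i) = bubble_ip p (e i)" if "i < n" for i
      using fo[OF that] by (simp add: p'_def bubble_ip_diff bubble_ip_smult)
    have "bubble_ip p' f = 0"
      by (subst ex[OF p']) (simp add: bubble_ip_sum bubble_ip_smult bubble_ip_commute[of "e _" f] fo)
    then have pf: "bubble_ip p f = coeff p n * c"
      by (simp add: p'_def bubble_ip_diff bubble_ip_smult c_def)
    have "smult (bubble_ip p (e' n)) (e' n) = smult (coeff p n) f"
      using c by (simp add: e'n bubble_ip_commute[of p "smult _ _"] bubble_ip_smult bubble_ip_commute[of f p] pf)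
    moreover have "p' = (\<Sum>i<n. smult (bubble_ip p (e' i)) (e' i))"
      by (subst ex[OF p']) (auto intro!: sum.cong simp: pe e'l)
    ultimately show "p = (\<Sum>i<Suc n. smult (bubble_ip p (e' i)) (e' i))"
      by (simp add: p'_def algebra_simps)
  qed
qed

section \<open>Interpolation and inverse inequality on the reference cell\<close>

lemma poly_family_bounded:
  fixes n :: nat and e :: "nat \<Rightarrow> real poly"
  obtains E :: real where "E \<ge> 1"
    "\<And>i x. i < n \<Longrightarrow> x \<in> {0..1} \<Longrightarrow> \<bar>poly (e i) x\<bar> \<le> E" "\<And>i x. i < n \<Longrightarrow> x \<in> {0..1} \<Longrightarrow> \<bar>poly (pderiv (e i)) x\<bar> \<le> E"
proof -
  have "\<forall>p :: real poly. \<exists>M. M \<ge> 0 \<and> (\<forall>x\<in>{0..1}. \<bar>poly p x\<bar> \<le> M)"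
  proof
    fix p :: "real poly"
    have "continuous_on {0..1} (poly p)" by (intro continuous_intros)
    then obtain M where "M \<ge> 0" "\<And>t. t \<in> {0..1} \<Longrightarrow> \<bar>poly p t\<bar> \<le> M"
      using continuous_on_Icc_bounded[of 0 1 "poly p"] by metis
    then show "\<exists>M. M \<ge> 0 \<and> (\<forall>x\<in>{0..1}. \<bar>poly p x\<bar> \<le> M)" by blast
  qed
  from choice[OF this] obtain M :: "real poly \<Rightarrow> real"
    where M: "\<And>p. M p \<ge> 0" "\<And>p x. x \<in> {0..1} \<Longrightarrow> \<bar>poly p x\<bar> \<le> M p" by blast
  define E where "E = 1 + (\<Sum>i<n. M (e i) + M (pderiv (e i)))"
  have le: "M (e i) + M (pderiv (e i)) \<le> E" if "i < n" for i
  proof -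
    have "M (e i) + M (pderiv (e i)) \<le> (\<Sum>i<n. M (e i) + M (pderiv (e i)))"
      by (rule member_le_sum) (use that M(1) in \<open>auto intro: add_nonneg_nonneg\<close>)
    then show ?thesis by (simp add: E_def)
  qed
  have "E \<ge> 1" unfolding E_def using M(1) by (auto intro!: sum_nonneg add_nonneg_nonneg)
  then show ?thesis
  proof (rule that[of E])
    fix i x assume i: "i < n" and x: "x \<in> {0..(1::real)}"
    have "M (e i) \<le> E" "M (pderiv (e i)) \<le> E"
      using le[OF i] M(1)[of "e i"] M(1)[of "pderiv (e i)"] by linarith+
    then show "\<bar>poly (e i) x\<bar> \<le> E" "\<bar>poly (pderiv (e i)) x\<bar> \<le> E"
      using M(2)[OF x, of "e i"] M(2)[OF x, of "pderiv (e i)"] by linarith+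
  qed
qed

lemma pderiv_sum: "pderiv (\<Sum>i\<in>A. f i) = (\<Sum>i\<in>A. pderiv (f i :: real poly))"
  by (induction A rule: infinite_finite_induct) (simp_all add: pderiv_add)

lemma abs_sum_le_const:
  assumes "\<And>i. i < n \<Longrightarrow> \<bar>f i\<bar> \<le> (B::real)"
  shows "\<bar>\<Sum>i<n. f i\<bar> \<le> real n * B"
  using order_trans[OF sum_abs sum_bounded_above[of "{..<n}" "\<lambda>i. \<bar>f i\<bar>" B]] assms by simp

text \<open>The end values fix a linear part, and the remainder is the bubble times a polynomial
  \<open>s\<close> of degree at most q - 2. The moment conditions express the weighted moments of
  \<open>s\<close> through the data, so its coefficients in the orthonormal basis, and with them
  \<open>r\<close> and its derivative, are bounded by the sup of \<open>g\<close>.\<close>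

lemma ref_interp_stable:
  assumes q: "q \<ge> 1"
  obtains C :: real where "C \<ge> 0"
    "\<And>(r :: real poly) g M x. degree r \<le> q \<Longrightarrow> continuous_on {0..1} g \<Longrightarrow> (\<And>x. x \<in> {0..1} \<Longrightarrow> \<bar>g x\<bar> \<le> M) \<Longrightarrow>
       poly r 0 = g 0 \<Longrightarrow> poly r 1 = g 1 \<Longrightarrow>
       (\<And>\<xi>. degree \<xi> + 2 \<le> q \<Longrightarrow> integral {0..1} (\<lambda>t. (poly r t - g t) * poly \<xi> t) = 0) \<Longrightarrow>
       x \<in> {0..1} \<Longrightarrow> \<bar>poly r x\<bar> \<le> C * M \<and> \<bar>poly (pderiv r) x\<bar> \<le> C * M"
proof -
  define n where "n = q - 1"
  obtain e where e: "\<And>i. i < n \<Longrightarrow> e i \<in> poly_lt n"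
    and ex: "\<And>p. p \<in> poly_lt n \<Longrightarrow> p = (\<Sum>i<n. smult (bubble_ip p (e i)) (e i))"
    using bubble_orthonormal[of n] by metis
  obtain E where E: "E \<ge> 1" "\<And>i x. i < n \<Longrightarrow> x \<in> {0..1} \<Longrightarrow> \<bar>poly (e i) x\<bar> \<le> E"
    "\<And>i x. i < n \<Longrightarrow> x \<in> {0..1} \<Longrightarrow> \<bar>poly (pderiv (e i)) x\<bar> \<le> E"
    using poly_family_bounded[of n e] by metis
  \<comment> \<open>The derivative of the linear part is at most \<open>2 * M\<close>. The product
    rule adds two terms from the bubble part, each at most \<open>n\<close> times the coefficient
    bound \<open>2 * M * E\<close> times \<open>E\<close>.\<close>
  define C where "C = 2 + 4 * (real n * (E * E))"
  have "C \<ge> 0" using E(1) by (simp add: C_def)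
  show ?thesis
  proof (rule that[OF \<open>C \<ge> 0\<close>])
    fix r :: "real poly" and g M x
    assume r: "degree r \<le> q" and g: "continuous_on {0..1} g" "\<And>x. x \<in> {0..1} \<Longrightarrow> \<bar>g x\<bar> \<le> M"
      and end0: "poly r 0 = g 0" and end1: "poly r 1 = g 1"
      and mom: "\<And>\<xi>. degree \<xi> + 2 \<le> q \<Longrightarrow> integral {0..1} (\<lambda>t. (poly r t - g t) * poly \<xi> t) = 0"
      and x: "x \<in> {0..(1::real)}"
    have M: "M \<ge> 0" using g(2)[of 0] by simp
    define lin where "lin = [:g 0, g 1 - g 0:]"
    \<comment> \<open>Both end points are roots of \<open>r - lin\<close>. The sign of the quotient
      is changed below so that the factor becomes the bubble itself.\<close>
    have "[:-0, 1:] dvd r - lin"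
      unfolding poly_eq_0_iff_dvd[symmetric] using end0 by (simp add: lin_def)
    then obtain u where u: "r - lin = [:0, 1:] * u" by (auto simp: dvd_def)
    have "poly (r - lin) 1 = 0" using end1 by (simp add: lin_def)
    then have "poly u 1 = 0" unfolding u by simp
    then have "[:-1, 1:] dvd u" by (simp add: poly_eq_0_iff_dvd)
    then obtain s' where s': "u = [:-1, 1:] * s'" by (auto simp: dvd_def)
    define s where "s = - s'"
    define W where "W = [:0, 1, -1:: real:]"
    have rs: "r = lin + W * s"
      using u by (simp add: s' s_def W_def algebra_simps)
    have Wx: "poly W t = t * (1 - t)" for t by (simp add: W_def algebra_simps)
    have s: "s \<in> poly_lt n"
    proof (cases "s = 0")
      case False
      have "degree (W * s) = 2 + degree s"
        using False by (subst degree_mult_eq) (auto simp: W_def)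
      moreover have "degree (W * s) \<le> q"
      proof -
        have "W * s = r - lin" using rs by simp
        moreover have "degree lin \<le> q" using q by (auto simp: lin_def)
        ultimately show ?thesis using r degree_diff_le by metis
      qed
      ultimately show ?thesis by (intro poly_lt_degreeI) (auto simp: n_def)
    qed (simp add: poly_lt_def)
    have lin: "\<bar>poly lin t\<bar> \<le> M" if "t \<in> {0..1}" for t
    proof -
      have "poly lin t = (1 - t) * g 0 + t * g 1" by (simp add: lin_def algebra_simps)
      also have "\<bar>\<dots>\<bar> \<le> \<bar>(1 - t) * g 0\<bar> + \<bar>t * g 1\<bar>" by (rule abs_triangle_ineq)
      also have "\<dots> = (1 - t) * \<bar>g 0\<bar> + t * \<bar>g 1\<bar>" using that by (simp add: abs_mult)
      also have "\<dots> \<le> (1 - t) * M + t * M"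
        using that g(2) by (intro add_mono mult_left_mono) auto
      finally show ?thesis by (simp add: algebra_simps)
    qed
    \<comment> \<open>The basis elements have degree at most q - 2 and are admissible in the moment
      conditions, which replace \<open>r\<close> by \<open>g\<close>.\<close>
    have co: "\<bar>bubble_ip s (e i)\<bar> \<le> 2 * M * E" if i: "i < n" for i
    proof -
      have "n > 0" using i by simp
      then have "degree (e i) + 2 \<le> q" using poly_lt_degree[OF e[OF i]] by (simp add: n_def)
      note m = mom[OF this]
      have i1: "(\<lambda>t. (poly r t - g t) * poly (e i) t) integrable_on {0..1}"
        and i2: "(\<lambda>t. (g t - poly lin t) * poly (e i) t) integrable_on {0..1}"
        using g(1) by (auto intro!: integrable_continuous_real continuous_intros)
      have "bubble_ip s (e i) = integral {0..1} (\<lambda>t. (poly r t - g t) * poly (e i) t + (g t - poly lin t) * poly (e i) t)"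
        unfolding bubble_ip_def by (intro integral_cong) (simp add: rs Wx algebra_simps)
      also have "\<dots> = integral {0..1} (\<lambda>t. (g t - poly lin t) * poly (e i) t)"
        using m i1 i2 by (simp add: integral_add)
      finally have eq: "bubble_ip s (e i) = integral {0..1} (\<lambda>t. (g t - poly lin t) * poly (e i) t)" .
      have "norm (integral {0..1} (\<lambda>t. (g t - poly lin t) * poly (e i) t)) \<le> integral {0..(1::real)} (\<lambda>t. 2 * M * E)"
      proof (rule integral_norm_bound_integral[OF i2])
        fix t :: real assume t: "t \<in> {0..1}"
        have "\<bar>g t - poly lin t\<bar> \<le> 2 * M" using g(2)[OF t] lin[OF t] by linarith
        then show "norm ((g t - poly lin t) * poly (e i) t) \<le> 2 * M * E"
          unfolding real_norm_def abs_mult using E(2)[OF i t] M by (intro mult_mono) auto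
      qed (rule integrable_const_ivl)
      then show ?thesis by (simp add: eq)
    qed
    have sx: "\<bar>poly s x\<bar> \<le> real n * (2 * M * E * E)"
    proof -
      have "poly s x = (\<Sum>i<n. bubble_ip s (e i) * poly (e i) x)"
        by (subst ex[OF s]) (simp add: poly_sum)
      also have "\<bar>\<dots>\<bar> \<le> real n * (2 * M * E * E)"
        by (rule abs_sum_le_const) (unfold abs_mult, intro mult_mono co E x, use M E(1) in auto)
      finally show ?thesis .
    qed
    have s'x: "\<bar>poly (pderiv s) x\<bar> \<le> real n * (2 * M * E * E)"
    proof -
      have "pderiv s = (\<Sum>i<n. smult (bubble_ip s (e i)) (pderiv (e i)))"
        by (subst ex[OF s]) (simp add: pderiv_sum pderiv_smult)
      then have "poly (pderiv s) x = (\<Sum>i<n. bubble_ip s (e i) * poly (pderiv (e i)) x)"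
        by (simp add: poly_sum)
      also have "\<bar>\<dots>\<bar> \<le> real n * (2 * M * E * E)"
        by (rule abs_sum_le_const) (unfold abs_mult, intro mult_mono co E x, use M E(1) in auto)
      finally show ?thesis .
    qed
    have W1: "\<bar>poly W x\<bar> \<le> 1" 
      using x mult_le_one[of x "1 - x"] by (simp add: Wx abs_mult)
    have W2: "\<bar>poly (pderiv W) x\<bar> \<le> 1" using x by (simp add: W_def pderiv_pCons abs_le_iff)
    have Ws: "\<bar>poly W x * poly s x\<bar> \<le> 1 * (real n * (2 * M * E * E))"
      "\<bar>poly W x * poly (pderiv s) x\<bar> \<le> 1 * (real n * (2 * M * E * E))"
      "\<bar>poly (pderiv W) x * poly s x\<bar> \<le> 1 * (real n * (2 * M * E * E))"
      unfolding abs_mult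
      by (rule mult_mono[OF W1 sx], simp, simp, rule mult_mono[OF W1 s'x], simp, simp,
          rule mult_mono[OF W2 sx], simp, simp)
    have l': "\<bar>poly (pderiv lin) x\<bar> \<le> 2 * M"
      using g(2)[of 0] g(2)[of 1] by (simp add: lin_def pderiv_pCons)
    have "poly r x = poly lin x + poly W x * poly s x" by (simp add: rs)
    moreover have "poly (pderiv r) x = poly (pderiv lin) x + poly W x * poly (pderiv s) x + poly (pderiv W) x * poly s x"
      by (simp add: rs pderiv_add pderiv_mult algebra_simps)
    moreover have "C * M = 2 * M + (real n * (2 * M * E * E)) + (real n * (2 * M * E * E))"
      by (simp add: C_def algebra_simps)
    moreover have "0 \<le> real n * (2 * M * E * E)" using M E(1) by simp
    ultimately show "\<bar>poly r x\<bar> \<le> C * M \<and> \<bar>poly (pderiv r) x\<bar> \<le> C * M"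
      using Ws l' lin[OF x] M by linarith
  qed
qed

text \<open>The bubble part is the Riesz representative, with respect to \<open>bubble_ip\<close>,
  of the functional given by the moments of \<open>g - lin\<close>.\<close>

lemma ref_interp_exists:
  fixes g :: "real \<Rightarrow> real"
  assumes q: "q \<ge> 1" and g: "continuous_on {0..1} g"
  obtains r where "degree r \<le> q" "poly r 0 = g 0" "poly r 1 = g 1"
    "\<And>\<xi>. degree \<xi> + 2 \<le> q \<Longrightarrow> integral {0..1} (\<lambda>t. (poly r t - g t) * poly \<xi> t) = 0"
proof -
  define n where "n = q - 1"
  obtain e where e: "\<And>i. i < n \<Longrightarrow> e i \<in> poly_lt n"
    and o: "\<And>i j. i < n \<Longrightarrow> j < n \<Longrightarrow> bubble_ip (e i) (e j) = (if i = j then 1 else 0)"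
    and ex: "\<And>p. p \<in> poly_lt n \<Longrightarrow> p = (\<Sum>i<n. smult (bubble_ip p (e i)) (e i))"
    using bubble_orthonormal[of n] by metis
  define lin where "lin = [:g 0, g 1 - g 0:]"
  define W where "W = [:0, 1, -1:: real:]"
  have Wx: "poly W t = t * (1 - t)" for t by (simp add: W_def algebra_simps)
  define F where "F \<xi> = integral {0..1} (\<lambda>t. (g t - poly lin t) * poly \<xi> t)" for \<xi>
  have Fi: "(\<lambda>t. (g t - poly lin t) * poly \<xi> t) integrable_on {0..1}" for \<xi>
    using g by (auto intro!: integrable_continuous_real continuous_intros)
  define s where "s = (\<Sum>i<n. smult (F (e i)) (e i))"
  define r where "r = lin + W * s"
  have s: "s \<in> poly_lt n" using e by (auto simp: s_def poly_lt_def coeff_sum)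
  have sF: "bubble_ip s \<xi> = F \<xi>" if "\<xi> \<in> poly_lt n" for \<xi>
  proof -
    have se: "bubble_ip s (e j) = F (e j)" if "j < n" for j
    proof -
      have "bubble_ip s (e j) = (\<Sum>i<n. F (e i) * (if i = j then 1 else 0))"
        unfolding s_def bubble_ip_sum bubble_ip_smult using o that by (intro sum.cong) auto
      also have "\<dots> = F (e j)" using that by (simp add: if_distrib[of "(*) _"] sum.delta cong: if_cong)
      finally show ?thesis .
    qed
    \<comment> \<open>The test polynomial is expanded, not \<open>s\<close>: both sides are linear
      in it and agree on the basis.\<close>
    have "bubble_ip s \<xi> = bubble_ip (\<Sum>i<n. smult (bubble_ip \<xi> (e i)) (e i)) s"
      by (subst bubble_ip_commute, subst (1) ex[OF that]) simp
    also have "\<dots> = (\<Sum>i<n. bubble_ip \<xi> (e i) * F (e i))"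
      unfolding bubble_ip_sum bubble_ip_smult by (simp add: bubble_ip_commute[of "e _" s] se)
    also have "\<dots> = F (\<Sum>i<n. smult (bubble_ip \<xi> (e i)) (e i))"
    proof -
      have "F (\<Sum>i<n. smult (bubble_ip \<xi> (e i)) (e i)) =
        integral {0..1} (\<lambda>t. \<Sum>i<n. bubble_ip \<xi> (e i) * ((g t - poly lin t) * poly (e i) t))"
        unfolding F_def by (intro integral_cong) (simp add: poly_sum sum_distrib_left mult_ac)
      also have "\<dots> = (\<Sum>i<n. bubble_ip \<xi> (e i) * F (e i))"
        using Fi by (subst integral_sum) (auto intro!: integrable_on_mult_right simp: F_def)
      finally show ?thesis by simp
    qed
    finally show ?thesis using ex[OF that] by simp
  qed
  show ?thesis
  proof (rule that[of r])
    have "degree (W * s) \<le> q"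
    proof (cases "s = 0")
      case False
      then have "n > 0" using s by (auto simp: poly_lt_def poly_eq_iff intro!: gr0I)
      then show ?thesis
        using degree_mult_le[of W s] poly_lt_degree[OF s] q by (auto simp: W_def n_def)
    qed simp
    moreover have "degree lin \<le> q" using q by (auto simp: lin_def)
    ultimately show "degree r \<le> q" unfolding r_def by (rule degree_add_le[rotated])
    show "poly r 0 = g 0" "poly r 1 = g 1" by (auto simp: r_def Wx lin_def)
    fix \<xi> :: "real poly" assume "degree \<xi> + 2 \<le> q"
    then have \<xi>: "\<xi> \<in> poly_lt n" by (intro poly_lt_degreeI) (auto simp: n_def)
    have "integral {0..1} (\<lambda>t. (poly r t - g t) * poly \<xi> t) =
      integral {0..1} (\<lambda>t. t * (1 - t) * poly s t * poly \<xi> t - (g t - poly lin t) * poly \<xi> t)"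
      by (intro integral_cong) (simp add: r_def Wx algebra_simps)
    also have "\<dots> = bubble_ip s \<xi> - F \<xi>"
      using Fi bubble_integrable by (simp add: integral_diff bubble_ip_def F_def)
    finally show "integral {0..1} (\<lambda>t. (poly r t - g t) * poly \<xi> t) = 0"
      using sF[OF \<xi>] by simp
  qed
qed

text \<open>The coefficients in the weighted orthonormal basis are bounded by the unweighted L2
  norm, since the weight is at most 1; the derivatives of the finitely many basis elements share one
  bound \<open>E\<close>.\<close>

lemma ref_inverse_inequality:
  obtains C :: real where "C \<ge> 0"
    "\<And>p :: real poly. degree p < n \<Longrightarrow> integral {0..1} (\<lambda>t. (poly (pderiv p) t)\<^sup>2) \<le> C * integral {0..1} (\<lambda>t. (poly p t)\<^sup>2)"
proof -
  obtain e where e: "\<And>i. i < n \<Longrightarrow> e i \<in> poly_lt n"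
    and ex: "\<And>p. p \<in> poly_lt n \<Longrightarrow> p = (\<Sum>i<n. smult (bubble_ip p (e i)) (e i))"
    using bubble_orthonormal[of n] by metis
  obtain E where E: "E \<ge> 1" "\<And>i x. i < n \<Longrightarrow> x \<in> {0..1} \<Longrightarrow> \<bar>poly (e i) x\<bar> \<le> E"
    "\<And>i x. i < n \<Longrightarrow> x \<in> {0..1} \<Longrightarrow> \<bar>poly (pderiv (e i)) x\<bar> \<le> E"
    using poly_family_bounded[of n e] by metis
  show ?thesis
  proof (rule that[of "(real n * (E * E))\<^sup>2"])
    fix p :: "real poly" assume p: "degree p < n"
    define A where "A = sqrt (integral {0..1} (\<lambda>t. (poly p t)\<^sup>2))"
    have Ann: "0 \<le> integral {0..1} (\<lambda>t. (poly p t)\<^sup>2)"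
      by (rule integral_nonneg) (auto intro!: integrable_continuous_real continuous_intros)
    then have A2: "A\<^sup>2 = integral {0..1} (\<lambda>t. (poly p t)\<^sup>2)" and A: "A \<ge> 0" by (auto simp: A_def)
    have co: "\<bar>bubble_ip p (e i)\<bar> \<le> A * E" if i: "i < n" for i
    proof -
      define k where "k t = t * (1 - t) * poly (e i) t" for t
      have ck: "continuous_on {0..1} k" unfolding k_def by (intro continuous_intros)
      have "integral {0..1} (\<lambda>t. (k t)\<^sup>2) \<le> integral {0..1} (\<lambda>t::real. E\<^sup>2)"
      proof (rule integral_le)
        show "(\<lambda>t. (k t)\<^sup>2) integrable_on {0..1}"
          by (intro integrable_continuous_real continuous_intros ck)
        fix t :: real assume t: "t \<in> {0..1}"
        have "\<bar>k t\<bar> \<le> 1 * E"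
          unfolding k_def abs_mult[of "t * (1 - t)"] using t E(2)[OF i t] mult_le_one[of t "1 - t"]
          by (intro mult_mono) (auto simp: abs_mult)
        then show "(k t)\<^sup>2 \<le> E\<^sup>2" using abs_le_square_iff[of "k t" E] E(1) by simp
      qed (rule integrable_const_ivl)
      then have kE: "integral {0..1} (\<lambda>t. (k t)\<^sup>2) \<le> E\<^sup>2" by simp
      have "bubble_ip p (e i) = integral {0..1} (\<lambda>t. poly p t * k t)"
        unfolding bubble_ip_def k_def by (intro integral_cong) (simp add: mult_ac)
      then have "(bubble_ip p (e i))\<^sup>2 \<le> A\<^sup>2 * integral {0..1} (\<lambda>t. (k t)\<^sup>2)"
        using L2on_Cauchy_Schwarz[of 0 1 "poly p" k] ck unfolding A2
        by (simp add: L2on_continuous continuous_intros)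
      also have "\<dots> \<le> A\<^sup>2 * E\<^sup>2" using kE by (intro mult_left_mono) auto
      finally have "(bubble_ip p (e i))\<^sup>2 \<le> (A * E)\<^sup>2" by (simp add: power_mult_distrib)
      then show ?thesis using A E(1) abs_le_square_iff[of "bubble_ip p (e i)" "A * E"] by simp
    qed
    have pt: "\<bar>poly (pderiv p) t\<bar> \<le> real n * (A * E * E)" if t: "t \<in> {0..1}" for t
    proof -
      have "pderiv p = (\<Sum>i<n. smult (bubble_ip p (e i)) (pderiv (e i)))"
        by (subst ex[OF poly_lt_degreeI[OF p]]) (simp add: pderiv_sum pderiv_smult)
      then have "poly (pderiv p) t = (\<Sum>i<n. bubble_ip p (e i) * poly (pderiv (e i)) t)"
        by (simp add: poly_sum)
      also have "\<bar>\<dots>\<bar> \<le> real n * (A * E * E)"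
        by (rule abs_sum_le_const) (unfold abs_mult, intro mult_mono co E t, use A E(1) in auto)
      finally show ?thesis .
    qed
    have "integral {0..1} (\<lambda>t. (poly (pderiv p) t)\<^sup>2) \<le> integral {0..1} (\<lambda>t::real. (real n * (A * E * E))\<^sup>2)"
    proof (rule integral_le)
      fix t :: real assume "t \<in> {0..1}"
      from pt[OF this] show "(poly (pderiv p) t)\<^sup>2 \<le> (real n * (A * E * E))\<^sup>2"
        using abs_le_square_iff[of "poly (pderiv p) t" "real n * (A * E * E)"] A E(1) by simp
    qed (auto intro!: integrable_continuous_real continuous_intros)
    also have "\<dots> = (real n * (E * E))\<^sup>2 * A\<^sup>2" by (simp add: power_mult_distrib mult_ac)
    finally show "integral {0..1} (\<lambda>t. (poly (pderiv p) t)\<^sup>2) \<le> (real n * (E * E))\<^sup>2 * integral {0..1} (\<lambda>t. (poly p t)\<^sup>2)"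
      by (simp add: A2)
  qed simp
qed

section \<open>Transfer to cells of arbitrary width\<close>

lemma integral_rescale:
  fixes f :: "real \<Rightarrow> real"
  assumes "a < b" "continuous_on {a..b} f"
  shows "integral {a..b} f = (b - a) * integral {0..1} (\<lambda>t. f (a + (b - a) * t))"
proof -
  have "(f has_integral integral {a..b} f) (cbox a b)"
    using assms by (auto intro!: integrable_integral integrable_continuous_real)
  from has_integral_affinity'[OF this, of "b - a" a]
  have "((\<lambda>t. f (a + (b - a) * t)) has_integral integral {a..b} f / (b - a)) {0..1}"
    using assms(1) by (simp add: add.commute divide_inverse mult.commute)
  then show ?thesis using assms(1) by (simp add: integral_unique)
qed

lemma poly_rescale:
  fixes p :: "real poly"
  shows "poly (pcompose p [:a, h:]) t = poly p (a + h * t)"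
    "poly (pderiv (pcompose p [:a, h:])) t = h * poly (pderiv p) (a + h * t)"
    "degree (pcompose p [:a, h:]) \<le> degree p"
proof -
  show "poly (pcompose p [:a, h:]) t = poly p (a + h * t)"
    by (simp add: poly_pcompose mult.commute)
  show "poly (pderiv (pcompose p [:a, h:])) t = h * poly (pderiv p) (a + h * t)"
    by (simp add: pderiv_pcompose poly_pcompose pderiv_pCons mult.commute)
  show "degree (pcompose p [:a, h:]) \<le> degree p"
    using degree_pcompose_le[of p "[:a, h:]"] by (cases "h = 0") auto
qed

lemma rescale_mem: "a < b \<Longrightarrow> t \<in> {0..1} \<Longrightarrow> a + (b - a) * t \<in> {a..(b::real)}"
  using mult_left_mono[of t 1 "b - a"] mult_nonneg_nonneg[of "b - a" t] by (auto simp: algebra_simps)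

lemma continuous_rescale:
  fixes f :: "real \<Rightarrow> real"
  assumes "a < b" "continuous_on {a..b} f"
  shows "continuous_on {0..1} (\<lambda>t. f (a + (b - a) * t))"
  by (rule continuous_on_compose2[OF assms(2)]) (use rescale_mem[OF assms(1)] in \<open>auto intro!: continuous_intros\<close>)

definition interp_poly :: "nat \<Rightarrow> real \<Rightarrow> real \<Rightarrow> (real \<Rightarrow> real) \<Rightarrow> real poly \<Rightarrow> bool" where
  "interp_poly q a b v r \<longleftrightarrow> degree r \<le> q \<and> poly r a = v a \<and> poly r b = v b \<and>
     (\<forall>\<xi>. degree \<xi> + 2 \<le> q \<longrightarrow> integral {a..b} (\<lambda>t. (poly r t - v t) * poly \<xi> t) = 0)"

lemma interp_poly_exists:
  assumes q: "q \<ge> 1" and "a \<le> b" and g: "continuous_on {a..b} g"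
  obtains r where "interp_poly q a b g r"
proof (cases "a = b")
  case True
  \<comment> \<open>On a degenerate cell the two nodal conditions coincide and all moments vanish,
    so a constant suffices.\<close>
  have "interp_poly q a b g [:g a:]" using True by (simp add: interp_poly_def)
  then show ?thesis by (rule that)
next
  case False
  then have ab: "a < b" using assms by simp
  define h where "h = b - a"
  have h: "h > 0" using ab by (simp add: h_def)
  obtain r where r: "degree r \<le> q" "poly r 0 = g a" "poly r 1 = g b"
    "\<And>\<xi>. degree \<xi> + 2 \<le> q \<Longrightarrow> integral {0..1} (\<lambda>t. (poly r t - g (a + (b - a) * t)) * poly \<xi> t) = 0"
    using ref_interp_exists[OF q continuous_rescale[OF ab g]] by (auto simp: algebra_simps)
  define r' where "r' = pcompose r [:- a / h, 1 / h:]"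
  have r': "poly r' x = poly r ((x - a) / h)" for x
    unfolding r'_def poly_rescale by (simp add: diff_divide_distrib add.commute)
  have "interp_poly q a b g r'"
    unfolding interp_poly_def
  proof (intro conjI allI impI)
    show "degree r' \<le> q" using poly_rescale(3)[of r] r(1) unfolding r'_def by (rule order_trans)
    show "poly r' a = g a" "poly r' b = g b" using r h by (auto simp: r' h_def)
    fix \<xi> :: "real poly" assume \<xi>: "degree \<xi> + 2 \<le> q"
    have "integral {a..b} (\<lambda>t. (poly r' t - g t) * poly \<xi> t) =
      h * integral {0..1} (\<lambda>t. (poly r' (a + (b - a) * t) - g (a + (b - a) * t)) * poly \<xi> (a + (b - a) * t))"
      unfolding h_def by (rule integral_rescale[OF ab]) (use g in \<open>auto intro!: continuous_intros\<close>)
    also have "integral {0..1} (\<lambda>t. (poly r' (a + (b - a) * t) - g (a + (b - a) * t)) * poly \<xi> (a + (b - a) * t))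
      = integral {0..1} (\<lambda>t. (poly r t - g (a + (b - a) * t)) * poly (pcompose \<xi> [:a, b - a:]) t)"
      using h by (intro integral_cong) (simp add: r' poly_rescale h_def)
    also have "\<dots> = 0" by (rule r(4)) (use \<xi> poly_rescale(3)[of \<xi> a "b - a"] in linarith)
    finally show "integral {a..b} (\<lambda>t. (poly r' t - g t) * poly \<xi> t) = 0" by simp
  qed
  then show ?thesis by (rule that)
qed

text \<open>Affine maps do not raise the degrees in the moment conditions, and the chain rule
  supplies the factor \<open>b - a\<close> in front of the derivative.\<close>

lemma interp_poly_stable:
  assumes q: "q \<ge> 1"
  obtains C where "C \<ge> 0"
    "\<And>a b r g M x. a < b \<Longrightarrow> interp_poly q a b g r \<Longrightarrow> continuous_on {a..b} g \<Longrightarrow>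
       (\<And>x. x \<in> {a..b} \<Longrightarrow> \<bar>g x\<bar> \<le> M) \<Longrightarrow> x \<in> {a..b} \<Longrightarrow>
       \<bar>poly r x\<bar> \<le> C * M \<and> (b - a) * \<bar>poly (pderiv r) x\<bar> \<le> C * M"
proof (rule ref_interp_stable[OF q])
  fix C :: real
  assume C: "C \<ge> 0"
    "\<And>(r :: real poly) g M x. degree r \<le> q \<Longrightarrow> continuous_on {0..1} g \<Longrightarrow> (\<And>x. x \<in> {0..1} \<Longrightarrow> \<bar>g x\<bar> \<le> M) \<Longrightarrow>
       poly r 0 = g 0 \<Longrightarrow> poly r 1 = g 1 \<Longrightarrow>
       (\<And>\<xi>. degree \<xi> + 2 \<le> q \<Longrightarrow> integral {0..1} (\<lambda>t. (poly r t - g t) * poly \<xi> t) = 0) \<Longrightarrow>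
       x \<in> {0..1} \<Longrightarrow> \<bar>poly r x\<bar> \<le> C * M \<and> \<bar>poly (pderiv r) x\<bar> \<le> C * M"
  show ?thesis
  proof (rule that[OF C(1)])
    fix a b r g M x
    assume ab: "a < b" and r: "interp_poly q a b g r" and g: "continuous_on {a..b} g"
       and M: "\<And>x. x \<in> {a..b} \<Longrightarrow> \<bar>g x\<bar> \<le> M" and x: "x \<in> {a..b}"
    define h where "h = b - a"
    have h: "h > 0" using ab by (simp add: h_def)
    define G where "G t = g (a + h * t)" for t
    define R where "R = pcompose r [:a, h:]"
    define y where "y = (x - a) / h"
    have xy: "x = a + h * y" and y: "y \<in> {0..1}" using h x by (auto simp: y_def h_def)
    have "\<bar>poly R y\<bar> \<le> C * M \<and> \<bar>poly (pderiv R) y\<bar> \<le> C * M"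
    proof (rule C(2)[of R G])
      show "degree R \<le> q" using r poly_rescale(3)[of r] unfolding R_def interp_poly_def by (metis order_trans)
      show "continuous_on {0..1} G" unfolding G_def h_def by (rule continuous_rescale[OF ab g])
      show "\<bar>G t\<bar> \<le> M" if "t \<in> {0..1}" for t
        unfolding G_def h_def by (rule M[OF rescale_mem[OF ab that]])
      show "poly R 0 = G 0" "poly R 1 = G 1" using r by (auto simp: R_def G_def poly_rescale interp_poly_def h_def)
      fix \<xi> :: "real poly" assume \<xi>: "degree \<xi> + 2 \<le> q"
      define \<xi>' where "\<xi>' = pcompose \<xi> [:- a / h, 1 / h:]"
      have \<xi>': "poly \<xi>' (a + h * t) = poly \<xi> t" for t
        unfolding \<xi>'_def poly_rescale using h by (simp add: field_simps)
      have "degree \<xi>' \<le> degree \<xi>" unfolding \<xi>'_def by (rule poly_rescale(3))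
      then have "0 = integral {a..b} (\<lambda>t. (poly r t - g t) * poly \<xi>' t)"
        using r \<xi> by (simp add: interp_poly_def)
      also have "\<dots> = h * integral {0..1} (\<lambda>t. (poly r (a + (b - a) * t) - g (a + (b - a) * t)) * poly \<xi>' (a + (b - a) * t))"
        unfolding h_def by (rule integral_rescale[OF ab]) (use g in \<open>auto intro!: continuous_intros\<close>)
      also have "\<dots> = h * integral {0..1} (\<lambda>t. (poly R t - G t) * poly \<xi> t)"
        by (simp add: R_def G_def poly_rescale \<xi>' flip: h_def)
      finally show "integral {0..1} (\<lambda>t. (poly R t - G t) * poly \<xi> t) = 0" using h by simp
    qed fact
    then show "\<bar>poly r x\<bar> \<le> C * M \<and> (b - a) * \<bar>poly (pderiv r) x\<bar> \<le> C * M"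
      using h by (simp add: R_def poly_rescale abs_mult flip: xy h_def)
  qed
qed

lemma inverse_inequality:
  obtains C :: real where "C \<ge> 0"
    "\<And>(p :: real poly) a b. degree p \<le> n \<Longrightarrow> a < b \<Longrightarrow>
       (b - a)\<^sup>2 * integral {a..b} (\<lambda>t. (poly (pderiv p) t)\<^sup>2) \<le> C * integral {a..b} (\<lambda>t. (poly p t)\<^sup>2)"
proof (rule ref_inverse_inequality[of "Suc n"])
  fix C :: real
  assume C: "C \<ge> 0"
    "\<And>p :: real poly. degree p < Suc n \<Longrightarrow> integral {0..1} (\<lambda>t. (poly (pderiv p) t)\<^sup>2) \<le> C * integral {0..1} (\<lambda>t. (poly p t)\<^sup>2)"
  show ?thesis
  proof (rule that[OF C(1)])
    fix p :: "real poly" and a b :: real assume p: "degree p \<le> n" and ab: "a < b"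
    define P where "P = pcompose p [:a, b - a:]"
    have "degree P < Suc n" using p poly_rescale(3)[of p a "b - a"] by (simp add: P_def)
    note le = C(2)[OF this]
    have "(b - a)\<^sup>2 * integral {a..b} (\<lambda>t. (poly (pderiv p) t)\<^sup>2)
      = (b - a)\<^sup>2 * ((b - a) * integral {0..1} (\<lambda>t. (poly (pderiv p) (a + (b - a) * t))\<^sup>2))"
      by (subst integral_rescale[OF ab]) (auto intro!: continuous_intros)
    also have "\<dots> = (b - a) * integral {0..1} (\<lambda>t. (b - a)\<^sup>2 * (poly (pderiv p) (a + (b - a) * t))\<^sup>2)"
      by simp
    also have "\<dots> = (b - a) * integral {0..1} (\<lambda>t. (poly (pderiv P) t)\<^sup>2)"
      unfolding P_def poly_rescale by (simp add: power_mult_distrib)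
    also have "\<dots> \<le> (b - a) * (C * integral {0..1} (\<lambda>t. (poly P t)\<^sup>2))"
      using ab le by (intro mult_left_mono) auto
    also have "\<dots> = C * ((b - a) * integral {0..1} (\<lambda>t. (poly p (a + (b - a) * t))\<^sup>2))"
      unfolding P_def poly_rescale by simp
    also have "\<dots> = C * integral {a..b} (\<lambda>t. (poly p t)\<^sup>2)"
      by (subst integral_rescale[OF ab, symmetric]) (auto intro!: continuous_intros)
    finally show "(b - a)\<^sup>2 * integral {a..b} (\<lambda>t. (poly (pderiv p) t)\<^sup>2) \<le> C * integral {a..b} (\<lambda>t. (poly p t)\<^sup>2)" .
  qed
qed

section \<open>Meshes and the interpolation operator\<close>

text \<open>As the mesh-defining function need not be strictly increasing, cells may degenerate to a point.\<close>

definition mesh_nodes :: "(nat \<Rightarrow> real) \<Rightarrow> nat \<Rightarrow> bool" where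
  "mesh_nodes X N \<longleftrightarrow> X 0 = 0 \<and> X N = 2 \<and> (\<forall>i\<in>{1..N}. X (i - 1) \<le> X i)"

lemma mesh_nodes_mono:
  assumes "mesh_nodes X N" "i \<le> j" "j \<le> N"
  shows "X i \<le> X j"
  using assms(2,3)
proof (induction rule: dec_induct)
  case (step n)
  then have "X n \<le> X (Suc n)" using assms(1) unfolding mesh_nodes_def by (metis Suc_eq_plus1 add_diff_cancel_right' atLeastAtMost_iff le_add2)
  then show ?case using step by simp
qed simp

lemma mesh_cell:
  assumes "mesh_nodes X N" "i \<in> {1..N}"
  shows "0 \<le> X (i - 1)" "X (i - 1) \<le> X i" "X i \<le> 2"
  using mesh_nodes_mono[OF assms(1), of 0 "i - 1"] mesh_nodes_mono[OF assms(1), of "i - 1" i]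
    mesh_nodes_mono[OF assms(1), of i N] assms by (auto simp: mesh_nodes_def)

lemma integral_cells:
  fixes f :: "real \<Rightarrow> real"
  assumes m: "mesh_nodes X N" and f: "f integrable_on {0..2}"
  shows "integral {0..2} f = (\<Sum>i\<in>{1..N}. integral {X (i - 1)..X i} f)"
proof -
  have "integral {0..X n} f = (\<Sum>i\<in>{1..n}. integral {X (i - 1)..X i} f)" if "n \<le> N" for n
    using that
  proof (induction n)
    case 0
    then show ?case using m by (simp add: mesh_nodes_def)
  next
    case (Suc n)
    note c = mesh_cell[OF m, of "Suc n"]
    have "integral {0..X n} f + integral {X n..X (Suc n)} f = integral {0..X (Suc n)} f"
      by (rule Henstock_Kurzweil_Integration.integral_combine)
         (use c Suc.prems in \<open>auto intro: integrable_subinterval_real[OF f]\<close>)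
    then show ?case using Suc by simp
  qed
  from this[of N] show ?thesis using m by (simp add: mesh_nodes_def)
qed

lemma L2_inner_Icc:
  assumes "(\<lambda>x. v x * g x) absolutely_integrable_on {a..b}"
  shows "L2_inner {a..b} v g = integral {a..b} (\<lambda>x. v x * g x)"
proof -
  have "integrable (lebesgue_on {a..b}) (\<lambda>x. v x * g x)"
    using assms by (simp add: integrable_restrict_space set_integrable_def)
  then show ?thesis by (simp add: L2_inner_def lebesgue_integral_eq_integral)
qed

text \<open>A common point of two cells is a node of both, and both cell polynomials take the value
  of \<open>v\<close> there. So every choice of a cell containing a given point defines the same
  value, even when degenerate cells put many cells at one point.\<close>

lemma is_interpolant_exists:
  assumes q: "q \<ge> 1" and m: "mesh_nodes X N" and v: "continuous_on {0..2} v"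
  shows "\<exists>g. is_interpolant q X N v g"
proof -
  have "\<exists>r. interp_poly q (X (i - 1)) (X i) v r" if i: "i \<in> {1..N}" for i
  proof -
    have "continuous_on {X (i - 1)..X i} v"
      by (rule continuous_on_subset[OF v]) (use mesh_cell[OF m i] in auto)
    then show ?thesis using interp_poly_exists[OF q mesh_cell(2)[OF m i]] by blast
  qed
  then obtain P where P: "\<And>i. i \<in> {1..N} \<Longrightarrow> interp_poly q (X (i - 1)) (X i) v (P i)" by metis
  define g where "g t = poly (P (SOME i. i \<in> {1..N} \<and> t \<in> {X (i - 1)..X i})) t" for t
  have g: "g t = poly (P i) t" if i: "i \<in> {1..N}" and t: "t \<in> {X (i - 1)..X i}" for i t
  proof -
    define j where "j = (SOME i. i \<in> {1..N} \<and> t \<in> {X (i - 1)..X i})"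
    have j: "j \<in> {1..N}" "t \<in> {X (j - 1)..X j}"
      using someI[of "\<lambda>i. i \<in> {1..N} \<and> t \<in> {X (i - 1)..X i}" i] i t by (auto simp: j_def)
    have common: "poly (P i) t = poly (P j) t"
      if "i \<in> {1..N}" "t \<in> {X (i - 1)..X i}" "j \<in> {1..N}" "t \<in> {X (j - 1)..X j}" "i < j" for i j
    proof -
      have "X i \<le> X (j - 1)" using mesh_nodes_mono[OF m, of i "j - 1"] that by auto
      then have "t = X i" "t = X (j - 1)" using that by auto
      then show ?thesis using P[OF that(1)] P[OF that(3)] by (simp add: interp_poly_def)
    qed
    show ?thesis
      using common[OF i t j] common[OF j i t] unfolding g_def j_def[symmetric] by (metis linorder_neqE_nat)
  qed
  have X0N: "X 0 = 0" "X N = 2" using m by (auto simp: mesh_nodes_def)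
  have cont: "continuous_on {0..X n} g" if "n \<le> N" for n
    using that
  proof (induction n)
    case (Suc n)
    note c = mesh_cell[OF m, of "Suc n"]
    have "continuous_on {X n..X (Suc n)} g \<longleftrightarrow> continuous_on {X n..X (Suc n)} (poly (P (Suc n)))"
      by (rule continuous_on_cong) (use g[of "Suc n"] Suc.prems in auto)
    then have "continuous_on ({0..X n} \<union> {X n..X (Suc n)}) g"
      using Suc by (intro continuous_on_closed_Un) (auto intro!: continuous_intros)
    also have "{0..X n} \<union> {X n..X (Suc n)} = {0..X (Suc n)}"
      using c Suc.prems by auto
    finally show ?case .
  qed (simp add: X0N)
  have "is_interpolant q X N v g"
    unfolding is_interpolant_def
  proof (intro conjI ballI allI impI)
    show "continuous_on {X 0..X N} g" using cont[of N] X0N by simp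
    show "piecewise_poly q X N g"
      unfolding piecewise_poly_def using g P interp_poly_def by blast
    fix i assume i: "i \<in> {1..N}"
    note c = mesh_cell[OF m i] and Pi = P[OF i]
    show "g (X (i - 1)) - v (X (i - 1)) = 0" "g (X i) - v (X i) = 0"
      using g[OF i] c Pi by (auto simp: interp_poly_def)
    fix \<xi> :: "real poly" assume \<xi>: "degree \<xi> + 2 \<le> q"
    have vc: "continuous_on {X (i - 1)..X i} v"
      by (rule continuous_on_subset[OF v]) (use c in auto)
    have "L2_inner {X (i - 1)..X i} (\<lambda>t. g t - v t) (poly \<xi>) = L2_inner {X (i - 1)..X i} (\<lambda>t. poly (P i) t - v t) (poly \<xi>)"
      unfolding L2_inner_def by (rule Bochner_Integration.integral_cong) (use g[OF i] in auto)
    also have "\<dots> = integral {X (i - 1)..X i} (\<lambda>t. (poly (P i) t - v t) * poly \<xi> t)"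
      by (intro L2_inner_Icc L2on_mult L2on_continuous continuous_intros vc)
    also have "\<dots> = 0" using Pi \<xi> by (simp add: interp_poly_def)
    finally show "L2_inner {X (i - 1)..X i} (\<lambda>t. g t - v t) (poly \<xi>) = 0" .
  qed
  then show ?thesis by blast
qed

lemma interp_is_interpolant:
  assumes "q \<ge> 1" "mesh_nodes X N" "continuous_on {0..2} v"
  shows "is_interpolant q X N v (interp q X N v)"
  unfolding interp_def using is_interpolant_exists[OF assms] by (rule someI_ex)

text \<open>Local access to the chosen interpolant: on a cell it is a polynomial satisfying the
  local conditions, to which stability applies.\<close>

lemma interp_cell:
  assumes "q \<ge> 1" "mesh_nodes X N" "continuous_on {0..2} v" and i: "i \<in> {1..N}"
  obtains r where "interp_poly q (X (i - 1)) (X i) v r" "\<And>t. t \<in> {X (i - 1)..X i} \<Longrightarrow> interp q X N v t = poly r t"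
proof -
  note I = interp_is_interpolant[OF assms(1-3)] and c = mesh_cell[OF assms(2) i]
  obtain r where r: "degree r \<le> q" "\<And>t. t \<in> {X (i - 1)..X i} \<Longrightarrow> interp q X N v t = poly r t"
    using I i unfolding is_interpolant_def piecewise_poly_def by blast
  have vc: "continuous_on {X (i - 1)..X i} v"
    by (rule continuous_on_subset[OF assms(3)]) (use c in auto)
  have "interp_poly q (X (i - 1)) (X i) v r"
    unfolding interp_poly_def
  proof (intro conjI allI impI)
    show "degree r \<le> q" by fact
    show "poly r (X (i - 1)) = v (X (i - 1))" "poly r (X i) = v (X i)"
      using I i r(2)[of "X (i - 1)"] r(2)[of "X i"] c by (auto simp: is_interpolant_def)
    fix \<xi> :: "real poly" assume \<xi>: "degree \<xi> + 2 \<le> q"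
    have "0 = L2_inner {X (i - 1)..X i} (\<lambda>t. interp q X N v t - v t) (poly \<xi>)"
      using I i \<xi> by (auto simp: is_interpolant_def)
    also have "\<dots> = L2_inner {X (i - 1)..X i} (\<lambda>t. poly r t - v t) (poly \<xi>)"
      unfolding L2_inner_def by (rule Bochner_Integration.integral_cong) (use r(2) in auto)
    also have "\<dots> = integral {X (i - 1)..X i} (\<lambda>t. (poly r t - v t) * poly \<xi> t)"
      by (intro L2_inner_Icc L2on_mult L2on_continuous continuous_intros vc)
    finally show "integral {X (i - 1)..X i} (\<lambda>t. (poly r t - v t) * poly \<xi> t) = 0" by simp
  qed
  then show ?thesis using that r(2) by blast
qed

section \<open>Piecewise polynomials as weakly differentiable functions\<close>

lemma L2on_sum: "(\<And>i. i \<in> A \<Longrightarrow> L2on a b (f i)) \<Longrightarrow> L2on a b (\<lambda>x. \<Sum>i\<in>A. f i x)"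
  by (induction A rule: infinite_finite_induct) (auto intro: L2on_add L2on_continuous)

text \<open>The fundamental theorem of calculus tolerates the finitely many nodes as exceptional
  points, because the function is continuous across them.\<close>

lemma piecewise_poly_H1:
  assumes m: "mesh_nodes X N" and v: "continuous_on {0..2} v" and pw: "piecewise_poly q X N v"
  shows "v \<in> H1"
proof -
  obtain P where P: "\<And>i t. i \<in> {1..N} \<Longrightarrow> t \<in> {X (i - 1)..X i} \<Longrightarrow> v t = poly (P i) t"
    using pw unfolding piecewise_poly_def by metis
  \<comment> \<open>Open cells are disjoint and let degenerate cells contribute nothing; the values
    at the nodes are irrelevant.\<close>
  define g where "g t = (\<Sum>i\<in>{1..N}. indicator {X (i - 1)<..<X i} t * poly (pderiv (P i)) t)" for t
  have L: "L2on 0 2 g"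
    unfolding g_def
  proof (rule L2on_sum, rule L2on_bounded_mult[of _ _ _ _ 1])
    show "indicator {X (i - 1)<..<X i} \<in> borel_measurable (lebesgue_on {0..2})" for i
      by (intro measurable_restrict_space1 borel_measurable_indicator) auto
  qed (auto intro!: L2on_continuous continuous_intros simp: indicator_def)
  have "v y - v x = integral {x..y} g" if xy: "0 \<le> x" "x \<le> y" "y \<le> 2" for x y
  proof -
    have "(g has_integral (v y - v x)) {x..y}"
    proof (rule fundamental_theorem_of_calculus_strong[of "X ` {0..N}"])
      fix t assume t: "t \<in> {x..y} - X ` {0..N}"
      have tN: "t < X N" "X 0 < t" using t xy m
        by (auto simp: mesh_nodes_def image_iff) (metis atLeastAtMost_iff le0 order_le_less order_refl order_trans)+
      \<comment> \<open>The first node to the right of \<open>t\<close> closes the one open cell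
        that contains \<open>t\<close>.\<close>
      define i where "i = (LEAST i. t < X i)"
      have ti: "t < X i" unfolding i_def using tN(1) by (rule LeastI)
      have iN: "i \<le> N" unfolding i_def using tN(1) by (rule Least_le)
      have i0: "i \<noteq> 0" using ti tN by (metis less_asym)
      then have "\<not> t < X (i - 1)" using not_less_Least[of "i - 1" "\<lambda>i. t < X i"] by (simp add: i_def)
      moreover have "t \<noteq> X (i - 1)" using t iN by auto
      ultimately have ti': "X (i - 1) < t" by simp
      have i: "i \<in> {1..N}" using iN i0 by auto
      have "indicator {X (j - 1)<..<X j} t * poly (pderiv (P j)) t = (if j = i then poly (pderiv (P i)) t else 0)"
        if j: "j \<in> {1..N}" for j
      proof (cases j i rule: linorder_cases)
        case less
        then have "j \<le> i - 1" "i - 1 \<le> N" using iN by auto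
        then have "X j \<le> X (i - 1)" by (rule mesh_nodes_mono[OF m])
        then show ?thesis using less ti' by (auto simp: indicator_def)
      next
        case greater
        then have "i \<le> j - 1" "j - 1 \<le> N" using j by auto
        then have "X i \<le> X (j - 1)" by (rule mesh_nodes_mono[OF m])
        then show ?thesis using greater ti by (auto simp: indicator_def)
      qed (use ti ti' in auto)
      then have "g t = poly (pderiv (P i)) t"
        unfolding g_def using i by (simp add: sum.delta)
      moreover have "(v has_real_derivative poly (pderiv (P i)) t) (at t)"
        by (rule has_field_derivative_transform_within_open[OF poly_DERIV, of "{X (i - 1)<..<X i}"])
           (use ti ti' P[OF i] in auto)
      ultimately show "(v has_vector_derivative g t) (at t)"
        by (simp add: has_real_derivative_iff_has_vector_derivative)
    next
      show "continuous_on {x..y} v" by (rule continuous_on_subset[OF v]) (use xy in auto)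
    qed (use xy in auto)
    then show ?thesis by (simp add: integral_unique)
  qed
  then have "AC 0 2 v g" using L v by (simp add: AC_def)
  then show ?thesis by (rule AC_H1)
qed

section \<open>Orthogonality of interpolation errors\<close>

text \<open>What the bound of the bilinear form has to know about an interpolation error, stated for
  the error alone so that both components share it.\<close>

definition node_orth :: "nat \<Rightarrow> (nat \<Rightarrow> real) \<Rightarrow> nat \<Rightarrow> (real \<Rightarrow> real) \<Rightarrow> bool" where
  "node_orth q X N e \<longleftrightarrow> (\<forall>i\<in>{1..N}. e (X (i - 1)) = 0 \<and> e (X i) = 0 \<and>
     (\<forall>\<xi>. degree \<xi> + 2 \<le> q \<longrightarrow> integral {X (i - 1)..X i} (\<lambda>t. e t * poly \<xi> t) = 0))"

lemma interp_error_node_orth: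
  assumes "q \<ge> 1" "mesh_nodes X N" "continuous_on {0..2} v"
  shows "node_orth q X N (\<lambda>t. v t - interp q X N v t)"
  unfolding node_orth_def
proof (intro ballI conjI allI impI)
  fix i assume i: "i \<in> {1..N}"
  note c = mesh_cell[OF assms(2) i]
  obtain r where r: "interp_poly q (X (i - 1)) (X i) v r" "\<And>t. t \<in> {X (i - 1)..X i} \<Longrightarrow> interp q X N v t = poly r t"
    using interp_cell[OF assms i] by metis
  show "v (X (i - 1)) - interp q X N v (X (i - 1)) = 0" "v (X i) - interp q X N v (X i) = 0"
    using r c by (auto simp: interp_poly_def)
  fix \<xi> :: "real poly" assume \<xi>: "degree \<xi> + 2 \<le> q"
  have "integral {X (i - 1)..X i} (\<lambda>t. (v t - interp q X N v t) * poly \<xi> t)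
    = integral {X (i - 1)..X i} (\<lambda>t. - ((poly r t - v t) * poly \<xi> t))"
    by (rule integral_cong) (use r(2) in \<open>auto simp: algebra_simps\<close>)
  also have "\<dots> = 0" using r(1) \<xi> by (simp add: interp_poly_def)
  finally show "integral {X (i - 1)..X i} (\<lambda>t. (v t - interp q X N v t) * poly \<xi> t) = 0" .
qed

lemma interp_H1:
  assumes "q \<ge> 1" "mesh_nodes X N" "continuous_on {0..2} v"
  shows "interp q X N v \<in> H1" "piecewise_poly q X N (interp q X N v)"
proof -
  note I = interp_is_interpolant[OF assms]
  show p: "piecewise_poly q X N (interp q X N v)" using I by (simp add: is_interpolant_def)
  have "continuous_on {0..2} (interp q X N v)"
    using I assms(2) by (simp add: is_interpolant_def mesh_nodes_def)
  then show "interp q X N v \<in> H1" using piecewise_poly_H1[OF assms(2) _ p] by blast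
qed

lemma piecewise_poly_diff:
  assumes "piecewise_poly q X N v" "piecewise_poly q X N g"
  shows "piecewise_poly q X N (\<lambda>t. v t - g t)"
  unfolding piecewise_poly_def
proof
  fix i assume "i \<in> {1..N}"
  then obtain p r where "degree p \<le> q" "degree r \<le> q"
    "\<forall>t\<in>{X (i - 1)..X i}. v t = poly p t" "\<forall>t\<in>{X (i - 1)..X i}. g t = poly r t"
    using assms unfolding piecewise_poly_def by metis
  then show "\<exists>p. degree p \<le> q \<and> (\<forall>t\<in>{X (i - 1)..X i}. v t - g t = poly p t)"
    by (intro exI[of _ "p - r"]) (auto intro: degree_diff_le)
qed

text \<open>The second derivative of a polynomial of degree at most q is zero or has degree at most
  q - 2, so a moment condition covers it. Integration by parts, without boundary terms as
  \<open>e\<close> vanishes at the nodes, carries this over to the derivatives.\<close>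

lemma cell_orthogonality:
  assumes e: "AC a b e e'" and "a \<le> b" and ends: "e a = 0" "e b = 0"
    and mom: "\<And>\<xi>. degree \<xi> + 2 \<le> q \<Longrightarrow> integral {a..b} (\<lambda>t. e t * poly \<xi> t) = 0"
    and p: "degree p \<le> q" and y: "AC a b y y'" "\<And>t. t \<in> {a..b} \<Longrightarrow> y t = poly p t"
  shows "integral {a..b} (\<lambda>t. e t * poly (pderiv (pderiv p)) t) = 0"
    "integral {a..b} (\<lambda>t. e' t * y' t) = 0"
proof -
  show 1: "integral {a..b} (\<lambda>t. e t * poly (pderiv (pderiv p)) t) = 0"
  proof (cases "pderiv (pderiv p) = 0")
    \<comment> \<open>A nonzero second derivative forces the first one to be nonconstant, so the
      truncated subtractions in the degree are exact.\<close>
    case False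
    then have "degree (pderiv p) \<noteq> 0" by (simp add: pderiv_eq_0_iff)
    then have "degree (pderiv (pderiv p)) + 2 \<le> q"
      using p by (simp add: degree_pderiv)
    then show ?thesis by (rule mom)
  qed simp
  obtain Z where Z: "negligible Z" "\<And>t. t \<in> {a<..<b} - Z \<Longrightarrow> y' t = poly (pderiv p) t"
    using AC_unique[OF y(1) AC_poly[of a b p]] y(2) by auto
  have "integral {a..b} (\<lambda>t. e' t * y' t) = integral {a..b} (\<lambda>t. e' t * poly (pderiv p) t)"
    by (rule integral_spike[of "Z \<union> {a, b}"]) (use Z in auto)
  also have "\<dots> = - integral {a..b} (\<lambda>t. e t * poly (pderiv (pderiv p)) t)"
    by (subst AC_by_parts[OF e \<open>a \<le> b\<close>])
       (auto simp: ends intro!: has_field_derivative_at_within poly_DERIV continuous_intros)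
  finally show "integral {a..b} (\<lambda>t. e' t * y' t) = 0" using 1 by simp
qed

lemma Young: "s > 0 \<Longrightarrow> \<bar>x * y\<bar> \<le> x\<^sup>2 / (4 * s) + s * (y::real)\<^sup>2"
proof -
  assume s: "s > 0"
  have "0 \<le> (\<bar>x\<bar> - 2 * s * \<bar>y\<bar>)\<^sup>2" by simp
  also have "\<dots> = x\<^sup>2 + 4 * s\<^sup>2 * y\<^sup>2 - 4 * s * \<bar>x * y\<bar>"
    by (simp add: power2_diff power_mult_distrib abs_mult)
  finally have "4 * s * \<bar>x * y\<bar> \<le> x\<^sup>2 + 4 * s\<^sup>2 * y\<^sup>2" by simp
  then have "\<bar>x * y\<bar> \<le> (x\<^sup>2 + 4 * s\<^sup>2 * y\<^sup>2) / (4 * s)"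
    using s by (simp add: pos_le_divide_eq mult.commute)
  also have "\<dots> = x\<^sup>2 / (4 * s) + s * y\<^sup>2" using s by (simp add: add_divide_distrib power2_eq_square)
  finally show ?thesis .
qed

section \<open>The bilinear form\<close>

text \<open>Integration by parts puts \<open>2 * b1 * p1 + b * p2 + b2 * p\<close> against
  \<open>e\<close>, and only the second derivative \<open>p2\<close> exceeds what the energy norm
  controls. The inverse inequality enters as a hypothesis, in a form that is also true for
  degenerate cells.\<close>

lemma cell_convection_bound:
  fixes q :: nat
  assumes s: "s > 0" and B: "B \<ge> 0"
    and b: "\<And>x. x \<in> {l..r} \<Longrightarrow> (b has_real_derivative b1 x) (at x within {l..r})"
       "\<And>x. x \<in> {l..r} \<Longrightarrow> (b1 has_real_derivative b2 x) (at x within {l..r})" "continuous_on {l..r} b2"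
    and bd: "\<And>x. x \<in> {l..r} \<Longrightarrow> 2 * \<bar>b1 x\<bar> \<le> B" "\<And>x. x \<in> {l..r} \<Longrightarrow> \<bar>b2 x\<bar> \<le> B"
    and Ci: "Ci \<ge> 0" "\<And>p. degree p \<le> q \<Longrightarrow> (r - l)\<^sup>2 * integral {l..r} (\<lambda>t. (poly (pderiv p) t)\<^sup>2) \<le> Ci * integral {l..r} (\<lambda>t. (poly p t)\<^sup>2)"
    and e: "AC l r e e'" and "l \<le> r" and ends: "e l = 0" "e r = 0"
    and mom: "\<And>\<xi>. degree \<xi> + 2 \<le> q \<Longrightarrow> integral {l..r} (\<lambda>t. e t * poly \<xi> t) = 0"
    and p: "degree p \<le> q" and y: "AC l r y y'" "\<And>t. t \<in> {l..r} \<Longrightarrow> y t = poly p t"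
  shows "\<bar>integral {l..r} (\<lambda>t. b t * e' t * y' t + b1 t * e' t * y t)\<bar>
    \<le> 3 * B\<^sup>2 / (4 * s) * integral {l..r} (\<lambda>t. (e t)\<^sup>2)
      + s * (1 + Ci) * integral {l..r} (\<lambda>t. (y' t)\<^sup>2) + s * integral {l..r} (\<lambda>t. (y t)\<^sup>2)"
proof -
  define p1 where "p1 = pderiv p"
  define p2 where "p2 = pderiv p1"
  define R where "R t = b t * poly p1 t + b1 t * poly p t" for t
  define R' where "R' t = 2 * b1 t * poly p1 t + b t * poly p2 t + b2 t * poly p t" for t
  obtain Z where Z: "negligible Z" "\<And>t. t \<in> {l<..<r} - Z \<Longrightarrow> y' t = poly p1 t"
    using AC_unique[OF y(1) AC_poly[of l r p]] y(2) unfolding p1_def by auto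
  have bc: "continuous_on {l..r} b" "continuous_on {l..r} b1"
    using b DERIV_continuous_on by blast+
  have ec: "continuous_on {l..r} e" by (rule AC_L2(3)[OF e])
  have R: "(R has_real_derivative R' x) (at x within {l..r})" if "x \<in> {l..r}" for x
    unfolding R_def R'_def
    by (auto intro!: derivative_eq_intros b that has_field_derivative_at_within[OF poly_DERIV] simp: p2_def p1_def algebra_simps)
  have R'c: "continuous_on {l..r} R'" unfolding R'_def by (intro continuous_intros bc b)
  have "integral {l..r} (\<lambda>t. b t * e' t * y' t + b1 t * e' t * y t) = integral {l..r} (\<lambda>t. e' t * R t)"
    by (rule integral_spike[of "Z \<union> {l, r}"]) (use Z y(2) in \<open>auto simp: R_def algebra_simps\<close>)
  also have "\<dots> = - integral {l..r} (\<lambda>t. e t * R' t)"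
    using AC_by_parts[OF e \<open>l \<le> r\<close> R R'c] ends by simp
  \<comment> \<open>The constant \<open>b l\<close> times \<open>p2\<close> integrates to 0 against
    \<open>e\<close>, by the moment conditions.\<close>
  also have "integral {l..r} (\<lambda>t. e t * R' t) =
     integral {l..r} (\<lambda>t. e t * (2 * b1 t * poly p1 t + (b t - b l) * poly p2 t + b2 t * poly p t))"
  proof -
    have i: "(\<lambda>t. e t * (2 * b1 t * poly p1 t + (b t - b l) * poly p2 t + b2 t * poly p t)) integrable_on {l..r}"
      "(\<lambda>t. e t * poly p2 t) integrable_on {l..r}"
      by (intro integrable_continuous_real continuous_intros ec bc b)+
    have "integral {l..r} (\<lambda>t. e t * R' t) =
     integral {l..r} (\<lambda>t. e t * (2 * b1 t * poly p1 t + (b t - b l) * poly p2 t + b2 t * poly p t) + b l * (e t * poly p2 t))"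
      by (intro integral_cong) (simp add: R'_def algebra_simps)
    also have "\<dots> = integral {l..r} (\<lambda>t. e t * (2 * b1 t * poly p1 t + (b t - b l) * poly p2 t + b2 t * poly p t))
       + b l * integral {l..r} (\<lambda>t. e t * poly p2 t)"
      using i by (subst integral_add) (auto intro: integrable_on_mult_right)
    also have "integral {l..r} (\<lambda>t. e t * poly p2 t) = 0"
      unfolding p2_def p1_def by (rule cell_orthogonality(1)[OF e \<open>l \<le> r\<close> ends mom p y])
    finally show ?thesis by simp
  qed
  finally have eq: "\<bar>integral {l..r} (\<lambda>t. b t * e' t * y' t + b1 t * e' t * y t)\<bar> =
    norm (integral {l..r} (\<lambda>t. e t * (2 * b1 t * poly p1 t + (b t - b l) * poly p2 t + b2 t * poly p t)))" by simp
  have bl: "\<bar>b t - b l\<bar> \<le> B * (r - l)" if t: "t \<in> {l..r}" for t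
  proof -
    have "AC l r b b1" by (rule AC_C1) (use b bc in auto)
    from AC_D[OF this, of l t] have "\<bar>b t - b l\<bar> = norm (integral {l..t} b1)" using t by simp
    also have "\<dots> \<le> integral {l..t} (\<lambda>_. B)"
    proof (rule integral_norm_bound_integral)
      show "b1 integrable_on {l..t}"
        by (rule integrable_continuous_real, rule continuous_on_subset[OF bc(2)]) (use t in auto)
      show "norm (b1 x) \<le> B" if "x \<in> {l..t}" for x
        using bd(1)[of x] that t by simp
    qed (rule integrable_const_ivl)
    also have "\<dots> \<le> B * (r - l)" using t B by (simp add: mult.commute mult_left_mono)
    finally show ?thesis .
  qed
  have "norm (integral {l..r} (\<lambda>t. e t * (2 * b1 t * poly p1 t + (b t - b l) * poly p2 t + b2 t * poly p t)))
    \<le> integral {l..r} (\<lambda>t. 3 * B\<^sup>2 / (4 * s) * (e t)\<^sup>2 + s * (poly p1 t)\<^sup>2 + s * ((r - l)\<^sup>2 * (poly p2 t)\<^sup>2) + s * (poly p t)\<^sup>2)"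
  proof (rule integral_norm_bound_integral)
    fix t assume t: "t \<in> {l..r}"
    have y1: "\<bar>e t * (2 * b1 t * poly p1 t)\<bar> \<le> B\<^sup>2 / (4 * s) * (e t)\<^sup>2 + s * (poly p1 t)\<^sup>2"
    proof -
      have "\<bar>e t * (2 * b1 t * poly p1 t)\<bar> = (2 * \<bar>b1 t\<bar>) * (\<bar>e t\<bar> * \<bar>poly p1 t\<bar>)" by (simp add: abs_mult)
      also have "\<dots> \<le> B * (\<bar>e t\<bar> * \<bar>poly p1 t\<bar>)" using bd(1)[OF t] by (intro mult_right_mono) auto
      also have "\<dots> = \<bar>(B * e t) * poly p1 t\<bar>" using B by (simp add: abs_mult)
      also have "\<dots> \<le> (B * e t)\<^sup>2 / (4 * s) + s * (poly p1 t)\<^sup>2" by (rule Young[OF s])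
      finally show ?thesis by (simp add: power_mult_distrib)
    qed
    have y2: "\<bar>e t * ((b t - b l) * poly p2 t)\<bar> \<le> B\<^sup>2 / (4 * s) * (e t)\<^sup>2 + s * ((r - l)\<^sup>2 * (poly p2 t)\<^sup>2)"
    proof -
      have "\<bar>e t * ((b t - b l) * poly p2 t)\<bar> = \<bar>b t - b l\<bar> * (\<bar>e t\<bar> * \<bar>poly p2 t\<bar>)" by (simp add: abs_mult)
      also have "\<dots> \<le> (B * (r - l)) * (\<bar>e t\<bar> * \<bar>poly p2 t\<bar>)" using bl[OF t] by (intro mult_right_mono) auto
      also have "\<dots> = \<bar>(B * e t) * ((r - l) * poly p2 t)\<bar>" using B \<open>l \<le> r\<close> by (simp add: abs_mult)
      also have "\<dots> \<le> (B * e t)\<^sup>2 / (4 * s) + s * ((r - l) * poly p2 t)\<^sup>2" by (rule Young[OF s])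
      finally show ?thesis by (simp add: power_mult_distrib)
    qed
    have y3: "\<bar>e t * (b2 t * poly p t)\<bar> \<le> B\<^sup>2 / (4 * s) * (e t)\<^sup>2 + s * (poly p t)\<^sup>2"
    proof -
      have "\<bar>e t * (b2 t * poly p t)\<bar> = \<bar>b2 t\<bar> * (\<bar>e t\<bar> * \<bar>poly p t\<bar>)" by (simp add: abs_mult)
      also have "\<dots> \<le> B * (\<bar>e t\<bar> * \<bar>poly p t\<bar>)" using bd(2)[OF t] by (intro mult_right_mono) auto
      also have "\<dots> = \<bar>(B * e t) * poly p t\<bar>" using B by (simp add: abs_mult)
      also have "\<dots> \<le> (B * e t)\<^sup>2 / (4 * s) + s * (poly p t)\<^sup>2" by (rule Young[OF s])
      finally show ?thesis by (simp add: power_mult_distrib)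
    qed
    have "norm (e t * (2 * b1 t * poly p1 t + (b t - b l) * poly p2 t + b2 t * poly p t))
      \<le> \<bar>e t * (2 * b1 t * poly p1 t)\<bar> + \<bar>e t * ((b t - b l) * poly p2 t)\<bar> + \<bar>e t * (b2 t * poly p t)\<bar>"
      unfolding real_norm_def distrib_left by linarith
    moreover have "3 * B\<^sup>2 / (4 * s) * (e t)\<^sup>2 = B\<^sup>2 / (4 * s) * (e t)\<^sup>2 + B\<^sup>2 / (4 * s) * (e t)\<^sup>2 + B\<^sup>2 / (4 * s) * (e t)\<^sup>2"
      by simp
    ultimately show "norm (e t * (2 * b1 t * poly p1 t + (b t - b l) * poly p2 t + b2 t * poly p t))
      \<le> 3 * B\<^sup>2 / (4 * s) * (e t)\<^sup>2 + s * (poly p1 t)\<^sup>2 + s * ((r - l)\<^sup>2 * (poly p2 t)\<^sup>2) + s * (poly p t)\<^sup>2"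
      using y1 y2 y3 by linarith
  qed (intro integrable_continuous_real continuous_intros ec bc b)+
  also have "\<dots> = 3 * B\<^sup>2 / (4 * s) * integral {l..r} (\<lambda>t. (e t)\<^sup>2) + s * integral {l..r} (\<lambda>t. (poly p1 t)\<^sup>2)
     + s * ((r - l)\<^sup>2 * integral {l..r} (\<lambda>t. (poly p2 t)\<^sup>2)) + s * integral {l..r} (\<lambda>t. (poly p t)\<^sup>2)"
  proof -
    have i: "(\<lambda>t. c * (e t)\<^sup>2) integrable_on {l..r}" "(\<lambda>t. c * (poly \<xi> t)\<^sup>2) integrable_on {l..r}"
       "(\<lambda>t. c * (c' * (poly \<xi> t)\<^sup>2)) integrable_on {l..r}" for \<xi> c c'
      by (intro integrable_continuous_real continuous_intros ec)+
    show ?thesis by (simp only: integral_add integrable_add i integral_mult_right)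
  qed
  \<comment> \<open>The inverse inequality for \<open>p1\<close>, not for \<open>p\<close>: the
    squared cell width trades the second derivative for the first.\<close>
  also have "s * ((r - l)\<^sup>2 * integral {l..r} (\<lambda>t. (poly p2 t)\<^sup>2)) \<le> s * (Ci * integral {l..r} (\<lambda>t. (poly p1 t)\<^sup>2))"
    unfolding p2_def using s p by (intro mult_left_mono Ci) (auto simp: p1_def degree_pderiv)
  also have "integral {l..r} (\<lambda>t. (poly p1 t)\<^sup>2) = integral {l..r} (\<lambda>t. (y' t)\<^sup>2)"
    by (rule integral_spike[of "Z \<union> {l, r}"]) (use Z in auto)
  also have "integral {l..r} (\<lambda>t. (poly p t)\<^sup>2) = integral {l..r} (\<lambda>t. (y t)\<^sup>2)"
    by (rule integral_cong) (use y(2) in auto)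
  finally show ?thesis unfolding eq by (simp add: algebra_simps)
qed

text \<open>Meant for integrands compared under the coefficient assumptions, which hold in open
  intervals only.\<close>

lemma integral_le_interior:
  fixes f g :: "real \<Rightarrow> real"
  assumes "f integrable_on {a..b}" "g integrable_on {a..b}" "\<And>x. x \<in> {a<..<b} \<Longrightarrow> f x \<le> g x"
  shows "integral {a..b} f \<le> integral {a..b} g"
proof -
  have "f integrable_on {a<..<b}" "g integrable_on {a<..<b}"
    using assms(1,2) by (auto simp: integrable_on_def has_integral_Icc_iff_Ioo)
  then show ?thesis
    unfolding integral_open_interval_real using assms(3) by (rule integral_le)
qed

lemma integral_shift_one:
  fixes f :: "real \<Rightarrow> real"
  assumes "continuous_on {0..1} f"
  shows "integral {1..2} (\<lambda>x. f (x - 1)) = integral {0..1} f"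
proof -
  have "continuous_on {1..2} (\<lambda>x. f (x - 1))"
    by (rule continuous_on_compose2[OF assms]) (auto intro!: continuous_intros)
  from integral_rescale[OF _ this] show ?thesis by simp
qed

text \<open>\<open>bform\<close> with the weak derivatives and the derivative of \<open>b\<close> as
  free arguments. Differences can then be taken literally, whereas \<open>wderiv\<close> of a
  difference is the difference of the derivatives only off a null set.\<close>

definition bform_AC where
  "bform_AC \<epsilon> b b1 c d u u' w w' y y' z z' =
     - \<epsilon> * integral {0..2} (\<lambda>x. w' x * y' x)
     + integral {0..2} (\<lambda>x. b x * u' x * y' x)
     + integral {0..2} (\<lambda>x. b1 x * u' x * y x)
     + integral {0..2} (\<lambda>x. c x * u x * y x)
     + integral {1..2} (\<lambda>x. d x * u (x - 1) * y x)
     + \<epsilon> * integral {0..2} (\<lambda>x. u' x * z' x)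
     + integral {0..2} (\<lambda>x. w x * z x)"

lemma AC_shift_continuous: "AC 0 2 u u' \<Longrightarrow> continuous_on {1..2} (\<lambda>x. u (x - 1))"
  by (rule continuous_on_compose2[OF AC_L2(3)]) (auto intro!: continuous_intros)

text \<open>All pairs of derivatives agree off one common null set. \<open>deriv b\<close> is
  two-sided and matches the one-sided \<open>b1\<close> inside the domain, which suffices under the
  integral.\<close>

lemma bform_eq:
  assumes cont: "continuous_on {0..2} b" "continuous_on {0..2} b1" "continuous_on {0..2} c" "continuous_on {0..2} d"
    and b1: "\<And>x. x \<in> Dom \<Longrightarrow> deriv b x = b1 x"
    and u: "AC 0 2 u u'" and w: "AC 0 2 w w'" and y: "AC 0 2 y y'" and z: "AC 0 2 z z'"
  shows "bform \<epsilon> b c d (u, w) (y, z) = bform_AC \<epsilon> b b1 c d u u' w w' y y' z z'"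
proof -
  have wd: "\<exists>Z. negligible Z \<and> (\<forall>t\<in>{0<..<2} - Z. wderiv Dom v t = v' t) \<and> L2on 0 2 (wderiv Dom v)"
    if v: "AC 0 2 v v'" for v v'
  proof -
    note a = H1_AC[OF AC_H1[OF v]]
    show ?thesis using AC_unique[OF a v] AC_L2(1)[OF a] by metis
  qed
  obtain Zu where Zu: "negligible Zu" "\<And>t. t \<in> {0<..<2} - Zu \<Longrightarrow> wderiv Dom u t = u' t" and Lu: "L2on 0 2 (wderiv Dom u)"
    using wd[OF u] by blast
  obtain Zw where Zw: "negligible Zw" "\<And>t. t \<in> {0<..<2} - Zw \<Longrightarrow> wderiv Dom w t = w' t" and Lw: "L2on 0 2 (wderiv Dom w)"
    using wd[OF w] by blast
  obtain Zy where Zy: "negligible Zy" "\<And>t. t \<in> {0<..<2} - Zy \<Longrightarrow> wderiv Dom y t = y' t" and Ly: "L2on 0 2 (wderiv Dom y)"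
    using wd[OF y] by blast
  obtain Zz where Zz: "negligible Zz" "\<And>t. t \<in> {0<..<2} - Zz \<Longrightarrow> wderiv Dom z t = z' t" and Lz: "L2on 0 2 (wderiv Dom z)"
    using wd[OF z] by blast
  define Z where "Z = Zu \<union> Zw \<union> Zy \<union> Zz \<union> {0, 2}"
  have Z: "negligible Z" using Zu Zw Zy Zz by (auto simp: Z_def)
  have sp: "wderiv Dom u t = u' t \<and> wderiv Dom w t = w' t \<and> wderiv Dom y t = y' t \<and> wderiv Dom z t = z' t \<and> deriv b t = b1 t"
    if "t \<in> {0..2} - Z" for t
    using that Zu Zw Zy Zz b1[of t] by (auto simp: Z_def)
  have dbu: "L2on 0 2 (\<lambda>x. deriv b x * wderiv Dom u x)"
    by (rule L2on_spike[OF L2on_cont_mult[OF AC_L2(1)[OF u] cont(2)] Z]) (use sp in auto)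
  have ys: "L2on 1 2 y" by (rule L2on_subinterval[OF AC_L2(2)[OF y]]) auto
  have du: "L2on 1 2 (\<lambda>x. d x * u (x - 1))"
    by (intro L2on_continuous continuous_intros AC_shift_continuous[OF u] continuous_on_subset[OF cont(4)]) auto
  have 1: "L2_inner Dom (wderiv Dom w) (wderiv Dom y) = integral {0..2} (\<lambda>x. w' x * y' x)"
    by (subst L2_inner_eq_integral[OF L2on_mult[OF Lw Ly]], rule integral_spike[OF Z]) (use sp in auto)
  have 2: "L2_inner Dom (\<lambda>x. b x * wderiv Dom u x) (wderiv Dom y) = integral {0..2} (\<lambda>x. b x * u' x * y' x)"
    by (subst L2_inner_eq_integral[OF L2on_mult[OF L2on_cont_mult[OF Lu cont(1)] Ly]], rule integral_spike[OF Z]) (use sp in auto)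
  have 3: "L2_inner Dom (\<lambda>x. deriv b x * wderiv Dom u x) y = integral {0..2} (\<lambda>x. b1 x * u' x * y x)"
    by (subst L2_inner_eq_integral[OF L2on_mult[OF dbu AC_L2(2)[OF y]]], rule integral_spike[OF Z]) (use sp in auto)
  have 4: "L2_inner Dom (\<lambda>x. c x * u x) y = integral {0..2} (\<lambda>x. c x * u x * y x)"
    by (rule L2_inner_eq_integral[OF L2on_mult[OF L2on_cont_mult[OF AC_L2(2)[OF u] cont(3)] AC_L2(2)[OF y]]])
  have 5: "L2_inner {1<..<2} (\<lambda>x. d x * u (x - 1)) y = integral {1..2} (\<lambda>x. d x * u (x - 1) * y x)"
    by (rule L2_inner_eq_integral[OF L2on_mult[OF du ys]])
  have 6: "L2_inner Dom (wderiv Dom u) (wderiv Dom z) = integral {0..2} (\<lambda>x. u' x * z' x)"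
    by (subst L2_inner_eq_integral[OF L2on_mult[OF Lu Lz]], rule integral_spike[OF Z]) (use sp in auto)
  have 7: "L2_inner Dom w z = integral {0..2} (\<lambda>x. w x * z x)"
    by (rule L2_inner_eq_integral[OF L2on_mult[OF AC_L2(2)[OF w] AC_L2(2)[OF z]]])
  show ?thesis by (simp only: bform.simps bform_AC_def 1 2 3 4 5 6 7)
qed

lemma energy_norm_sq:
  assumes y: "AC 0 2 y y'" and z: "L2on 0 2 z" and \<delta>: "\<delta> > 0"
  shows "(energy_norm \<beta> \<delta> (y, z))\<^sup>2 =
    integral {0..2} (\<lambda>x. (z x)\<^sup>2) + \<beta>\<^sup>2 / 2 * integral {0..2} (\<lambda>x. (y' x)\<^sup>2) + \<delta> * integral {0..2} (\<lambda>x. (y x)\<^sup>2)"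
    "0 \<le> energy_norm \<beta> \<delta> (y, z)"
proof -
  note a = H1_AC[OF AC_H1[OF y]]
  obtain Z where Z: "negligible Z" "\<And>t. t \<in> {0<..<2} - Z \<Longrightarrow> wderiv Dom y t = y' t"
    using AC_unique[OF a y] by metis
  have "integral {0..2} (\<lambda>x. (wderiv Dom y x)\<^sup>2) = integral {0..2} (\<lambda>x. (y' x)\<^sup>2)"
    by (rule integral_spike[of "Z \<union> {0, 2}"]) (use Z in auto)
  then have n: "(L2_norm Dom (wderiv Dom y))\<^sup>2 = integral {0..2} (\<lambda>x. (y' x)\<^sup>2)"
    using L2_norm_sq[OF AC_L2(1)[OF a]] by simp
  have "0 \<le> (L2_norm Dom z)\<^sup>2 + \<beta>\<^sup>2 / 2 * (L2_norm Dom (wderiv Dom y))\<^sup>2 + \<delta> * (L2_norm Dom y)\<^sup>2"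
    using \<delta> by (intro add_nonneg_nonneg mult_nonneg_nonneg) auto
  then show "(energy_norm \<beta> \<delta> (y, z))\<^sup>2 =
    integral {0..2} (\<lambda>x. (z x)\<^sup>2) + \<beta>\<^sup>2 / 2 * integral {0..2} (\<lambda>x. (y' x)\<^sup>2) + \<delta> * integral {0..2} (\<lambda>x. (y x)\<^sup>2)"
    "0 \<le> energy_norm \<beta> \<delta> (y, z)"
    by (simp_all add: n L2_norm_sq[OF z] L2_norm_sq[OF AC_L2(2)[OF y]])
qed

lemma bform_AC_diff:
  assumes cont: "continuous_on {0..2} b" "continuous_on {0..2} b1" "continuous_on {0..2} c" "continuous_on {0..2} d"
    and u: "AC 0 2 u u'" and w: "AC 0 2 w w'" and v: "AC 0 2 v v'" and x: "AC 0 2 x x'" and y: "AC 0 2 y y'" and z: "AC 0 2 z z'"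
  shows "bform_AC \<epsilon> b b1 c d (\<lambda>t. u t - v t) (\<lambda>t. u' t - v' t) (\<lambda>t. w t - x t) (\<lambda>t. w' t - x' t) y y' z z' =
    bform_AC \<epsilon> b b1 c d u u' w w' y y' z z' - bform_AC \<epsilon> b b1 c d v v' x x' y y' z z'"
proof -
  have ys: "L2on 1 2 y" by (rule L2on_subinterval[OF AC_L2(2)[OF y]]) auto
  have du: "L2on 1 2 (\<lambda>x. d x * u (x - 1))" if "AC 0 2 u u'" for u u'
    by (intro L2on_continuous continuous_intros AC_shift_continuous[OF that] continuous_on_subset[OF cont(4)]) auto
  note I = L2on_integrable_mult
  have i: "(\<lambda>t. w' t * y' t) integrable_on {0..2}" "(\<lambda>t. b t * w' t * y' t) integrable_on {0..2}"
    "(\<lambda>t. b1 t * w' t * y t) integrable_on {0..2}" "(\<lambda>t. c t * w t * y t) integrable_on {0..2}"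
    "(\<lambda>t. w t * z t) integrable_on {0..2}" "(\<lambda>t. w' t * z' t) integrable_on {0..2}"
    "(\<lambda>t. d t * w (t - 1) * y t) integrable_on {1..2}" if w: "AC 0 2 w w'" for w w'
    by (intro I L2on_cont_mult cont AC_L2(1)[OF w] AC_L2(1)[OF y] AC_L2(1)[OF z] AC_L2(2)[OF w] AC_L2(2)[OF y] AC_L2(2)[OF z] du[OF w] ys)+
  have e: "integral A (\<lambda>t. f t - g t) = integral A f - integral A g"
    if "f integrable_on A" "g integrable_on A" for f g :: "real \<Rightarrow> real" and A
    using that by (rule integral_diff)
  show ?thesis
    unfolding bform_AC_def right_diff_distrib left_diff_distrib
    using i[OF u] i[OF v] i[OF w] i[OF x] by (simp add: e right_diff_distrib)
qed

text \<open>Both terms with the factor \<open>\<epsilon>\<close> vanish exactly by cell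
  orthogonality, so \<open>C\<close> can be independent of \<open>\<epsilon>\<close> and of the
  mesh. The rest is split by Young's inequality: the share of the test functions stays within half
  the squared energy norm, and the share of the errors contains no derivative.\<close>

lemma bform_interp_error_bound:
  assumes cont: "continuous_on {0..2} b2" "continuous_on {0..2} c" "continuous_on {0..2} d"
    and b: "\<And>x. x \<in> {0..2} \<Longrightarrow> (b has_real_derivative b1 x) (at x within {0..2})"
       "\<And>x. x \<in> {0..2} \<Longrightarrow> (b1 has_real_derivative b2 x) (at x within {0..2})"
    and \<beta>: "\<beta> > 0" and \<delta>: "\<delta> > 0"
  obtains C :: real where "C \<ge> 0"
    "\<And>\<epsilon> X N e e' f f' y y' z z'. mesh_nodes X N \<Longrightarrow> AC 0 2 e e' \<Longrightarrow> AC 0 2 f f' \<Longrightarrow> AC 0 2 y y' \<Longrightarrow> AC 0 2 z z' \<Longrightarrow>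
      node_orth q X N e \<Longrightarrow> node_orth q X N f \<Longrightarrow> piecewise_poly q X N y \<Longrightarrow> piecewise_poly q X N z \<Longrightarrow>
      \<bar>bform_AC \<epsilon> b b1 c d e e' f f' y y' z z'\<bar> \<le>
        C * (integral {0..2} (\<lambda>t. (e t)\<^sup>2) + integral {0..2} (\<lambda>t. (f t)\<^sup>2))
        + 1/2 * (integral {0..2} (\<lambda>x. (z x)\<^sup>2) + \<beta>\<^sup>2 / 2 * integral {0..2} (\<lambda>x. (y' x)\<^sup>2) + \<delta> * integral {0..2} (\<lambda>x. (y x)\<^sup>2))"
proof (rule inverse_inequality[of q])
  fix Ci :: real
  assume Ci: "Ci \<ge> 0" "\<And>(p :: real poly) a b. degree p \<le> q \<Longrightarrow> a < b \<Longrightarrow>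
       (b - a)\<^sup>2 * integral {a..b} (\<lambda>t. (poly (pderiv p) t)\<^sup>2) \<le> Ci * integral {a..b} (\<lambda>t. (poly p t)\<^sup>2)"
  have bc: "continuous_on {0..2} b" "continuous_on {0..2} b1"
    using b DERIV_continuous_on by blast+
  obtain B1 where B1: "B1 \<ge> 0" "\<And>t. t \<in> {0..2} \<Longrightarrow> \<bar>b1 t\<bar> \<le> B1" using continuous_on_Icc_bounded[OF bc(2)] by metis
  obtain B2 where B2: "B2 \<ge> 0" "\<And>t. t \<in> {0..2} \<Longrightarrow> \<bar>b2 t\<bar> \<le> B2" using continuous_on_Icc_bounded[OF cont(1)] by metis
  obtain Cc where Cc: "Cc \<ge> 0" "\<And>t. t \<in> {0..2} \<Longrightarrow> \<bar>c t\<bar> \<le> Cc" using continuous_on_Icc_bounded[OF cont(2)] by metis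
  obtain Cd where Cd: "Cd \<ge> 0" "\<And>t. t \<in> {0..2} \<Longrightarrow> \<bar>d t\<bar> \<le> Cd" using continuous_on_Icc_bounded[OF cont(3)] by metis
  define B where "B = 2 * B1 + B2"
  have B: "B \<ge> 0" using B1 B2 by (simp add: B_def)
  \<comment> \<open>Half of the weights \<beta>^2 / 2 and \<delta> of the energy norm may be spent.
    The derivative of \<open>y\<close> occurs with \<open>s * (1 + Ci)\<close>, where
    \<open>Ci\<close> stems from the inverse inequality, and \<open>y\<close> itself three times
    with \<open>s\<close>: in convection, reaction and delay.\<close>
  define s where "s = min (\<beta>\<^sup>2 / (4 * (1 + Ci))) (\<delta> / 6)"
  have s: "s > 0" using \<beta> \<delta> Ci by (simp add: s_def)
  have s1: "s * (1 + Ci) \<le> \<beta>\<^sup>2 / 4"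
  proof -
    have "s * (1 + Ci) \<le> \<beta>\<^sup>2 / (4 * (1 + Ci)) * (1 + Ci)"
      using Ci by (intro mult_right_mono) (auto simp: s_def)
    also have "\<dots> = \<beta>\<^sup>2 / 4" using Ci by (simp add: field_simps)
    finally show ?thesis .
  qed
  have s2: "3 * s \<le> \<delta> / 2" by (simp add: s_def)
  define C where "C = (3 * B\<^sup>2 + Cc\<^sup>2 + Cd\<^sup>2) / (4 * s) + 1/2"
  have C: "C \<ge> 0" using s by (simp add: C_def)
  show thesis
  proof (rule that[OF C])
    fix \<epsilon> :: real and X N e e' f f' y y' z z'
    assume m: "mesh_nodes X N" and e: "AC 0 2 e e'" and f: "AC 0 2 f f'" and y: "AC 0 2 y y'" and z: "AC 0 2 z z'"
      and oe: "node_orth q X N e" and of: "node_orth q X N f"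
      and py: "piecewise_poly q X N y" and pz: "piecewise_poly q X N z"
    define Ie where "Ie = integral {0..2} (\<lambda>t. (e t)\<^sup>2)"
    define If where "If = integral {0..2} (\<lambda>t. (f t)\<^sup>2)"
    define Iy where "Iy = integral {0..2} (\<lambda>t. (y t)\<^sup>2)"
    define Iy' where "Iy' = integral {0..2} (\<lambda>t. (y' t)\<^sup>2)"
    define Iz where "Iz = integral {0..2} (\<lambda>t. (z t)\<^sup>2)"
    note L = AC_L2(1,2)[OF e] AC_L2(1,2)[OF f] AC_L2(1,2)[OF y] AC_L2(1,2)[OF z]
    have orth: "integral {0..2} (\<lambda>t. g' t * v' t) = 0"
      if g: "AC 0 2 g g'" and v: "AC 0 2 v v'" and o: "node_orth q X N g" and p: "piecewise_poly q X N v" for g g' v v'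
    proof -
      have "integral {X (i - 1)..X i} (\<lambda>t. g' t * v' t) = 0" if i: "i \<in> {1..N}" for i
      proof -
        note c = mesh_cell[OF m i]
        obtain r where r: "degree r \<le> q" "\<And>t. t \<in> {X (i - 1)..X i} \<Longrightarrow> v t = poly r t"
          using p i unfolding piecewise_poly_def by blast
        show ?thesis
          by (rule cell_orthogonality(2)[OF AC_subinterval[OF g c(1,3)] c(2) _ _ _ r(1) AC_subinterval[OF v c(1,3)] r(2)])
             (use o i in \<open>auto simp: node_orth_def\<close>)
      qed
      then show ?thesis
        using integral_cells[OF m L2on_integrable_mult[OF AC_L2(1)[OF g] AC_L2(1)[OF v]]] by simp
    qed
    have conv: "\<bar>integral {0..2} (\<lambda>x. b x * e' x * y' x) + integral {0..2} (\<lambda>x. b1 x * e' x * y x)\<bar>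
      \<le> 3 * B\<^sup>2 / (4 * s) * Ie + s * (1 + Ci) * Iy' + s * Iy"
    proof -
      have i: "(\<lambda>x. b x * e' x * y' x) integrable_on {0..2}" "(\<lambda>x. b1 x * e' x * y x) integrable_on {0..2}"
        by (intro L2on_integrable_mult L2on_cont_mult L bc)+
      define k where "k i = 3 * B\<^sup>2 / (4 * s) * integral {X (i - 1)..X i} (\<lambda>t. (e t)\<^sup>2)
          + s * (1 + Ci) * integral {X (i - 1)..X i} (\<lambda>t. (y' t)\<^sup>2) + s * integral {X (i - 1)..X i} (\<lambda>t. (y t)\<^sup>2)" for i
      have "\<bar>integral {X (i - 1)..X i} (\<lambda>x. b x * e' x * y' x + b1 x * e' x * y x)\<bar> \<le> k i" if i: "i \<in> {1..N}" for i
      proof -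
        note c = mesh_cell[OF m i]
        obtain r where r: "degree r \<le> q" "\<And>t. t \<in> {X (i - 1)..X i} \<Longrightarrow> y t = poly r t"
          using py i unfolding piecewise_poly_def by blast
        have sub: "{X (i - 1)..X i} \<subseteq> {0..2}" using c by auto
        show ?thesis unfolding k_def
        proof (rule cell_convection_bound[OF s B, where q = q and ?b2.0 = b2])
          show "(b has_real_derivative b1 x) (at x within {X (i - 1)..X i})"
            "(b1 has_real_derivative b2 x) (at x within {X (i - 1)..X i})" if "x \<in> {X (i - 1)..X i}" for x
            using b that sub DERIV_subset by blast+
          show "continuous_on {X (i - 1)..X i} b2" using cont(1) sub continuous_on_subset by blast
          show "2 * \<bar>b1 x\<bar> \<le> B" "\<bar>b2 x\<bar> \<le> B" if "x \<in> {X (i - 1)..X i}" for x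
          proof -
            have "x \<in> {0..2}" using that sub by blast
            from B1(2)[OF this] B2(2)[OF this] show "2 * \<bar>b1 x\<bar> \<le> B" "\<bar>b2 x\<bar> \<le> B"
              using B1(1) B2(1) by (auto simp: B_def)
          qed
          show "(X i - X (i - 1))\<^sup>2 * integral {X (i - 1)..X i} (\<lambda>t. (poly (pderiv p) t)\<^sup>2)
             \<le> Ci * integral {X (i - 1)..X i} (\<lambda>t. (poly p t)\<^sup>2)" if "degree p \<le> q" for p
            using Ci(2)[OF that, of "X (i - 1)" "X i"] c(2) by (cases "X (i - 1) = X i") auto
          show "AC (X (i - 1)) (X i) e e'" by (rule AC_subinterval[OF e c(1,3)])
          show "AC (X (i - 1)) (X i) y y'" by (rule AC_subinterval[OF y c(1,3)])
        qed (use Ci c r oe i in \<open>auto simp: node_orth_def\<close>)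
      qed
      then have "(\<Sum>i\<in>{1..N}. \<bar>integral {X (i - 1)..X i} (\<lambda>x. b x * e' x * y' x + b1 x * e' x * y x)\<bar>) \<le> (\<Sum>i\<in>{1..N}. k i)"
        by (rule sum_mono)
      also have "(\<Sum>i\<in>{1..N}. k i) = 3 * B\<^sup>2 / (4 * s) * Ie + s * (1 + Ci) * Iy' + s * Iy"
        unfolding k_def sum.distrib sum_distrib_left[symmetric] Ie_def Iy_def Iy'_def
        by (simp only: integral_cells[OF m L2on_square] L)
      finally have "\<bar>\<Sum>i\<in>{1..N}. integral {X (i - 1)..X i} (\<lambda>x. b x * e' x * y' x + b1 x * e' x * y x)\<bar>
         \<le> 3 * B\<^sup>2 / (4 * s) * Ie + s * (1 + Ci) * Iy' + s * Iy"
        by (rule order_trans[OF sum_abs])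
      then show ?thesis
        using integral_cells[OF m integrable_add[OF i]] i by (simp add: integral_add)
    qed
    have ct: "\<bar>integral {0..2} (\<lambda>x. c x * e x * y x)\<bar> \<le> Cc\<^sup>2 / (4 * s) * Ie + s * Iy"
    proof -
      have "norm (integral {0..2} (\<lambda>x. c x * e x * y x)) \<le> integral {0..2} (\<lambda>x. Cc\<^sup>2 / (4 * s) * (e x)\<^sup>2 + s * (y x)\<^sup>2)"
      proof (rule integral_norm_bound_integral)
        show "(\<lambda>x. c x * e x * y x) integrable_on {0..2}" by (intro L2on_integrable_mult L2on_cont_mult L cont)
        show "(\<lambda>x. Cc\<^sup>2 / (4 * s) * (e x)\<^sup>2 + s * (y x)\<^sup>2) integrable_on {0..2}"
          by (intro integrable_add integrable_on_mult_right L2on_square L)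
        fix x :: real assume x: "x \<in> {0..2}"
        have "\<bar>c x * e x * y x\<bar> = \<bar>c x\<bar> * (\<bar>e x\<bar> * \<bar>y x\<bar>)" by (simp add: abs_mult)
        also have "\<dots> \<le> Cc * (\<bar>e x\<bar> * \<bar>y x\<bar>)" using Cc(2)[OF x] by (intro mult_right_mono) auto
        also have "\<dots> = \<bar>(Cc * e x) * y x\<bar>" using Cc by (simp add: abs_mult)
        also have "\<dots> \<le> (Cc * e x)\<^sup>2 / (4 * s) + s * (y x)\<^sup>2" by (rule Young[OF s])
        finally show "norm (c x * e x * y x) \<le> Cc\<^sup>2 / (4 * s) * (e x)\<^sup>2 + s * (y x)\<^sup>2" by (simp add: power_mult_distrib)
      qed
      also have "\<dots> = Cc\<^sup>2 / (4 * s) * Ie + s * Iy"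
        unfolding Ie_def Iy_def by (simp only: integral_add integrable_on_mult_right L2on_square L integral_mult_right)
      finally show ?thesis by simp
    qed
    have dt: "\<bar>integral {1..2} (\<lambda>x. d x * e (x - 1) * y x)\<bar> \<le> Cd\<^sup>2 / (4 * s) * Ie + s * Iy"
    proof -
      have ec: "continuous_on {1..2} (\<lambda>x. e (x - 1))" by (rule AC_shift_continuous[OF e])
      have yc: "continuous_on {1..2} y" by (rule continuous_on_subset[OF AC_L2(3)[OF y]]) auto
      have dc: "continuous_on {1..2} d" by (rule continuous_on_subset[OF cont(3)]) auto
      have ec0: "continuous_on {0..1} e" by (rule continuous_on_subset[OF AC_L2(3)[OF e]]) auto
      have "norm (integral {1..2} (\<lambda>x. d x * e (x - 1) * y x)) \<le> integral {1..2} (\<lambda>x. Cd\<^sup>2 / (4 * s) * (e (x - 1))\<^sup>2 + s * (y x)\<^sup>2)"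
      proof (rule integral_norm_bound_integral)
        fix x :: real assume x: "x \<in> {1..2}"
        have "\<bar>d x * e (x - 1) * y x\<bar> = \<bar>d x\<bar> * (\<bar>e (x - 1)\<bar> * \<bar>y x\<bar>)" by (simp add: abs_mult)
        also have "\<dots> \<le> Cd * (\<bar>e (x - 1)\<bar> * \<bar>y x\<bar>)" using Cd(2)[of x] x by (intro mult_right_mono) auto
        also have "\<dots> = \<bar>(Cd * e (x - 1)) * y x\<bar>" using Cd by (simp add: abs_mult)
        also have "\<dots> \<le> (Cd * e (x - 1))\<^sup>2 / (4 * s) + s * (y x)\<^sup>2" by (rule Young[OF s])
        finally show "norm (d x * e (x - 1) * y x) \<le> Cd\<^sup>2 / (4 * s) * (e (x - 1))\<^sup>2 + s * (y x)\<^sup>2" by (simp add: power_mult_distrib)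
      qed (intro integrable_continuous_real continuous_intros ec yc dc)+
      also have "\<dots> = Cd\<^sup>2 / (4 * s) * integral {1..2} (\<lambda>x. (e (x - 1))\<^sup>2) + s * integral {1..2} (\<lambda>x. (y x)\<^sup>2)"
      proof -
        have "(\<lambda>x. (e (x - 1))\<^sup>2) integrable_on {1..2}" "(\<lambda>x. (y x)\<^sup>2) integrable_on {1..2}"
          by (intro integrable_continuous_real continuous_intros ec yc)+
        then show ?thesis by (simp only: integral_add integrable_on_mult_right integral_mult_right)
      qed
      \<comment> \<open>The shifted error on (1, 2) is the error on (0, 1), so the delay costs no
        more than a reaction term.\<close>
      also have "integral {1..2} (\<lambda>x. (e (x - 1))\<^sup>2) = integral {0..1} (\<lambda>x. (e x)\<^sup>2)"
        by (rule integral_shift_one) (intro continuous_intros ec0)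
      also have "Cd\<^sup>2 / (4 * s) * integral {0..1} (\<lambda>x. (e x)\<^sup>2) \<le> Cd\<^sup>2 / (4 * s) * Ie"
        unfolding Ie_def using s
        by (intro mult_left_mono integral_subset_le L2on_square L L2on_subinterval[OF L(2)]) auto
      also have "s * integral {1..2} (\<lambda>x. (y x)\<^sup>2) \<le> s * Iy"
        unfolding Iy_def using s
        by (intro mult_left_mono integral_subset_le L2on_square L L2on_subinterval[OF L(6)]) auto
      finally show ?thesis by simp
    qed
    have wt: "\<bar>integral {0..2} (\<lambda>x. f x * z x)\<bar> \<le> 1/2 * If + 1/2 * Iz"
    proof -
      have "norm (integral {0..2} (\<lambda>x. f x * z x)) \<le> integral {0..2} (\<lambda>x. 1/2 * (f x)\<^sup>2 + 1/2 * (z x)\<^sup>2)"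
      proof (rule integral_norm_bound_integral)
        show "(\<lambda>x. f x * z x) integrable_on {0..2}" by (intro L2on_integrable_mult L)
        show "(\<lambda>x. 1/2 * (f x)\<^sup>2 + 1/2 * (z x)\<^sup>2) integrable_on {0..2}"
          by (intro integrable_add integrable_on_mult_right L2on_square L)
        show "norm (f x * z x) \<le> 1/2 * (f x)\<^sup>2 + 1/2 * (z x)\<^sup>2" for x
          using Young[of "1/2" "f x" "z x"] by simp
      qed
      also have "\<dots> = 1/2 * If + 1/2 * Iz"
        unfolding If_def Iz_def
        by (simp only: integral_add integrable_on_mult_right L2on_square L integral_mult_right)
      finally show ?thesis by simp
    qed
    have nn: "Ie \<ge> 0" "If \<ge> 0" "Iy \<ge> 0" "Iy' \<ge> 0" "Iz \<ge> 0"
      unfolding Ie_def If_def Iy_def Iy'_def Iz_def by (auto intro!: integral_nonneg L2on_square L)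
    have tot: "\<bar>bform_AC \<epsilon> b b1 c d e e' f f' y y' z z'\<bar> \<le>
       (3 * B\<^sup>2 / (4 * s) * Ie + s * (1 + Ci) * Iy' + s * Iy) + (Cc\<^sup>2 / (4 * s) * Ie + s * Iy)
       + (Cd\<^sup>2 / (4 * s) * Ie + s * Iy) + (1/2 * If + 1/2 * Iz)"
      unfolding bform_AC_def orth[OF f y of py] orth[OF e z oe pz] using conv ct dt wt by linarith
    have g1: "s * (1 + Ci) * Iy' \<le> \<beta>\<^sup>2 / 4 * Iy'" by (rule mult_right_mono[OF s1 nn(4)])
    have g2: "3 * s * Iy \<le> \<delta> / 2 * Iy" by (rule mult_right_mono[OF s2 nn(3)])
    have g3: "3 * B\<^sup>2 / (4 * s) * Ie + Cc\<^sup>2 / (4 * s) * Ie + Cd\<^sup>2 / (4 * s) * Ie + 1/2 * If \<le> C * (Ie + If)"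
    proof -
      have "C * (Ie + If) = (3 * B\<^sup>2 / (4 * s) * Ie + Cc\<^sup>2 / (4 * s) * Ie + Cd\<^sup>2 / (4 * s) * Ie + 1/2 * If) + 
         (1/2 * Ie + (3 * B\<^sup>2 + Cc\<^sup>2 + Cd\<^sup>2) / (4 * s) * If)"
        by (simp add: C_def add_divide_distrib algebra_simps)
      moreover have "0 \<le> 1/2 * Ie + (3 * B\<^sup>2 + Cc\<^sup>2 + Cd\<^sup>2) / (4 * s) * If" using nn s by simp
      ultimately show ?thesis by linarith
    qed
    show "\<bar>bform_AC \<epsilon> b b1 c d e e' f f' y y' z z'\<bar> \<le>
        C * (integral {0..2} (\<lambda>t. (e t)\<^sup>2) + integral {0..2} (\<lambda>t. (f t)\<^sup>2))
        + 1/2 * (integral {0..2} (\<lambda>x. (z x)\<^sup>2) + \<beta>\<^sup>2 / 2 * integral {0..2} (\<lambda>x. (y' x)\<^sup>2) + \<delta> * integral {0..2} (\<lambda>x. (y x)\<^sup>2))"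
      unfolding Ie_def[symmetric] If_def[symmetric] Iy_def[symmetric] Iy'_def[symmetric] Iz_def[symmetric]
      using tot g1 g2 g3 by (simp add: algebra_simps)
  qed
qed

section \<open>Coercivity\<close>

lemma closure_Ioo_minus_negligible:
  fixes Z :: "real set"
  assumes "negligible Z" "a < b"
  shows "closure ({a<..<b} - Z) = {a..b}"
proof (rule antisym)
  show "closure ({a<..<b} - Z) \<subseteq> {a..b}" by (rule closure_minimal) auto
qed (rule dense_Ioo_minus_negligible[OF assms])

text \<open>A null set has dense complement in the interval, so for a continuous function an almost
  everywhere bound holds at every point, including the end points.\<close>

lemma Linf_norm_bound:
  assumes ab: "a < b" and v: "continuous_on {a..b} v" and x: "x \<in> {a..b}"
  shows "\<bar>v x\<bar> \<le> Linf_norm {a<..<b} v"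
  unfolding Linf_norm_def
proof (rule cInf_greatest)
  obtain B where B: "B \<ge> 0" "\<And>t. t \<in> {a..b} \<Longrightarrow> \<bar>v t\<bar> \<le> B"
    using continuous_on_Icc_bounded[OF v] by metis
  have "AE x in lebesgue_on {a<..<b}. \<bar>v x\<bar> \<le> B"
    by (rule AE_I2) (use B in auto)
  then show "{C. 0 \<le> C \<and> (AE x in lebesgue_on {a<..<b}. \<bar>v x\<bar> \<le> C)} \<noteq> {}" using B by blast
  fix C assume "C \<in> {C. 0 \<le> C \<and> (AE x in lebesgue_on {a<..<b}. \<bar>v x\<bar> \<le> C)}"
  then have "AE x in lebesgue_on {a<..<b}. \<bar>v x\<bar> \<le> C" by simp
  then obtain Z where Z: "Z \<in> null_sets (lebesgue_on {a<..<b})"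
    "{x \<in> space (lebesgue_on {a<..<b}). \<not> \<bar>v x\<bar> \<le> C} \<subseteq> Z"
    by (auto simp: eventually_ae_filter)
  have neg: "negligible Z"
    using Z(1) by (simp add: null_sets_restrict_space negligible_iff_null_sets)
  note cl = closure_Ioo_minus_negligible[OF neg ab]
  show "\<bar>v x\<bar> \<le> C"
    by (rule continuous_le_on_closure[of "{a<..<b} - Z" "\<lambda>x. \<bar>v x\<bar>"])
       (use x v Z(2) in \<open>auto simp: cl intro!: continuous_intros\<close>)
qed

lemma Linf_norm_cong:
  assumes "\<And>x. x \<in> D \<Longrightarrow> v x = g x" "D \<in> sets lebesgue"
  shows "Linf_norm D v = Linf_norm D g"
proof -
  have "(AE x in lebesgue_on D. \<bar>v x\<bar> \<le> C) \<longleftrightarrow> (AE x in lebesgue_on D. \<bar>g x\<bar> \<le> C)" for C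
    by (rule AE_cong) (use assms in auto)
  then show ?thesis by (simp add: Linf_norm_def)
qed

text \<open>With equal arguments the two terms with the factor \<open>\<epsilon>\<close> cancel. The
  rest is a pointwise inequality except for the delay, whose squares at \<open>x - 1\<close> and
  \<open>x\<close> live on the two halves of the domain and add up to one full norm.\<close>

lemma bform_AC_coercive:
  assumes cont: "continuous_on {0..2} b" "continuous_on {0..2} b1" "continuous_on {0..2} c" "continuous_on {0..2} d"
    and \<beta>: "\<beta> > 0" "\<And>t. t \<in> Dom \<Longrightarrow> b t \<ge> \<beta>\<^sup>2"
    and Lb: "\<And>t. t \<in> Dom \<Longrightarrow> \<bar>b1 t\<bar> \<le> Lb" and Ld: "Ld \<ge> 0" "\<And>t. t \<in> {1<..<2} \<Longrightarrow> \<bar>d t\<bar> \<le> Ld"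
    and c: "\<And>t. t \<in> Dom \<Longrightarrow> c t - 1/2 * Ld - 1 / (2 * \<beta>\<^sup>2) * Lb\<^sup>2 \<ge> \<delta>"
    and y: "AC 0 2 y y'" and z: "AC 0 2 z z'"
  shows "integral {0..2} (\<lambda>x. (z x)\<^sup>2) + \<beta>\<^sup>2 / 2 * integral {0..2} (\<lambda>x. (y' x)\<^sup>2) + \<delta> * integral {0..2} (\<lambda>x. (y x)\<^sup>2)
    \<le> bform_AC \<epsilon> b b1 c d y y' z z' y y' z z'"
proof -
  note L = AC_L2(1,2)[OF y] AC_L2(1,2)[OF z]
  note I = L2on_integrable_mult[OF L2on_cont_mult]
  have i: "(\<lambda>x. b x * y' x * y' x) integrable_on {0..2}" "(\<lambda>x. b1 x * y' x * y x) integrable_on {0..2}"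
     "(\<lambda>x. c x * y x * y x) integrable_on {0..2}"
    by (intro I L cont)+
  have main: "integral {0..2} (\<lambda>x. \<beta>\<^sup>2 / 2 * (y' x)\<^sup>2 + (\<delta> + Ld / 2) * (y x)\<^sup>2)
    \<le> integral {0..2} (\<lambda>x. b x * y' x * y' x + b1 x * y' x * y x + c x * y x * y x)"
  proof (rule integral_le_interior)
    show "(\<lambda>x. \<beta>\<^sup>2 / 2 * (y' x)\<^sup>2 + (\<delta> + Ld / 2) * (y x)\<^sup>2) integrable_on {0..2}"
      by (intro integrable_add integrable_on_mult_right L2on_square L)
    show "(\<lambda>x. b x * y' x * y' x + b1 x * y' x * y x + c x * y x * y x) integrable_on {0..2}"
      by (intro integrable_add i)
    fix x :: real assume x: "x \<in> {0<..<2}"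
    \<comment> \<open>Young's parameter \<beta>^2 / 2 gives away half of the lower bound \<beta>^2
      of the diffusion; the other factor becomes 1 / (2 \<beta>^2), the one in the assumption on
      \<open>c\<close>.\<close>
    have "\<bar>(b1 x * y x) * y' x\<bar> \<le> (b1 x * y x)\<^sup>2 / (4 * (\<beta>\<^sup>2 / 2)) + \<beta>\<^sup>2 / 2 * (y' x)\<^sup>2"
      using \<beta>(1) by (intro Young) simp
    then have 1: "b1 x * y' x * y x \<ge> - ((b1 x)\<^sup>2 * (y x)\<^sup>2 / (2 * \<beta>\<^sup>2)) - \<beta>\<^sup>2 / 2 * (y' x)\<^sup>2"
      by (simp add: power_mult_distrib mult_ac abs_le_iff)
    have "(b1 x)\<^sup>2 \<le> Lb\<^sup>2" using Lb[OF x] abs_le_square_iff[of "b1 x" Lb] by simp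
    then have 2: "(b1 x)\<^sup>2 * (y x)\<^sup>2 / (2 * \<beta>\<^sup>2) \<le> Lb\<^sup>2 * (y x)\<^sup>2 / (2 * \<beta>\<^sup>2)"
      by (intro divide_right_mono mult_right_mono) auto
    have "(\<delta> + Ld / 2 + 1 / (2 * \<beta>\<^sup>2) * Lb\<^sup>2) * (y x)\<^sup>2 \<le> c x * (y x)\<^sup>2"
      using c[OF x] by (intro mult_right_mono) auto
    then have 3: "(\<delta> + Ld / 2) * (y x)\<^sup>2 + Lb\<^sup>2 * (y x)\<^sup>2 / (2 * \<beta>\<^sup>2) \<le> c x * y x * y x"
      by (simp add: power2_eq_square algebra_simps)
    have "\<beta>\<^sup>2 * (y' x)\<^sup>2 \<le> b x * (y' x)\<^sup>2" using \<beta>(2)[OF x] by (intro mult_right_mono) auto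
    then have 4: "\<beta>\<^sup>2 / 2 * (y' x)\<^sup>2 + \<beta>\<^sup>2 / 2 * (y' x)\<^sup>2 \<le> b x * y' x * y' x"
      by (simp add: power2_eq_square mult.assoc)
    show "\<beta>\<^sup>2 / 2 * (y' x)\<^sup>2 + (\<delta> + Ld / 2) * (y x)\<^sup>2 \<le> b x * y' x * y' x + b1 x * y' x * y x + c x * y x * y x"
      using 1 2 3 4 by linarith
  qed
  have l: "integral {0..2} (\<lambda>x. \<beta>\<^sup>2 / 2 * (y' x)\<^sup>2 + (\<delta> + Ld / 2) * (y x)\<^sup>2) =
     \<beta>\<^sup>2 / 2 * integral {0..2} (\<lambda>x. (y' x)\<^sup>2) + (\<delta> + Ld / 2) * integral {0..2} (\<lambda>x. (y x)\<^sup>2)"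
    by (simp only: integral_add integrable_on_mult_right L2on_square L integral_mult_right)
  have r: "integral {0..2} (\<lambda>x. b x * y' x * y' x + b1 x * y' x * y x + c x * y x * y x) =
    integral {0..2} (\<lambda>x. b x * y' x * y' x) + integral {0..2} (\<lambda>x. b1 x * y' x * y x) + integral {0..2} (\<lambda>x. c x * y x * y x)"
    by (simp only: integral_add integrable_add i)
  have yc: "continuous_on {0..2} y" by (rule AC_L2(3)[OF y])
  have c12: "continuous_on {1..2} y" "continuous_on {1..2} d" "continuous_on {0..1} y" "continuous_on {1..2} (\<lambda>x. y (x - 1))"
    using continuous_on_subset[OF yc] continuous_on_subset[OF cont(4)] AC_shift_continuous[OF y] by auto
  have dterm: "- (Ld / 2) * integral {0..2} (\<lambda>x. (y x)\<^sup>2) \<le> integral {1..2} (\<lambda>x. d x * y (x - 1) * y x)"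
  proof -
    have "integral {1..2} (\<lambda>x. - (Ld / 2) * (y (x - 1))\<^sup>2 + - (Ld / 2) * (y x)\<^sup>2) \<le> integral {1..2} (\<lambda>x. d x * y (x - 1) * y x)"
    proof (rule integral_le_interior)
      fix x :: real assume x: "x \<in> {1<..<2}"
      have "\<bar>y (x - 1) * y x\<bar> \<le> (y (x - 1))\<^sup>2 / (4 * (1/2)) + 1/2 * (y x)\<^sup>2" by (rule Young) simp
      then have "\<bar>d x\<bar> * \<bar>y (x - 1) * y x\<bar> \<le> Ld * ((y (x - 1))\<^sup>2 / 2 + 1/2 * (y x)\<^sup>2)"
        using Ld x by (intro mult_mono) auto
      then have "\<bar>d x * y (x - 1) * y x\<bar> \<le> Ld / 2 * (y (x - 1))\<^sup>2 + Ld / 2 * (y x)\<^sup>2"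
        by (simp add: abs_mult algebra_simps)
      then show "- (Ld / 2) * (y (x - 1))\<^sup>2 + - (Ld / 2) * (y x)\<^sup>2 \<le> d x * y (x - 1) * y x" by linarith
    qed (intro integrable_continuous_real continuous_intros c12)+
    also have "integral {1..2} (\<lambda>x. - (Ld / 2) * (y (x - 1))\<^sup>2 + - (Ld / 2) * (y x)\<^sup>2)
      = - (Ld / 2) * integral {1..2} (\<lambda>x. (y (x - 1))\<^sup>2) + - (Ld / 2) * integral {1..2} (\<lambda>x. (y x)\<^sup>2)"
    proof -
      have "(\<lambda>x. (y (x - 1))\<^sup>2) integrable_on {1..2}" "(\<lambda>x. (y x)\<^sup>2) integrable_on {1..2}"
        by (intro integrable_continuous_real continuous_intros c12)+
      then show ?thesis by (simp only: integral_add integrable_on_mult_right integral_mult_right)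
    qed
    also have "integral {1..2} (\<lambda>x. (y (x - 1))\<^sup>2) = integral {0..1} (\<lambda>x. (y x)\<^sup>2)"
      by (rule integral_shift_one) (intro continuous_intros c12)
    also have "- (Ld / 2) * integral {0..1} (\<lambda>x. (y x)\<^sup>2) + - (Ld / 2) * integral {1..2} (\<lambda>x. (y x)\<^sup>2)
       = - (Ld / 2) * (integral {0..1} (\<lambda>x. (y x)\<^sup>2) + integral {1..2} (\<lambda>x. (y x)\<^sup>2))" by (simp add: algebra_simps)
    also have "integral {0..1} (\<lambda>x. (y x)\<^sup>2) + integral {1..2} (\<lambda>x. (y x)\<^sup>2) = integral {0..2} (\<lambda>x. (y x)\<^sup>2)"
      by (rule Henstock_Kurzweil_Integration.integral_combine) (auto intro: L2on_square L)
    finally show ?thesis .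
  qed
  have s: "integral {0..2} (\<lambda>x. z' x * y' x) = integral {0..2} (\<lambda>x. y' x * z' x)"
    by (simp add: mult.commute)
  have zz: "integral {0..2} (\<lambda>x. z x * z x) = integral {0..2} (\<lambda>x. (z x)\<^sup>2)" by (simp add: power2_eq_square)
  show ?thesis
    using main[unfolded l r] dterm unfolding bform_AC_def s zz by (simp add: algebra_simps)
qed

section \<open>Galerkin orthogonality and reduction to interpolation errors\<close>

lemma smooth_on_derivs:
  assumes "smooth_on {0..2} b"
  obtains b1 b2 where
    "\<And>x. x \<in> {0..2} \<Longrightarrow> (b has_real_derivative b1 x) (at x within {0..2})"
    "\<And>x. x \<in> {0..2} \<Longrightarrow> (b1 has_real_derivative b2 x) (at x within {0..2})"
    "continuous_on {0..2} b2" "\<And>x. x \<in> Dom \<Longrightarrow> deriv b x = b1 x"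
proof -
  obtain D where hd: "\<And>n. has_derivs n {0..2} b D" using assms by (auto simp: smooth_on_def)
  have D0: "D 0 = b" using hd[of 0] by (simp add: has_derivs_def)
  have D: "(D k has_real_derivative D (Suc k) x) (at x within {0..2})" if "x \<in> {0..2}" for k x
    using hd[of "Suc k"] that by (auto simp: has_derivs_def)
  show ?thesis
  proof (rule that[of "D 1" "D 2"])
    show "(b has_real_derivative D 1 x) (at x within {0..2})" if "x \<in> {0..2}" for x
      using D[OF that, of 0] D0 by simp
    show "(D 1 has_real_derivative D 2 x) (at x within {0..2})" if "x \<in> {0..2}" for x
      using D[OF that, of 1] by (simp add: numeral_2_eq_2)
    show "continuous_on {0..2} (D 2)"
      by (rule DERIV_continuous_on) (rule D)
    fix x :: real assume x: "x \<in> Dom"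
    have "(b has_real_derivative D 1 x) (at x within {0..2})" using D[of x 0] D0 x by simp
    moreover have "at x within {0..2} = at x" by (rule at_within_interior) (use x in auto)
    ultimately show "deriv b x = D 1 x" by (simp add: DERIV_imp_deriv)
  qed
qed

lemma smooth_on_continuous: "smooth_on {0..2} b \<Longrightarrow> continuous_on {0..2} b"
  using smooth_on_derivs[of b] DERIV_continuous_on by metis

lemma U_space_H1: "(y, z) \<in> U_space m \<Longrightarrow> y \<in> H1 \<and> z \<in> H1"
  by (auto simp: U_space_def H10_def split: if_splits)

lemma Linf_norm_nonneg: 
  assumes "a < b" "continuous_on {a..b} v" shows "0 \<le> Linf_norm {a<..<b} v"
  using Linf_norm_bound[OF assms, of a] assms(1) by (meson abs_ge_zero atLeastAtMost_iff less_imp_le order_refl order_trans)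

text \<open>The end points 0 and 2 are nodes, so interpolation preserves boundary values; the second
  component carries boundary conditions in only one of the two cases.\<close>

lemma interp_diff_Uh:
  assumes q: "q \<ge> 1" and m: "mesh_nodes X N"
    and uw: "(u, w) \<in> U_space k" and uwh: "(uh, wh) \<in> Uh_space k q X N"
  shows "(\<lambda>t. interp q X N u t - uh t, \<lambda>t. interp q X N w t - wh t) \<in> Uh_space k q X N"
proof -
  have N: "N \<ge> 1" using m by (auto simp: mesh_nodes_def intro!: Suc_leI gr0I)
  have ends: "interp q X N v 0 = v 0" "interp q X N v 2 = v 2" if "v \<in> H1" for v
  proof -
    note I = interp_is_interpolant[OF q m AC_L2(3)[OF H1_AC[OF that]]]
    show "interp q X N v 0 = v 0"
      using I N m unfolding is_interpolant_def mesh_nodes_def by (force dest!: bspec[of _ _ 1])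
    show "interp q X N v 2 = v 2"
      using I N m unfolding is_interpolant_def mesh_nodes_def by (force dest!: bspec[of _ _ N])
  qed
  have h: "u \<in> H1" "w \<in> H1" "uh \<in> H1" "wh \<in> H1" "piecewise_poly q X N uh" "piecewise_poly q X N wh"
    using uw uwh U_space_H1 by (auto simp: Uh_space_def)
  have H: "(\<lambda>t. interp q X N v t - vh t) \<in> H1" "piecewise_poly q X N (\<lambda>t. interp q X N v t - vh t)"
    if "v \<in> H1" "vh \<in> H1" "piecewise_poly q X N vh" for v vh
    using H1_diff piecewise_poly_diff interp_H1[OF q m AC_L2(3)[OF H1_AC[OF that(1)]]] that by blast+
  show ?thesis
    using uw uwh H[of u uh] H[of w wh] h ends[of u] ends[of w]
    by (auto simp: Uh_space_def U_space_def H10_def split: if_splits)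
qed

text \<open>The constant is fixed before \<open>\<epsilon>\<close>, the mesh, the solutions and the
  right-hand side \<open>F\<close>; all that is used of \<open>F\<close> is that both problems share
  it.\<close>

lemma supercloseness_bound:
  assumes q: "q \<ge> 1" and smooth: "smooth_on {0..2} b" "smooth_on {0..2} c" "smooth_on {0..2} d"
    and \<beta>: "\<beta> > 0" "\<forall>t\<in>Dom. b t \<ge> \<beta>\<^sup>2"
    and \<delta>: "\<delta> > 0"
      "\<forall>t\<in>Dom. c t - 1/2 * Linf_norm {1<..<2} d
                 - 1 / (2 * \<beta>\<^sup>2) * (Linf_norm Dom (deriv b))\<^sup>2 \<ge> \<delta>"
  obtains C where "C \<ge> 0"
    "\<And>\<epsilon> X N u w uh wh F k. mesh_nodes X N \<Longrightarrow> (u, w) \<in> U_space k \<Longrightarrow> (uh, wh) \<in> Uh_space k q X N \<Longrightarrow>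
       (\<forall>(y, z)\<in>U_space k. bform \<epsilon> b c d (u, w) (y, z) = F y) \<Longrightarrow>
       (\<forall>(y, z)\<in>Uh_space k q X N. bform \<epsilon> b c d (uh, wh) (y, z) = F y) \<Longrightarrow>
       (energy_norm \<beta> \<delta> (\<lambda>t. interp q X N u t - uh t, \<lambda>t. interp q X N w t - wh t))\<^sup>2
        \<le> C * (integral {0..2} (\<lambda>t. (u t - interp q X N u t)\<^sup>2) + integral {0..2} (\<lambda>t. (w t - interp q X N w t)\<^sup>2))"
proof (rule smooth_on_derivs[OF smooth(1)])
  fix b1 b2 :: "real \<Rightarrow> real"
  assume b: "\<And>x. x \<in> {0..2} \<Longrightarrow> (b has_real_derivative b1 x) (at x within {0..2})"
    "\<And>x. x \<in> {0..2} \<Longrightarrow> (b1 has_real_derivative b2 x) (at x within {0..2})"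
    and b2: "continuous_on {0..2} b2" and db: "\<And>x. x \<in> Dom \<Longrightarrow> deriv b x = b1 x"
  have cont: "continuous_on {0..2} b" "continuous_on {0..2} b1" "continuous_on {0..2} c" "continuous_on {0..2} d"
    using b DERIV_continuous_on smooth smooth_on_continuous by blast+
  have d12: "continuous_on {1..2} d" by (rule continuous_on_subset[OF cont(4)]) auto
  define Lb where "Lb = Linf_norm Dom (deriv b)"
  define Ld where "Ld = Linf_norm {1<..<2} d"
  have Lb: "\<bar>b1 t\<bar> \<le> Lb" if "t \<in> Dom" for t
    using Linf_norm_bound[OF _ cont(2), of t] that Linf_norm_cong[of Dom "deriv b" b1] db by (simp add: Lb_def)
  have Ld: "Ld \<ge> 0" "\<And>t. t \<in> {1<..<2} \<Longrightarrow> \<bar>d t\<bar> \<le> Ld"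
    using Linf_norm_bound[OF _ d12] Linf_norm_nonneg[OF _ d12] by (auto simp: Ld_def)
  have cc: "c t - 1/2 * Ld - 1 / (2 * \<beta>\<^sup>2) * Lb\<^sup>2 \<ge> \<delta>" if "t \<in> Dom" for t
    using \<delta>(2) that by (simp add: Lb_def Ld_def)
  have bb: "b t \<ge> \<beta>\<^sup>2" if "t \<in> Dom" for t using \<beta>(2) that by blast
  show thesis
  proof (rule bform_interp_error_bound[OF b2 cont(3,4) b \<beta>(1) \<delta>(1), of q])
    fix C :: real
    assume C: "C \<ge> 0"
     "\<And>\<epsilon> X N e e' f f' y y' z z'. mesh_nodes X N \<Longrightarrow> AC 0 2 e e' \<Longrightarrow> AC 0 2 f f' \<Longrightarrow> AC 0 2 y y' \<Longrightarrow> AC 0 2 z z' \<Longrightarrow>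
      node_orth q X N e \<Longrightarrow> node_orth q X N f \<Longrightarrow> piecewise_poly q X N y \<Longrightarrow> piecewise_poly q X N z \<Longrightarrow>
      \<bar>bform_AC \<epsilon> b b1 c d e e' f f' y y' z z'\<bar> \<le>
        C * (integral {0..2} (\<lambda>t. (e t)\<^sup>2) + integral {0..2} (\<lambda>t. (f t)\<^sup>2))
        + 1/2 * (integral {0..2} (\<lambda>x. (z x)\<^sup>2) + \<beta>\<^sup>2 / 2 * integral {0..2} (\<lambda>x. (y' x)\<^sup>2) + \<delta> * integral {0..2} (\<lambda>x. (y x)\<^sup>2))"
    have C2: "2 * C \<ge> 0" using C(1) by simp
    show thesis
    proof (rule that[OF C2])
      fix \<epsilon> :: real and X N u w uh wh F k
      assume m: "mesh_nodes X N" and uw: "(u, w) \<in> U_space k" and uwh: "(uh, wh) \<in> Uh_space k q X N"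
        and sol: "\<forall>(y, z)\<in>U_space k. bform \<epsilon> b c d (u, w) (y, z) = F y"
        and solh: "\<forall>(y, z)\<in>Uh_space k q X N. bform \<epsilon> b c d (uh, wh) (y, z) = F y"
      define uI where "uI = interp q X N u"
      define wI where "wI = interp q X N w"
      define y where "y t = uI t - uh t" for t
      define z where "z t = wI t - wh t" for t
      have h: "u \<in> H1" "w \<in> H1" "uh \<in> H1" "wh \<in> H1"
        using uw uwh U_space_H1 by (auto simp: Uh_space_def)
      note uc = AC_L2(3)[OF H1_AC[OF h(1)]] and wc = AC_L2(3)[OF H1_AC[OF h(2)]]
      have hI: "uI \<in> H1" "wI \<in> H1" unfolding uI_def wI_def using interp_H1[OF q m] uc wc by blast+
      note A = h[THEN H1_AC] hI[THEN H1_AC]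
      let ?D = "wderiv Dom"
      have yz: "(y, z) \<in> Uh_space k q X N"
        using interp_diff_Uh[OF q m uw uwh] by (simp add: y_def[abs_def] z_def[abs_def] uI_def wI_def)
      have yA: "AC 0 2 y (\<lambda>t. ?D uI t - ?D uh t)" and zA: "AC 0 2 z (\<lambda>t. ?D wI t - ?D wh t)"
        unfolding y_def[abs_def] z_def[abs_def] by (intro AC_diff A)+
      have eA: "AC 0 2 (\<lambda>t. u t - uI t) (\<lambda>t. ?D u t - ?D uI t)" and fA: "AC 0 2 (\<lambda>t. w t - wI t) (\<lambda>t. ?D w t - ?D wI t)"
        by (intro AC_diff A)+
      define y' where "y' t = ?D uI t - ?D uh t" for t
      define z' where "z' t = ?D wI t - ?D wh t" for t
      note yA' = yA[folded y'_def[abs_def]] and zA' = zA[folded z'_def[abs_def]]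
      define Q where "Q = integral {0..2} (\<lambda>x. (z x)\<^sup>2) + \<beta>\<^sup>2 / 2 * integral {0..2} (\<lambda>x. (y' x)\<^sup>2) + \<delta> * integral {0..2} (\<lambda>x. (y x)\<^sup>2)"
      have "Q \<le> bform_AC \<epsilon> b b1 c d y y' z z' y y' z z'"
        unfolding Q_def by (rule bform_AC_coercive[OF cont \<beta>(1) bb Lb Ld cc yA' zA'])
      also have "bform_AC \<epsilon> b b1 c d y y' z z' y y' z z' =
        bform_AC \<epsilon> b b1 c d uI (?D uI) wI (?D wI) y y' z z' - bform_AC \<epsilon> b b1 c d uh (?D uh) wh (?D wh) y y' z z'"
        using bform_AC_diff[OF cont A(5) A(6) A(3) A(4) yA' zA'] by (simp add: y_def[abs_def] z_def[abs_def] y'_def[abs_def] z'_def[abs_def])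
      \<comment> \<open>Galerkin orthogonality: \<open>(y, z)\<close> is admissible in both
        variational problems, so the discrete solution may be exchanged for the exact one.\<close>
      also have "bform_AC \<epsilon> b b1 c d uh (?D uh) wh (?D wh) y y' z z' = bform_AC \<epsilon> b b1 c d u (?D u) w (?D w) y y' z z'"
      proof -
        have "bform \<epsilon> b c d (uh, wh) (y, z) = F y" using solh yz by blast
        moreover have "bform \<epsilon> b c d (u, w) (y, z) = F y" using sol yz by (auto simp: Uh_space_def)
        ultimately show ?thesis
          using bform_eq[OF cont db A(3) A(4) yA' zA'] bform_eq[OF cont db A(1) A(2) yA' zA'] by simp
      qed
      also have "bform_AC \<epsilon> b b1 c d uI (?D uI) wI (?D wI) y y' z z' - bform_AC \<epsilon> b b1 c d u (?D u) w (?D w) y y' z z'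
        = - bform_AC \<epsilon> b b1 c d (\<lambda>t. u t - uI t) (\<lambda>t. ?D u t - ?D uI t) (\<lambda>t. w t - wI t) (\<lambda>t. ?D w t - ?D wI t) y y' z z'"
        using bform_AC_diff[OF cont A(1) A(2) A(5) A(6) yA' zA'] by simp
      also have "\<dots> \<le> C * (integral {0..2} (\<lambda>t. (u t - uI t)\<^sup>2) + integral {0..2} (\<lambda>t. (w t - wI t)\<^sup>2)) + 1/2 * Q"
      proof -
        have "\<bar>bform_AC \<epsilon> b b1 c d (\<lambda>t. u t - uI t) (\<lambda>t. ?D u t - ?D uI t) (\<lambda>t. w t - wI t) (\<lambda>t. ?D w t - ?D wI t) y y' z z'\<bar>
          \<le> C * (integral {0..2} (\<lambda>t. (u t - uI t)\<^sup>2) + integral {0..2} (\<lambda>t. (w t - wI t)\<^sup>2)) + 1/2 * Q"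
          unfolding Q_def
          by (rule C(2)[OF m eA fA yA' zA'])
             (use yz interp_error_node_orth[OF q m uc] interp_error_node_orth[OF q m wc] in \<open>auto simp: uI_def wI_def Uh_space_def\<close>)
        then show ?thesis by linarith
      qed
      \<comment> \<open>Half of \<open>Q\<close> is absorbed on the left, which doubles the
        constant.\<close>
      finally have "Q \<le> 2 * C * (integral {0..2} (\<lambda>t. (u t - uI t)\<^sup>2) + integral {0..2} (\<lambda>t. (w t - wI t)\<^sup>2))" by simp
      moreover have "(energy_norm \<beta> \<delta> (y, z))\<^sup>2 = Q"
        unfolding Q_def by (rule energy_norm_sq(1)[OF yA' AC_L2(2)[OF zA'] \<delta>(1)])
      ultimately show "(energy_norm \<beta> \<delta> (\<lambda>t. interp q X N u t - uh t, \<lambda>t. interp q X N w t - wh t))\<^sup>2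
        \<le> 2 * C * (integral {0..2} (\<lambda>t. (u t - interp q X N u t)\<^sup>2) + integral {0..2} (\<lambda>t. (w t - interp q X N w t)\<^sup>2))"
        by (simp add: y_def[abs_def] z_def[abs_def] uI_def wI_def)
    qed
  qed
qed

section \<open>Local approximation\<close>

lemma lipschitz_on_Icc_of_ae:
  fixes f :: "real \<Rightarrow> real"
  assumes "L-lipschitz_on ({a<..<b} - Z) f" "negligible Z" "a < b" "continuous_on {a..b} f"
  shows "L-lipschitz_on {a..b} f"
  using lipschitz_on_closure[OF assms(1)] assms(4) by (simp add: closure_Ioo_minus_negligible[OF assms(2,3)])

lemma lipschitz_on_bounded_deriv:
  fixes f :: "real \<Rightarrow> real"
  assumes "\<And>x. x \<in> X \<Longrightarrow> (f has_real_derivative f' x) (at x within X)" "convex X"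
    "\<And>x. x \<in> X \<Longrightarrow> \<bar>f' x\<bar> \<le> L" "L \<ge> 0"
  shows "L-lipschitz_on X f"
proof (rule bounded_derivative_imp_lipschitz[of X f "\<lambda>x. (*) (f' x)"])
  show "(f has_derivative (*) (f' x)) (at x within X)" if "x \<in> X" for x
    using assms(1)[OF that] by (simp add: has_field_derivative_def)
  show "onorm ((*) (f' x)) \<le> L" if "x \<in> X" for x
    using assms(3)[OF that] by (simp add: onorm_bound abs_mult mult_right_mono assms(4))
qed (use assms in auto)

text \<open>Lipschitz constants control the derivative of the error without splitting the weak derivative
  of the decomposed function.\<close>

definition approx_sup :: "nat \<Rightarrow> real \<Rightarrow> real \<Rightarrow> (real \<Rightarrow> real) \<Rightarrow> real \<Rightarrow> bool" where
  "approx_sup q a b v B \<longleftrightarrow> (\<exists>p. degree p \<le> q \<and> (\<forall>t\<in>{a<..<b}. \<bar>v t - poly p t\<bar> \<le> B))"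

definition approx_lip :: "nat \<Rightarrow> real \<Rightarrow> real \<Rightarrow> (real \<Rightarrow> real) \<Rightarrow> real \<Rightarrow> bool" where
  "approx_lip q a b v L \<longleftrightarrow> (\<exists>p Z. degree p \<le> q \<and> negligible Z \<and> L-lipschitz_on ({a<..<b} - Z) (\<lambda>t. v t - poly p t))"

lemma approx_sup_add:
  assumes "approx_sup q a b v B" "approx_sup q a b v' B'"
  shows "approx_sup q a b (\<lambda>t. v t + v' t) (B + B')"
proof -
  obtain p p' where "degree p \<le> q" "\<forall>t\<in>{a<..<b}. \<bar>v t - poly p t\<bar> \<le> B" "degree p' \<le> q" "\<forall>t\<in>{a<..<b}. \<bar>v' t - poly p' t\<bar> \<le> B'"
    using assms unfolding approx_sup_def by blast
  then show ?thesis unfolding approx_sup_def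
    by (intro exI[of _ "p + p'"]) (fastforce intro: degree_add_le)
qed

lemma approx_lip_add:
  assumes "approx_lip q a b v L" "approx_lip q a b v' L'"
  shows "approx_lip q a b (\<lambda>t. v t + v' t) (L + L')"
proof -
  obtain p Z p' Z' where *: "degree p \<le> q" "negligible Z" "L-lipschitz_on ({a<..<b} - Z) (\<lambda>t. v t - poly p t)"
    "degree p' \<le> q" "negligible Z'" "L'-lipschitz_on ({a<..<b} - Z') (\<lambda>t. v' t - poly p' t)"
    using assms unfolding approx_lip_def by blast
  have "(L + L')-lipschitz_on ({a<..<b} - (Z \<union> Z')) (\<lambda>t. (v t - poly p t) + (v' t - poly p' t))"
    by (intro lipschitz_on_add lipschitz_on_subset[OF *(3)] lipschitz_on_subset[OF *(6)]) auto
  also have "(\<lambda>t. (v t - poly p t) + (v' t - poly p' t)) = (\<lambda>t. (v t + v' t) - poly (p + p') t)"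
    by (auto simp: algebra_simps)
  finally show ?thesis unfolding approx_lip_def
    using * by (intro exI[of _ "p + p'"] exI[of _ "Z \<union> Z'"]) (auto intro: degree_add_le)
qed

lemma approx_sup_cong: "(\<And>t. t \<in> {a<..<b} \<Longrightarrow> v t = v' t) \<Longrightarrow> approx_sup q a b v B = approx_sup q a b v' B"
  by (simp add: approx_sup_def)

lemma approx_lip_cong:
  assumes "\<And>t. t \<in> {a<..<b} \<Longrightarrow> v t = v' t"
  shows "approx_lip q a b v L = approx_lip q a b v' L"
proof -
  have "L-lipschitz_on ({a<..<b} - Z) (\<lambda>t. v t - poly p t) = L-lipschitz_on ({a<..<b} - Z) (\<lambda>t. v' t - poly p t)" for Z p
    by (rule lipschitz_on_cong) (use assms in auto)
  then show ?thesis by (simp add: approx_lip_def)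
qed

lemma approx_sup_mono: "approx_sup q a b v B \<Longrightarrow> B \<le> B' \<Longrightarrow> approx_sup q a b v B'"
  unfolding approx_sup_def by (meson order_trans)

lemma approx_lip_mono: "approx_lip q a b v L \<Longrightarrow> L \<le> L' \<Longrightarrow> approx_lip q a b v L'"
  unfolding approx_lip_def by (meson lipschitz_on_mono order_refl)

lemma interp_poly_diff_poly:
  assumes "interp_poly q a b v r" "degree p \<le> q" "continuous_on {a..b} v"
  shows "interp_poly q a b (\<lambda>t. v t - poly p t) (r - p)"
  using assms by (auto simp: interp_poly_def intro: degree_diff_le)

text \<open>Interpolation reproduces polynomials of degree at most q, so the error at
  \<open>v\<close> is the error at \<open>v - p\<close>, where stability applies. The bound on the
  open cell extends to the closed one by continuity.\<close>

lemma interp_error_sup: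
  assumes q: "q \<ge> 1"
  obtains C where "C \<ge> 0"
    "\<And>X N v i B t. mesh_nodes X N \<Longrightarrow> continuous_on {0..2} v \<Longrightarrow> i \<in> {1..N} \<Longrightarrow> X (i - 1) < X i \<Longrightarrow>
       approx_sup q (X (i - 1)) (X i) v B \<Longrightarrow> t \<in> {X (i - 1)..X i} \<Longrightarrow> \<bar>v t - interp q X N v t\<bar> \<le> C * B"
proof (rule interp_poly_stable[OF q])
  fix C :: real
  assume C: "C \<ge> 0" "\<And>a b r g M x. a < b \<Longrightarrow> interp_poly q a b g r \<Longrightarrow> continuous_on {a..b} g \<Longrightarrow>
       (\<And>x. x \<in> {a..b} \<Longrightarrow> \<bar>g x\<bar> \<le> M) \<Longrightarrow> x \<in> {a..b} \<Longrightarrow>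
       \<bar>poly r x\<bar> \<le> C * M \<and> (b - a) * \<bar>poly (pderiv r) x\<bar> \<le> C * M"
  have C1: "1 + C \<ge> 0" using C by simp
  show thesis
  proof (rule that[OF C1])
    fix X N v i B t
    assume m: "mesh_nodes X N" and v: "continuous_on {0..2} v" and i: "i \<in> {1..N}" and lt: "X (i - 1) < X i"
      and a: "approx_sup q (X (i - 1)) (X i) v B" and t: "t \<in> {X (i - 1)..X i}"
    note c = mesh_cell[OF m i]
    obtain p where p: "degree p \<le> q" "\<And>t. t \<in> {X (i - 1)<..<X i} \<Longrightarrow> \<bar>v t - poly p t\<bar> \<le> B"
      using a by (auto simp: approx_sup_def)
    obtain r where r: "interp_poly q (X (i - 1)) (X i) v r" "\<And>t. t \<in> {X (i - 1)..X i} \<Longrightarrow> interp q X N v t = poly r t"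
      using interp_cell[OF q m v i] by metis
    have vc: "continuous_on {X (i - 1)..X i} v"
      by (rule continuous_on_subset[OF v]) (use c in auto)
    have gc: "continuous_on {X (i - 1)..X i} (\<lambda>t. v t - poly p t)" by (intro continuous_intros vc)
    have cl: "closure {X (i - 1)<..<X i} = {X (i - 1)..X i}" using lt by simp
    have bd: "\<bar>v t - poly p t\<bar> \<le> B" if "t \<in> {X (i - 1)..X i}" for t
      by (rule continuous_le_on_closure[of "{X (i - 1)<..<X i}" "\<lambda>t. \<bar>v t - poly p t\<bar>"])
         (use that gc p cl in \<open>auto intro!: continuous_intros\<close>)
    have "\<bar>poly (r - p) t\<bar> \<le> C * B"
      using C(2)[OF lt interp_poly_diff_poly[OF r(1) p(1) vc] gc bd t] by simp
    moreover have "v t - interp q X N v t = (v t - poly p t) - poly (r - p) t" using r(2)[OF t] by simp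
    ultimately show "\<bar>v t - interp q X N v t\<bar> \<le> (1 + C) * B"
      using bd[OF t] by (simp add: algebra_simps abs_le_iff)
  qed
qed

text \<open>Stability of the derivative costs the inverse cell width. It is regained by shifting the
  approximating polynomial so that it equals \<open>v\<close> at the left node: a Lipschitz function
  vanishing there is at most \<open>L\<close> times the width.\<close>

lemma interp_error_lip:
  assumes q: "q \<ge> 1"
  obtains C where "C \<ge> 0"
    "\<And>X N v i L. mesh_nodes X N \<Longrightarrow> continuous_on {0..2} v \<Longrightarrow> i \<in> {1..N} \<Longrightarrow> X (i - 1) < X i \<Longrightarrow>
       approx_lip q (X (i - 1)) (X i) v L \<Longrightarrow> (C * L)-lipschitz_on {X (i - 1)..X i} (\<lambda>t. v t - interp q X N v t)"
proof (rule interp_poly_stable[OF q])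
  fix C :: real
  assume C: "C \<ge> 0" "\<And>a b r g M x. a < b \<Longrightarrow> interp_poly q a b g r \<Longrightarrow> continuous_on {a..b} g \<Longrightarrow>
       (\<And>x. x \<in> {a..b} \<Longrightarrow> \<bar>g x\<bar> \<le> M) \<Longrightarrow> x \<in> {a..b} \<Longrightarrow>
       \<bar>poly r x\<bar> \<le> C * M \<and> (b - a) * \<bar>poly (pderiv r) x\<bar> \<le> C * M"
  have C1: "1 + C \<ge> 0" using C by simp
  show thesis
  proof (rule that[OF C1])
    fix X N v i L
    assume m: "mesh_nodes X N" and v: "continuous_on {0..2} v" and i: "i \<in> {1..N}" and lt: "X (i - 1) < X i"
      and a: "approx_lip q (X (i - 1)) (X i) v L"
    define l where "l = X (i - 1)"
    define u where "u = X i"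
    note c = mesh_cell[OF m i, folded l_def u_def]
    have lu: "l < u" using lt by (simp add: l_def u_def)
    obtain p Z where p: "degree p \<le> q" "negligible Z" "L-lipschitz_on ({l<..<u} - Z) (\<lambda>t. v t - poly p t)"
      using a unfolding approx_lip_def l_def u_def by blast
    obtain r where r: "interp_poly q l u v r" "\<And>t. t \<in> {l..u} \<Longrightarrow> interp q X N v t = poly r t"
      using interp_cell[OF q m v i] unfolding l_def u_def by metis
    have vc: "continuous_on {l..u} v"
      by (rule continuous_on_subset[OF v]) (use c in auto)
    have gc: "continuous_on {l..u} (\<lambda>t. v t - poly p t)" by (intro continuous_intros vc)
    have lip: "L-lipschitz_on {l..u} (\<lambda>t. v t - poly p t)"
      by (rule lipschitz_on_Icc_of_ae[OF p(3,2) lu gc])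
    have L: "L \<ge> 0" using lip by (rule lipschitz_on_nonneg)
    define k where "k = v l - poly p l"
    define p0 where "p0 = p + [:k:]"
    have p0: "degree p0 \<le> q" unfolding p0_def using p(1) by (intro degree_add_le) auto
    have bd: "\<bar>v t - poly p0 t\<bar> \<le> L * (u - l)" if t: "t \<in> {l..u}" for t
    proof -
      have "\<bar>(v t - poly p t) - (v l - poly p l)\<bar> \<le> L * \<bar>t - l\<bar>"
        using lipschitz_onD[OF lip t, of l] lu by (simp add: dist_real_def)
      also have "\<dots> \<le> L * (u - l)" using t L by (intro mult_left_mono) auto
      finally show ?thesis by (simp add: p0_def k_def algebra_simps)
    qed
    have gc0: "continuous_on {l..u} (\<lambda>t. v t - poly p0 t)" by (intro continuous_intros vc)
    have d: "\<bar>poly (pderiv (r - p0)) t\<bar> \<le> C * L" if t: "t \<in> {l..u}" for t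
    proof -
      have "(u - l) * \<bar>poly (pderiv (r - p0)) t\<bar> \<le> (u - l) * (C * L)"
        using C(2)[OF lu interp_poly_diff_poly[OF r(1) p0 vc] gc0 bd t] by (simp add: mult_ac)
      then show ?thesis using lu by simp
    qed
    have "(C * L)-lipschitz_on {l..u} (poly (r - p0))"
      by (rule lipschitz_on_bounded_deriv[of _ _ "poly (pderiv (r - p0))"])
         (use d C L in \<open>auto intro!: has_field_derivative_at_within poly_DERIV\<close>)
    from lipschitz_on_diff[OF lip this]
    have "(L + C * L)-lipschitz_on {l..u} (\<lambda>t. (v t - poly p t) - poly (r - p0) t)" .
    then have "(L + C * L)-lipschitz_on {l..u} (\<lambda>t. (v t - interp q X N v t) + k)"
      by (rule lipschitz_on_transform) (simp add: r(2) p0_def)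
    from lipschitz_on_diff[OF this lipschitz_on_constant[of _ k]]
    show "((1 + C) * L)-lipschitz_on {X (i - 1)..X i} (\<lambda>t. v t - interp q X N v t)"
      by (simp add: algebra_simps l_def u_def)
  qed
qed

section \<open>Polynomial approximation of smooth and of weakly differentiable functions\<close>

lemma poly_antiderivative:
  fixes r :: "real poly"
  obtains P where "pderiv P = r" "degree P \<le> Suc (degree r)"
proof -
  define P where "P = (\<Sum>i\<le>degree r. monom (coeff r i / real (Suc i)) (Suc i))"
  have "pderiv P = (\<Sum>i\<le>degree r. monom (coeff r i) i)"
    unfolding P_def pderiv_sum by (intro sum.cong) (simp_all add: pderiv_monom del: of_nat_Suc)
  then have "pderiv P = r" by (simp add: poly_as_sum_of_monoms)
  moreover have "degree P \<le> Suc (degree r)"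
    unfolding P_def by (rule degree_sum_le) (auto intro: order_trans[OF degree_monom_le])
  ultimately show ?thesis by (rule that)
qed

lemma has_derivs_mono: "has_derivs n A v D \<Longrightarrow> B \<subseteq> A \<Longrightarrow> m \<le> n \<Longrightarrow> has_derivs m B v D"
  unfolding has_derivs_def by (meson DERIV_subset order_less_le_trans subsetD)

text \<open>An approximation of the derivative is integrated and its constant adjusted at the
  midpoint; each step gains one power of the width. Every stage yields the Lipschitz bound first and
  the sup bound from it. This scheme, unlike Taylor's formula, carries over to weak derivatives
  almost verbatim.\<close>

lemma taylor_approx:
  assumes "has_derivs (Suc k) {a<..<b} v D" "a < b" "M \<ge> 0" "\<And>x. x \<in> {a<..<b} \<Longrightarrow> \<bar>D (Suc k) x\<bar> \<le> M"
  shows "\<exists>p. degree p \<le> k \<and> (M * (b - a) ^ k)-lipschitz_on {a<..<b} (\<lambda>t. v t - poly p t)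
     \<and> (\<forall>t\<in>{a<..<b}. \<bar>v t - poly p t\<bar> \<le> M * (b - a) ^ Suc k)"
  using assms
proof (induction k arbitrary: v D)
  case 0
  define c where "c = (a + b) / 2"
  have c: "c \<in> {a<..<b}" using 0 by (auto simp: c_def)
  have "M-lipschitz_on {a<..<b} v"
    by (rule lipschitz_on_bounded_deriv[of _ _ "D 1"]) (use 0 in \<open>auto simp: has_derivs_def\<close>)
  then have l: "M-lipschitz_on {a<..<b} (\<lambda>t. v t - v c)"
    using lipschitz_on_diff[OF _ lipschitz_on_constant[of _ "v c"]] by fastforce
  have "\<bar>v t - v c\<bar> \<le> M * (b - a)" if t: "t \<in> {a<..<b}" for t
  proof -
    have "\<bar>v t - v c\<bar> \<le> M * \<bar>t - c\<bar>" using lipschitz_onD[OF l t c] by (simp add: dist_real_def)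
    also have "\<dots> \<le> M * (b - a)" using t c \<open>M \<ge> 0\<close> by (intro mult_left_mono) auto
    finally show ?thesis .
  qed
  then show ?case using l by (intro exI[of _ "[:v c:]"]) auto
next
  case (Suc k)
  define c where "c = (a + b) / 2"
  have c: "c \<in> {a<..<b}" using Suc.prems by (auto simp: c_def)
  have vD: "v = D 0" and dv: "\<And>x. x \<in> {a<..<b} \<Longrightarrow> (v has_real_derivative D 1 x) (at x within {a<..<b})"
    using Suc.prems(1) by (auto simp: has_derivs_def)
  have "has_derivs (Suc k) {a<..<b} (D 1) (\<lambda>j. D (Suc j))"
    using Suc.prems(1) by (auto simp: has_derivs_def)
  from Suc.IH[OF this Suc.prems(2,3)] Suc.prems(4)
  obtain r where r: "degree r \<le> k" "\<And>t. t\<in>{a<..<b} \<Longrightarrow> \<bar>D 1 t - poly r t\<bar> \<le> M * (b - a) ^ Suc k" by auto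
  obtain P where P: "pderiv P = r" "degree P \<le> Suc (degree r)" by (rule poly_antiderivative)
  define p where "p = P + [:v c - poly P c:]"
  have dp: "degree p \<le> Suc k" unfolding p_def using P r(1) by (intro degree_add_le) auto
  have pd: "pderiv p = r" by (simp add: p_def P pderiv_add pderiv_pCons)
  define K where "K = M * (b - a) ^ Suc k"
  have K: "K \<ge> 0" using Suc.prems by (simp add: K_def)
  have lip: "K-lipschitz_on {a<..<b} (\<lambda>t. v t - poly p t)"
  proof (rule lipschitz_on_bounded_deriv[of _ _ "\<lambda>t. D 1 t - poly r t"])
    show "((\<lambda>t. v t - poly p t) has_real_derivative D 1 x - poly r x) (at x within {a<..<b})" if "x \<in> {a<..<b}" for x
      using dv[OF that] has_field_derivative_at_within[OF poly_DERIV[of p x]] pd by (auto intro!: derivative_eq_intros)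
  qed (use r K in \<open>auto simp: K_def\<close>)
  have "\<bar>v t - poly p t\<bar> \<le> K * (b - a)" if t: "t \<in> {a<..<b}" for t
  proof -
    have "v c - poly p c = 0" by (simp add: p_def)
    then have "\<bar>v t - poly p t\<bar> \<le> K * \<bar>t - c\<bar>" using lipschitz_onD[OF lip t c] by (simp add: dist_real_def)
    also have "\<dots> \<le> K * (b - a)" using t c K by (intro mult_left_mono) auto
    finally show ?thesis .
  qed
  then show ?case using lip dp by (intro exI[of _ p]) (auto simp: K_def mult_ac)
qed

text \<open>The integration step for weak derivatives. The constant is adjusted at a point
  \<open>c\<close> outside the exceptional null set, off which increments of \<open>v\<close> are
  integrals of \<open>g\<close>.\<close>

lemma weak_antiderivative_approx:
  assumes w: "has_weak_deriv {a<..<b} v g" and L: "L2on a b v" "L2on a b g" and ab: "a < b"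
    and r: "degree r \<le> k" and Z: "negligible Z" and M: "M \<ge> 0" "\<And>t. t \<in> {a<..<b} - Z \<Longrightarrow> \<bar>g t - poly r t\<bar> \<le> M"
  shows "\<exists>p Z'. degree p \<le> Suc k \<and> negligible Z' \<and> M-lipschitz_on ({a<..<b} - Z') (\<lambda>t. v t - poly p t) \<and>
    (\<forall>t\<in>{a<..<b} - Z'. \<bar>v t - poly p t\<bar> \<le> M * (b - a))"
proof -
  obtain Y where Y: "negligible Y" "\<And>x y. x \<in> {a<..<b} - Y \<Longrightarrow> y \<in> {a<..<b} - Y \<Longrightarrow> x < y \<Longrightarrow> v y - v x = integral {x..y} g"
    using weak_deriv_integral[OF w L2on_absint[OF L(1)] L2on_absint[OF L(2)]] by metis
  obtain P where P: "pderiv P = r" "degree P \<le> Suc (degree r)" by (rule poly_antiderivative)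
  have ne: "{a<..<b} - Y \<noteq> {}"
  proof
    assume e: "{a<..<b} - Y = {}"
    have "a \<in> closure ({a<..<b} - Y)" using dense_Ioo_minus_negligible[OF Y(1) ab] ab by force
    then show False unfolding e by simp
  qed
  then obtain c where c: "c \<in> {a<..<b} - Y" by blast
  define p where "p = P + [:v c - poly P c:]"
  have pd: "pderiv p = r" by (simp add: p_def P pderiv_add pderiv_pCons)
  have key: "\<bar>(v y - poly p y) - (v x - poly p x)\<bar> \<le> M * (y - x)"
    if xy: "x \<in> {a<..<b} - Y" "y \<in> {a<..<b} - Y" "x < y" for x y
  proof -
    have gi: "g integrable_on {x..y}" using L2on_integrable[OF L2on_subinterval[OF L(2)]] xy by auto
    have ri: "poly r integrable_on {x..y}" by (intro integrable_continuous_real continuous_intros)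
    have "poly p y - poly p x = integral {x..y} (poly r)"
      using AC_D[OF AC_poly[of x y p], of x y] xy pd by simp
    then have "(v y - poly p y) - (v x - poly p x) = integral {x..y} (\<lambda>t. g t - poly r t)"
      using Y(2)[OF xy] gi ri by (simp add: integral_diff)
    also have "\<dots> = integral {x..y} (\<lambda>t. if t \<in> Z then 0 else g t - poly r t)"
      by (rule integral_spike[OF Z]) auto
    also have "norm \<dots> \<le> integral {x..y} (\<lambda>_. M)"
    proof (rule integral_norm_bound_integral)
      show "(\<lambda>t. if t \<in> Z then 0 else g t - poly r t) integrable_on {x..y}"
        by (rule integrable_spike[OF integrable_diff[OF gi ri] Z]) auto
      show "norm (if t \<in> Z then 0 else g t - poly r t) \<le> M" if "t \<in> {x..y}" for t
        using M(1) M(2)[of t] that xy by auto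
    qed (rule integrable_const_ivl)
    finally show ?thesis using xy by (simp add: mult.commute)
  qed
  have lip: "M-lipschitz_on ({a<..<b} - Y) (\<lambda>t. v t - poly p t)"
  proof (rule lipschitz_onI)
    fix x y assume "x \<in> {a<..<b} - Y" "y \<in> {a<..<b} - Y"
    then show "dist (v x - poly p x) (v y - poly p y) \<le> M * dist x y"
      using key[of x y] key[of y x] by (cases x y rule: linorder_cases) (auto simp: dist_real_def abs_minus_commute)
  qed (rule M(1))
  show ?thesis
  proof (intro exI[of _ p] exI[of _ Y] conjI ballI Y(1) lip)
    show "degree p \<le> Suc k" unfolding p_def using P r by (intro degree_add_le) auto
    fix t assume t: "t \<in> {a<..<b} - Y"
    have "v c - poly p c = 0" by (simp add: p_def)
    then have "\<bar>v t - poly p t\<bar> \<le> M * \<bar>t - c\<bar>" using lipschitz_onD[OF lip t c] by (simp add: dist_real_def)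
    also have "\<dots> \<le> M * (b - a)" using t c M(1) by (intro mult_left_mono) auto
    finally show "\<bar>v t - poly p t\<bar> \<le> M * (b - a)" .
  qed
qed

text \<open>Cauchy-Schwarz in the first step brings in the L2 norm of the highest derivative over
  this very interval; the remaining steps are sup bounds. One factor is therefore only the root of
  the width; the missing half power returns when the bound is squared and integrated over the
  cell.\<close>

lemma weak_taylor_sup:
  assumes "\<And>j. j \<le> k \<Longrightarrow> has_weak_deriv {a<..<b} (G j) (G (Suc j))" "\<And>j. j \<le> Suc k \<Longrightarrow> L2on a b (G j)" "a < b"
  shows "\<exists>p Z. degree p \<le> k \<and> negligible Z \<and> (\<forall>t\<in>{a<..<b} - Z. \<bar>G 0 t - poly p t\<bar> \<le>
      sqrt (b - a) * sqrt (integral {a..b} (\<lambda>t. (G (Suc k) t)\<^sup>2)) * (b - a) ^ k)"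
  using assms
proof (induction k arbitrary: G)
  case 0
  have w: "has_weak_deriv {a<..<b} (G 0) (G 1)" and L: "L2on a b (G 0)" "L2on a b (G 1)" using 0 by auto
  obtain Y where Y: "negligible Y" "\<And>x y. x \<in> {a<..<b} - Y \<Longrightarrow> y \<in> {a<..<b} - Y \<Longrightarrow> x < y \<Longrightarrow> G 0 y - G 0 x = integral {x..y} (G 1)"
    using weak_deriv_integral[OF w L2on_absint[OF L(1)] L2on_absint[OF L(2)]] by metis
  define T where "T = sqrt (b - a) * sqrt (integral {a..b} (\<lambda>t. (G 1 t)\<^sup>2))"
  have T0: "T \<ge> 0" unfolding T_def using 0 L by (auto intro!: mult_nonneg_nonneg integral_nonneg L2on_square)
  have ne: "{a<..<b} - Y \<noteq> {}"
  proof
    assume e: "{a<..<b} - Y = {}"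
    have "a \<in> closure ({a<..<b} - Y)" using dense_Ioo_minus_negligible[OF Y(1) 0(3)] 0(3) by force
    then show False unfolding e by simp
  qed
  then obtain c where c: "c \<in> {a<..<b} - Y" by blast
  have key: "\<bar>G 0 y - G 0 x\<bar> \<le> T" if xy: "x \<in> {a<..<b} - Y" "y \<in> {a<..<b} - Y" "x < y" for x y
  proof -
    have g: "L2on x y (G 1)" using L2on_subinterval[OF L(2)] xy by auto
    have "(integral {x..y} (\<lambda>t. 1 * G 1 t))\<^sup>2 \<le> integral {x..y} (\<lambda>t. 1\<^sup>2) * integral {x..y} (\<lambda>t. (G 1 t)\<^sup>2)"
      by (rule L2on_Cauchy_Schwarz[OF _ g]) (intro L2on_continuous continuous_intros)
    then have "(G 0 y - G 0 x)\<^sup>2 \<le> (y - x) * integral {x..y} (\<lambda>t. (G 1 t)\<^sup>2)" using Y(2)[OF xy] xy by simp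
    also have "\<dots> \<le> (b - a) * integral {a..b} (\<lambda>t. (G 1 t)\<^sup>2)"
      using xy by (intro mult_mono integral_subset_le integral_nonneg L2on_square L g) auto
    finally have "sqrt ((G 0 y - G 0 x)\<^sup>2) \<le> sqrt ((b - a) * integral {a..b} (\<lambda>t. (G 1 t)\<^sup>2))" by (rule real_sqrt_le_mono)
    then show ?thesis by (simp add: T_def real_sqrt_mult)
  qed
  have "\<bar>G 0 t - G 0 c\<bar> \<le> T" if "t \<in> {a<..<b} - Y" for t
    using key[of t c] key[of c t] that c T0 by (cases t c rule: linorder_cases) (auto simp: abs_minus_commute)
  then show ?case
    using Y(1) by (intro exI[of _ "[:G 0 c:]"] exI[of _ Y]) (auto simp: T_def)
next
  case (Suc k)
  have "\<exists>p Z. degree p \<le> k \<and> negligible Z \<and> (\<forall>t\<in>{a<..<b} - Z. \<bar>G (Suc 0) t - poly p t\<bar> \<le>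
      sqrt (b - a) * sqrt (integral {a..b} (\<lambda>t. (G (Suc (Suc k)) t)\<^sup>2)) * (b - a) ^ k)"
    by (rule Suc.IH[of "\<lambda>j. G (Suc j)"]) (use Suc.prems in auto)
  then obtain r Z where r: "degree r \<le> k" "negligible Z" "\<And>t. t\<in>{a<..<b} - Z \<Longrightarrow> \<bar>G 1 t - poly r t\<bar> \<le>
      sqrt (b - a) * sqrt (integral {a..b} (\<lambda>t. (G (Suc (Suc k)) t)\<^sup>2)) * (b - a) ^ k" by auto
  have M: "0 \<le> sqrt (b - a) * sqrt (integral {a..b} (\<lambda>t. (G (Suc (Suc k)) t)\<^sup>2)) * (b - a) ^ k"
    using Suc.prems by (auto intro!: mult_nonneg_nonneg integral_nonneg L2on_square)
  have w: "has_weak_deriv {a<..<b} (G 0) (G 1)" and L: "L2on a b (G 0)" "L2on a b (G 1)"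
    using Suc.prems(1)[of 0] Suc.prems(2)[of 0] Suc.prems(2)[of 1] by auto
  from weak_antiderivative_approx[OF w L Suc.prems(3) r(1,2) M r(3)]
  obtain p Z' where "degree p \<le> Suc k" "negligible Z'" "\<forall>t \<in> {a<..<b} - Z'. \<bar>G 0 t - poly p t\<bar> \<le>
     sqrt (b - a) * sqrt (integral {a..b} (\<lambda>t. (G (Suc (Suc k)) t)\<^sup>2)) * (b - a) ^ k * (b - a)"
    by blast
  then show ?case by (intro exI[of _ p] exI[of _ Z']) (simp add: mult_ac)
qed

text \<open>A sup bound for the first derivative, integrated once: hence \<open>q - 1\<close> powers
  of the width beside the root.\<close>

lemma weak_taylor_lip:
  assumes w: "\<And>j. j \<le> q \<Longrightarrow> has_weak_deriv {a<..<b} (G j) (G (Suc j))" and L: "\<And>j. j \<le> Suc q \<Longrightarrow> L2on a b (G j)"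
    and "a < b" and q: "q \<ge> 1"
  shows "approx_lip q a b (G 0) (sqrt (b - a) * sqrt (integral {a..b} (\<lambda>t. (G (Suc q) t)\<^sup>2)) * (b - a) ^ (q - 1))"
proof -
  define k where "k = q - 1"
  have qk: "q = Suc k" using q by (simp add: k_def)
  have "\<exists>p Z. degree p \<le> k \<and> negligible Z \<and> (\<forall>t\<in>{a<..<b} - Z. \<bar>G (Suc 0) t - poly p t\<bar> \<le>
      sqrt (b - a) * sqrt (integral {a..b} (\<lambda>t. (G (Suc (Suc k)) t)\<^sup>2)) * (b - a) ^ k)"
    by (rule weak_taylor_sup[of _ _ _ "\<lambda>j. G (Suc j)"]) (use assms in \<open>auto simp: qk\<close>)
  then obtain r Z where r: "degree r \<le> k" "negligible Z" "\<And>t. t\<in>{a<..<b} - Z \<Longrightarrow> \<bar>G 1 t - poly r t\<bar> \<le>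
      sqrt (b - a) * sqrt (integral {a..b} (\<lambda>t. (G (Suc (Suc k)) t)\<^sup>2)) * (b - a) ^ k" by auto
  have M: "0 \<le> sqrt (b - a) * sqrt (integral {a..b} (\<lambda>t. (G (Suc (Suc k)) t)\<^sup>2)) * (b - a) ^ k"
    using assms by (auto intro!: mult_nonneg_nonneg integral_nonneg L2on_square simp: qk)
  have w0: "has_weak_deriv {a<..<b} (G 0) (G 1)" and L0: "L2on a b (G 0)" "L2on a b (G 1)"
    using w[of 0] L[of 0] L[of 1] by auto
  show ?thesis
    using weak_antiderivative_approx[OF w0 L0 assms(3) r(1,2) M r(3)]
    unfolding approx_lip_def qk diff_Suc_1 by blast
qed

section \<open>S-type meshes\<close>

text \<open>The mean value bound across the finitely many points where a piecewise continuously
  differentiable function may lack a derivative.\<close>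

lemma abs_diff_le_deriv_bound_finite:
  fixes f :: "real \<Rightarrow> real"
  assumes S: "finite S" and f: "continuous_on {a..b} f" "a \<le> b"
    and d: "\<And>x. x \<in> {a<..<b} - S \<Longrightarrow> (f has_real_derivative f' x) (at x)"
    and L: "L \<ge> 0" "\<And>x. x \<in> {a<..<b} - S \<Longrightarrow> \<bar>f' x\<bar> \<le> L"
  shows "\<bar>f b - f a\<bar> \<le> L * (b - a)"
proof -
  have "(f' has_integral (f b - f a)) {a..b}"
    by (rule fundamental_theorem_of_calculus_interior_strong[OF S f(2) _ f(1)])
       (use d in \<open>auto simp flip: has_real_derivative_iff_has_vector_derivative\<close>)
  then have "norm (f b - f a) \<le> L * measure lborel (cbox a b)"
    by (intro has_integral_bound_spike_finite[of L "S \<union> {a, b}"]) (use S L in auto)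
  then show ?thesis using f(2) by simp
qed

text \<open>The first two estimates measure one mesh step by \<open>K\<close> and by
  \<open>max_psi_deriv\<close>. That the latter is at least 1 makes 1 / N at most its share of the
  rate; that it is at most \<open>K * N\<close> keeps the rate bounded.\<close>

lemma mesh_function_estimates:
  assumes mf: "mesh_function N \<phi>" and N: "N \<ge> 8" and K: "K \<ge> 0"
    and d: "\<forall>t\<in>{0<..<1/2}. \<phi> field_differentiable at t \<longrightarrow> deriv \<phi> t \<le> K * real N"
  shows "\<And>a b. 0 \<le> a \<Longrightarrow> a \<le> b \<Longrightarrow> b \<le> 1/2 \<Longrightarrow> \<phi> b - \<phi> a \<le> K * real N * (b - a)"
    and "\<And>a b. 0 \<le> a \<Longrightarrow> a \<le> b \<Longrightarrow> b \<le> 1/2 \<Longrightarrow> \<phi> b - \<phi> a \<le> max_psi_deriv \<phi> * (b - a) * exp (\<phi> b)"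
    and "1 \<le> max_psi_deriv \<phi>" and "max_psi_deriv \<phi> \<le> K * real N"
proof -
  define \<psi> where "\<psi> t = exp (- \<phi> t)" for t
  define T where "T = {t \<in> {0<..<1/2}. \<psi> field_differentiable at t}"
  define P where "P = max_psi_deriv \<phi>"
  have P: "P = Sup ((\<lambda>t. \<bar>deriv \<psi> t\<bar>) ` T)"
    by (simp add: P_def max_psi_deriv_def T_def \<psi>_def[abs_def] Let_def)
  have c: "continuous_on {0..1/2} \<phi>" and mono: "mono_on {0..1/2} \<phi>" and e0: "\<phi> 0 = 0" and e1: "\<phi> (1/2) = ln (real N)"
    using mf by (auto simp: mesh_function_def)
  obtain S where S: "finite S" "\<phi> C1_differentiable_on ({0..1/2} - S)"
    using mf by (auto simp: mesh_function_def piecewise_C1_differentiable_on_def)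
  have pos: "0 \<le> \<phi> t" if "t \<in> {0..1/2}" for t using mono_onD[OF mono, of 0 t] that e0 by simp
  have nonneg: "D \<ge> 0" if "(\<phi> has_real_derivative D) (at t)" "t \<in> {0<..<1/2}" for D t
    by (rule mono_on_imp_deriv_nonneg[OF mono that(1)]) (use that in auto)
  have d\<phi>: "\<exists>D. (\<phi> has_real_derivative D) (at t) \<and> 0 \<le> D \<and> D \<le> K * real N" if t: "t \<in> {0<..<1/2} - S" for t
  proof -
    obtain D where D: "(\<phi> has_real_derivative D) (at t)"
      using S(2) t unfolding C1_differentiable_on_def has_real_derivative_iff_has_vector_derivative by force
    then have "\<phi> field_differentiable at t" by (auto simp: field_differentiable_def)
    then show ?thesis using d t D nonneg[OF D] DERIV_imp_deriv[OF D] by auto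
  qed
  have \<psi>d: "(\<psi> has_real_derivative - D * \<psi> t) (at t)" if "(\<phi> has_real_derivative D) (at t)" for D t
    unfolding \<psi>_def using that by (auto intro!: derivative_eq_intros)
  \<comment> \<open>\<open>max_psi_deriv\<close> ranges over the points where \<open>\<psi>\<close>
    is differentiable, while \<open>K\<close> bounds the derivative of \<open>\<phi>\<close>. As
    \<open>\<phi>\<close> is minus the logarithm of \<open>\<psi>\<close>, both are differentiable
    at the same points.\<close>
  have bound: "\<bar>deriv \<psi> t\<bar> \<le> K * real N" if "t \<in> T" for t
  proof -
    have t: "t \<in> {0<..<1/2}" using that by (simp add: T_def)
    have "\<psi> field_differentiable at t" using that by (simp add: T_def)
    then obtain D' where D': "(\<psi> has_real_derivative D') (at t)" unfolding field_differentiable_def by blast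
    have "\<psi> t > 0" by (simp add: \<psi>_def)
    then have "((\<lambda>t. - ln (\<psi> t)) has_real_derivative - (D' / \<psi> t)) (at t)"
      using D' by (auto intro!: derivative_eq_intros)
    moreover have "(\<lambda>t. - ln (\<psi> t)) = \<phi>" by (auto simp: \<psi>_def)
    ultimately have D: "(\<phi> has_real_derivative - (D' / \<psi> t)) (at t)" by simp
    then have "\<phi> field_differentiable at t" by (auto simp: field_differentiable_def)
    then have le: "- (D' / \<psi> t) \<le> K * real N" using d t DERIV_imp_deriv[OF D] by auto
    have ge: "0 \<le> - (D' / \<psi> t)" by (rule nonneg[OF D t])
    have \<psi>1: "0 < \<psi> t" "\<psi> t \<le> 1" using pos[of t] t by (auto simp: \<psi>_def)
    have "\<bar>D'\<bar> = - (D' / \<psi> t) * \<psi> t" using ge \<psi>1 by (auto simp: zero_le_divide_iff divide_le_0_iff field_simps abs_if)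
    also have "\<dots> \<le> - (D' / \<psi> t) * 1" using ge \<psi>1 by (intro mult_left_mono) auto
    finally show ?thesis using le DERIV_imp_deriv[OF D'] by simp
  qed
  have ne: "T \<noteq> {}"
  proof -
    have "infinite {0<..<1/2::real}" by (rule infinite_Ioo) simp
    then have "\<not> {0<..<1/2} \<subseteq> S" using S(1) finite_subset by blast
    then obtain t where t: "t \<in> {0<..<1/2} - S" by blast
    then obtain D where "(\<phi> has_real_derivative D) (at t)" using d\<phi> by blast
    from \<psi>d[OF this] have "t \<in> T" using t by (auto simp: T_def field_differentiable_def)
    then show ?thesis by blast
  qed
  have bdd: "bdd_above ((\<lambda>t. \<bar>deriv \<psi> t\<bar>) ` T)" using bound by (auto simp: bdd_above_def)
  show "max_psi_deriv \<phi> \<le> K * real N"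
    unfolding P_def[symmetric] P by (rule cSUP_least[OF ne bound])
  have leP: "\<bar>D\<bar> \<le> P" if "(\<psi> has_real_derivative D) (at t)" "t \<in> {0<..<1/2}" for D t
  proof -
    have "t \<in> T" using that by (auto simp: T_def field_differentiable_def)
    then have "\<bar>deriv \<psi> t\<bar> \<le> P" unfolding P using bdd by (intro cSUP_upper)
    then show ?thesis using DERIV_imp_deriv[OF that(1)] by simp
  qed
  have P0: "P \<ge> 0"
  proof -
    obtain t where "t \<in> T" using ne by blast
    then have "\<bar>deriv \<psi> t\<bar> \<le> P" unfolding P using bdd by (intro cSUP_upper)
    then show ?thesis by (meson abs_ge_zero order_trans)
  qed
  from d\<phi> obtain D where D: "\<And>t. t \<in> {0<..<1/2} - S \<Longrightarrow> (\<phi> has_real_derivative D t) (at t)"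
    "\<And>t. t \<in> {0<..<1/2} - S \<Longrightarrow> 0 \<le> D t" "\<And>t. t \<in> {0<..<1/2} - S \<Longrightarrow> D t \<le> K * real N" by metis
  show "\<phi> b - \<phi> a \<le> K * real N * (b - a)" if ab: "0 \<le> a" "a \<le> b" "b \<le> 1/2" for a b
  proof -
    have "\<bar>\<phi> b - \<phi> a\<bar> \<le> K * real N * (b - a)"
    proof (rule abs_diff_le_deriv_bound_finite[OF S(1) continuous_on_subset[OF c] ab(2)])
      show "(\<phi> has_real_derivative D x) (at x)" "\<bar>D x\<bar> \<le> K * real N" if "x \<in> {a<..<b} - S" for x
      proof -
        have "x \<in> {0<..<1/2} - S" using that ab by auto
        then show "(\<phi> has_real_derivative D x) (at x)" "\<bar>D x\<bar> \<le> K * real N" using D by auto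
      qed
    qed (use ab K in auto)
    then show ?thesis by linarith
  qed
  have \<psi>lip: "\<psi> a - \<psi> b \<le> P * (b - a)" if ab: "0 \<le> a" "a \<le> b" "b \<le> 1/2" for a b
  proof -
    have "\<bar>\<psi> b - \<psi> a\<bar> \<le> P * (b - a)"
    proof (rule abs_diff_le_deriv_bound_finite[OF S(1) _ ab(2)])
      show "continuous_on {a..b} \<psi>"
        unfolding \<psi>_def[abs_def] by (intro continuous_intros continuous_on_subset[OF c]) (use ab in auto)
      show "(\<psi> has_real_derivative - D x * \<psi> x) (at x)" "\<bar>- D x * \<psi> x\<bar> \<le> P" if "x \<in> {a<..<b} - S" for x
      proof -
        have x: "x \<in> {0<..<1/2} - S" using that ab by auto
        then show 1: "(\<psi> has_real_derivative - D x * \<psi> x) (at x)" using \<psi>d D(1) by blast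
        show "\<bar>- D x * \<psi> x\<bar> \<le> P" by (rule leP[OF 1]) (use x in auto)
      qed
    qed (rule P0)
    then show ?thesis by linarith
  qed
  show "\<phi> b - \<phi> a \<le> max_psi_deriv \<phi> * (b - a) * exp (\<phi> b)" if ab: "0 \<le> a" "a \<le> b" "b \<le> 1/2" for a b
  proof -
    \<comment> \<open>The inequality 1 + t \<le> exp t turns increments of \<open>\<phi>\<close>
      into increments of \<open>\<psi>\<close>, at the price of the factor
      \<open>exp (\<phi> b)\<close>.\<close>
    have "\<phi> b - \<phi> a \<le> exp (\<phi> b - \<phi> a) - 1" using exp_ge_add_one_self[of "\<phi> b - \<phi> a"] by linarith
    also have "\<dots> = (\<psi> a - \<psi> b) * exp (\<phi> b)" by (simp add: \<psi>_def left_diff_distrib flip: exp_add)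
    also have "\<dots> \<le> P * (b - a) * exp (\<phi> b)" using \<psi>lip[OF ab] by (intro mult_right_mono) auto
    finally show ?thesis by (simp add: P_def)
  qed
  have "\<psi> 0 - \<psi> (1/2) \<le> P * (1/2 - 0)" by (rule \<psi>lip) auto
  moreover have "\<psi> 0 = 1" by (simp add: \<psi>_def e0)
  moreover have "\<psi> (1/2) = 1 / real N" using N by (simp add: \<psi>_def e1 exp_minus inverse_eq_divide)
  \<comment> \<open>\<open>\<psi>\<close> drops from 1 to at most 1/8 over an interval of length
    1/2, so its steepest slope is at least 7/4.\<close>
  moreover have "1 / real N \<le> 1/8" using N by (simp add: field_simps)
  ultimately have "7/8 \<le> P / 2" by simp
  then show "1 \<le> max_psi_deriv \<phi>" by (simp add: P_def)
qed

section \<open>Decay of layer terms on graded and on distant cells\<close>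

text \<open>The grading bound has \<open>exp (\<phi> b)\<close> at the far node, while the decay is
  taken at the near node. Across one cell, a parameter step of 4 / N, \<open>\<phi>\<close> grows by
  at most \<open>4 * K\<close>, so the exchange costs \<open>exp (4 * K)\<close>. The remaining
  \<open>exp (k * \<phi> a)\<close> is dominated by the decay since
  \<open>k \<le> \<sigma>\<close>.\<close>

lemma layer_cell_decay:
  assumes est: "\<phi> b - \<phi> a \<le> K * real N * (b - a)" "\<phi> b - \<phi> a \<le> P * (b - a) * exp (\<phi> b)"
    and ab: "b = a + 4 / real N" and pos: "\<phi> a \<ge> 0" "\<phi> a \<le> \<phi> b" "P \<ge> 0" "s \<ge> 0" and N: "N > 0"
    and k: "real k \<le> \<sigma>"
  shows "(s * (\<phi> b - \<phi> a)) ^ k * exp (- (\<sigma> * \<phi> a)) \<le> (4 * s * exp (4 * K) * (P / real N)) ^ k"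
proof -
  have "\<phi> b \<le> 4 * K + \<phi> a" using est(1) N unfolding ab by simp
  then have "exp (\<phi> b) \<le> exp (4 * K) * exp (\<phi> a)" by (simp flip: exp_add)
  then have "P * (b - a) * exp (\<phi> b) \<le> P * (b - a) * (exp (4 * K) * exp (\<phi> a))"
    using pos N by (intro mult_left_mono) (auto simp: ab)
  then have "\<phi> b - \<phi> a \<le> P * (b - a) * (exp (4 * K) * exp (\<phi> a))" using est(2) by linarith
  also have "\<dots> = 4 * exp (4 * K) * (P / real N) * exp (\<phi> a)" by (simp add: ab)
  finally have "s * (\<phi> b - \<phi> a) \<le> s * (4 * exp (4 * K) * (P / real N) * exp (\<phi> a))"
    using pos by (intro mult_left_mono)
  then have "(s * (\<phi> b - \<phi> a)) ^ k \<le> (4 * s * exp (4 * K) * (P / real N) * exp (\<phi> a)) ^ k"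
    using pos by (intro power_mono) (auto simp: mult_ac)
  also have "\<dots> = (4 * s * exp (4 * K) * (P / real N)) ^ k * exp (real k * \<phi> a)"
    by (simp only: power_mult_distrib[of "4 * s * exp (4 * K) * (P / real N)"] exp_of_nat_mult)
  finally have "(s * (\<phi> b - \<phi> a)) ^ k * exp (- (\<sigma> * \<phi> a)) \<le>
     (4 * s * exp (4 * K) * (P / real N)) ^ k * exp (real k * \<phi> a) * exp (- (\<sigma> * \<phi> a))"
    by (intro mult_right_mono) auto
  also have "\<dots> = (4 * s * exp (4 * K) * (P / real N)) ^ k * exp ((real k - \<sigma>) * \<phi> a)"
    by (simp add: algebra_simps flip: exp_add)
  also have "\<dots> \<le> (4 * s * exp (4 * K) * (P / real N)) ^ k * 1"
    using k pos by (intro mult_left_mono) (auto simp: mult_nonpos_nonneg)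
  finally show ?thesis by simp
qed

text \<open>Either the cell of width \<open>h\<close> lies in the region of the layer term with decay factor \<open>\<mu>\<close>, or
  \<open>\<mu>\<close> is already small there.\<close>

definition resolved :: "nat \<Rightarrow> real \<Rightarrow> real \<Rightarrow> real \<Rightarrow> real \<Rightarrow> real \<Rightarrow> bool" where
  "resolved q C \<epsilon> \<theta> h \<mu> \<longleftrightarrow> (\<forall>k\<le>q + 1. h ^ k * \<mu> \<le> (\<epsilon> * C * \<theta>) ^ k) \<or> (\<forall>k\<le>q + 1. \<mu> \<le> \<theta> ^ k)"

text \<open>At a distance of at least the transition parameter the decay factor is at most
  \<open>N\<close> to the power -\<sigma>; powers of 1 / N are at most those of \<open>P / N\<close>
  because \<open>P \<ge> 1\<close>.\<close>

lemma far_resolved: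
  assumes "\<beta> > 0" "\<epsilon> > 0" "\<sigma> \<ge> real q + 1" "N \<ge> 8" "P \<ge> 1" "r \<ge> transition \<sigma> \<beta> \<epsilon> N"
  shows "resolved q C \<epsilon> (P / real N) h (exp (- \<beta> * r / \<epsilon>))"
proof -
  have "exp (- \<beta> * r / \<epsilon>) \<le> (P / real N) ^ k" if k: "k \<le> q + 1" for k
  proof -
    have "\<sigma> * ln (real N) \<le> \<beta> * r / \<epsilon>"
      using assms by (simp add: transition_def field_simps)
    moreover have "real k * ln (real N) \<le> \<sigma> * ln (real N)"
      using assms k by (intro mult_right_mono) auto
    ultimately have "exp (- \<beta> * r / \<epsilon>) \<le> exp (- (real k * ln (real N)))" by simp
    also have "\<dots> = (1 / real N) ^ k"
      using assms by (simp add: exp_minus exp_of_nat_mult power_one_over inverse_eq_divide)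
    also have "\<dots> \<le> (P / real N) ^ k" using assms by (intro power_mono divide_right_mono) auto
    finally show ?thesis .
  qed
  then show ?thesis by (simp add: resolved_def)
qed

text \<open>The mesh on [1, 2] is a shifted copy of that on [0, 1], so one half, with a layer at
  each end, contains all the local work. \<open>C\<close> is the constant of the decay estimate for
  the layer scale \<sigma> \<epsilon> / \<beta>, divided by \<epsilon>.\<close>

lemma half_mesh:
  fixes \<sigma> \<beta> \<epsilon> K :: real and n :: nat
  assumes pars: "\<beta> > 0" "\<epsilon> > 0" "\<sigma> \<ge> real q + 1" "K \<ge> 0" and N: "N = 8 * n" "n > 0"
    and lam: "transition \<sigma> \<beta> \<epsilon> N < 1/4" and mf: "mesh_function N \<phi>"
    and d: "\<forall>t\<in>{0<..<1/2}. \<phi> field_differentiable at t \<longrightarrow> deriv \<phi> t \<le> K * real N"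
  defines "H \<equiv> half_node \<sigma> \<beta> \<epsilon> \<phi> N" and "P \<equiv> max_psi_deriv \<phi>" and "C \<equiv> 4 * \<sigma> / \<beta> * exp (4 * K)"
  shows "H 0 = 0" "H (4 * n) = 1"
    "\<And>j. 1 \<le> j \<Longrightarrow> j \<le> 4 * n \<Longrightarrow> H (j - 1) \<le> H j"
    "\<And>j. n < j \<Longrightarrow> j \<le> 3 * n \<Longrightarrow> H j - H (j - 1) \<le> 4 / real N"
    "\<And>j. 1 \<le> j \<Longrightarrow> j \<le> 4 * n \<Longrightarrow> resolved q C \<epsilon> (P / real N) (H j - H (j - 1)) (exp (- \<beta> * H (j - 1) / \<epsilon>))"
    "\<And>j. 1 \<le> j \<Longrightarrow> j \<le> 4 * n \<Longrightarrow> resolved q C \<epsilon> (P / real N) (H j - H (j - 1)) (exp (- \<beta> * (1 - H j) / \<epsilon>))"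
proof -
  define s where "s = \<sigma> * \<epsilon> / \<beta>"
  define l where "l = transition \<sigma> \<beta> \<epsilon> N"
  have \<sigma>: "\<sigma> > 0" using pars by linarith
  have s: "s > 0" using pars \<sigma> by (simp add: s_def)
  have N8: "N \<ge> 8" using N by simp
  note E = mesh_function_estimates[OF mf N8 pars(4) d, folded P_def]
  have mono: "mono_on {0..1/2} \<phi>" and e0: "\<phi> 0 = 0" and e1: "\<phi> (1/2) = ln (real N)"
    using mf by (auto simp: mesh_function_def)
  have \<phi>le: "\<phi> a \<le> \<phi> b" if "0 \<le> a" "a \<le> b" "b \<le> 1/2" for a b
    by (rule mono_onD[OF mono]) (use that in auto)
  have sl: "s * \<phi> (1/2) = l" by (simp add: s_def l_def transition_def e1)
  have l0: "l \<ge> 0" using s e1 N8 sl by (metis ln_ge_zero mult_nonneg_nonneg less_imp_le of_nat_1 of_nat_le_iff order_trans one_le_numeral)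
  have l14: "l < 1/4" using lam by (simp add: l_def)
  define t where "t j = 4 * real j / real N" for j :: nat
  have tn: "t j = real j / (2 * real n)" for j using N by (simp add: t_def)
  have dv: "N div 8 = n" "3 * N div 8 = 3 * n" using N by simp_all
  have HL: "H j = s * \<phi> (t j)" if "j \<le> n" for j
    using that unfolding H_def half_node_def Let_def dv t_def s_def by simp
  \<comment> \<open>At the shared nodes \<open>n\<close> and \<open>3 * n\<close> the case
    distinction in \<open>half_node\<close> picks one branch. The neighbouring formula gives the
    same value there, so each of the three formulas is available on a closed range of
    indices.\<close>
  have HM: "H j = t j * (1 - 2 * l) + 2 * l - 1/2" if "n \<le> j" "j \<le> 3 * n" for j
  proof (cases "j = n")
    case True
    have t2: "t n = 1/2" using N by (simp add: tn)
    have "H n = l" using HL[of n] sl unfolding t2 by simp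
    then show ?thesis unfolding True t2 by (simp add: algebra_simps)
  next
    case False
    then show ?thesis using that unfolding H_def half_node_def Let_def dv t_def l_def by simp
  qed
  have HR: "H j = 1 - s * \<phi> (2 - t j)" if "3 * n \<le> j" "j \<le> 4 * n" for j
  proof (cases "j = 3 * n")
    case True
    have t3: "t (3 * n) = 3/2" using N by (simp add: tn)
    have "2 - t (3 * n) = 1/2" unfolding t3 by simp
    then have "1 - s * \<phi> (2 - t (3 * n)) = 1 - l" using sl by (simp only:)
    moreover have "H (3 * n) = 1 - l" using HM[of "3 * n"] unfolding t3 by (simp add: field_simps)
    ultimately show ?thesis using True by simp
  next
    case False
    then show ?thesis using that N unfolding H_def half_node_def Let_def dv t_def s_def by simp
  qed
  have tm: "t (j - 1) = t j - 4 / real N" if "j \<ge> 1" for j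
    using that by (simp add: t_def of_nat_diff diff_divide_distrib algebra_simps)
  have t4: "t (4 * n) = 2" using N by (simp add: tn)
  show "H 0 = 0" using HL[of 0] e0 by (simp add: t_def)
  show "H (4 * n) = 1" using HR[of "4 * n"] N e0 by (simp add: t4)
  have tb: "0 \<le> t (j - 1)" "t j \<le> 1/2" if "j \<le> n" for j
    using that N by (auto simp: tn field_simps)
  have tb': "0 \<le> 2 - t j" "2 - t (j - 1) \<le> 1/2" if "3 * n < j" "j \<le> 4 * n" for j
  proof -
    have "real j \<le> 4 * real n" "3 * real n \<le> real (j - 1)" using that by linarith+
    then show "0 \<le> 2 - t j" "2 - t (j - 1) \<le> 1/2" using N unfolding tn by (simp_all add: field_simps)
  qed
  have step: "4 / real N > 0" using N by simp
  have mid: "H j - H (j - 1) = 4 / real N * (1 - 2 * l)" if "n < j" "j \<le> 3 * n" for j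
  proof -
    have "n \<le> j" "n \<le> j - 1" "j - 1 \<le> 3 * n" using that by linarith+
    then have "H j - H (j - 1) = (t j - t (j - 1)) * (1 - 2 * l)"
      using HM[of j] HM[of "j - 1"] that(2) by (simp add: algebra_simps)
    then show ?thesis using tm[of j] that by simp
  qed
  have left: "H j - H (j - 1) = s * (\<phi> (t j) - \<phi> (t (j - 1)))" if "1 \<le> j" "j \<le> n" for j
    using HL[of j] HL[of "j - 1"] that by (simp add: algebra_simps)
  have right: "H j - H (j - 1) = s * (\<phi> (2 - t (j - 1)) - \<phi> (2 - t j))" if "3 * n < j" "j \<le> 4 * n" for j
  proof -
    have "3 * n \<le> j" "3 * n \<le> j - 1" "j - 1 \<le> 4 * n" using that by linarith+
    then show ?thesis using HR[of j] HR[of "j - 1"] that(2) by (simp add: algebra_simps)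
  qed
  show Hm: "H (j - 1) \<le> H j" if j: "1 \<le> j" "j \<le> 4 * n" for j
  proof -
    consider "j \<le> n" | "n < j" "j \<le> 3 * n" | "3 * n < j" by linarith
    then have "0 \<le> H j - H (j - 1)"
    proof cases
      case 1
      have "\<phi> (t (j - 1)) \<le> \<phi> (t j)" using tb[OF 1] tm[OF j(1)] step by (intro \<phi>le) auto
      then show ?thesis using left[OF j(1) 1] s by simp
    next
      case 2
      then show ?thesis using mid[OF 2] l14 by simp
    next
      case 3
      have "\<phi> (2 - t j) \<le> \<phi> (2 - t (j - 1))" using tb'[OF 3 j(2)] tm[OF j(1)] step by (intro \<phi>le) auto
      then show ?thesis using right[OF 3 j(2)] s by simp
    qed
    then show ?thesis by simp
  qed
  show "H j - H (j - 1) \<le> 4 / real N" if "n < j" "j \<le> 3 * n" for j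
  proof -
    have "4 / real N * (1 - 2 * l) \<le> 4 / real N * 1" using l0 by (intro mult_left_mono) auto
    then show ?thesis using mid[OF that] by simp
  qed
  have Hmono: "H i \<le> H j" if "i \<le> j" "j \<le> 4 * n" for i j
    using that
  proof (induction rule: dec_induct)
    case (step k)
    then show ?case using Hm[of "Suc k"] by simp
  qed simp
  have Hn: "H n = l" using HL[of n] sl N by (simp add: tn)
  have H3n: "H (3 * n) = 1 - l"
  proof -
    have t3: "t (3 * n) = 3/2" using N by (simp add: tn)
    show ?thesis using HM[of "3 * n"] unfolding t3 by (simp add: field_simps)
  qed
  \<comment> \<open>One estimate for both ends: near 1 it is applied to the reflected parameters
    \<open>2 - t j\<close> and \<open>2 - t (j - 1)\<close>, whose order is reversed.\<close>
  have main: "resolved q C \<epsilon> (P / real N) (s * (\<phi> b - \<phi> a)) (exp (- \<beta> * (s * \<phi> a) / \<epsilon>))"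
    if ab: "b = a + 4 / real N" "0 \<le> a" "b \<le> 1/2" for a b
  proof -
    have le: "a \<le> b" using ab step by simp
    have "(s * (\<phi> b - \<phi> a)) ^ k * exp (- \<beta> * (s * \<phi> a) / \<epsilon>) \<le> (\<epsilon> * C * (P / real N)) ^ k" if k: "k \<le> q + 1" for k
    proof -
      have "(s * (\<phi> b - \<phi> a)) ^ k * exp (- (\<sigma> * \<phi> a)) \<le> (4 * s * exp (4 * K) * (P / real N)) ^ k"
      proof (rule layer_cell_decay[OF E(1)[OF ab(2) le ab(3)] E(2)[OF ab(2) le ab(3)] ab(1)])
        show "0 \<le> \<phi> a" using \<phi>le[of 0 a] ab le e0 by simp
        show "\<phi> a \<le> \<phi> b" using ab le by (intro \<phi>le)
        show "0 \<le> P" using E(3) by simp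
        show "real k \<le> \<sigma>" using k pars(3) by linarith
      qed (use s N in auto)
      moreover have "- \<beta> * (s * \<phi> a) / \<epsilon> = - (\<sigma> * \<phi> a)" using pars by (simp add: s_def)
      moreover have "4 * s * exp (4 * K) = \<epsilon> * C" by (simp add: s_def C_def)
      ultimately show ?thesis by simp
    qed
    then show ?thesis by (simp add: resolved_def)
  qed
  note far = far_resolved[OF pars(1-3) N8 E(3), folded l_def]
  show "resolved q C \<epsilon> (P / real N) (H j - H (j - 1)) (exp (- \<beta> * H (j - 1) / \<epsilon>))" if j: "1 \<le> j" "j \<le> 4 * n" for j
  proof (cases "j \<le> n")
    case True
    then have "H (j - 1) = s * \<phi> (t (j - 1))" by (intro HL) auto
    then show ?thesis using main[of "t j" "t (j - 1)"] tb[OF True] tm[OF j(1)] left[OF j(1) True] by simp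
  next
    case False
    then have "l \<le> H (j - 1)" using Hmono[of n "j - 1"] Hn j by simp
    then show ?thesis by (rule far)
  qed
  show "resolved q C \<epsilon> (P / real N) (H j - H (j - 1)) (exp (- \<beta> * (1 - H j) / \<epsilon>))" if j: "1 \<le> j" "j \<le> 4 * n" for j
  proof (cases "3 * n < j")
    case True
    then have "1 - H j = s * \<phi> (2 - t j)" using HR[of j] j by simp
    then show ?thesis using main[of "2 - t (j - 1)" "2 - t j"] tb'[OF True j(2)] tm[OF j(1)] right[OF True j(2)] by simp
  next
    case False
    then have "l \<le> 1 - H j" using Hmono[of j "3 * n"] H3n by simp
    then show ?thesis by (rule far)
  qed
qed

text \<open>A layer at one end of the domain is at distance at least 1 from every cell of the other
  half, more than the transition parameter, so the far estimate applies there. For the interior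
  layers only the side of 1 on which the cell lies matters, as each of these terms is cut off at
  1.\<close>

lemma full_mesh:
  fixes \<sigma> \<beta> \<epsilon> K :: real
  assumes pars: "\<beta> > 0" "\<epsilon> > 0" "\<sigma> \<ge> real q + 1" "K \<ge> 0" and N: "8 dvd N" "N > 0"
    and lam: "transition \<sigma> \<beta> \<epsilon> N < 1/4" and mf: "mesh_function N \<phi>"
    and d: "\<forall>t\<in>{0<..<1/2}. \<phi> field_differentiable at t \<longrightarrow> deriv \<phi> t \<le> K * real N"
  defines "X \<equiv> node \<sigma> \<beta> \<epsilon> \<phi> N" and "P \<equiv> max_psi_deriv \<phi>" and "C \<equiv> 4 * \<sigma> / \<beta> * exp (4 * K)"
  shows "mesh_nodes X N"
    "\<And>i. i \<in> {1..N} \<Longrightarrow> X i - X (i - 1) \<le> 4 * (layer_width X N + P / real N)"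
    "0 \<le> P / real N" "P / real N \<le> layer_width X N + P / real N" "layer_width X N + P / real N \<le> 2 + K"
    "\<And>i. i \<in> {1..N} \<Longrightarrow> resolved q C \<epsilon> (P / real N) (X i - X (i - 1)) (exp (- \<beta> * X (i - 1) / \<epsilon>))"
    "\<And>i. i \<in> {1..N} \<Longrightarrow> resolved q C \<epsilon> (P / real N) (X i - X (i - 1)) (exp (- \<beta> * (2 - X i) / \<epsilon>))"
    "\<And>i. i \<in> {1..N} \<Longrightarrow> X i \<le> 1 \<and> resolved q C \<epsilon> (P / real N) (X i - X (i - 1)) (exp (- \<beta> * (1 - X i) / \<epsilon>))
       \<or> 1 \<le> X (i - 1) \<and> resolved q C \<epsilon> (P / real N) (X i - X (i - 1)) (exp (- \<beta> * (X (i - 1) - 1) / \<epsilon>))"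
proof -
  obtain n where n: "N = 8 * n" using N by (auto simp: dvd_def)
  have n0: "n > 0" using N n by simp
  have N8: "N \<ge> 8" using n n0 by simp
  define H where "H = half_node \<sigma> \<beta> \<epsilon> \<phi> N"
  note A = half_mesh[OF pars n n0 lam mf d, folded H_def P_def C_def]
  note E = mesh_function_estimates[OF mf N8 pars(4) d, folded P_def]
  have d2: "N div 2 = 4 * n" using n by simp
  have X1: "X i = H i" if "i \<le> 4 * n" for i using that by (simp add: X_def node_def d2 H_def)
  have X2: "X i = 1 + H (i - 4 * n)" if "i \<ge> 4 * n" for i
    using that A(1,2) by (cases "i = 4 * n") (auto simp: X_def node_def d2 H_def)
  have half: "(i \<le> 4 * n \<and> X i = H i \<and> X (i - 1) = H (i - 1)) \<or>
     (\<exists>j. i = 4 * n + j \<and> 1 \<le> j \<and> j \<le> 4 * n \<and> X i = 1 + H j \<and> X (i - 1) = 1 + H (j - 1))" if i: "i \<in> {1..N}" for i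
  proof (cases "i \<le> 4 * n")
    case True
    then show ?thesis using X1[of i] X1[of "i - 1"] by simp
  next
    case False
    then show ?thesis using X2[of i] X2[of "i - 1"] i n
      by (intro disjI2 exI[of _ "i - 4 * n"]) (auto simp: diff_commute)
  qed
  show m: "mesh_nodes X N"
    unfolding mesh_nodes_def
  proof (intro conjI ballI)
    show "X 0 = 0" using X1[of 0] A(1) by simp
    show "X N = 2" using X2[of N] A(2) n by simp
    fix i assume i: "i \<in> {1..N}"
    from half[OF i] show "X (i - 1) \<le> X i" using A(3) i by auto
  qed
  have dv: "N div 8 = n" "3 * N div 8 = 3 * n" "5 * N div 8 = 5 * n" "7 * N div 8 = 7 * n" using n by simp_all
  have lc: "layer_cells N = {1..n} \<union> {3 * n + 1..5 * n} \<union> {7 * n + 1..N}"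
    unfolding layer_cells_def dv ..
  have fin: "finite ((\<lambda>i. X i - X (i - 1)) ` layer_cells N)" by (simp add: lc)
  have lw: "X i - X (i - 1) \<le> layer_width X N" if "i \<in> layer_cells N" for i
    unfolding layer_width_def using fin that by (intro Max_ge) auto
  have one: "1 \<in> layer_cells N" using n0 by (auto simp: lc)
  have lw0: "0 \<le> layer_width X N" using lw[OF one] mesh_cell[OF m, of 1] N8 by force
  have lw2: "layer_width X N \<le> 2"
    unfolding layer_width_def
  proof (rule Max.boundedI[OF fin])
    show "(\<lambda>i. X i - X (i - 1)) ` layer_cells N \<noteq> {}" using one by blast
    fix h assume "h \<in> (\<lambda>i. X i - X (i - 1)) ` layer_cells N"
    then obtain i where "i \<in> layer_cells N" "h = X i - X (i - 1)" by blast
    moreover from this have "i \<in> {1..N}" unfolding lc using n by auto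
    ultimately show "h \<le> 2" using mesh_cell[OF m, of i] by auto
  qed
  show P0: "0 \<le> P / real N" using E(3) by simp
  show "P / real N \<le> layer_width X N + P / real N" using lw0 by simp
  have "P / real N \<le> K" using E(4) N by (simp add: pos_divide_le_eq)
  then show "layer_width X N + P / real N \<le> 2 + K" using lw2 by simp
  show "X i - X (i - 1) \<le> 4 * (layer_width X N + P / real N)" if i: "i \<in> {1..N}" for i
  proof (cases "i \<in> layer_cells N")
    case True
    then show ?thesis using lw[OF True] lw0 P0 unfolding distrib_left by linarith
  next
    case False
    have "X i - X (i - 1) \<le> 4 / real N"
    proof (cases "i \<le> 4 * n")
      case True
      then have "n < i" "i \<le> 3 * n" using False[unfolded lc] i n by auto
      then show ?thesis using A(4)[of i] half[OF i] True by auto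
    next
      case F: False
      then obtain j where j: "i = 4 * n + j" "1 \<le> j" "j \<le> 4 * n" "X i = 1 + H j" "X (i - 1) = 1 + H (j - 1)"
        using half[OF i] by blast
      then have "n < j" "j \<le> 3 * n" using False[unfolded lc] i n by auto
      then show ?thesis using A(4)[of j] j by simp
    qed
    \<comment> \<open>The uniform cells are not measured by \<open>layer_width\<close>; they are
      covered because \<open>P \<ge> 1\<close>.\<close>
    also have "\<dots> \<le> 4 * (P / real N)" using E(3) by (simp add: divide_right_mono)
    finally show ?thesis using lw0 by simp
  qed
  have H01: "0 \<le> H j" "H j \<le> 1" if "j \<le> 4 * n" for j
    using mesh_nodes_mono[OF m, of 0 j] mesh_nodes_mono[OF m, of j "4 * n"] X1[of j] X1[of 0] X1[of "4 * n"] that n A(1,2) by auto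
  have lam1: "transition \<sigma> \<beta> \<epsilon> N \<le> r" if "1 \<le> r" for r using lam that by linarith
  have far: "resolved q C \<epsilon> (P / real N) h (exp (- \<beta> * r / \<epsilon>))" if "1 \<le> r" for h r
    by (rule far_resolved[OF pars(1-3) N8 E(3) lam1[OF that]])
  show "resolved q C \<epsilon> (P / real N) (X i - X (i - 1)) (exp (- \<beta> * X (i - 1) / \<epsilon>))" if i: "i \<in> {1..N}" for i
    using half[OF i]
  proof (elim disjE exE conjE)
    assume "i \<le> 4 * n" "X i = H i" "X (i - 1) = H (i - 1)"
    then show ?thesis using A(5)[of i] i by simp
  next
    fix j assume "X (i - 1) = 1 + H (j - 1)" "j \<le> 4 * n"
    then have "1 \<le> X (i - 1)" using H01[of "j - 1"] by simp
    then show ?thesis by (rule far)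
  qed
  show "resolved q C \<epsilon> (P / real N) (X i - X (i - 1)) (exp (- \<beta> * (2 - X i) / \<epsilon>))" if i: "i \<in> {1..N}" for i
    using half[OF i]
  proof (elim disjE exE conjE)
    assume "i \<le> 4 * n" "X i = H i" "X (i - 1) = H (i - 1)"
    then have "1 \<le> 2 - X i" using H01[of i] by simp
    then show ?thesis by (rule far)
  next
    fix j assume "X i = 1 + H j" "X (i - 1) = 1 + H (j - 1)" "1 \<le> j" "j \<le> 4 * n"
    then show ?thesis using A(6)[of j] by simp
  qed
  show "X i \<le> 1 \<and> resolved q C \<epsilon> (P / real N) (X i - X (i - 1)) (exp (- \<beta> * (1 - X i) / \<epsilon>))
       \<or> 1 \<le> X (i - 1) \<and> resolved q C \<epsilon> (P / real N) (X i - X (i - 1)) (exp (- \<beta> * (X (i - 1) - 1) / \<epsilon>))" if i: "i \<in> {1..N}" for i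
    using half[OF i]
  proof (elim disjE exE conjE)
    assume "i \<le> 4 * n" "X i = H i" "X (i - 1) = H (i - 1)"
    then show ?thesis using A(6)[of i] H01[of i] i by simp
  next
    fix j assume "X i = 1 + H j" "X (i - 1) = 1 + H (j - 1)" "1 \<le> j" "j \<le> 4 * n"
    then show ?thesis using A(5)[of j] H01[of "j - 1"] by simp
  qed
qed

section \<open>The solution decomposition\<close>

text \<open>Each iterate of \<open>wderiv\<close> is known only up to a null set when the next weak
  derivative is taken.\<close>

lemma has_weak_deriv_cong_ae:
  assumes w: "has_weak_deriv {a<..<b} v g" and L: "L2on a b v"
    and Z: "negligible Z" "\<And>x. x \<in> {a<..<b} - Z \<Longrightarrow> v' x = v x"
  shows "has_weak_deriv {a<..<b} v' g"
proof -
  have L': "L2on a b v'" by (rule L2on_spike[OF L Z])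
  have "L2_inner {a<..<b} v' (deriv \<eta>) = L2_inner {a<..<b} v (deriv \<eta>)" if t: "\<eta> \<in> test_functions {a<..<b}" for \<eta>
  proof -
    obtain D where D: "\<And>x. (\<eta> has_real_derivative D x) (at x)" "continuous_on UNIV D"
      using t unfolding test_functions_def C1_differentiable_on_def
      by (auto simp: has_real_derivative_iff_has_vector_derivative)
    have eq: "deriv \<eta> = D" using D(1) DERIV_imp_deriv by blast
    have c: "L2on a b D" using D(2) continuous_on_subset by (blast intro: L2on_continuous)
    have "integral {a..b} (\<lambda>x. v' x * D x) = integral {a..b} (\<lambda>x. v x * D x)"
      by (rule integral_spike[of "Z \<union> {a, b}"]) (use Z in auto)
    then show ?thesis unfolding eq
      by (simp add: L2_inner_eq_integral L2on_mult L L' c)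
  qed
  then show ?thesis using w loc_integrable_L2on[OF L'] by (simp add: has_weak_deriv_def)
qed

text \<open>\<open>Sobolev\<close> supplies some chain of derivatives, while the decomposition
  measures the iterates of \<open>wderiv\<close>. Uniqueness of weak derivatives shows by induction
  that both chains agree off null sets.\<close>

lemma Sobolev_iterated:
  assumes "S \<in> Sobolev n {a<..<b}"
  shows "\<And>j. j \<le> n \<Longrightarrow> L2on a b ((wderiv {a<..<b} ^^ j) S)"
    "\<And>j. j < n \<Longrightarrow> has_weak_deriv {a<..<b} ((wderiv {a<..<b} ^^ j) S) ((wderiv {a<..<b} ^^ Suc j) S)"
proof -
  define G where "G j = (wderiv {a<..<b} ^^ j) S" for j
  obtain g where g: "g 0 = S" "\<And>j. j \<le> n \<Longrightarrow> L2on a b (g j)" "\<And>j. j < n \<Longrightarrow> has_weak_deriv {a<..<b} (g j) (g (Suc j))"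
    using assms unfolding Sobolev_def L2_space_iff by blast
  have step: "has_weak_deriv {a<..<b} (G j) (G (Suc j)) \<and> has_weak_deriv {a<..<b} (G j) (g (Suc j))"
    if "j < n" "negligible Z" "\<And>x. x \<in> {a<..<b} - Z \<Longrightarrow> G j x = g j x" for j Z
  proof -
    have w: "has_weak_deriv {a<..<b} (G j) (g (Suc j))"
      by (rule has_weak_deriv_cong_ae[OF g(3)[OF that(1)] g(2) that(2,3)]) (use that in auto)
    have "G (Suc j) = wderiv {a<..<b} (G j)" by (simp add: G_def)
    then show ?thesis using w someI[of "\<lambda>g. has_weak_deriv {a<..<b} (G j) g", OF w] by (simp add: wderiv_def)
  qed
  have ae: "\<exists>Z. negligible Z \<and> (\<forall>x \<in> {a<..<b} - Z. G j x = g j x)" if "j \<le> n" for j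
    using that
  proof (induction j)
    case 0
    show ?case by (intro exI[of _ "{}"]) (simp add: G_def g)
  next
    case (Suc j)
    then obtain Z where "negligible Z" "\<And>x. x \<in> {a<..<b} - Z \<Longrightarrow> G j x = g j x" by auto
    from step[OF _ this] Suc.prems weak_deriv_unique[of a b "G j" "G (Suc j)" "g (Suc j)"] show ?case
      by (metis Suc_le_lessD)
  qed
  show "L2on a b ((wderiv {a<..<b} ^^ j) S)" if "j \<le> n" for j
    using ae[OF that] L2on_spike[OF g(2)[OF that]] unfolding G_def by blast
  show "has_weak_deriv {a<..<b} ((wderiv {a<..<b} ^^ j) S) ((wderiv {a<..<b} ^^ Suc j) S)" if "j < n" for j
    using ae[of j] step[of j] that unfolding G_def by (meson less_imp_le)
qed

lemma L2on_combine:
  assumes "L2on a c f" "L2on c b f" "a \<le> c" "c \<le> b"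
  shows "L2on a b f"
proof -
  have "f absolutely_integrable_on {a..c} \<union> {c..b}"
    using L2on_absint[OF assms(1)] L2on_absint[OF assms(2)] by (intro absolutely_integrable_Un) auto
  also have "{a..c} \<union> {c..b} = {a..b}" using assms by auto
  finally have "f \<in> borel_measurable (lebesgue_on {a..b})"
    using absolutely_integrable_measurable_real[of "{a..b}" f] by simp
  moreover have "(\<lambda>x. (f x)\<^sup>2) integrable_on {a..b}"
    by (rule Henstock_Kurzweil_Integration.integrable_combine[OF assms(3,4) L2on_square[OF assms(1)] L2on_square[OF assms(2)]])
  ultimately show ?thesis by (simp add: L2on_def)
qed

section \<open>Approximation of the layer and smooth parts on one cell\<close>

lemma powi_shift: "\<epsilon> > 0 \<Longrightarrow> \<epsilon> powi (int k - int j) * \<epsilon> ^ j = (\<epsilon>::real) ^ k"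
  by (simp add: power_int_diff)

text \<open>In the first case of \<open>resolved\<close>, the derivative of order q + 1 brings
  \<open>\<epsilon>\<close> to the power m - 1 - q, and q cell widths against the decay give back q
  of these powers together with the q-th power of \<open>\<theta>\<close>. In the second, the first
  derivative alone is small and a constant serves as approximation. With \<open>m \<ge> 1\<close> no
  negative power of \<open>\<epsilon>\<close> remains.\<close>

lemma layer_approx_lip:
  assumes d: "derivs_bounded (q + 1) A v (\<lambda>k x. K * \<epsilon> powi (int m - int k) * E x)"
    and ab: "{a<..<b} \<subseteq> A" "a < b" and E: "\<And>x. x \<in> {a<..<b} \<Longrightarrow> E x \<le> \<mu>" "\<mu> \<ge> 0"
    and p: "\<epsilon> > 0" "K \<ge> 0" "C \<ge> 0" "\<theta> \<ge> 0" and m: "m \<ge> 1" and r: "resolved q C \<epsilon> \<theta> (b - a) \<mu>"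
  shows "approx_lip q a b v (K * \<epsilon> ^ (m - 1) * (1 + C) ^ (q + 1) * \<theta> ^ q)"
proof -
  obtain D where D: "has_derivs (q + 1) A v D" "\<And>k x. k \<le> q + 1 \<Longrightarrow> x \<in> A \<Longrightarrow> \<bar>D k x\<bar> \<le> K * \<epsilon> powi (int m - int k) * E x"
    using d by (auto simp: derivs_bounded_def)
  have bd: "\<bar>D k x\<bar> \<le> K * \<epsilon> powi (int m - int k) * \<mu>" if "k \<le> q + 1" "x \<in> {a<..<b}" for k x
  proof -
    have "\<bar>D k x\<bar> \<le> K * \<epsilon> powi (int m - int k) * E x" using D(2) that ab by blast
    also have "\<dots> \<le> K * \<epsilon> powi (int m - int k) * \<mu>" using E(1)[OF that(2)] p by (intro mult_left_mono) auto
    finally show ?thesis .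
  qed
  have nn: "K * \<epsilon> powi j * \<mu> \<ge> 0" for j using p E(2) by simp
  have C1: "C ^ q \<le> (1 + C) ^ (q + 1)" "1 \<le> (1 + C) ^ (q + 1)"
  proof -
    have "C ^ q \<le> (1 + C) ^ q" using p by (intro power_mono) auto
    also have "\<dots> \<le> (1 + C) ^ (q + 1)" using p by (intro power_increasing) auto
    finally show "C ^ q \<le> (1 + C) ^ (q + 1)" .
    show "1 \<le> (1 + C) ^ (q + 1)" using p by (intro one_le_power) auto
  qed
  have m1: "int (m - 1) = int m - 1" using m by simp
  from r show ?thesis
    unfolding resolved_def
  proof
    assume "\<forall>k\<le>q + 1. (b - a) ^ k * \<mu> \<le> (\<epsilon> * C * \<theta>) ^ k"
    then have h: "(b - a) ^ q * \<mu> \<le> (\<epsilon> * C * \<theta>) ^ q" by auto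
    have "has_derivs (Suc q) {a<..<b} v D" using has_derivs_mono[OF D(1) ab(1)] by simp
    moreover have "\<bar>D (Suc q) x\<bar> \<le> K * \<epsilon> powi (int m - int (q + 1)) * \<mu>" if "x \<in> {a<..<b}" for x
      using bd[of "Suc q", OF _ that] by simp
    ultimately obtain P where P: "degree P \<le> q" "(K * \<epsilon> powi (int m - int (q + 1)) * \<mu> * (b - a) ^ q)-lipschitz_on {a<..<b} (\<lambda>t. v t - poly P t)"
      using taylor_approx[OF _ ab(2) nn] by blast
    have "K * \<epsilon> powi (int m - int (q + 1)) * \<mu> * (b - a) ^ q = K * \<epsilon> powi (int m - int (q + 1)) * ((b - a) ^ q * \<mu>)" by simp
    also have "\<dots> \<le> K * \<epsilon> powi (int m - int (q + 1)) * (\<epsilon> * C * \<theta>) ^ q" using h p by (intro mult_left_mono) auto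
    also have "\<dots> = K * (\<epsilon> powi (int (m - 1) - int q) * \<epsilon> ^ q) * C ^ q * \<theta> ^ q" using m1 by (simp add: power_mult_distrib diff_diff_eq)
    also have "\<dots> = K * \<epsilon> ^ (m - 1) * C ^ q * \<theta> ^ q" unfolding powi_shift[OF p(1)] ..
    also have "\<dots> \<le> K * \<epsilon> ^ (m - 1) * (1 + C) ^ (q + 1) * \<theta> ^ q"
      using p C1 by (intro mult_right_mono mult_left_mono) auto
    finally have le: "K * \<epsilon> powi (int m - int (q + 1)) * \<mu> * (b - a) ^ q \<le> K * \<epsilon> ^ (m - 1) * (1 + C) ^ (q + 1) * \<theta> ^ q" .
    show ?thesis unfolding approx_lip_def
      by (intro exI[of _ P] exI[of _ "{}"]) (use P le in \<open>auto intro: lipschitz_on_mono\<close>)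
  next
    assume "\<forall>k\<le>q + 1. \<mu> \<le> \<theta> ^ k"
    then have h: "\<mu> \<le> \<theta> ^ q" by auto
    have "has_derivs (Suc 0) {a<..<b} v D" using has_derivs_mono[OF D(1) ab(1)] by simp
    moreover have "\<bar>D (Suc 0) x\<bar> \<le> K * \<epsilon> powi (int m - int 1) * \<mu>" if "x \<in> {a<..<b}" for x
      using bd[of "Suc 0", OF _ that] by simp
    ultimately obtain P where "degree P \<le> 0" "(K * \<epsilon> powi (int m - int 1) * \<mu> * (b - a) ^ 0)-lipschitz_on {a<..<b} (\<lambda>t. v t - poly P t)"
      using taylor_approx[OF _ ab(2) nn] by blast
    then have P: "degree P \<le> 0" "(K * \<epsilon> powi (int m - int 1) * \<mu>)-lipschitz_on {a<..<b} (\<lambda>t. v t - poly P t)" by simp_all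
    have "K * \<epsilon> powi (int m - int 1) * \<mu> = K * \<epsilon> ^ (m - 1) * 1 * \<mu>" using m1 by (simp flip: power_int_of_nat)
    also have "\<dots> \<le> K * \<epsilon> ^ (m - 1) * (1 + C) ^ (q + 1) * \<theta> ^ q"
      using p C1 h E(2) by (intro mult_mono mult_nonneg_nonneg) auto
    finally have le: "K * \<epsilon> powi (int m - int 1) * \<mu> \<le> K * \<epsilon> ^ (m - 1) * (1 + C) ^ (q + 1) * \<theta> ^ q" .
    show ?thesis unfolding approx_lip_def
      by (intro exI[of _ P] exI[of _ "{}"]) (use P le in \<open>auto intro: lipschitz_on_mono\<close>)
  qed
qed

text \<open>The same balance with q + 1 cell widths; in the second case the zero polynomial
  suffices. No derivative costs a power of \<open>\<epsilon>\<close>, so \<open>m = 0\<close> is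
  allowed, as it occurs for the end layers of \<open>w\<close>.\<close>

lemma layer_approx_sup:
  assumes d: "derivs_bounded (q + 1) A v (\<lambda>k x. K * \<epsilon> powi (int m - int k) * E x)"
    and ab: "{a<..<b} \<subseteq> A" "a < b" and E: "\<And>x. x \<in> {a<..<b} \<Longrightarrow> E x \<le> \<mu>" "\<mu> \<ge> 0"
    and p: "\<epsilon> > 0" "K \<ge> 0" "C \<ge> 0" "\<theta> \<ge> 0" and r: "resolved q C \<epsilon> \<theta> (b - a) \<mu>"
  shows "approx_sup q a b v (K * \<epsilon> ^ m * (1 + C) ^ (q + 1) * \<theta> ^ (q + 1))"
proof -
  obtain D where D: "has_derivs (q + 1) A v D" "\<And>k x. k \<le> q + 1 \<Longrightarrow> x \<in> A \<Longrightarrow> \<bar>D k x\<bar> \<le> K * \<epsilon> powi (int m - int k) * E x"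
    using d by (auto simp: derivs_bounded_def)
  have bd: "\<bar>D k x\<bar> \<le> K * \<epsilon> powi (int m - int k) * \<mu>" if "k \<le> q + 1" "x \<in> {a<..<b}" for k x
  proof -
    have "\<bar>D k x\<bar> \<le> K * \<epsilon> powi (int m - int k) * E x" using D(2) that ab by blast
    also have "\<dots> \<le> K * \<epsilon> powi (int m - int k) * \<mu>" using E(1)[OF that(2)] p by (intro mult_left_mono) auto
    finally show ?thesis .
  qed
  have nn: "K * \<epsilon> powi j * \<mu> \<ge> 0" for j using p E(2) by simp
  have C1: "C ^ (q + 1) \<le> (1 + C) ^ (q + 1)" "1 \<le> (1 + C) ^ (q + 1)"
    using p by (intro power_mono one_le_power; simp)+
  from r show ?thesis
    unfolding resolved_def
  proof
    assume "\<forall>k\<le>q + 1. (b - a) ^ k * \<mu> \<le> (\<epsilon> * C * \<theta>) ^ k"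
    then have h: "(b - a) ^ (q + 1) * \<mu> \<le> (\<epsilon> * C * \<theta>) ^ (q + 1)" by blast
    have "has_derivs (Suc q) {a<..<b} v D" using has_derivs_mono[OF D(1) ab(1)] by simp
    moreover have "\<bar>D (Suc q) x\<bar> \<le> K * \<epsilon> powi (int m - int (q + 1)) * \<mu>" if "x \<in> {a<..<b}" for x
      using bd[of "Suc q", OF _ that] by simp
    ultimately obtain P where "degree P \<le> q" "\<forall>t\<in>{a<..<b}. \<bar>v t - poly P t\<bar> \<le> K * \<epsilon> powi (int m - int (q + 1)) * \<mu> * (b - a) ^ Suc q"
      using taylor_approx[OF _ ab(2) nn] by blast
    then have P: "degree P \<le> q" "\<forall>t\<in>{a<..<b}. \<bar>v t - poly P t\<bar> \<le> K * \<epsilon> powi (int m - int (q + 1)) * \<mu> * (b - a) ^ (q + 1)"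
      by simp_all
    have "K * \<epsilon> powi (int m - int (q + 1)) * \<mu> * (b - a) ^ (q + 1) = K * \<epsilon> powi (int m - int (q + 1)) * ((b - a) ^ (q + 1) * \<mu>)" by simp
    also have "\<dots> \<le> K * \<epsilon> powi (int m - int (q + 1)) * (\<epsilon> * C * \<theta>) ^ (q + 1)" using h p by (intro mult_left_mono) auto
    also have "\<dots> = K * (\<epsilon> powi (int m - int (q + 1)) * \<epsilon> ^ (q + 1)) * C ^ (q + 1) * \<theta> ^ (q + 1)" by (simp only: power_mult_distrib mult_ac)
    also have "\<dots> = K * \<epsilon> ^ m * C ^ (q + 1) * \<theta> ^ (q + 1)" unfolding powi_shift[OF p(1)] ..
    also have "\<dots> \<le> K * \<epsilon> ^ m * (1 + C) ^ (q + 1) * \<theta> ^ (q + 1)"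
      using p C1 by (intro mult_right_mono mult_left_mono mult_nonneg_nonneg zero_le_power) auto
    finally show ?thesis unfolding approx_sup_def using P by (meson order_trans)
  next
    assume "\<forall>k\<le>q + 1. \<mu> \<le> \<theta> ^ k"
    then have h: "\<mu> \<le> \<theta> ^ (q + 1)" by blast
    have v: "v = D 0" using D(1) by (simp add: has_derivs_def)
    have "\<bar>v t - poly 0 t\<bar> \<le> K * \<epsilon> ^ m * (1 + C) ^ (q + 1) * \<theta> ^ (q + 1)" if t: "t \<in> {a<..<b}" for t
    proof -
      have "\<bar>v t\<bar> \<le> K * \<epsilon> ^ m * 1 * \<mu>" using bd[of 0 t] t v by simp
      also have "\<dots> \<le> K * \<epsilon> ^ m * (1 + C) ^ (q + 1) * \<theta> ^ (q + 1)"
        using p C1 h E(2) by (intro mult_mono mult_nonneg_nonneg zero_le_power) auto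
      finally show ?thesis by simp
    qed
    then show ?thesis unfolding approx_sup_def by (intro exI[of _ 0]) auto
  qed
qed

lemma smooth_approx_sup:
  assumes d: "derivs_bounded (q + 1) A v (\<lambda>k x. M)" and ab: "{a<..<b} \<subseteq> A" "a < b" and M: "M \<ge> 0"
  shows "approx_sup q a b v (M * (b - a) ^ (q + 1))"
proof -
  obtain D where D: "has_derivs (q + 1) A v D" "\<And>k x. k \<le> q + 1 \<Longrightarrow> x \<in> A \<Longrightarrow> \<bar>D k x\<bar> \<le> M"
    using d by (auto simp: derivs_bounded_def)
  have "has_derivs (Suc q) {a<..<b} v D" using has_derivs_mono[OF D(1) ab(1)] by simp
  moreover have "\<bar>D (Suc q) x\<bar> \<le> M" if "x \<in> {a<..<b}" for x
    using D(2)[of "Suc q" x] ab(1) that by auto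
  ultimately show ?thesis
    using taylor_approx[OF _ ab(2) M] unfolding approx_sup_def Suc_eq_plus1 by blast
qed

lemma L2_norm_nonneg: "0 \<le> L2_norm D v"
  by (simp add: L2_norm_def L2_inner_def)

text \<open>\<open>G\<close> is the weak derivative of order q + 1 of the smooth part of
  \<open>u\<close>, glued from both halves. The cell bound for \<open>u\<close> keeps its local
  norm; everything else is \<open>M\<close> times a power of the rate. \<open>\<theta>\<close> is
  the share of the rate that controls the layers, \<open>\<rho>\<close> the full rate, which also
  controls the widths.\<close>

lemma local_approximation:
  assumes dec: "has_decomposition m q \<beta> K \<epsilon> u w" and m: "m = 1 \<or> m = 2" and q: "q \<ge> 1"
    and eps: "0 < \<epsilon>" "\<epsilon> \<le> \<epsilon>0" and \<beta>: "\<beta> > 0" and C: "C \<ge> 0"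
  defines "M \<equiv> 4 * K * (1 + \<epsilon>0)\<^sup>2 * ((1 + C) ^ (q + 1) + 4 ^ (q + 1))"
  obtains G where "L2on 0 2 G" "integral {0..2} (\<lambda>t. (G t)\<^sup>2) \<le> 2 * K\<^sup>2" "K \<ge> 0"
    "\<And>a b \<theta> \<rho>. 0 \<le> a \<Longrightarrow> a < b \<Longrightarrow> b \<le> 2 \<Longrightarrow> 0 \<le> \<theta> \<Longrightarrow> \<theta> \<le> \<rho> \<Longrightarrow> b - a \<le> 4 * \<rho> \<Longrightarrow>
      resolved q C \<epsilon> \<theta> (b - a) (exp (- \<beta> * a / \<epsilon>)) \<Longrightarrow> resolved q C \<epsilon> \<theta> (b - a) (exp (- \<beta> * (2 - b) / \<epsilon>)) \<Longrightarrow>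
      b \<le> 1 \<and> resolved q C \<epsilon> \<theta> (b - a) (exp (- \<beta> * (1 - b) / \<epsilon>)) \<or>
      1 \<le> a \<and> resolved q C \<epsilon> \<theta> (b - a) (exp (- \<beta> * (a - 1) / \<epsilon>)) \<Longrightarrow>
      approx_lip q a b u (sqrt (b - a) * sqrt (integral {a..b} (\<lambda>t. (G t)\<^sup>2)) * (b - a) ^ (q - 1) + M * \<rho> ^ q) \<and>
      approx_sup q a b w (M * \<rho> ^ (q + 1))"
proof -
  obtain S E1 E2 W1 W2 S' E1' E2' W1' W2' where
    u': "\<forall>x \<in> Dom - {1}. u x = S x + E1 x + E2 x + W1 x * indicator {0<..<1} x + W2 x * indicator {1<..<2} x" and
    w': "\<forall>x \<in> Dom - {1}. w x = S' x + E1' x + E2' x + W1' x * indicator {0<..<1} x + W2' x * indicator {1<..<2} x" and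
    S: "S \<in> Sobolev (q + 1) {0<..<1}" "S \<in> Sobolev (q + 1) {1<..<2}" and
    SK': "\<forall>k\<le>q + 1. L2_norm {0<..<1} ((wderiv {0<..<1} ^^ k) S) + L2_norm {1<..<2} ((wderiv {1<..<2} ^^ k) S) \<le> K" and
    E1: "derivs_bounded (q + 1) Dom E1 (\<lambda>k x. K * \<epsilon> powi (int m - int k) * exp (- \<beta> * x / \<epsilon>))" and
    E2: "derivs_bounded (q + 1) Dom E2 (\<lambda>k x. K * \<epsilon> powi (int m - int k) * exp (- \<beta> * (2 - x) / \<epsilon>))" and
    W1: "derivs_bounded (q + 1) {0<..<1} W1 (\<lambda>k x. K * \<epsilon> powi (3 - int k) * exp (- \<beta> * (1 - x) / \<epsilon>))" and
    W2: "derivs_bounded (q + 1) {1<..<2} W2 (\<lambda>k x. K * \<epsilon> powi (3 - int k) * exp (- \<beta> * (x - 1) / \<epsilon>))" and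
    S': "derivs_bounded (q + 1) (Dom - {1}) S' (\<lambda>k x. K * \<epsilon>)" and
    E1': "derivs_bounded (q + 1) Dom E1' (\<lambda>k x. K * \<epsilon> powi (int m - 1 - int k) * exp (- \<beta> * x / \<epsilon>))" and
    E2': "derivs_bounded (q + 1) Dom E2' (\<lambda>k x. K * \<epsilon> powi (int m - 1 - int k) * exp (- \<beta> * (2 - x) / \<epsilon>))" and
    W1': "derivs_bounded (q + 1) {0<..<1} W1' (\<lambda>k x. K * \<epsilon> powi (2 - int k) * exp (- \<beta> * (1 - x) / \<epsilon>))" and
    W2': "derivs_bounded (q + 1) {1<..<2} W2' (\<lambda>k x. K * \<epsilon> powi (2 - int k) * exp (- \<beta> * (x - 1) / \<epsilon>))"
    using dec unfolding has_decomposition_def by (elim exE conjE) (rule that)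
  have SK: "L2_norm {0<..<1} ((wderiv {0<..<1} ^^ (q + 1)) S) + L2_norm {1<..<2} ((wderiv {1<..<2} ^^ (q + 1)) S) \<le> K"
    using SK' by blast
  note u = u'[rule_format] and w = w'[rule_format]
  define G1 where "G1 = (wderiv {0<..<1} ^^ (q + 1)) S"
  define G2 where "G2 = (wderiv {1<..<2} ^^ (q + 1)) S"
  define G where "G x = (if x < 1 then G1 x else G2 x)" for x :: real
  have L12: "L2on 0 1 G1" "L2on 1 2 G2"
    unfolding G1_def G2_def using Sobolev_iterated(1)[OF S(1), of "q + 1"] Sobolev_iterated(1)[OF S(2), of "q + 1"] by auto
  have LG: "L2on 0 1 G" "L2on 1 2 G"
    by (rule L2on_spike[OF L12(1) negligible_empty], simp add: G_def)
       (rule L2on_spike[OF L12(2) negligible_empty], simp add: G_def)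
  have G: "L2on 0 2 G" by (rule L2on_combine[OF LG]) auto
  have G1e: "integral {a..b} (\<lambda>t. (G1 t)\<^sup>2) = integral {a..b} (\<lambda>t. (G t)\<^sup>2)" if "b \<le> 1" for a b
    by (rule integral_spike[of "{1}"]) (use that in \<open>auto simp: G_def\<close>)
  have G2e: "integral {a..b} (\<lambda>t. (G2 t)\<^sup>2) = integral {a..b} (\<lambda>t. (G t)\<^sup>2)" if "1 \<le> a" for a b
    by (rule integral_cong) (use that in \<open>auto simp: G_def\<close>)
  have nK: "L2_norm {0<..<1} G1 \<le> K" "L2_norm {1<..<2} G2 \<le> K"
    using SK L2_norm_nonneg[of "{0<..<1}" G1] L2_norm_nonneg[of "{1<..<2}" G2] by (auto simp: G1_def G2_def)
  have K: "K \<ge> 0" using nK(1) L2_norm_nonneg order_trans by blast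
  have IG: "integral {0..2} (\<lambda>t. (G t)\<^sup>2) \<le> 2 * K\<^sup>2"
  proof -
    have "integral {0..2} (\<lambda>t. (G t)\<^sup>2) = integral {0..1} (\<lambda>t. (G t)\<^sup>2) + integral {1..2} (\<lambda>t. (G t)\<^sup>2)"
      by (rule Henstock_Kurzweil_Integration.integral_combine[symmetric]) (auto intro: L2on_square G)
    also have "\<dots> = (L2_norm {0<..<1} G1)\<^sup>2 + (L2_norm {1<..<2} G2)\<^sup>2"
      using G1e[of 1 0] G2e[of 1 2] L2_norm_sq[OF L12(1)] L2_norm_sq[OF L12(2)] by simp
    also have "\<dots> \<le> K\<^sup>2 + K\<^sup>2" using nK by (intro add_mono power_mono L2_norm_nonneg)
    finally show ?thesis by simp
  qed
  show ?thesis
  proof (rule that[OF G IG K])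
    fix a b \<theta> \<rho> :: real
    assume ab: "0 \<le> a" "a < b" "b \<le> 2" and \<theta>: "0 \<le> \<theta>" "\<theta> \<le> \<rho>" and h: "b - a \<le> 4 * \<rho>"
      and r1: "resolved q C \<epsilon> \<theta> (b - a) (exp (- \<beta> * a / \<epsilon>))" and r2: "resolved q C \<epsilon> \<theta> (b - a) (exp (- \<beta> * (2 - b) / \<epsilon>))"
      and r3: "b \<le> 1 \<and> resolved q C \<epsilon> \<theta> (b - a) (exp (- \<beta> * (1 - b) / \<epsilon>)) \<or>
        1 \<le> a \<and> resolved q C \<epsilon> \<theta> (b - a) (exp (- \<beta> * (a - 1) / \<epsilon>))"
    have \<rho>: "\<rho> \<ge> 0" using \<theta> by simp
    have sub: "{a<..<b} \<subseteq> Dom" "{a<..<b} \<subseteq> Dom - {1}" using ab r3 by auto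
    \<comment> \<open>The bound for a single part. The square of \<open>1 + \<epsilon>0\<close>
      covers the remaining powers of \<open>\<epsilon>\<close>, which are at most 2, and
      \<open>4 ^ (q + 1)\<close> the widths up to \<open>4 * \<rho>\<close>. \<open>w\<close>
      consists of four such parts and \<open>u\<close> of three beside \<open>S\<close>, hence the 4
      in \<open>M\<close>.\<close>
    define Q where "Q = K * (1 + \<epsilon>0)\<^sup>2 * ((1 + C) ^ (q + 1) + 4 ^ (q + 1))"
    have MQ: "M = Q + Q + Q + Q" by (simp add: M_def Q_def)
    have epow: "\<epsilon> ^ k \<le> (1 + \<epsilon>0)\<^sup>2" if "k \<le> 2" for k
    proof -
      have "\<epsilon> ^ k \<le> (1 + \<epsilon>0) ^ k" using eps by (intro power_mono) auto
      also have "\<dots> \<le> (1 + \<epsilon>0) ^ 2" using eps that by (intro power_increasing) auto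
      finally show ?thesis .
    qed
    have Qle: "K * \<epsilon> ^ k * (1 + C) ^ (q + 1) * \<theta> ^ j \<le> Q * \<rho> ^ j" if "k \<le> 2" for k j
    proof -
      have "K * \<epsilon> ^ k * (1 + C) ^ (q + 1) \<le> Q"
        unfolding Q_def using K eps C epow[OF that] by (intro mult_mono mult_left_mono) auto
      then show ?thesis using K eps C \<theta> by (intro mult_mono power_mono) (auto simp: Q_def)
    qed
    have ex: "\<beta> * y / \<epsilon> \<le> \<beta> * x / \<epsilon>" if "y \<le> x" for x y
      using that \<beta> eps by (simp add: divide_right_mono)
    note LU = layer_approx_lip[OF _ _ ab(2) _ _ eps(1) K C \<theta>(1)]
    note LW = layer_approx_sup[OF _ _ ab(2) _ _ eps(1) K C \<theta>(1)]
    \<comment> \<open>The end layers of \<open>w\<close> lose one power of \<open>\<epsilon>\<close>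
      against those of \<open>u\<close>; the shifted exponent \<open>k\<close> is still a natural
      number.\<close>
    obtain k where k: "m = Suc k" "k \<le> 1" using m by (cases m) auto
    have i3: "3 - int j = int 3 - int j" "2 - int j = int 2 - int j" "int m - 1 - int j = int k - int j" for j
      using k by simp_all
    have uE1: "approx_lip q a b E1 (Q * \<rho> ^ q)"
      by (rule approx_lip_mono[OF LU[OF E1 sub(1) _ _ _ r1] Qle]) (use k in \<open>auto intro: ex\<close>)
    have uE2: "approx_lip q a b E2 (Q * \<rho> ^ q)"
      by (rule approx_lip_mono[OF LU[OF E2 sub(1) _ _ _ r2] Qle]) (use k in \<open>auto intro: ex\<close>)
    have wE1: "approx_sup q a b E1' (Q * \<rho> ^ (q + 1))"
      by (rule approx_sup_mono[OF LW[OF E1'[unfolded i3] sub(1) _ _ r1] Qle]) (use k in \<open>auto intro: ex\<close>)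
    have wE2: "approx_sup q a b E2' (Q * \<rho> ^ (q + 1))"
      by (rule approx_sup_mono[OF LW[OF E2'[unfolded i3] sub(1) _ _ r2] Qle]) (use k in \<open>auto intro: ex\<close>)
    have wS: "approx_sup q a b S' (Q * \<rho> ^ (q + 1))"
    proof (rule approx_sup_mono[OF smooth_approx_sup[OF S' sub(2) ab(2)]])
      show "0 \<le> K * \<epsilon>" using K eps by simp
      have "K * \<epsilon> * (b - a) ^ (q + 1) \<le> K * (1 + \<epsilon>0)\<^sup>2 * (4 * \<rho>) ^ (q + 1)"
        using K eps h ab epow[of 1] by (intro mult_mono power_mono mult_nonneg_nonneg) auto
      also have "\<dots> = K * (1 + \<epsilon>0)\<^sup>2 * 4 ^ (q + 1) * \<rho> ^ (q + 1)" by (simp only: power_mult_distrib mult.assoc)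
      also have "\<dots> \<le> Q * \<rho> ^ (q + 1)" unfolding Q_def
        using K eps C \<rho> by (intro mult_right_mono mult_left_mono) auto
      finally show "K * \<epsilon> * (b - a) ^ (q + 1) \<le> Q * \<rho> ^ (q + 1)" .
    qed
    have uS: "approx_lip q a b S (sqrt (b - a) * sqrt (integral {a..b} (\<lambda>t. (G t)\<^sup>2)) * (b - a) ^ (q - 1))"
      using r3
    proof
      assume r: "b \<le> 1 \<and> resolved q C \<epsilon> \<theta> (b - a) (exp (- \<beta> * (1 - b) / \<epsilon>))"
      have "approx_lip q a b ((wderiv {0<..<1} ^^ 0) S) (sqrt (b - a) * sqrt (integral {a..b} (\<lambda>t. ((wderiv {0<..<1} ^^ Suc q) S t)\<^sup>2)) * (b - a) ^ (q - 1))"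
      proof (rule weak_taylor_lip[of _ _ _ "\<lambda>j. (wderiv {0<..<1} ^^ j) S"])
        show "has_weak_deriv {a<..<b} ((wderiv {0<..<1} ^^ j) S) ((wderiv {0<..<1} ^^ Suc j) S)" if "j \<le> q" for j
          by (rule has_weak_deriv_subinterval[OF Sobolev_iterated(2)[OF S(1)]]) (use that r ab in auto)
        show "L2on a b ((wderiv {0<..<1} ^^ j) S)" if "j \<le> Suc q" for j
          by (rule L2on_subinterval[OF Sobolev_iterated(1)[OF S(1)]]) (use that r ab in auto)
      qed (use ab q in auto)
      then show ?thesis using G1e[of b a] r by (simp add: G1_def)
    next
      assume r: "1 \<le> a \<and> resolved q C \<epsilon> \<theta> (b - a) (exp (- \<beta> * (a - 1) / \<epsilon>))"
      have "approx_lip q a b ((wderiv {1<..<2} ^^ 0) S) (sqrt (b - a) * sqrt (integral {a..b} (\<lambda>t. ((wderiv {1<..<2} ^^ Suc q) S t)\<^sup>2)) * (b - a) ^ (q - 1))"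
      proof (rule weak_taylor_lip[of _ _ _ "\<lambda>j. (wderiv {1<..<2} ^^ j) S"])
        show "has_weak_deriv {a<..<b} ((wderiv {1<..<2} ^^ j) S) ((wderiv {1<..<2} ^^ Suc j) S)" if "j \<le> q" for j
          by (rule has_weak_deriv_subinterval[OF Sobolev_iterated(2)[OF S(2)]]) (use that r ab in auto)
        show "L2on a b ((wderiv {1<..<2} ^^ j) S)" if "j \<le> Suc q" for j
          by (rule L2on_subinterval[OF Sobolev_iterated(1)[OF S(2)]]) (use that r ab in auto)
      qed (use ab q in auto)
      then show ?thesis using G2e[of a b] r by (simp add: G2_def)
    qed
    \<comment> \<open>Whichever side of 1 the cell lies on, one of the two interior layer terms is
      present and the other is cut off.\<close>
    from r3 obtain W W' where W: "approx_lip q a b W (Q * \<rho> ^ q)" "approx_sup q a b W' (Q * \<rho> ^ (q + 1))"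
      and uW: "\<And>x. x \<in> {a<..<b} \<Longrightarrow> u x = S x + E1 x + E2 x + W x"
      and wW: "\<And>x. x \<in> {a<..<b} \<Longrightarrow> w x = S' x + E1' x + E2' x + W' x"
    proof
      assume r: "b \<le> 1 \<and> resolved q C \<epsilon> \<theta> (b - a) (exp (- \<beta> * (1 - b) / \<epsilon>))"
      then have s: "{a<..<b} \<subseteq> {0<..<1}" using ab by auto
      show thesis
      proof (rule that[of W1 W1'])
        show "approx_lip q a b W1 (Q * \<rho> ^ q)"
          by (rule approx_lip_mono[OF LU[OF W1[unfolded i3] s _ _ _ conjunct2[OF r]] Qle]) (auto intro: ex)
        show "approx_sup q a b W1' (Q * \<rho> ^ (q + 1))"
          by (rule approx_sup_mono[OF LW[OF W1'[unfolded i3] s _ _ conjunct2[OF r]] Qle]) (auto intro: ex)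
      qed (use u w s in force)+
    next
      assume r: "1 \<le> a \<and> resolved q C \<epsilon> \<theta> (b - a) (exp (- \<beta> * (a - 1) / \<epsilon>))"
      then have s: "{a<..<b} \<subseteq> {1<..<2}" using ab by auto
      show thesis
      proof (rule that[of W2 W2'])
        show "approx_lip q a b W2 (Q * \<rho> ^ q)"
          by (rule approx_lip_mono[OF LU[OF W2[unfolded i3] s _ _ _ conjunct2[OF r]] Qle]) (auto intro: ex)
        show "approx_sup q a b W2' (Q * \<rho> ^ (q + 1))"
          by (rule approx_sup_mono[OF LW[OF W2'[unfolded i3] s _ _ conjunct2[OF r]] Qle]) (auto intro: ex)
      qed (use u w s in force)+
    qed
    have "approx_lip q a b (\<lambda>x. S x + E1 x + E2 x + W x)
       (sqrt (b - a) * sqrt (integral {a..b} (\<lambda>t. (G t)\<^sup>2)) * (b - a) ^ (q - 1) + Q * \<rho> ^ q + Q * \<rho> ^ q + Q * \<rho> ^ q)"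
      by (intro approx_lip_add uS uE1 uE2 W)
    then have "approx_lip q a b u
       (sqrt (b - a) * sqrt (integral {a..b} (\<lambda>t. (G t)\<^sup>2)) * (b - a) ^ (q - 1) + Q * \<rho> ^ q + Q * \<rho> ^ q + Q * \<rho> ^ q)"
      by (subst approx_lip_cong[OF uW])
    moreover have "approx_sup q a b (\<lambda>x. S' x + E1' x + E2' x + W' x) (Q * \<rho> ^ (q + 1) + Q * \<rho> ^ (q + 1) + Q * \<rho> ^ (q + 1) + Q * \<rho> ^ (q + 1))"
      by (intro approx_sup_add wS wE1 wE2 W)
    then have "approx_sup q a b w (Q * \<rho> ^ (q + 1) + Q * \<rho> ^ (q + 1) + Q * \<rho> ^ (q + 1) + Q * \<rho> ^ (q + 1))"
      by (subst approx_sup_cong[OF wW])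
    moreover have "0 \<le> Q * \<rho> ^ q" unfolding Q_def using K eps C \<rho> by simp
    ultimately show "approx_lip q a b u (sqrt (b - a) * sqrt (integral {a..b} (\<lambda>t. (G t)\<^sup>2)) * (b - a) ^ (q - 1) + M * \<rho> ^ q) \<and>
      approx_sup q a b w (M * \<rho> ^ (q + 1))"
      unfolding MQ distrib_right by (auto elim!: approx_lip_mono approx_sup_mono)
  qed
qed

section \<open>Error estimates\<close>

text \<open>On a cell, the squared Lipschitz constant of the error times the width bounds the
  integral of its squared derivative. Summed over cells, the local norms of \<open>G\<close> add up
  to the full one and the widths to the length 2 of the domain. The error of \<open>u\<close> itself
  vanishes at the nodes and so gains one more width.\<close>

lemma interp_error_estimate:
  assumes q: "q \<ge> 1"
  obtains Cq :: real where "Cq \<ge> 0"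
    "\<And>X N \<rho> M u u' w G. mesh_nodes X N \<Longrightarrow> AC 0 2 u u' \<Longrightarrow> continuous_on {0..2} w \<Longrightarrow> L2on 0 2 G \<Longrightarrow> \<rho> \<ge> 0 \<Longrightarrow> M \<ge> 0 \<Longrightarrow>
      \<forall>i\<in>{1..N}. X i - X (i - 1) \<le> 4 * \<rho> \<Longrightarrow>
      \<forall>i\<in>{1..N}. X (i - 1) < X i \<longrightarrow>
        approx_lip q (X (i - 1)) (X i) u
          (sqrt (X i - X (i - 1)) * sqrt (integral {X (i - 1)..X i} (\<lambda>t. (G t)\<^sup>2)) * (X i - X (i - 1)) ^ (q - 1) + M * \<rho> ^ q) \<and>
        approx_sup q (X (i - 1)) (X i) w (M * \<rho> ^ (q + 1)) \<Longrightarrow>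
      integral {0..2} (\<lambda>t. (u t - interp q X N u t)\<^sup>2) \<le> Cq * (integral {0..2} (\<lambda>t. (G t)\<^sup>2) + M\<^sup>2) * (\<rho> ^ (q + 1))\<^sup>2 \<and>
      integral {0..2} (\<lambda>t. (u' t - wderiv Dom (interp q X N u) t)\<^sup>2) \<le> Cq * (integral {0..2} (\<lambda>t. (G t)\<^sup>2) + M\<^sup>2) * (\<rho> ^ q)\<^sup>2 \<and>
      integral {0..2} (\<lambda>t. (w t - interp q X N w t)\<^sup>2) \<le> Cq * (integral {0..2} (\<lambda>t. (G t)\<^sup>2) + M\<^sup>2) * (\<rho> ^ (q + 1))\<^sup>2"
proof (rule interp_error_lip[OF q], rule interp_error_sup[OF q])
  fix C2 C3 :: real
  assume C2: "C2 \<ge> 0"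
    "\<And>X N v i L. mesh_nodes X N \<Longrightarrow> continuous_on {0..2} v \<Longrightarrow> i \<in> {1..N} \<Longrightarrow> X (i - 1) < X i \<Longrightarrow>
       approx_lip q (X (i - 1)) (X i) v L \<Longrightarrow> (C2 * L)-lipschitz_on {X (i - 1)..X i} (\<lambda>t. v t - interp q X N v t)"
  assume C3: "C3 \<ge> 0"
    "\<And>X N v i B t. mesh_nodes X N \<Longrightarrow> continuous_on {0..2} v \<Longrightarrow> i \<in> {1..N} \<Longrightarrow> X (i - 1) < X i \<Longrightarrow>
       approx_sup q (X (i - 1)) (X i) v B \<Longrightarrow> t \<in> {X (i - 1)..X i} \<Longrightarrow> \<bar>v t - interp q X N v t\<bar> \<le> C3 * B"
  \<comment> \<open>The 2 comes from squaring a sum of two terms, \<open>16 ^ q\<close> from the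
    squared q-th power of the width bound \<open>4 * \<rho>\<close>. In \<open>Cq\<close> below, 32
    is 16 from one more squared width times 2 from summing the \<open>\<kappa> i\<close>; its second
    term is the length of the domain times the squared constant of the sup estimate.\<close>
  define k where "k = 2 * C2\<^sup>2 * 16 ^ q"
  define Cq where "Cq = 32 * k + 2 * C3\<^sup>2"
  have k0: "k \<ge> 0" by (simp add: k_def)
  have Cq0: "Cq \<ge> 0" using k0 by (simp add: Cq_def)
  show thesis
  proof (rule that[OF Cq0], intro conjI)
    fix X N \<rho> M u u' w G
    assume m: "mesh_nodes X N" and u: "AC 0 2 u u'" and wc: "continuous_on {0..2} w" and G: "L2on 0 2 G"
      and \<rho>: "\<rho> \<ge> 0" and M: "M \<ge> 0" and width: "\<forall>i\<in>{1..N}. X i - X (i - 1) \<le> 4 * \<rho>"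
      and app: "\<forall>i\<in>{1..N}. X (i - 1) < X i \<longrightarrow>
        approx_lip q (X (i - 1)) (X i) u
          (sqrt (X i - X (i - 1)) * sqrt (integral {X (i - 1)..X i} (\<lambda>t. (G t)\<^sup>2)) * (X i - X (i - 1)) ^ (q - 1) + M * \<rho> ^ q) \<and>
        approx_sup q (X (i - 1)) (X i) w (M * \<rho> ^ (q + 1))"
    define IG where "IG = integral {0..2} (\<lambda>t. (G t)\<^sup>2)"
    define R where "R = (\<rho> ^ q)\<^sup>2"
    define e where "e t = u t - interp q X N u t" for t
    define e' where "e' t = u' t - wderiv Dom (interp q X N u) t" for t
    define f where "f t = w t - interp q X N w t" for t
    note uc = AC_L2(3)[OF u]
    note IA = H1_AC[OF interp_H1(1)[OF q m uc]] and WA = H1_AC[OF interp_H1(1)[OF q m wc]]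
    have eA: "AC 0 2 e e'" unfolding e_def[abs_def] e'_def[abs_def] by (rule AC_diff[OF u IA])
    have fc: "continuous_on {0..2} f" unfolding f_def[abs_def] by (intro continuous_intros wc AC_L2(3)[OF WA])
    have R0: "R \<ge> 0" by (simp add: R_def)
    have IG0: "IG \<ge> 0" unfolding IG_def by (rule integral_nonneg[OF L2on_square[OF G]]) simp
    \<comment> \<open>One integral per cell that collects both contributions to the Lipschitz
      constant and is additive over cells.\<close>
    define \<kappa> where "\<kappa> i = integral {X (i - 1)..X i} (\<lambda>t. (G t)\<^sup>2 + M\<^sup>2)" for i
    have i\<kappa>: "(\<lambda>t. (G t)\<^sup>2 + M\<^sup>2) integrable_on {0..2}"
      by (intro integrable_add L2on_square G integrable_const_ivl)
    have \<kappa>: "\<kappa> i = integral {X (i - 1)..X i} (\<lambda>t. (G t)\<^sup>2) + (X i - X (i - 1)) * M\<^sup>2" "\<kappa> i \<ge> 0" if i: "i \<in> {1..N}" for i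
    proof -
      note c = mesh_cell[OF m i]
      have gi: "(\<lambda>t. (G t)\<^sup>2) integrable_on {X (i - 1)..X i}"
        by (rule L2on_square[OF L2on_subinterval[OF G c(1,3)]])
      show "\<kappa> i = integral {X (i - 1)..X i} (\<lambda>t. (G t)\<^sup>2) + (X i - X (i - 1)) * M\<^sup>2"
        unfolding \<kappa>_def using c by (subst integral_add[OF gi integrable_const_ivl]) simp
      show "\<kappa> i \<ge> 0" unfolding \<kappa>_def
        by (rule integral_nonneg[OF integrable_add[OF gi integrable_const_ivl]]) simp
    qed
    have sum\<kappa>: "(\<Sum>i\<in>{1..N}. \<kappa> i) \<le> 2 * (IG + M\<^sup>2)"
    proof -
      have "(\<Sum>i\<in>{1..N}. \<kappa> i) = integral {0..2} (\<lambda>t. (G t)\<^sup>2 + M\<^sup>2)"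
        unfolding \<kappa>_def by (rule integral_cells[OF m i\<kappa>, symmetric])
      also have "\<dots> = IG + 2 * M\<^sup>2"
        unfolding IG_def by (subst integral_add[OF L2on_square[OF G] integrable_const_ivl]) simp
      finally show ?thesis using IG0 by simp
    qed
    have cell: "integral {X (i - 1)..X i} (\<lambda>t. (e' t)\<^sup>2) \<le> k * R * \<kappa> i \<and>
        integral {X (i - 1)..X i} (\<lambda>t. (e t)\<^sup>2) \<le> 16 * \<rho>\<^sup>2 * (k * R * \<kappa> i) \<and>
        integral {X (i - 1)..X i} (\<lambda>t. (f t)\<^sup>2) \<le> integral {X (i - 1)..X i} (\<lambda>t. (C3 * (M * \<rho> ^ (q + 1)))\<^sup>2)"
      if i: "i \<in> {1..N}" for i
    proof (cases "X (i - 1) < X i")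
      \<comment> \<open>A degenerate cell contributes nothing, and no approximation is assumed on
        it.\<close>
      case False
      then have "X (i - 1) = X i" using mesh_cell[OF m i] by simp
      then show ?thesis using \<kappa>(2)[OF i] k0 R0 by simp
    next
      case lt: True
      define a where "a = X (i - 1)"
      define b where "b = X i"
      define h where "h = b - a"
      note c = mesh_cell[OF m i, folded a_def b_def]
      have h: "h > 0" "h \<le> 4 * \<rho>" using lt width i by (auto simp: h_def a_def b_def)
      define s where "s = integral {a..b} (\<lambda>t. (G t)\<^sup>2)"
      have s: "s \<ge> 0" unfolding s_def
        by (rule integral_nonneg[OF L2on_square[OF L2on_subinterval[OF G c(1,3)]]]) simp
      have \<kappa>s: "\<kappa> i = s + h * M\<^sup>2" using \<kappa>(1)[OF i] by (simp add: s_def h_def a_def b_def)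
      define L where "L = sqrt h * sqrt s * h ^ (q - 1) + M * \<rho> ^ q"
      have al: "approx_lip q a b u L" and as: "approx_sup q a b w (M * \<rho> ^ (q + 1))"
        using app i lt by (auto simp: L_def h_def s_def a_def b_def)
      have lip: "(C2 * L)-lipschitz_on {a..b} e"
        using C2(2)[OF m uc i lt] al by (simp add: a_def b_def e_def[abs_def])
      have L0: "0 \<le> C2 * L" by (rule lipschitz_on_nonneg[OF lip])
      have ecell: "AC a b e e'" by (rule AC_subinterval[OF eA c(1,3)])
      have main: "h * (C2 * L)\<^sup>2 \<le> k * R * \<kappa> i"
      proof -
        have "L\<^sup>2 \<le> 2 * (sqrt h * sqrt s * h ^ (q - 1))\<^sup>2 + 2 * (M * \<rho> ^ q)\<^sup>2"
          unfolding L_def using sum_squares_bound[of "sqrt h * sqrt s * h ^ (q - 1)" "M * \<rho> ^ q"] by (simp add: power2_sum)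
        also have "(sqrt h * sqrt s * h ^ (q - 1))\<^sup>2 = h * s * (h ^ (q - 1))\<^sup>2"
          using h s by (simp add: power_mult_distrib)
        finally have "h * L\<^sup>2 \<le> h * (2 * (h * s * (h ^ (q - 1))\<^sup>2) + 2 * (M * \<rho> ^ q)\<^sup>2)"
          using h by (intro mult_left_mono) auto
        also have "\<dots> = 2 * (s * (h * h ^ (q - 1))\<^sup>2 + h * M\<^sup>2 * R)"
          by (simp add: R_def power2_eq_square algebra_simps)
        \<comment> \<open>One of the two factors \<open>h\<close> so combined is the squared root of
          the local bound, the other the length of the cell.\<close>
        also have "h * h ^ (q - 1) = h ^ q" using q by (simp flip: power_Suc)
        finally have "h * L\<^sup>2 \<le> 2 * (s * (h ^ q)\<^sup>2 + h * M\<^sup>2 * R)" .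
        moreover have "(h ^ q)\<^sup>2 \<le> 16 ^ q * R"
        proof -
          have "(h ^ q)\<^sup>2 \<le> ((4 * \<rho>) ^ q)\<^sup>2" using h by (intro power_mono) auto
          also have "\<dots> = (4\<^sup>2) ^ q * R" by (simp only: R_def power_mult_distrib power_mult[symmetric] mult.commute[of q 2])
          finally show ?thesis by simp
        qed
        then have "s * (h ^ q)\<^sup>2 \<le> s * (16 ^ q * R)" using s by (rule mult_left_mono)
        moreover have "h * M\<^sup>2 * R * 1 \<le> h * M\<^sup>2 * R * 16 ^ q" using h R0 by (intro mult_left_mono) auto
        ultimately have "h * L\<^sup>2 \<le> 2 * 16 ^ q * R * \<kappa> i" unfolding \<kappa>s by (simp add: algebra_simps)
        then have "C2\<^sup>2 * (h * L\<^sup>2) \<le> C2\<^sup>2 * (2 * 16 ^ q * R * \<kappa> i)" by (intro mult_left_mono) auto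
        then show ?thesis by (simp add: k_def power_mult_distrib mult_ac)
      qed
      obtain Z where Z: "negligible Z" "\<And>t. t \<in> {a<..<b} - Z \<Longrightarrow> \<bar>e' t\<bar> \<le> C2 * L"
      proof (rule AC_Lipschitz_bound[OF ecell])
        show "\<bar>e y - e x\<bar> \<le> C2 * L * (y - x)" if "a < x" "x < y" "y < b" for x y
          using lipschitz_onD[OF lip, of y x] that by (simp add: dist_real_def)
      qed metis
      have 1: "integral {a..b} (\<lambda>t. (e' t)\<^sup>2) \<le> h * (C2 * L)\<^sup>2"
      proof -
        have neg: "negligible (Z \<union> {a, b})" using Z by auto
        have "integral {a..b} (\<lambda>t. (e' t)\<^sup>2) = integral {a..b} (\<lambda>t. if t \<in> Z \<union> {a, b} then 0 else (e' t)\<^sup>2)"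
          by (rule integral_spike[OF neg]) auto
        also have "\<dots> \<le> integral {a..b} (\<lambda>t. (C2 * L)\<^sup>2)"
        proof (rule integral_le)
          show "(\<lambda>t. if t \<in> Z \<union> {a, b} then 0 else (e' t)\<^sup>2) integrable_on {a..b}"
            by (rule integrable_spike[OF L2on_square[OF AC_L2(1)[OF ecell]] neg]) auto
          show "(if t \<in> Z \<union> {a, b} then 0 else (e' t)\<^sup>2) \<le> (C2 * L)\<^sup>2" if "t \<in> {a..b}" for t
            using Z(2)[of t] that L0 abs_le_square_iff[of "e' t" "C2 * L"] by auto
        qed (rule integrable_const_ivl)
        finally show ?thesis using h by (simp add: h_def)
      qed
      have ea: "e a = 0"
        using interp_error_node_orth[OF q m uc] i by (simp add: node_orth_def e_def a_def)
      have "integral {a..b} (\<lambda>t. (e t)\<^sup>2) \<le> integral {a..b} (\<lambda>t. (C2 * L * h)\<^sup>2)"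
      proof (rule integral_le)
        show "(\<lambda>t. (e t)\<^sup>2) integrable_on {a..b}" by (rule L2on_square[OF AC_L2(2)[OF ecell]])
        fix t assume t: "t \<in> {a..b}"
        have "\<bar>e t\<bar> \<le> C2 * L * \<bar>t - a\<bar>" using lipschitz_onD[OF lip t, of a] c ea by (simp add: dist_real_def)
        also have "\<dots> \<le> C2 * L * h" using t L0 by (intro mult_left_mono) (auto simp: h_def)
        finally show "(e t)\<^sup>2 \<le> (C2 * L * h)\<^sup>2" using L0 h abs_le_square_iff[of "e t" "C2 * L * h"] by simp
      qed (rule integrable_const_ivl)
      also have "\<dots> = h\<^sup>2 * (h * (C2 * L)\<^sup>2)" using h by (simp add: h_def power_mult_distrib)
      also have "\<dots> \<le> (4 * \<rho>)\<^sup>2 * (k * R * \<kappa> i)"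
        using h by (intro mult_mono[OF power_mono main]) auto
      finally have 2: "integral {a..b} (\<lambda>t. (e t)\<^sup>2) \<le> 16 * \<rho>\<^sup>2 * (k * R * \<kappa> i)" by (simp add: power_mult_distrib)
      have 3: "integral {a..b} (\<lambda>t. (f t)\<^sup>2) \<le> integral {a..b} (\<lambda>t. (C3 * (M * \<rho> ^ (q + 1)))\<^sup>2)"
      proof (rule integral_le)
        have "continuous_on {a..b} f" by (rule continuous_on_subset[OF fc]) (use c in auto)
        then show "(\<lambda>t. (f t)\<^sup>2) integrable_on {a..b}" by (intro L2on_square L2on_continuous)
        fix t assume t: "t \<in> {a..b}"
        have "\<bar>f t\<bar> \<le> C3 * (M * \<rho> ^ (q + 1))"
          using C3(2)[OF m wc i lt, of "M * \<rho> ^ (q + 1)" t] as t by (simp add: f_def a_def b_def)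
        then show "(f t)\<^sup>2 \<le> (C3 * (M * \<rho> ^ (q + 1)))\<^sup>2" by (metis abs_ge_zero power2_abs power_mono)
      qed (rule integrable_const_ivl)
      show ?thesis using main 1 2 3 by (auto simp: a_def b_def)
    qed
    have e'sum: "integral {0..2} (\<lambda>t. (e' t)\<^sup>2) \<le> k * R * (\<Sum>i\<in>{1..N}. \<kappa> i)"
      unfolding integral_cells[OF m L2on_square[OF AC_L2(1)[OF eA]]] sum_distrib_left
      by (rule sum_mono) (use cell in blast)
    also have "\<dots> \<le> k * R * (2 * (IG + M\<^sup>2))" using sum\<kappa> k0 R0 by (intro mult_left_mono) auto
    also have "\<dots> = 2 * k * (IG + M\<^sup>2) * R" by simp
    also have "\<dots> \<le> Cq * (IG + M\<^sup>2) * R"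
      using k0 R0 IG0 by (intro mult_right_mono) (auto simp: Cq_def)
    finally show "integral {0..2} (\<lambda>t. (u' t - wderiv Dom (interp q X N u) t)\<^sup>2) \<le> Cq * (integral {0..2} (\<lambda>t. (G t)\<^sup>2) + M\<^sup>2) * (\<rho> ^ q)\<^sup>2"
      by (simp add: e'_def IG_def R_def)
    have R1: "(\<rho> ^ (q + 1))\<^sup>2 = \<rho>\<^sup>2 * R" by (simp add: R_def power_mult_distrib)
    have "integral {0..2} (\<lambda>t. (e t)\<^sup>2) \<le> (\<Sum>i\<in>{1..N}. 16 * \<rho>\<^sup>2 * (k * R * \<kappa> i))"
      unfolding integral_cells[OF m L2on_square[OF AC_L2(2)[OF eA]]]
      by (rule sum_mono) (use cell in blast)
    also have "\<dots> = 16 * \<rho>\<^sup>2 * (k * R) * (\<Sum>i\<in>{1..N}. \<kappa> i)" by (simp only: sum_distrib_left mult.assoc)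
    also have "\<dots> \<le> 16 * \<rho>\<^sup>2 * (k * R) * (2 * (IG + M\<^sup>2))" using sum\<kappa> k0 R0 by (intro mult_left_mono) auto
    also have "\<dots> = 32 * k * (IG + M\<^sup>2) * (\<rho>\<^sup>2 * R)" by simp
    also have "\<dots> \<le> Cq * (IG + M\<^sup>2) * (\<rho>\<^sup>2 * R)"
      using k0 R0 IG0 by (intro mult_right_mono) (auto simp: Cq_def)
    finally show "integral {0..2} (\<lambda>t. (u t - interp q X N u t)\<^sup>2) \<le> Cq * (integral {0..2} (\<lambda>t. (G t)\<^sup>2) + M\<^sup>2) * (\<rho> ^ (q + 1))\<^sup>2"
      unfolding R1 by (simp add: e_def IG_def)
    have "integral {0..2} (\<lambda>t. (f t)\<^sup>2) \<le> (\<Sum>i\<in>{1..N}. integral {X (i - 1)..X i} (\<lambda>t. (C3 * (M * \<rho> ^ (q + 1)))\<^sup>2))"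
      unfolding integral_cells[OF m L2on_square[OF L2on_continuous[OF fc]]]
      by (rule sum_mono) (use cell in blast)
    also have "\<dots> = 2 * (C3 * (M * \<rho> ^ (q + 1)))\<^sup>2"
      by (subst integral_cells[OF m integrable_const_ivl, symmetric]) simp
    also have "\<dots> = 2 * C3\<^sup>2 * M\<^sup>2 * (\<rho> ^ (q + 1))\<^sup>2" by (simp only: power_mult_distrib mult.assoc)
    also have "\<dots> \<le> Cq * (IG + M\<^sup>2) * (\<rho> ^ (q + 1))\<^sup>2"
      using k0 IG0 by (intro mult_right_mono mult_mono) (auto simp: Cq_def)
    finally show "integral {0..2} (\<lambda>t. (w t - interp q X N w t)\<^sup>2) \<le> Cq * (integral {0..2} (\<lambda>t. (G t)\<^sup>2) + M\<^sup>2) * (\<rho> ^ (q + 1))\<^sup>2"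
      by (simp add: f_def IG_def)
  qed
qed

section \<open>Triangle inequality and conclusion\<close>

lemma L2on_add_square_le:
  assumes "L2on a b f" "L2on a b g"
  shows "integral {a..b} (\<lambda>t. (f t + g t)\<^sup>2) \<le> 2 * integral {a..b} (\<lambda>t. (f t)\<^sup>2) + 2 * integral {a..b} (\<lambda>t. (g t)\<^sup>2)"
proof -
  have "integral {a..b} (\<lambda>t. (f t + g t)\<^sup>2) \<le> integral {a..b} (\<lambda>t. 2 * (f t)\<^sup>2 + 2 * (g t)\<^sup>2)"
  proof (rule integral_le)
    show "(\<lambda>t. (f t + g t)\<^sup>2) integrable_on {a..b}" by (rule L2on_square[OF L2on_add[OF assms]])
    show "(\<lambda>t. 2 * (f t)\<^sup>2 + 2 * (g t)\<^sup>2) integrable_on {a..b}"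
      by (intro integrable_add integrable_on_mult_right L2on_square assms)
    show "(f t + g t)\<^sup>2 \<le> 2 * (f t)\<^sup>2 + 2 * (g t)\<^sup>2" for t
      using sum_squares_bound[of "f t" "g t"] by (simp add: power2_sum)
  qed
  also have "\<dots> = 2 * integral {a..b} (\<lambda>t. (f t)\<^sup>2) + 2 * integral {a..b} (\<lambda>t. (g t)\<^sup>2)"
    by (simp only: integral_add integrable_on_mult_right L2on_square assms integral_mult_right)
  finally show ?thesis .
qed

text \<open>The factor 2 in place of the sharp triangle inequality affects only the constant of the
  convergence result.\<close>

lemma energy_norm_add_sq:
  assumes y: "AC 0 2 y y'" and v: "AC 0 2 v v'" and z: "L2on 0 2 z" and r: "L2on 0 2 r" and \<delta>: "\<delta> > 0"
  shows "(energy_norm \<beta> \<delta> (\<lambda>t. y t + v t, \<lambda>t. z t + r t))\<^sup>2 \<le> 2 * (energy_norm \<beta> \<delta> (y, z))\<^sup>2 + 2 * (energy_norm \<beta> \<delta> (v, r))\<^sup>2"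
proof -
  have "(energy_norm \<beta> \<delta> (\<lambda>t. y t + v t, \<lambda>t. z t + r t))\<^sup>2 = integral {0..2} (\<lambda>x. (z x + r x)\<^sup>2)
     + \<beta>\<^sup>2 / 2 * integral {0..2} (\<lambda>x. (y' x + v' x)\<^sup>2) + \<delta> * integral {0..2} (\<lambda>x. (y x + v x)\<^sup>2)"
    by (rule energy_norm_sq(1)[OF AC_add[OF y v] L2on_add[OF z r] \<delta>])
  also have "\<dots> \<le> (2 * integral {0..2} (\<lambda>x. (z x)\<^sup>2) + 2 * integral {0..2} (\<lambda>x. (r x)\<^sup>2))
     + \<beta>\<^sup>2 / 2 * (2 * integral {0..2} (\<lambda>x. (y' x)\<^sup>2) + 2 * integral {0..2} (\<lambda>x. (v' x)\<^sup>2))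
     + \<delta> * (2 * integral {0..2} (\<lambda>x. (y x)\<^sup>2) + 2 * integral {0..2} (\<lambda>x. (v x)\<^sup>2))"
    using \<delta> by (intro add_mono mult_left_mono L2on_add_square_le z r AC_L2[OF y] AC_L2[OF v]) auto
  also have "\<dots> = 2 * (energy_norm \<beta> \<delta> (y, z))\<^sup>2 + 2 * (energy_norm \<beta> \<delta> (v, r))\<^sup>2"
    unfolding energy_norm_sq(1)[OF y z \<delta>] energy_norm_sq(1)[OF v r \<delta>] by (simp add: algebra_simps)
  finally show ?thesis .
qed

lemma le_sqrt_mult:
  assumes "x\<^sup>2 \<le> A * y\<^sup>2" "y \<ge> 0"
  shows "x \<le> sqrt A * (y::real)"
  using real_le_rsqrt[OF assms(1)] assms(2) by (simp add: real_sqrt_mult)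

theorem theorem4p3:
  fixes m q :: nat
    and \<beta> \<delta> \<sigma> \<epsilon>0 :: real
    and b c d f \<Phi> :: "real \<Rightarrow> real"
    and \<phi> :: "nat \<Rightarrow> real \<Rightarrow> real"
    and u w :: "real \<Rightarrow> real \<Rightarrow> real"
    and uh wh :: "real \<Rightarrow> nat \<Rightarrow> real \<Rightarrow> real"
  defines "x \<equiv> (\<lambda>\<epsilon> N. node \<sigma> \<beta> \<epsilon> (\<phi> N) N)"
    and "admissible \<equiv> (\<lambda>\<epsilon> N. 0 < \<epsilon> \<and> \<epsilon> \<le> \<epsilon>0 \<and> 0 < N \<and> 8 dvd N \<and> transition \<sigma> \<beta> \<epsilon> N < 1/4)"
    and "rate \<equiv> (\<lambda>\<epsilon> N. layer_width (node \<sigma> \<beta> \<epsilon> (\<phi> N) N) N + max_psi_deriv (\<phi> N) / real N)"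
  assumes m: "m = 1 \<or> m = 2"
    and q: "q \<ge> 1"
    and eps0: "\<epsilon>0 > 0"
    and smooth: "smooth_on {0..2} b" "smooth_on {0..2} c" "smooth_on {0..2} d"
    and beta: "\<beta> > 0" "\<forall>t\<in>Dom. b t \<ge> \<beta>\<^sup>2"
    and delta: "\<delta> > 0"
      "\<forall>t\<in>Dom. c t - 1/2 * Linf_norm {1<..<2} d
                 - 1 / (2 * \<beta>\<^sup>2) * (Linf_norm Dom (deriv b))\<^sup>2 \<ge> \<delta>"
    and data: "f \<in> L2_space Dom" "\<Phi> \<in> L2_space {-1<..<0}" "history_compatible m \<Phi>"
    and sigma: "\<sigma> > 0" "\<sigma> \<ge> real q + 1"
    and mesh: "\<forall>N. 0 < N \<and> 8 dvd N \<longrightarrow> mesh_function N (\<phi> N)"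
      "\<exists>K. \<forall>N. 0 < N \<and> 8 dvd N \<longrightarrow>
         (\<forall>t\<in>{0<..<1/2}. \<phi> N field_differentiable at t \<longrightarrow> deriv (\<phi> N) t \<le> K * real N)"
    and solution: "\<forall>\<epsilon>. 0 < \<epsilon> \<and> \<epsilon> \<le> \<epsilon>0 \<longrightarrow> (u \<epsilon>, w \<epsilon>) \<in> U_space m \<and>
         (\<forall>(y, z)\<in>U_space m. bform \<epsilon> b c d (u \<epsilon>, w \<epsilon>) (y, z) = load f d \<Phi> y)"
    and decomposition: "\<exists>K. \<forall>\<epsilon>. 0 < \<epsilon> \<and> \<epsilon> \<le> \<epsilon>0 \<longrightarrow>
         has_decomposition m q \<beta> K \<epsilon> (u \<epsilon>) (w \<epsilon>)"
    and regularity: "\<forall>\<epsilon>. 0 < \<epsilon> \<and> \<epsilon> \<le> \<epsilon>0 \<longrightarrow>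
         u \<epsilon> \<in> Sobolev (q + 1) Dom \<and> w \<epsilon> \<in> Sobolev (q + 1) Dom"
    and discrete_solution: "\<forall>\<epsilon> N. admissible \<epsilon> N \<longrightarrow>
         (uh \<epsilon> N, wh \<epsilon> N) \<in> Uh_space m q (x \<epsilon> N) N \<and>
         (\<forall>(y, z)\<in>Uh_space m q (x \<epsilon> N) N.
            bform \<epsilon> b c d (uh \<epsilon> N, wh \<epsilon> N) (y, z) = load f d \<Phi> y)"
  shows "(\<exists>C. \<forall>\<epsilon> N. admissible \<epsilon> N \<longrightarrow>
            energy_norm \<beta> \<delta> (\<lambda>t. interp q (x \<epsilon> N) N (u \<epsilon>) t - uh \<epsilon> N t,
                             \<lambda>t. interp q (x \<epsilon> N) N (w \<epsilon>) t - wh \<epsilon> N t)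
              \<le> C * rate \<epsilon> N ^ (q + 1)) \<and>
         (\<exists>C. \<forall>\<epsilon> N. admissible \<epsilon> N \<longrightarrow>
            energy_norm \<beta> \<delta> (\<lambda>t. u \<epsilon> t - uh \<epsilon> N t, \<lambda>t. w \<epsilon> t - wh \<epsilon> N t)
              \<le> C * rate \<epsilon> N ^ q)"
proof (rule supercloseness_bound[OF q smooth beta delta], rule interp_error_estimate[OF q])
  fix Cs Cq :: real
  assume Cs: "Cs \<ge> 0"
    "\<And>\<epsilon> X N u w uh wh F k. mesh_nodes X N \<Longrightarrow> (u, w) \<in> U_space k \<Longrightarrow> (uh, wh) \<in> Uh_space k q X N \<Longrightarrow>
       (\<forall>(y, z)\<in>U_space k. bform \<epsilon> b c d (u, w) (y, z) = F y) \<Longrightarrow>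
       (\<forall>(y, z)\<in>Uh_space k q X N. bform \<epsilon> b c d (uh, wh) (y, z) = F y) \<Longrightarrow>
       (energy_norm \<beta> \<delta> (\<lambda>t. interp q X N u t - uh t, \<lambda>t. interp q X N w t - wh t))\<^sup>2
        \<le> Cs * (integral {0..2} (\<lambda>t. (u t - interp q X N u t)\<^sup>2) + integral {0..2} (\<lambda>t. (w t - interp q X N w t)\<^sup>2))"
  assume Cq: "Cq \<ge> 0"
    "\<And>X N \<rho> M u u' w G. mesh_nodes X N \<Longrightarrow> AC 0 2 u u' \<Longrightarrow> continuous_on {0..2} w \<Longrightarrow> L2on 0 2 G \<Longrightarrow> \<rho> \<ge> 0 \<Longrightarrow> M \<ge> 0 \<Longrightarrow>
      \<forall>i\<in>{1..N}. X i - X (i - 1) \<le> 4 * \<rho> \<Longrightarrow>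
      \<forall>i\<in>{1..N}. X (i - 1) < X i \<longrightarrow>
        approx_lip q (X (i - 1)) (X i) u
          (sqrt (X i - X (i - 1)) * sqrt (integral {X (i - 1)..X i} (\<lambda>t. (G t)\<^sup>2)) * (X i - X (i - 1)) ^ (q - 1) + M * \<rho> ^ q) \<and>
        approx_sup q (X (i - 1)) (X i) w (M * \<rho> ^ (q + 1)) \<Longrightarrow>
      integral {0..2} (\<lambda>t. (u t - interp q X N u t)\<^sup>2) \<le> Cq * (integral {0..2} (\<lambda>t. (G t)\<^sup>2) + M\<^sup>2) * (\<rho> ^ (q + 1))\<^sup>2 \<and>
      integral {0..2} (\<lambda>t. (u' t - wderiv Dom (interp q X N u) t)\<^sup>2) \<le> Cq * (integral {0..2} (\<lambda>t. (G t)\<^sup>2) + M\<^sup>2) * (\<rho> ^ q)\<^sup>2 \<and>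
      integral {0..2} (\<lambda>t. (w t - interp q X N w t)\<^sup>2) \<le> Cq * (integral {0..2} (\<lambda>t. (G t)\<^sup>2) + M\<^sup>2) * (\<rho> ^ (q + 1))\<^sup>2"
  obtain K0 where K0: "\<forall>N. 0 < N \<and> 8 dvd N \<longrightarrow>
         (\<forall>t\<in>{0<..<1/2}. \<phi> N field_differentiable at t \<longrightarrow> deriv (\<phi> N) t \<le> K0 * real N)"
    using mesh(2) by blast
  \<comment> \<open>The assumption on the mesh provides a constant of unknown sign, while the mesh
    estimates use a nonnegative one.\<close>
  define Km where "Km = max K0 0"
  have Km: "Km \<ge> 0" by (simp add: Km_def)
  obtain K where K: "\<And>\<epsilon>. 0 < \<epsilon> \<Longrightarrow> \<epsilon> \<le> \<epsilon>0 \<Longrightarrow> has_decomposition m q \<beta> K \<epsilon> (u \<epsilon>) (w \<epsilon>)"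
    using decomposition by blast
  define C1 where "C1 = 4 * \<sigma> / \<beta> * exp (4 * Km)"
  have C1: "C1 \<ge> 0" using sigma beta by (simp add: C1_def)
  define M where "M = 4 * K * (1 + \<epsilon>0)\<^sup>2 * ((1 + C1) ^ (q + 1) + 4 ^ (q + 1))"
  define Y where "Y = Cq * (2 * K\<^sup>2 + M\<^sup>2)"
  have Y: "Y \<ge> 0" using Cq(1) by (simp add: Y_def)
  \<comment> \<open>\<open>A\<close> and \<open>B\<close> are the squares of the constants of the
    two results; 2 in \<open>A\<close> counts the two interpolation errors.\<close>
  define A where "A = Cs * (2 * Y)"
  define B where "B = (2 + 2 * \<delta>) * Y * (2 + Km)\<^sup>2 + \<beta>\<^sup>2 * Y + 2 * A * (2 + Km)\<^sup>2"
  have main: "rate \<epsilon> N \<ge> 0 \<and>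
     (energy_norm \<beta> \<delta> (\<lambda>t. interp q (x \<epsilon> N) N (u \<epsilon>) t - uh \<epsilon> N t, \<lambda>t. interp q (x \<epsilon> N) N (w \<epsilon>) t - wh \<epsilon> N t))\<^sup>2
        \<le> A * (rate \<epsilon> N ^ (q + 1))\<^sup>2 \<and>
     (energy_norm \<beta> \<delta> (\<lambda>t. u \<epsilon> t - uh \<epsilon> N t, \<lambda>t. w \<epsilon> t - wh \<epsilon> N t))\<^sup>2 \<le> B * (rate \<epsilon> N ^ q)\<^sup>2"
    if adm: "admissible \<epsilon> N" for \<epsilon> N
  proof -
    have e: "0 < \<epsilon>" "\<epsilon> \<le> \<epsilon>0" and N: "8 dvd N" "0 < N" and lam: "transition \<sigma> \<beta> \<epsilon> N < 1/4"
      using adm by (auto simp: admissible_def)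
    define X where "X = x \<epsilon> N"
    define \<rho> where "\<rho> = rate \<epsilon> N"
    define \<theta> where "\<theta> = max_psi_deriv (\<phi> N) / real N"
    have Xn: "X = node \<sigma> \<beta> \<epsilon> (\<phi> N) N" by (simp add: X_def x_def)
    have \<rho>X: "\<rho> = layer_width X N + \<theta>" by (simp add: \<rho>_def rate_def Xn \<theta>_def)
    have dK: "\<forall>t\<in>{0<..<1/2}. \<phi> N field_differentiable at t \<longrightarrow> deriv (\<phi> N) t \<le> Km * real N"
    proof (intro ballI impI)
      fix t :: real assume "t \<in> {0<..<1/2}" "\<phi> N field_differentiable at t"
      then have "deriv (\<phi> N) t \<le> K0 * real N" using K0 N by blast
      also have "\<dots> \<le> Km * real N" by (intro mult_right_mono) (auto simp: Km_def)
      finally show "deriv (\<phi> N) t \<le> Km * real N" .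
    qed
    have mf: "mesh_function N (\<phi> N)" using mesh(1) N by blast
    note fm = full_mesh[OF beta(1) e(1) sigma(2) Km N lam mf dK, folded Xn \<theta>_def C1_def, folded \<rho>X]
    have \<rho>0: "\<rho> \<ge> 0" using fm(3,4) by simp
    have uw: "(u \<epsilon>, w \<epsilon>) \<in> U_space m" and sol: "\<forall>(y, z)\<in>U_space m. bform \<epsilon> b c d (u \<epsilon>, w \<epsilon>) (y, z) = load f d \<Phi> y"
      using solution e by blast+
    have uwh: "(uh \<epsilon> N, wh \<epsilon> N) \<in> Uh_space m q X N"
      and solh: "\<forall>(y, z)\<in>Uh_space m q X N. bform \<epsilon> b c d (uh \<epsilon> N, wh \<epsilon> N) (y, z) = load f d \<Phi> y"
      using discrete_solution adm unfolding X_def by blast+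
    have h: "u \<epsilon> \<in> H1" "w \<epsilon> \<in> H1" "uh \<epsilon> N \<in> H1" "wh \<epsilon> N \<in> H1"
      using U_space_H1[OF uw] uwh U_space_H1 by (auto simp: Uh_space_def)
    note HA = h[THEN H1_AC]
    note uc = AC_L2(3)[OF HA(1)] and wc = AC_L2(3)[OF HA(2)]
    obtain G where G: "L2on 0 2 G" "integral {0..2} (\<lambda>t. (G t)\<^sup>2) \<le> 2 * K\<^sup>2" "K \<ge> 0"
      and loc: "\<And>a b \<theta> \<rho>. 0 \<le> a \<Longrightarrow> a < b \<Longrightarrow> b \<le> 2 \<Longrightarrow> 0 \<le> \<theta> \<Longrightarrow> \<theta> \<le> \<rho> \<Longrightarrow> b - a \<le> 4 * \<rho> \<Longrightarrow>
      resolved q C1 \<epsilon> \<theta> (b - a) (exp (- \<beta> * a / \<epsilon>)) \<Longrightarrow> resolved q C1 \<epsilon> \<theta> (b - a) (exp (- \<beta> * (2 - b) / \<epsilon>)) \<Longrightarrow>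
      b \<le> 1 \<and> resolved q C1 \<epsilon> \<theta> (b - a) (exp (- \<beta> * (1 - b) / \<epsilon>)) \<or>
      1 \<le> a \<and> resolved q C1 \<epsilon> \<theta> (b - a) (exp (- \<beta> * (a - 1) / \<epsilon>)) \<Longrightarrow>
      approx_lip q a b (u \<epsilon>) (sqrt (b - a) * sqrt (integral {a..b} (\<lambda>t. (G t)\<^sup>2)) * (b - a) ^ (q - 1) + M * \<rho> ^ q) \<and>
      approx_sup q a b (w \<epsilon>) (M * \<rho> ^ (q + 1))"
      using local_approximation[OF K[OF e] m q e beta(1) C1] unfolding M_def[symmetric] by blast
    have M0: "M \<ge> 0" using G(3) C1 by (simp add: M_def)
    have app: "\<forall>i\<in>{1..N}. X (i - 1) < X i \<longrightarrow>
        approx_lip q (X (i - 1)) (X i) (u \<epsilon>)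
          (sqrt (X i - X (i - 1)) * sqrt (integral {X (i - 1)..X i} (\<lambda>t. (G t)\<^sup>2)) * (X i - X (i - 1)) ^ (q - 1) + M * \<rho> ^ q) \<and>
        approx_sup q (X (i - 1)) (X i) (w \<epsilon>) (M * \<rho> ^ (q + 1))"
    proof (intro ballI impI)
      fix i assume i: "i \<in> {1..N}" and lt: "X (i - 1) < X i"
      note cl = mesh_cell[OF fm(1) i]
      show "approx_lip q (X (i - 1)) (X i) (u \<epsilon>)
          (sqrt (X i - X (i - 1)) * sqrt (integral {X (i - 1)..X i} (\<lambda>t. (G t)\<^sup>2)) * (X i - X (i - 1)) ^ (q - 1) + M * \<rho> ^ q) \<and>
        approx_sup q (X (i - 1)) (X i) (w \<epsilon>) (M * \<rho> ^ (q + 1))"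
        by (rule loc[OF cl(1) lt cl(3) fm(3,4) fm(2)[OF i] fm(6)[OF i] fm(7)[OF i] fm(8)[OF i]])
    qed
    have width: "\<forall>i\<in>{1..N}. X i - X (i - 1) \<le> 4 * \<rho>" using fm(2) by blast
    define Ie where "Ie = integral {0..2} (\<lambda>t. (u \<epsilon> t - interp q X N (u \<epsilon>) t)\<^sup>2)"
    define Ie' where "Ie' = integral {0..2} (\<lambda>t. (wderiv Dom (u \<epsilon>) t - wderiv Dom (interp q X N (u \<epsilon>)) t)\<^sup>2)"
    define If where "If = integral {0..2} (\<lambda>t. (w \<epsilon> t - interp q X N (w \<epsilon>) t)\<^sup>2)"
    have YG: "Cq * (integral {0..2} (\<lambda>t. (G t)\<^sup>2) + M\<^sup>2) * r\<^sup>2 \<le> Y * r\<^sup>2" for r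
      unfolding Y_def using G(2) Cq(1) by (intro mult_right_mono mult_left_mono) auto
    have I: "Ie \<le> Y * (\<rho> ^ (q + 1))\<^sup>2" "Ie' \<le> Y * (\<rho> ^ q)\<^sup>2" "If \<le> Y * (\<rho> ^ (q + 1))\<^sup>2"
      using Cq(2)[OF fm(1) HA(1) wc G(1) \<rho>0 M0 width app] YG[of "\<rho> ^ (q + 1)"] YG[of "\<rho> ^ q"]
      unfolding Ie_def Ie'_def If_def by (meson order_trans)+
    define Ex where "Ex = energy_norm \<beta> \<delta> (\<lambda>t. interp q X N (u \<epsilon>) t - uh \<epsilon> N t, \<lambda>t. interp q X N (w \<epsilon>) t - wh \<epsilon> N t)"
    have "Ex\<^sup>2 \<le> Cs * (Ie + If)"
      unfolding Ex_def Ie_def If_def by (rule Cs(2)[OF fm(1) uw uwh sol solh])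
    also have "\<dots> \<le> Cs * (Y * (\<rho> ^ (q + 1))\<^sup>2 + Y * (\<rho> ^ (q + 1))\<^sup>2)"
      using I Cs(1) by (intro mult_left_mono add_mono)
    finally have 1: "Ex\<^sup>2 \<le> A * (\<rho> ^ (q + 1))\<^sup>2" by (simp add: A_def)
    have IuA: "AC 0 2 (interp q X N (u \<epsilon>)) (wderiv Dom (interp q X N (u \<epsilon>)))"
      and IwA: "AC 0 2 (interp q X N (w \<epsilon>)) (wderiv Dom (interp q X N (w \<epsilon>)))"
      by (rule H1_AC[OF interp_H1(1)[OF q fm(1)]], rule uc) (rule H1_AC[OF interp_H1(1)[OF q fm(1)]], rule wc)
    define Ey where "Ey = energy_norm \<beta> \<delta> (\<lambda>t. u \<epsilon> t - interp q X N (u \<epsilon>) t, \<lambda>t. w \<epsilon> t - interp q X N (w \<epsilon>) t)"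
    have Ey: "Ey\<^sup>2 = If + \<beta>\<^sup>2 / 2 * Ie' + \<delta> * Ie"
      unfolding Ey_def If_def Ie'_def Ie_def
      by (rule energy_norm_sq(1)[OF AC_diff[OF HA(1) IuA] AC_L2(2)[OF AC_diff[OF HA(2) IwA]] delta(1)])
    \<comment> \<open>The rate is at most \<open>2 + Km\<close>, so powers q + 1 may be lowered to q
      at the price of a constant.\<close>
    have low: "Z * (\<rho> ^ (q + 1))\<^sup>2 \<le> Z * (2 + Km)\<^sup>2 * (\<rho> ^ q)\<^sup>2" if "Z \<ge> 0" for Z
    proof -
      have "(\<rho> ^ (q + 1))\<^sup>2 = \<rho>\<^sup>2 * (\<rho> ^ q)\<^sup>2" by (simp add: power_mult_distrib)
      also have "\<dots> \<le> (2 + Km)\<^sup>2 * (\<rho> ^ q)\<^sup>2"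
        using fm(5) \<rho>0 by (intro mult_right_mono power_mono) auto
      finally have "Z * (\<rho> ^ (q + 1))\<^sup>2 \<le> Z * ((2 + Km)\<^sup>2 * (\<rho> ^ q)\<^sup>2)" using that by (rule mult_left_mono)
      then show ?thesis by (simp add: mult.assoc)
    qed
    have A0: "A \<ge> 0" using Cs(1) Y by (simp add: A_def)
    \<comment> \<open>Triangle inequality through the interpolants. Only \<open>Ie'\<close>, from
      the derivative of the interpolation error of \<open>u\<close>, is estimated with the lower
      order q.\<close>
    have "(energy_norm \<beta> \<delta> (\<lambda>t. u \<epsilon> t - uh \<epsilon> N t, \<lambda>t. w \<epsilon> t - wh \<epsilon> N t))\<^sup>2 \<le> 2 * Ey\<^sup>2 + 2 * Ex\<^sup>2"
      using energy_norm_add_sq[OF AC_diff[OF HA(1) IuA] AC_diff[OF IuA HA(3)] AC_L2(2)[OF AC_diff[OF HA(2) IwA]]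
          AC_L2(2)[OF AC_diff[OF IwA HA(4)]] delta(1), of \<beta>]
      by (simp add: Ey_def Ex_def)
    also have "\<dots> \<le> 2 * (Y * (\<rho> ^ (q + 1))\<^sup>2 + \<beta>\<^sup>2 / 2 * (Y * (\<rho> ^ q)\<^sup>2) + \<delta> * (Y * (\<rho> ^ (q + 1))\<^sup>2)) + 2 * (A * (\<rho> ^ (q + 1))\<^sup>2)"
      unfolding Ey using I 1 delta(1) by (intro add_mono mult_left_mono) auto
    also have "\<dots> = (2 + 2 * \<delta>) * Y * (\<rho> ^ (q + 1))\<^sup>2 + \<beta>\<^sup>2 * Y * (\<rho> ^ q)\<^sup>2 + 2 * A * (\<rho> ^ (q + 1))\<^sup>2"
      by (simp add: algebra_simps)
    also have "\<dots> \<le> (2 + 2 * \<delta>) * Y * (2 + Km)\<^sup>2 * (\<rho> ^ q)\<^sup>2 + \<beta>\<^sup>2 * Y * (\<rho> ^ q)\<^sup>2 + 2 * A * (2 + Km)\<^sup>2 * (\<rho> ^ q)\<^sup>2"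
      using Y A0 delta(1) by (intro add_mono low order_refl) auto
    also have "\<dots> = B * (\<rho> ^ q)\<^sup>2" by (simp only: B_def distrib_right)
    finally show ?thesis using 1 \<rho>0 unfolding Ex_def X_def \<rho>_def by blast
  qed
  show ?thesis
  proof (intro conjI exI allI impI)
    fix \<epsilon> N assume "admissible \<epsilon> N"
    note mn = main[OF this]
    show "energy_norm \<beta> \<delta> (\<lambda>t. interp q (x \<epsilon> N) N (u \<epsilon>) t - uh \<epsilon> N t,
                             \<lambda>t. interp q (x \<epsilon> N) N (w \<epsilon>) t - wh \<epsilon> N t) \<le> sqrt A * rate \<epsilon> N ^ (q + 1)"
      using mn by (intro le_sqrt_mult) auto
    show "energy_norm \<beta> \<delta> (\<lambda>t. u \<epsilon> t - uh \<epsilon> N t, \<lambda>t. w \<epsilon> t - wh \<epsilon> N t) \<le> sqrt B * rate \<epsilon> N ^ q"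
      using mn by (intro le_sqrt_mult) auto
  qed
qed

end
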